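(* Assume that no instantaneous CSI is utilized for decoding ($\tilde{\mathcal H}^{\mathrm{BS}}=\tilde{\mathcal H}^{\mathrm{UE}}=\emptyset$), interference is treated as noise, and the receive combining vector is $\mathbf v=\hat{\mathbf h}/\|\hat{\mathbf h}\|_2$. Under the multi-user interference model of the context, as $N\to\infty$, $$\mathbb E\{|\mathbf h_l^H\mathbf v|^2\}=\begin{cases}\mathbb E\left\{\dfrac{p^{\mathrm{UE}}\,|\mathrm{tr}(\mathbf A\mathbf R_l)|^2}{\mathrm{tr}\big(\mathbf A(|d+\eta_t^{\mathrm{UE}}|^2\mathbf R+\boldsymbol\Psi)\mathbf A^H\big)}\right\}+\mathcal O(\sqrt N),& l\in\mathcal U_\parallel,\\[2mm] \mathcal O(1),& l\in\mathcal U_\perp,\end{cases}$$ where $\eta_t^{\mathrm{UE}}$ is stochastic and $\mathbf A=d^*\mathbf R\bar{\mathbf Z}^{-1}$, $\boldsymbol\Psi=p^{\mathrm{UE}}\kappa_r^{\mathrm{BS}}\mathbf R_{\mathrm{diag}}+\mathbf S+\sigma_{\mathrm{BS}}^2\mathbf I$. Moreover, the uplink lower capacity bound becomes $${\tt C}^{\mathrm{UL}}\ge\frac{T^{\mathrm{UL}}_{\mathrm{data}}}{T_{\mathrm{coher}}}\log_2\left(1+\frac{|\mathbb E\{\varphi\}|^2+\mathcal O\big(\frac1{\sqrt N}\big)}{(1+\kappa_t^{\mathrm{UE}})\mathbb E\{|\varphi|^2\}-|\mathbb E\{\varphi\}|^2+\mathcal O\big(\frac1{\sqrt N}\big)+\Xi}\right),$$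 $$\Xi=\mathbb E\left\{\frac{\mathrm{tr}(\mathbf R-\mathbf C)}{\mathrm{tr}\big(\mathbf A(|d+\eta_t^{\mathrm{UE}}|^2\mathbf R+\boldsymbol\Psi)\mathbf A^H\big)}\right\}\sum_{l\in\mathcal U_\parallel}\left|\frac{\mathrm{tr}(\mathbf A\mathbf R_l)}{\mathrm{tr}(\mathbf A\mathbf R)}\right|^2+\mathcal O\Big(\frac1N\Big),$$ where $\varphi=\dfrac{(1+d^{-1}\eta_t^{\mathrm{UE}})\sqrt{\mathrm{tr}(\mathbf R-\mathbf C)}}{\sqrt{\mathrm{tr}(\mathbf A(|d+\eta_t^{\mathrm{UE}}|^2\mathbf R+\boldsymbol\Psi)\mathbf A^H)}}$.
   Context: An $N$-antenna base station (BS) and a single-antenna user (the UE under study) share a block-fading channel $\mathbf h=[h_1\dots h_N]^T\sim\mathcal{CN}(\mathbf 0,\mathbf R)$, constant in each coherence period of $T_{\mathrm{coher}}$ channel uses ($T^{\mathrm{UL}}_{\mathrm{data}}$ for uplink data), independent between periods. A finite set $\mathcal U=\mathcal U_\parallel\cup\mathcal U_\perp$ (disjoint, independent of $N$) of co-users interferes, with channels $\mathbf h_l\sim\mathcal{CN}(\mathbf 0,\mathbf R_l)$ to the BS, $\|\mathbf R_l\|_2=\mathcal O(1)$; all channels ($\mathbf h$ and $\mathbf h_l$, $l\in\mathcal U$) are mutually independent. $\mathcal U_\parallel$ are the co-users transmitting in parallel with the pilot of the UE under study. $\mathcal H$ is the set of all channel realizations. Uplink model: $\mathbf z=\mathbf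 h(d+\eta_t^{\mathrm{UE}})+\boldsymbol\eta_r^{\mathrm{BS}}+\boldsymbol\nu_{\mathrm{noise}}+\boldsymbol\nu_{\mathrm{interf}}$, $\boldsymbol\nu_{\mathrm{noise}}\sim\mathcal{CN}(\mathbf 0,\sigma_{\mathrm{BS}}^2\mathbf I)$ independent; given $\mathcal H$, $\eta_t^{\mathrm{UE}}\sim\mathcal{CN}(0,\kappa_t^{\mathrm{UE}}p^{\mathrm{UE}})$ and $\boldsymbol\eta_r^{\mathrm{BS}}\sim\mathcal{CN}(\mathbf 0,\kappa_r^{\mathrm{BS}}p^{\mathrm{UE}}\mathrm{diag}(|h_1|^2,\dots,|h_N|^2))$ are independent of each other, of the signals, and over time. Pilot phase: $d\in\mathbb C$ is a nonzero deterministic pilot, $|d|^2=p^{\mathrm{UE}}$; $\boldsymbol\nu_{\mathrm{interf}}=\sum_{l\in\mathcal U_\parallel}d_l\mathbf h_l$, where $d_l$ is the (deterministic or stochastic) signal of co-user $l$ with $\mathbb E\{|d_l|^2\}=p^{\mathrm{UE}}$, so $\mathbf S=\mathbb E\{\boldsymbol\nu_{\mathrm{interf}}\boldsymbol\nu_{\mathrm{interf}}^H\}=p^{\mathrm{UE}}\sum_{l\in\mathcal U_\parallel}\mathbf R_l$, and $\boldsymbol\nu_{\mathrm{noise}}+\boldsymbol\nu_{\mathrm{interf}}\sim\mathcal{CN}(\mathbf 0,\mathbf S+\sigma_{\mathrm{BS}}^2\mathbf I)$. With $\mathbf R_{\mathrm{diag}}$ the diagonal part of $\mathbf R$: $\bar{\mathbf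 Z}=p^{\mathrm{UE}}(1+\kappa_t^{\mathrm{UE}})\mathbf R+p^{\mathrm{UE}}\kappa_r^{\mathrm{BS}}\mathbf R_{\mathrm{diag}}+\mathbf S+\sigma_{\mathrm{BS}}^2\mathbf I$; the LMMSE estimate is $\hat{\mathbf h}=\mathbf A\mathbf z$; $\mathbf C=\mathbf R-p^{\mathrm{UE}}\mathbf R\bar{\mathbf Z}^{-1}\mathbf R$. In the claim, $d$ and $\eta_t^{\mathrm{UE}}$ are those of the pilot phase. Data phase: $d$ is a stochastic data signal of power $p^{\mathrm{UE}}$; $\boldsymbol\nu_{\mathrm{interf}}=\sum_{l\in\mathcal U}d_l\mathbf h_l$ with independent zero-mean data signals $d_l$ of power $p^{\mathrm{UE}}$, so the conditional interference covariance given $\mathcal H$ is $\mathbf Q_{\mathcal H}=p^{\mathrm{UE}}\sum_{l\in\mathcal U}\mathbf h_l\mathbf h_l^H$. Capacity: with $\mathcal H^{\mathrm{BS}}$ (at least $\hat{\mathbf h}$) and $\mathcal H^{\mathrm{UE}}$ the channel knowledge at BS and UE, ${\tt C}^{\mathrm{UL}}=\frac{T^{\mathrm{UL}}_{\mathrm{data}}}{T_{\mathrm{coher}}}\mathbb E\{\max_{f(d|\mathcal H^{\mathrm{UE}}):\mathbb E\{|d|^2\}\le p^{\mathrm{UE}}}\mathcal I(d;\mathbf z|\mathcal H,\mathcal H^{\mathrm{BS}},\mathcal H^{\mathrm{UE}})\}$ ($\mathcal I$: conditional mutual information in bits for the given realizations). The uplink lower capacity bound referred to is $$\frac{T^{\mathrm{UL}}_{\mathrm{data}}}{T_{\mathrm{coher}}}\log_2\left(1+\frac{|\mathbb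 E\{\mathbf h^H\mathbf v\}|^2}{(1+\kappa_t^{\mathrm{UE}})\mathbb E\{|\mathbf h^H\mathbf v|^2\}-|\mathbb E\{\mathbf h^H\mathbf v\}|^2+\kappa_r^{\mathrm{BS}}\sum_{i=1}^N\mathbb E\{|h_i|^2|v_i|^2\}+\frac{\mathbb E\{\mathbf v^H(\mathbf Q_{\mathcal H}+\sigma_{\mathrm{BS}}^2\mathbf I)\mathbf v\}}{p^{\mathrm{UE}}}}\right).$$ Standing assumptions: $\|\mathbf R\|_2=\mathcal O(1)$, $0<\liminf_N\frac1N\mathrm{tr}(\mathbf R)\le\limsup_N\frac1N\mathrm{tr}(\mathbf R)<\infty$, $\mathbf R$ positive semi-definite with strictly positive diagonal; $p^{\mathrm{UE}}$, $\sigma_{\mathrm{BS}}^2>0$, the pilot and $\kappa_t^{\mathrm{UE}},\kappa_r^{\mathrm{BS}}\ge0$ do not depend on $N$. *)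

theory Defs
  imports
    "HOL-Probability.Probability"
    "HOL-Library.Landau_Symbols"
    "Jordan_Normal_Form.Gauss_Jordan_Elimination"
    "Jordan_Normal_Form.Schur_Decomposition"
begin

section \<open>Vectors and matrices\<close>

text \<open>Vectors of length \<open>N\<close> are functions on \<open>{..<N}\<close>, so that random vectors are
  random variables with values in a finite product space; matrices are the dimension-carrying
  matrices of the Jordan normal form library.\<close>

definition cvec :: "nat \<Rightarrow> (nat \<Rightarrow> complex) measure" where
  "cvec N = PiM {..<N} (\<lambda>_. borel)"

text \<open>\<open>cdot N u x\<close> is $u^H x$.\<close>

definition cdot :: "nat \<Rightarrow> (nat \<Rightarrow> complex) \<Rightarrow> (nat \<Rightarrow> complex) \<Rightarrow> complex" where
  "cdot N u x = (\<Sum>i<N. cnj (u i) * x i)"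

definition norm2 :: "nat \<Rightarrow> (nat \<Rightarrow> complex) \<Rightarrow> real" where
  "norm2 N x = L2_set (\<lambda>i. cmod (x i)) {..<N}"

definition mat_app :: "complex mat \<Rightarrow> (nat \<Rightarrow> complex) \<Rightarrow> nat \<Rightarrow> complex" where
  "mat_app A x = (\<lambda>i\<in>{..<dim_row A}. \<Sum>j<dim_col A. A $$ (i, j) * x j)"

definition mtrace :: "complex mat \<Rightarrow> complex" where
  "mtrace A = (\<Sum>i<dim_row A. A $$ (i, i))"

definition spectral_norm :: "complex mat \<Rightarrow> real" where
  "spectral_norm A =
     (SUP x\<in>{x. norm2 (dim_col A) x \<le> 1}. norm2 (dim_row A) (mat_app A x))"

definition cov_mat :: "nat \<Rightarrow> complex mat \<Rightarrow> bool" where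
  "cov_mat N C \<longleftrightarrow> C \<in> carrier_mat N N \<and> mat_adjoint C = C \<and>
     (\<forall>x. 0 \<le> Re (cdot N x (mat_app C x)))"


section \<open>Circularly symmetric complex Gaussians and conditional laws\<close>

text \<open>$\mathcal{CN}(0,s)$: independent real and imaginary parts of variance \<open>s / 2\<close>.
  Written as an image measure so that \<open>s = 0\<close> gives the point mass at 0.\<close>

definition cnormal :: "real \<Rightarrow> complex measure" where
  "cnormal s = distr (density lborel std_normal_density \<Otimes>\<^sub>M density lborel std_normal_density)
     borel (\<lambda>(x, y). complex_of_real (sqrt (s / 2)) * Complex x y)"

text \<open>\<open>X\<close> is $\mathcal{CN}(0,C)$ on $\mathbb{C}^N$. As \<open>C\<close> may be singular, the law is
  characterised by its linear functionals: $u^H X$ is $\mathcal{CN}(0, u^H C u)$ for all \<open>u\<close>.\<close>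

definition complex_normal ::
  "'a measure \<Rightarrow> nat \<Rightarrow> complex mat \<Rightarrow> ('a \<Rightarrow> nat \<Rightarrow> complex) \<Rightarrow> bool" where
  "complex_normal M N C X \<longleftrightarrow> cov_mat N C \<and> X \<in> measurable M (cvec N) \<and>
     (\<forall>u. distr M borel (\<lambda>\<omega>. cdot N u (X \<omega>)) = cnormal (Re (cdot N u (mat_app C u))))"

text \<open>The library's \<open>indep_var\<close> for random elements with values in different types.\<close>

definition indep_elems ::
  "'a measure \<Rightarrow> 'x measure \<Rightarrow> ('a \<Rightarrow> 'x) \<Rightarrow> 'y measure \<Rightarrow> ('a \<Rightarrow> 'y) \<Rightarrow> bool" where
  "indep_elems M S X T Y \<longleftrightarrow> X \<in> measurable M S \<and> Y \<in> measurable M T \<and>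
     prob_space.indep_set M {X -` A \<inter> space M | A. A \<in> sets S} {Y -` B \<inter> space M | B. B \<in> sets T}"

text \<open>\<open>K x\<close> is the regular conditional law of \<open>Y\<close> given \<open>X = x\<close>.\<close>

definition has_cond_law ::
  "'a measure \<Rightarrow> 'x measure \<Rightarrow> ('a \<Rightarrow> 'x) \<Rightarrow> 'y measure \<Rightarrow> ('a \<Rightarrow> 'y) \<Rightarrow> ('x \<Rightarrow> 'y measure) \<Rightarrow> bool"
where
  "has_cond_law M S X T Y K \<longleftrightarrow>
     X \<in> measurable M S \<and> Y \<in> measurable M T \<and> K \<in> measurable S (prob_algebra T) \<and>
     (\<forall>A\<in>sets S. \<forall>B\<in>sets T. emeasure M {\<omega>\<in>space M. X \<omega> \<in> A \<and> Y \<omega> \<in> B} =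
        (\<integral>\<^sup>+\<omega>. indicator A (X \<omega>) * emeasure (K (X \<omega>)) B \<partial>M))"


section \<open>Uplink with transceiver impairments\<close>

text \<open>Law of $(\eta_t, \eta_r)$ given the user channel \<open>x\<close>.\<close>

definition distortion_law ::
  "nat \<Rightarrow> real \<Rightarrow> real \<Rightarrow> real \<Rightarrow> (nat \<Rightarrow> complex) \<Rightarrow> (complex \<times> (nat \<Rightarrow> complex)) measure" where
  "distortion_law N \<kappa>t \<kappa>r p x =
     cnormal (\<kappa>t * p) \<Otimes>\<^sub>M PiM {..<N} (\<lambda>i. cnormal (\<kappa>r * p * (cmod (x i))\<^sup>2))"

text \<open>The data-phase disturbances are (distortions, noise, co-user data signals); \<open>D l\<close> is the
  law of the data signal of co-user \<open>l\<close>.\<close>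

type_synonym 'u disturbance =
  "(complex \<times> (nat \<Rightarrow> complex)) \<times> (nat \<Rightarrow> complex) \<times> ('u \<Rightarrow> complex)"

definition disturbance_space :: "nat \<Rightarrow> 'u set \<Rightarrow> 'u disturbance measure" where
  "disturbance_space N U = (borel \<Otimes>\<^sub>M cvec N) \<Otimes>\<^sub>M cvec N \<Otimes>\<^sub>M PiM U (\<lambda>_. borel)"

definition disturbance_law ::
  "nat \<Rightarrow> 'u set \<Rightarrow> real \<Rightarrow> real \<Rightarrow> real \<Rightarrow> real \<Rightarrow> ('u \<Rightarrow> complex measure) \<Rightarrow> (nat \<Rightarrow> complex)
     \<Rightarrow> 'u disturbance measure" where
  "disturbance_law N U \<kappa>t \<kappa>r p \<sigma>2 D x =
     distortion_law N \<kappa>t \<kappa>r p x \<Otimes>\<^sub>M PiM {..<N} (\<lambda>_. cnormal \<sigma>2) \<Otimes>\<^sub>M PiM U D"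

definition received ::
  "nat \<Rightarrow> 'u set \<Rightarrow> (nat \<Rightarrow> complex) \<Rightarrow> ('u \<Rightarrow> nat \<Rightarrow> complex) \<Rightarrow> complex \<Rightarrow> 'u disturbance
     \<Rightarrow> nat \<Rightarrow> complex" where
  "received N U x g = (\<lambda>s ((\<eta>t, \<eta>r), \<nu>, c). \<lambda>i\<in>{..<N}.
     x i * (s + \<eta>t) + \<eta>r i + \<nu> i + (\<Sum>l\<in>U. c l * g l i))"

text \<open>Mutual information in bits between the input, of law \<open>F\<close>, and the received signal, for
  fixed channels \<open>x\<close>, \<open>g\<close> and disturbances of law \<open>L\<close>. The KL divergence of the library is a
  Bochner integral; it is the true mutual information here because additive Gaussian noise of
  positive variance and finite input and interference power make it finite.\<close>

definition uplink_mi ::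
  "nat \<Rightarrow> 'u set \<Rightarrow> (nat \<Rightarrow> complex) \<Rightarrow> ('u \<Rightarrow> nat \<Rightarrow> complex) \<Rightarrow> complex measure
     \<Rightarrow> 'u disturbance measure \<Rightarrow> real" where
  "uplink_mi N U x g F L =
     prob_space.mutual_information (F \<Otimes>\<^sub>M L) 2 borel (cvec N) fst (\<lambda>(s, w). received N U x g s w)"

text \<open>Conditional input distributions $f(d\,|\,\mathcal{H}^{UE})$ under the power constraint.\<close>

definition input_laws :: "'ue measure \<Rightarrow> real \<Rightarrow> ('ue \<Rightarrow> complex measure) set" where
  "input_laws SUE p = {f \<in> measurable SUE (prob_algebra borel).
     \<forall>u\<in>space SUE. (\<integral>\<^sup>+s. ennreal ((cmod s)\<^sup>2) \<partial>f u) \<le> ennreal p}"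

text \<open>\<open>K (x, g, b, u)\<close> is the conditional law of the data-phase disturbances given that the
  channels are \<open>x\<close>, \<open>g\<close> and that the channel knowledge at the base station and at the user is
  \<open>b\<close> and \<open>u\<close>. The maximum over the input distributions is rendered as a supremum, taken for
  each realization.\<close>

definition uplink_capacity ::
  "real \<Rightarrow> real \<Rightarrow> 'a measure \<Rightarrow> nat \<Rightarrow> 'u set \<Rightarrow> real \<Rightarrow> 'ue measure
     \<Rightarrow> ((nat \<Rightarrow> complex) \<times> ('u \<Rightarrow> nat \<Rightarrow> complex) \<times> 'bs \<times> 'ue \<Rightarrow> 'u disturbance measure)
     \<Rightarrow> ('a \<Rightarrow> nat \<Rightarrow> complex) \<Rightarrow> ('a \<Rightarrow> 'u \<Rightarrow> nat \<Rightarrow> complex) \<Rightarrow> ('a \<Rightarrow> 'bs) \<Rightarrow> ('a \<Rightarrow> 'ue)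
     \<Rightarrow> ennreal" where
  "uplink_capacity Tdata Tcoher M N U p SUE K h g hBS hUE =
     ennreal (Tdata / Tcoher) *
     (\<integral>\<^sup>+\<omega>. (SUP f\<in>input_laws SUE p.
        ennreal (uplink_mi N U (h \<omega>) (g \<omega>) (f (hUE \<omega>)) (K (h \<omega>, g \<omega>, hBS \<omega>, hUE \<omega>)))) \<partial>M)"

text \<open>The lower capacity bound without instantaneous CSI in the decoding, with combining vector
  \<open>v\<close> and interference covariance \<open>Q\<close> given the channels.\<close>

definition uplink_lower_bound ::
  "real \<Rightarrow> real \<Rightarrow> 'a measure \<Rightarrow> nat \<Rightarrow> real \<Rightarrow> real \<Rightarrow> real \<Rightarrow> real
     \<Rightarrow> ('a \<Rightarrow> complex mat) \<Rightarrow> ('a \<Rightarrow> nat \<Rightarrow> complex) \<Rightarrow> ('a \<Rightarrow> nat \<Rightarrow> complex) \<Rightarrow> real" where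
  "uplink_lower_bound Tdata Tcoher M N p \<kappa>t \<kappa>r \<sigma>2 Q h v =
     Tdata / Tcoher * log 2 (1 +
       (cmod (\<integral>\<omega>. cdot N (h \<omega>) (v \<omega>) \<partial>M))\<^sup>2 /
       ((1 + \<kappa>t) * (\<integral>\<omega>. (cmod (cdot N (h \<omega>) (v \<omega>)))\<^sup>2 \<partial>M)
        - (cmod (\<integral>\<omega>. cdot N (h \<omega>) (v \<omega>) \<partial>M))\<^sup>2
        + \<kappa>r * (\<Sum>i<N. \<integral>\<omega>. (cmod (h \<omega> i))\<^sup>2 * (cmod (v \<omega> i))\<^sup>2 \<partial>M)
        + (\<integral>\<omega>. Re (cdot N (v \<omega>)
              (mat_app (Q \<omega> + complex_of_real \<sigma>2 \<cdot>\<^sub>m 1\<^sub>m N) (v \<omega>))) \<partial>M) / p))"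

end

theory Submission
  imports Defs
begin

text \<open>Write \<open>a = h\<^sup>H A z\<close>, \<open>b = \<parallel>A z\<parallel>\<^sup>2\<close> and \<open>a0 = (d + \<eta>t) tr(A R)\<close>. Hanson--Wright type second moment
  computations for Gaussian quadratic forms show \<open>E |b - \<tau>|\<^sup>2 = O(N)\<close> and \<open>E |a - a0|\<^sup>2 = O(N)\<close>, whereas
  \<open>\<tau> \<ge> c N\<close>. In
  \<open>|a|\<^sup>2 / b - |a0|\<^sup>2 / \<tau> = (|a|\<^sup>2 / b) (\<tau> - b) / \<tau> + (|a|\<^sup>2 - |a0|\<^sup>2) / \<tau>\<close> the quotient \<open>|a|\<^sup>2 / b\<close> is
  at most \<open>\<parallel>h\<parallel>\<^sup>2\<close>, so no inverse moment of \<open>b\<close> is needed, and \<open>b = 0\<close> is harmless because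
  \<open>x / 0 = 0\<close>. The same works for a parallel co-user with \<open>a0 = dl tr(A Rl)\<close>; a co-user that does not
  disturb the pilot is independent of \<open>v\<close>. Dividing numerator and denominator of the capacity bound
  by \<open>t = tr(R - C) \<ge> c N\<close> turns these estimates into the claimed remainders, and \<open>e3\<close> can be zero.

  For the capacity bound itself take a Gaussian input and use the variational formula for the
  Kullback--Leibler divergence with the log-likelihood ratio of the Gaussian test channel of the linear
  estimate \<open>c v\<^sup>H y\<close> of the data signal from the received \<open>y\<close>, where \<open>c\<close> does not depend on the channel realization.\<close>

section \<open>Conditional laws and independence\<close>

text \<open>Two obstacles shape the moment estimates. The receiver distortion is Gaussian only
  conditionally on the channel, so its terms are centred in two stages: first at the mean given
  \<open>h\<close>, then that conditional mean around its own mean. And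
  \<open>complex_normal\<close> speaks of single linear functionals, so mixed fourth moments come
  from polarization; they turn the variance of a quadratic form into a squared Frobenius norm, which
  is N times a power of operator norms rather than N^2. Linear growth of \<open>\<tau>\<close> and
  of \<open>t\<close> has one source: by Cauchy-Schwarz on the diagonal, the squared Frobenius norm
  of R is at least (tr R)^2 / N, while Zbar lies between \<open>\<sigma>2\<close> I and a constant
  multiple of I. For the capacity, the scalar \<open>c\<close> minimises the estimation error
  averaged over the channel realizations, and the variance parameter of the test channel is this
  averaged error. The divergence bounds at single realizations then average exactly to the logarithm
  in the bound.\<close>

lemma has_cond_lawD:
  assumes "has_cond_law M S X T Y K"
  shows "X \<in> measurable M S" "Y \<in> measurable M T" "K \<in> measurable S (prob_algebra T)"
  using assms by (auto simp: has_cond_law_def)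

lemma has_cond_law_kernel:
  assumes "has_cond_law M S X T Y K" and "x \<in> space S"
  shows "prob_space (K x)" "sets (K x) = sets T" "space (K x) = space T"
proof -
  have "K x \<in> space (prob_algebra T)"
    using has_cond_lawD(3)[OF assms(1)] assms(2) by (rule measurable_space)
  then show "prob_space (K x)" "sets (K x) = sets T"
    by (auto simp: space_prob_algebra)
  then show "space (K x) = space T"
    by (auto dest: sets_eq_imp_space_eq)
qed

text \<open>Rectangles, on which the conditional law is defined, are stable under intersection and
  generate the product sigma-algebra, so a Dynkin argument reaches every measurable set. Complements
  work because both sides are then 1 minus a finite value.\<close>

lemma has_cond_law_emeasure:
  assumes "prob_space M" and L: "has_cond_law M S X T Y K" and E: "E \<in> sets (S \<Otimes>\<^sub>M T)"
  shows "emeasure M {x\<in>space M. (X x, Y x) \<in> E} =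
    (\<integral>\<^sup>+x. (\<integral>\<^sup>+y. indicator E (X x, y) \<partial>K (X x)) \<partial>M)"
proof -
  interpret M: prob_space M by fact
  note [measurable] = has_cond_lawD(1,2)[OF L]
  have K: "K \<in> measurable S (subprob_algebra T)"
    using has_cond_lawD(3)[OF L] by (rule measurable_prob_algebraD)
  have rect: "emeasure M {x\<in>space M. X x \<in> A \<and> Y x \<in> B} =
      (\<integral>\<^sup>+x. indicator A (X x) * emeasure (K (X x)) B \<partial>M)" if "A \<in> sets S" "B \<in> sets T" for A B
    using L that by (auto simp: has_cond_law_def)
  have Xs: "X x \<in> space S" if "x \<in> space M" for x
    using that by (rule measurable_space[OF has_cond_lawD(1)[OF L]])
  note Kp = has_cond_law_kernel[OF L Xs]
  have "E \<in> sigma_sets (space S \<times> space T) {a \<times> b | a b. a \<in> sets S \<and> b \<in> sets T}"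
    using E by (simp add: sets_pair_measure)
  then show ?thesis
  proof (induction rule: sigma_sets_induct_disjoint
      [OF Int_stable_pair_measure_generator pair_measure_closed, consumes 1, case_names basic empty compl union])
    case (basic E)
    then obtain A B where AB: "E = A \<times> B" "A \<in> sets S" "B \<in> sets T" by auto
    have "(\<integral>\<^sup>+y. indicator E (X x, y) \<partial>K (X x)) = indicator A (X x) * emeasure (K (X x)) B"
      if "x \<in> space M" for x
    proof -
      have "B \<in> sets (K (X x))" using AB Kp[OF that] by auto
      then show ?thesis
        by (simp add: AB(1) indicator_times nn_integral_cmult)
    qed
    moreover have "{x\<in>space M. (X x, Y x) \<in> E} = {x\<in>space M. X x \<in> A \<and> Y x \<in> B}"
      using AB by auto
    ultimately show ?case
      using rect[OF AB(2,3)] by (simp cong: nn_integral_cong)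
  next
    case empty
    show ?case by simp
  next
    case (compl E)
    then have E[measurable]: "E \<in> sets (S \<Otimes>\<^sub>M T)" by (simp add: sets_pair_measure)
    have "{x\<in>space M. (X x, Y x) \<in> space S \<times> space T - E} = space M - {x\<in>space M. (X x, Y x) \<in> E}"
      using Xs measurable_space[OF has_cond_lawD(2)[OF L]] by auto
    then have l: "emeasure M {x\<in>space M. (X x, Y x) \<in> space S \<times> space T - E} =
        1 - emeasure M {x\<in>space M. (X x, Y x) \<in> E}"
      by (simp add: emeasure_Diff M.emeasure_space_1)
    have in1: "(\<integral>\<^sup>+y. indicator (space S \<times> space T - E) (X x, y) \<partial>K (X x)) =
        1 - (\<integral>\<^sup>+y. indicator E (X x, y) \<partial>K (X x))"
      and le1: "(\<integral>\<^sup>+y. indicator E (X x, y) \<partial>K (X x)) \<le> 1" if w: "x \<in> space M" for x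
    proof -
      interpret k: prob_space "K (X x)" using Kp(1)[OF w] .
      have XS: "X x \<in> space S" using Xs[OF w] .
      have EX: "Pair (X x) -` E \<inter> space T \<in> sets (K (X x))"
        using measurable_sets[OF measurable_Pair1'[OF XS] E] Kp(2)[OF w] by simp
      have 1: "(\<integral>\<^sup>+y. indicator E (X x, y) \<partial>K (X x)) = emeasure (K (X x)) (Pair (X x) -` E \<inter> space T)"
        unfolding nn_integral_indicator[OF EX, symmetric]
        by (intro nn_integral_cong) (auto simp: Kp(3)[OF w] split: split_indicator)
      have "(\<integral>\<^sup>+y. indicator (space S \<times> space T - E) (X x, y) \<partial>K (X x)) =
        emeasure (K (X x)) (space (K (X x)) - (Pair (X x) -` E \<inter> space T))"
        unfolding nn_integral_indicator[OF sets.compl_sets[OF EX], symmetric]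
        using XS by (intro nn_integral_cong) (auto simp: Kp(3)[OF w] split: split_indicator)
      also have "\<dots> = 1 - emeasure (K (X x)) (Pair (X x) -` E \<inter> space T)"
        using EX by (subst emeasure_compl) (auto simp: k.emeasure_space_1 simp del: Kp(3)[OF w])
      finally show "(\<integral>\<^sup>+y. indicator (space S \<times> space T - E) (X x, y) \<partial>K (X x)) =
        1 - (\<integral>\<^sup>+y. indicator E (X x, y) \<partial>K (X x))" using 1 by simp
      show "(\<integral>\<^sup>+y. indicator E (X x, y) \<partial>K (X x)) \<le> 1"
        unfolding 1 by (rule k.measure_le_1)
    qed
    have meas: "(\<lambda>x. \<integral>\<^sup>+y. indicator E (X x, y) \<partial>K (X x)) \<in> borel_measurable M"
      by (rule measurable_compose[OF has_cond_lawD(1)[OF L]],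
          rule nn_integral_measurable_subprob_algebra2[OF _ K]) measurable
    have "(\<integral>\<^sup>+x. (\<integral>\<^sup>+y. indicator (space S \<times> space T - E) (X x, y) \<partial>K (X x)) \<partial>M) =
        (\<integral>\<^sup>+x. 1 - (\<integral>\<^sup>+y. indicator E (X x, y) \<partial>K (X x)) \<partial>M)"
      by (intro nn_integral_cong in1)
    also have "\<dots> = (\<integral>\<^sup>+x. 1 \<partial>M) - (\<integral>\<^sup>+x. (\<integral>\<^sup>+y. indicator E (X x, y) \<partial>K (X x)) \<partial>M)"
    proof (rule nn_integral_diff[OF _ meas])
      have "(\<integral>\<^sup>+x. (\<integral>\<^sup>+y. indicator E (X x, y) \<partial>K (X x)) \<partial>M) \<le> (\<integral>\<^sup>+x. 1 \<partial>M)"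
        by (intro nn_integral_mono le1)
      also have "\<dots> < \<infinity>" by (simp add: M.emeasure_space_1)
      finally show "(\<integral>\<^sup>+x. (\<integral>\<^sup>+y. indicator E (X x, y) \<partial>K (X x)) \<partial>M) \<noteq> \<infinity>" by simp
    qed (auto intro!: AE_I2 le1)
    finally show ?case
      using l compl.IH by (simp add: M.emeasure_space_1)
  next
    case (union F)
    then have F: "F i \<in> sets (S \<Otimes>\<^sub>M T)" for i by (auto simp: sets_pair_measure)
    note [measurable] = F
    have meas: "(\<lambda>x. \<integral>\<^sup>+y. indicator (F i) (X x, y) \<partial>K (X x)) \<in> borel_measurable M" for i
      by (rule measurable_compose[OF has_cond_lawD(1)[OF L]],
          rule nn_integral_measurable_subprob_algebra2[OF _ K]) measurable
    have "emeasure M {x\<in>space M. (X x, Y x) \<in> \<Union>(range F)} =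
        emeasure M (\<Union>i. {x\<in>space M. (X x, Y x) \<in> F i})"
      by (intro arg_cong2[where f=emeasure]) auto
    also have "\<dots> = (\<Sum>i. emeasure M {x\<in>space M. (X x, Y x) \<in> F i})"
      using union(1) by (intro suminf_emeasure[symmetric]) (auto simp: disjoint_family_on_def)
    also have "\<dots> = (\<Sum>i. (\<integral>\<^sup>+x. (\<integral>\<^sup>+y. indicator (F i) (X x, y) \<partial>K (X x)) \<partial>M))"
      by (simp add: union.IH)
    also have "\<dots> = (\<integral>\<^sup>+x. (\<Sum>i. \<integral>\<^sup>+y. indicator (F i) (X x, y) \<partial>K (X x)) \<partial>M)"
      by (intro nn_integral_suminf[symmetric] meas)
    also have "\<dots> = (\<integral>\<^sup>+x. (\<integral>\<^sup>+y. indicator (\<Union>(range F)) (X x, y) \<partial>K (X x)) \<partial>M)"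
    proof (rule nn_integral_cong)
      fix x assume w: "x \<in> space M"
      have XS: "X x \<in> space S" using Xs[OF w] .
      have m: "(\<lambda>y. indicator (F i) (X x, y)) \<in> borel_measurable (K (X x))" for i
        using measurable_compose[OF measurable_Pair1'[OF XS] borel_measurable_indicator[OF F[of i]]]
        by (simp add: measurable_cong_sets[OF Kp(2)[OF w] refl])
      have "(\<Sum>i. \<integral>\<^sup>+y. indicator (F i) (X x, y) \<partial>K (X x)) = (\<integral>\<^sup>+y. (\<Sum>i. indicator (F i) (X x, y)) \<partial>K (X x))"
        by (intro nn_integral_suminf[symmetric] m)
      also have "\<dots> = (\<integral>\<^sup>+y. indicator (\<Union>(range F)) (X x, y) \<partial>K (X x))"
        using union(1) by (intro nn_integral_cong suminf_indicator) 
      finally show "(\<Sum>i. \<integral>\<^sup>+y. indicator (F i) (X x, y) \<partial>K (X x)) = \<dots>" .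
    qed
    finally show ?case .
  qed
qed

lemma measurable_cond_law_nn_integral:
  assumes L: "has_cond_law M S X T Y K" and f[measurable]: "f \<in> borel_measurable (S \<Otimes>\<^sub>M T)"
  shows "(\<lambda>x. \<integral>\<^sup>+y. f (x, y) \<partial>K x) \<in> borel_measurable S"
  by (rule nn_integral_measurable_subprob_algebra2[OF _ measurable_prob_algebraD[OF has_cond_lawD(3)[OF L]]])
     measurable

text \<open>Disintegration: the version for sets passes to simple functions and, by monotone
  convergence, to every nonnegative measurable \<open>f\<close>. Integration over independent
  quantities and over the distortions given the channel are both instances.\<close>

lemma nn_integral_cond_law:
  assumes M: "prob_space M" and L: "has_cond_law M S X T Y K"
    and f: "f \<in> borel_measurable (S \<Otimes>\<^sub>M T)"
  shows "(\<integral>\<^sup>+s. f (X s, Y s) \<partial>M) = (\<integral>\<^sup>+s. (\<integral>\<^sup>+y. f (X s, y) \<partial>K (X s)) \<partial>M)"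
proof -
  note [measurable] = has_cond_lawD(1,2)[OF L]
  have Xs: "X s \<in> space S" if "s \<in> space M" for s
    using that by (rule measurable_space[OF has_cond_lawD(1)[OF L]])
  note Kp = has_cond_law_kernel[OF L Xs]
  have outer: "(\<lambda>s. \<integral>\<^sup>+y. u (X s, y) \<partial>K (X s)) \<in> borel_measurable M"
    if "u \<in> borel_measurable (S \<Otimes>\<^sub>M T)" for u
    by (rule measurable_compose[OF has_cond_lawD(1)[OF L]], rule measurable_cond_law_nn_integral[OF L that])
  have inner: "(\<lambda>y. u (X s, y)) \<in> borel_measurable (K (X s))"
    if "s \<in> space M" "u \<in> borel_measurable (S \<Otimes>\<^sub>M T)" for u :: "_ \<Rightarrow> ennreal" and s
    using measurable_compose[OF measurable_Pair1'[OF Xs[OF that(1)]] that(2)]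
    by (simp add: measurable_cong_sets[OF Kp(2)[OF that(1)] refl])
  show ?thesis
    using f
  proof (induction rule: borel_measurable_induct)
    case (cong f g)
    have "(\<integral>\<^sup>+s. f (X s, Y s) \<partial>M) = (\<integral>\<^sup>+s. g (X s, Y s) \<partial>M)"
      using Xs measurable_space[OF has_cond_lawD(2)[OF L]]
      by (intro nn_integral_cong cong(3)) (auto simp: space_pair_measure)
    also have "\<dots> = (\<integral>\<^sup>+s. (\<integral>\<^sup>+y. g (X s, y) \<partial>K (X s)) \<partial>M)"
      by (rule cong(4))
    also have "\<dots> = (\<integral>\<^sup>+s. (\<integral>\<^sup>+y. f (X s, y) \<partial>K (X s)) \<partial>M)"
      using Xs Kp(3)
      by (intro nn_integral_cong cong(3)[symmetric]) (auto simp: space_pair_measure)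
    finally show ?case .
  next
    case (set E)
    have "(\<integral>\<^sup>+s. indicator E (X s, Y s) \<partial>M) = (\<integral>\<^sup>+s. indicator {s\<in>space M. (X s, Y s) \<in> E} s \<partial>M)"
      by (intro nn_integral_cong) (auto split: split_indicator)
    also have "\<dots> = emeasure M {s\<in>space M. (X s, Y s) \<in> E}"
      using measurable_sets[OF measurable_Pair[OF has_cond_lawD(1,2)[OF L]] set]
      by (intro nn_integral_indicator) (simp add: vimage_def Int_def conj_commute)
    finally show ?case
      using has_cond_law_emeasure[OF M L set] by simp
  next
    case (mult u c)
    then show ?case
      by (simp add: nn_integral_cmult inner outer cong: nn_integral_cong)
  next
    case (add u v)
    then show ?case
      by (simp add: nn_integral_add inner outer cong: nn_integral_cong)
  next
    case (seq U)
    have mU: "U i \<in> borel_measurable (S \<Otimes>\<^sub>M T)" for i using seq by auto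
    have incU: "U i x \<le> U (Suc i) x" for i x
      by (rule le_funD[OF incseq_SucD[OF seq(3)]])
    have "(\<integral>\<^sup>+s. (SUP i. U i) (X s, Y s) \<partial>M) = (\<integral>\<^sup>+s. (SUP i. U i (X s, Y s)) \<partial>M)"
      by (simp add: image_comp)
    also have "\<dots> = (SUP i. \<integral>\<^sup>+s. U i (X s, Y s) \<partial>M)"
      using incU measurable_compose[OF measurable_Pair[OF has_cond_lawD(1,2)[OF L]] mU]
      by (intro nn_integral_monotone_convergence_SUP) (simp_all add: incseq_Suc_iff le_fun_def)
    also have "\<dots> = (SUP i. \<integral>\<^sup>+s. (\<integral>\<^sup>+y. U i (X s, y) \<partial>K (X s)) \<partial>M)"
      by (simp add: seq.IH)
    also have "\<dots> = (\<integral>\<^sup>+s. (SUP i. \<integral>\<^sup>+y. U i (X s, y) \<partial>K (X s)) \<partial>M)"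
      using incU
      by (intro nn_integral_monotone_convergence_SUP[symmetric] outer mU)
         (auto simp: incseq_Suc_iff le_fun_def intro!: nn_integral_mono)
    also have "\<dots> = (\<integral>\<^sup>+s. (\<integral>\<^sup>+y. (SUP i. U i (X s, y)) \<partial>K (X s)) \<partial>M)"
      using incU
      by (intro nn_integral_cong nn_integral_monotone_convergence_SUP[symmetric] inner mU)
         (auto simp: incseq_Suc_iff le_fun_def)
    finally show ?case by (simp add: image_comp)
  qed
qed

text \<open>Independence of \<open>X\<close> and \<open>Y\<close> is a conditional law of \<open>X\<close> given \<open>Y\<close> that does not depend
  on \<open>Y\<close>; the kernel form makes Fubini arguments uniform.\<close>

definition indep_of :: "'a measure \<Rightarrow> 'x measure \<Rightarrow> ('a \<Rightarrow> 'x) \<Rightarrow> 'y measure \<Rightarrow> ('a \<Rightarrow> 'y) \<Rightarrow> bool" where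
  "indep_of M S X T Y \<longleftrightarrow> has_cond_law M T Y S X (\<lambda>_. distr M S X)"

lemma indep_of_iff:
  assumes "prob_space M"
  shows "indep_of M S X T Y \<longleftrightarrow> X \<in> measurable M S \<and> Y \<in> measurable M T \<and>
    (\<forall>A\<in>sets S. \<forall>B\<in>sets T. emeasure M {x\<in>space M. X x \<in> A \<and> Y x \<in> B} =
      emeasure M {x\<in>space M. X x \<in> A} * emeasure M {x\<in>space M. Y x \<in> B})"
proof (cases "X \<in> measurable M S \<and> Y \<in> measurable M T")
  case True
  interpret M: prob_space M by fact
  have [measurable]: "X \<in> measurable M S" "Y \<in> measurable M T" using True by auto
  have k: "(\<lambda>_. distr M S X) \<in> measurable T (prob_algebra S)"
    by (intro measurable_const) (auto simp: space_prob_algebra intro: M.prob_space_distr)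
  have "(\<integral>\<^sup>+x. indicator B (Y x) * emeasure (distr M S X) A \<partial>M) =
      emeasure M {x\<in>space M. X x \<in> A} * emeasure M {x\<in>space M. Y x \<in> B}"
    if [measurable]: "A \<in> sets S" "B \<in> sets T" for A B
  proof -
    have "(\<integral>\<^sup>+x. indicator B (Y x) * emeasure (distr M S X) A \<partial>M) =
        (\<integral>\<^sup>+x. indicator {x\<in>space M. Y x \<in> B} x \<partial>M) * emeasure (distr M S X) A"
      by (subst nn_integral_multc[symmetric], measurable)
         (auto intro!: nn_integral_cong split: split_indicator)
    then show ?thesis
      by (simp add: emeasure_distr vimage_def Int_def mult.commute conj_commute)
  qed
  then show ?thesis
    using True k by (auto simp: indep_of_def has_cond_law_def conj_commute)
qed (auto simp: indep_of_def has_cond_law_def)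

lemma indep_of_measurable:
  assumes "indep_of M S X T Y"
  shows "X \<in> measurable M S" "Y \<in> measurable M T"
  using assms by (auto simp: indep_of_def dest: has_cond_lawD)

lemma indep_of_sym:
  assumes "prob_space M" "indep_of M S X T Y"
  shows "indep_of M T Y S X"
proof -
  have "emeasure M {x\<in>space M. Y x \<in> B \<and> X x \<in> A} =
      emeasure M {x\<in>space M. Y x \<in> B} * emeasure M {x\<in>space M. X x \<in> A}"
    if "A \<in> sets S" "B \<in> sets T" for A B
  proof -
    have "{x\<in>space M. Y x \<in> B \<and> X x \<in> A} = {x\<in>space M. X x \<in> A \<and> Y x \<in> B}" by auto
    then show ?thesis
      using assms(2) that unfolding indep_of_iff[OF assms(1)] by (simp add: mult.commute)
  qed
  then show ?thesis
    using assms(2) unfolding indep_of_iff[OF assms(1)] by simp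
qed

lemma nn_integral_indep_of:
  assumes M: "prob_space M" and I: "indep_of M S X T Y"
    and f: "(\<lambda>(x, y). f x y) \<in> borel_measurable (S \<Otimes>\<^sub>M T)"
  shows "(\<integral>\<^sup>+s. f (X s) (Y s) \<partial>M) = (\<integral>\<^sup>+s. (\<integral>\<^sup>+s'. f (X s') (Y s) \<partial>M) \<partial>M)"
proof -
  note [measurable] = indep_of_measurable[OF I]
  have [measurable]: "(\<lambda>(y, x). f x y) \<in> borel_measurable (T \<Otimes>\<^sub>M S)"
    using measurable_compose[OF measurable_pair_swap' f] by (simp add: case_prod_beta')
  have "(\<integral>\<^sup>+s. f (X s) (Y s) \<partial>M) = (\<integral>\<^sup>+s. (\<integral>\<^sup>+x. f x (Y s) \<partial>distr M S X) \<partial>M)"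
    using nn_integral_cond_law[OF M I[unfolded indep_of_def], of "\<lambda>(y, x). f x y"] by simp
  also have "\<dots> = (\<integral>\<^sup>+s. (\<integral>\<^sup>+s'. f (X s') (Y s) \<partial>M) \<partial>M)"
    by (intro nn_integral_cong nn_integral_distr) measurable
  finally show ?thesis .
qed

lemma indep_of_compose:
  assumes M: "prob_space M" and I: "indep_of M S X T Y"
    and f[measurable]: "f \<in> measurable S S'" and g[measurable]: "g \<in> measurable T T'"
  shows "indep_of M S' (\<lambda>x. f (X x)) T' (\<lambda>x. g (Y x))"
proof -
  note [measurable] = indep_of_measurable[OF I]
  have "emeasure M {x\<in>space M. f (X x) \<in> A \<and> g (Y x) \<in> B} =
      emeasure M {x\<in>space M. f (X x) \<in> A} * emeasure M {x\<in>space M. g (Y x) \<in> B}"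
    if [measurable]: "A \<in> sets S'" "B \<in> sets T'" for A B
  proof -
    have X: "X x \<in> space S" "Y x \<in> space T" if "x \<in> space M" for x
      using measurable_space[OF indep_of_measurable(1)[OF I] that]
        measurable_space[OF indep_of_measurable(2)[OF I] that] by auto
    have eq: "{x\<in>space M. f (X x) \<in> A \<and> g (Y x) \<in> B} =
        {x\<in>space M. X x \<in> f -` A \<inter> space S \<and> Y x \<in> g -` B \<inter> space T}"
      "{x\<in>space M. f (X x) \<in> A} = {x\<in>space M. X x \<in> f -` A \<inter> space S}"
      "{x\<in>space M. g (Y x) \<in> B} = {x\<in>space M. Y x \<in> g -` B \<inter> space T}"
      using X by auto
    show ?thesis
      unfolding eq using I[unfolded indep_of_iff[OF M]] measurable_sets[OF f that(1)] measurable_sets[OF g that(2)]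
      by (elim conjE) (drule (1) bspec, erule (1) bspec)
  qed
  then show ?thesis
    unfolding indep_of_iff[OF M] by simp
qed

text \<open>The kernel of \<open>Z\<close> ignores \<open>X\<close>, so given \<open>Y\<close>
  nothing about \<open>X\<close> enters \<open>Z\<close>, and \<open>Z\<close> can join
  \<open>Y\<close> without destroying independence. In this way the distortions, whose law depends
  on \<open>h\<close> alone, are added to whatever is independent of the quantity in
  question.\<close>

lemma indep_of_extend:
  assumes M: "prob_space M" and I: "indep_of M S X T Y"
    and L: "has_cond_law M (S \<Otimes>\<^sub>M T) (\<lambda>s. (X s, Y s)) V Z (\<lambda>(x, y). K y)"
  shows "indep_of M S X (T \<Otimes>\<^sub>M V) (\<lambda>s. (Y s, Z s))"
proof -
  interpret M: prob_space M by fact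
  note [measurable] = indep_of_measurable[OF I] has_cond_lawD(2)[OF L]
  have *: "emeasure M {s\<in>space M. X s \<in> A \<and> (Y s, Z s) \<in> B} =
      emeasure M {s\<in>space M. X s \<in> A} * (\<integral>\<^sup>+s. (\<integral>\<^sup>+z. indicator B (Y s, z) \<partial>K (Y s)) \<partial>M)"
    if [measurable]: "A \<in> sets S" "B \<in> sets (T \<Otimes>\<^sub>M V)" for A B
  proof -
    define E where "E = {xyz \<in> space ((S \<Otimes>\<^sub>M T) \<Otimes>\<^sub>M V). fst (fst xyz) \<in> A \<and> (snd (fst xyz), snd xyz) \<in> B}"
    have E[measurable]: "E \<in> sets ((S \<Otimes>\<^sub>M T) \<Otimes>\<^sub>M V)" unfolding E_def by measurable
    have ms: "X s \<in> space S" "Y s \<in> space T" "Z s \<in> space V" if "s \<in> space M" for s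
      using that by (rule measurable_space[OF indep_of_measurable(1)[OF I]]
          measurable_space[OF indep_of_measurable(2)[OF I]] measurable_space[OF has_cond_lawD(2)[OF L]])+
    have kv: "space (K (Y s)) = space V" if "s \<in> space M" for s
      using has_cond_law_kernel(3)[OF L, of "(X s, Y s)"] ms[OF that] by (simp add: space_pair_measure)
    have Em: "(\<lambda>x. \<integral>\<^sup>+z. indicator E (x, z) \<partial>(case x of (x, y) \<Rightarrow> K y)) \<in> borel_measurable (S \<Otimes>\<^sub>M T)"
      by (rule measurable_cond_law_nn_integral[OF L]) measurable
    have "emeasure M {s\<in>space M. X s \<in> A \<and> (Y s, Z s) \<in> B} = emeasure M {s\<in>space M. ((X s, Y s), Z s) \<in> E}"
      using ms by (intro arg_cong2[where f=emeasure]) (auto simp: E_def space_pair_measure)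
    also have "\<dots> = (\<integral>\<^sup>+s. (\<integral>\<^sup>+z. indicator E ((X s, Y s), z) \<partial>K (Y s)) \<partial>M)"
      using has_cond_law_emeasure[OF M L E] by simp
    also have "\<dots> = (\<integral>\<^sup>+s. (\<integral>\<^sup>+s'. (\<integral>\<^sup>+z. indicator E ((X s', Y s), z) \<partial>K (Y s)) \<partial>M) \<partial>M)"
      using nn_integral_indep_of[OF M I, of "\<lambda>x y. \<integral>\<^sup>+z. indicator E ((x, y), z) \<partial>K y"] Em
      by (simp add: case_prod_beta')
    also have "\<dots> = (\<integral>\<^sup>+s. (\<integral>\<^sup>+s'. indicator {s\<in>space M. X s \<in> A} s' * (\<integral>\<^sup>+z. indicator B (Y s, z) \<partial>K (Y s)) \<partial>M) \<partial>M)"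
      using ms kv by (intro nn_integral_cong)
        (auto simp: E_def space_pair_measure split: split_indicator intro!: nn_integral_cong nn_integral_zero')
    also have "\<dots> = (\<integral>\<^sup>+s. emeasure M {s\<in>space M. X s \<in> A} * (\<integral>\<^sup>+z. indicator B (Y s, z) \<partial>K (Y s)) \<partial>M)"
      by (intro nn_integral_cong) (simp add: nn_integral_multc)
    also have "\<dots> = emeasure M {s\<in>space M. X s \<in> A} * (\<integral>\<^sup>+s. (\<integral>\<^sup>+z. indicator B (Y s, z) \<partial>K (Y s)) \<partial>M)"
    proof (rule nn_integral_cmult)
      have "(\<lambda>q. indicator B (snd (fst q), snd q) :: ennreal) \<in> borel_measurable ((S \<Otimes>\<^sub>M T) \<Otimes>\<^sub>M V)"
        by measurable
      from measurable_cond_law_nn_integral[OF L this]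
      have "(\<lambda>x. \<integral>\<^sup>+z. indicator B (snd x, z) \<partial>K (snd x)) \<in> borel_measurable (S \<Otimes>\<^sub>M T)"
        by (simp add: case_prod_beta')
      from measurable_compose[OF _ this, of "\<lambda>s. (X s, Y s)" M]
      show "(\<lambda>s. \<integral>\<^sup>+z. indicator B (Y s, z) \<partial>K (Y s)) \<in> borel_measurable M" by simp
    qed
    finally show ?thesis .
  qed
  have **: "emeasure M {s\<in>space M. (Y s, Z s) \<in> B} = (\<integral>\<^sup>+s. (\<integral>\<^sup>+z. indicator B (Y s, z) \<partial>K (Y s)) \<partial>M)"
    if B: "B \<in> sets (T \<Otimes>\<^sub>M V)" for B
  proof -
    have "{s\<in>space M. X s \<in> space S} = space M"
      using measurable_space[OF indep_of_measurable(1)[OF I]] by auto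
    moreover have "{s\<in>space M. X s \<in> space S \<and> (Y s, Z s) \<in> B} = {s\<in>space M. (Y s, Z s) \<in> B}"
      using measurable_space[OF indep_of_measurable(1)[OF I]] by auto
    ultimately show ?thesis
      using *[OF sets.top B] by (simp add: M.emeasure_space_1)
  qed
  show ?thesis
    unfolding indep_of_iff[OF M]
  proof (intro conjI ballI)
    show "X \<in> measurable M S" "(\<lambda>s. (Y s, Z s)) \<in> measurable M (T \<Otimes>\<^sub>M V)" by measurable
  qed (simp only: * **)
qed

text \<open>A \<open>Z\<close> independent of the pair has a constant kernel, which in particular
  ignores \<open>X\<close>.\<close>

lemma indep_of_extend':
  assumes M: "prob_space M" and I: "indep_of M S X T Y"
    and J: "indep_of M V Z (S \<Otimes>\<^sub>M T) (\<lambda>x. (X x, Y x))"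
  shows "indep_of M S X (T \<Otimes>\<^sub>M V) (\<lambda>x. (Y x, Z x))"
  using indep_of_extend[OF M I, of V Z "\<lambda>_. distr M V Z"] J
  by (simp add: indep_of_def case_prod_beta')

lemma indep_elems_imp_indep_of:
  assumes M: "prob_space M" and I: "indep_elems M S X T Y"
  shows "indep_of M S X T Y"
proof -
  interpret M: prob_space M by fact
  have [measurable]: "X \<in> measurable M S" "Y \<in> measurable M T"
    using I by (auto simp: indep_elems_def)
  have "M.indep_set {X -` A \<inter> space M | A. A \<in> sets S} {Y -` B \<inter> space M | B. B \<in> sets T}"
    using I by (auto simp: indep_elems_def)
  then have "M.prob ((X -` A \<inter> space M) \<inter> (Y -` B \<inter> space M)) = M.prob (X -` A \<inter> space M) * M.prob (Y -` B \<inter> space M)"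
    if "A \<in> sets S" "B \<in> sets T" for A B
    using that by (intro M.indep_setD) auto
  moreover have "(X -` A \<inter> space M) \<inter> (Y -` B \<inter> space M) = {x\<in>space M. X x \<in> A \<and> Y x \<in> B}"
    "X -` A \<inter> space M = {x\<in>space M. X x \<in> A}" "Y -` B \<inter> space M = {x\<in>space M. Y x \<in> B}" for A B
    by auto
  ultimately show ?thesis
    unfolding indep_of_iff[OF M] by (simp add: M.emeasure_eq_measure ennreal_mult)
qed

lemma indep_var_imp_indep_of:
  assumes M: "prob_space M" and I: "prob_space.indep_var M S X T Y"
  shows "indep_of M S X T Y"
proof -
  interpret M: prob_space M by fact
  have XY: "X \<in> measurable M S" "Y \<in> measurable M T"
    using M.indep_var_rv1[OF I] M.indep_var_rv2[OF I] by auto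
  show ?thesis
    unfolding indep_of_iff[OF M]
  proof (intro conjI ballI)
    fix A B assume AB: "A \<in> sets S" "B \<in> sets T"
    have "M.prob ((\<lambda>x. (X x, Y x)) -` (A \<times> B) \<inter> space M) = M.prob (X -` A \<inter> space M) * M.prob (Y -` B \<inter> space M)"
      by (rule M.indep_varD[OF I AB])
    moreover have "(\<lambda>x. (X x, Y x)) -` (A \<times> B) \<inter> space M = {y\<in>space M. X y \<in> A \<and> Y y \<in> B}"
      "X -` A \<inter> space M = {y\<in>space M. X y \<in> A}" "Y -` B \<inter> space M = {y\<in>space M. Y y \<in> B}"
      by auto
    ultimately show "emeasure M {y\<in>space M. X y \<in> A \<and> Y y \<in> B} =
      emeasure M {y\<in>space M. X y \<in> A} * emeasure M {y\<in>space M. Y y \<in> B}"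
      by (simp add: M.emeasure_eq_measure ennreal_mult)
  qed (use XY in auto)
qed

lemma cond_law_imp_indep_of:
  assumes M: "prob_space M" and L: "has_cond_law M S X T Y (\<lambda>_. K)"
  shows "indep_of M T Y S X" "distr M T Y = K"
proof -
  interpret M: prob_space M by fact
  note [measurable] = has_cond_lawD(1,2)[OF L]
  \<comment> \<open>Kernel properties are available at points of \<open>space S\<close> only; a
    sample point provides one at which the constant kernel can be inspected.\<close>
  obtain x where w: "x \<in> space M" using M.not_empty by auto
  have Xs: "X x \<in> space S" using w measurable_space[OF has_cond_lawD(1)[OF L]] by auto
  have KT: "sets K = sets T" using has_cond_law_kernel(2)[OF L Xs] .
  show 1: "distr M T Y = K"
  proof (rule measure_eqI)
    fix B assume "B \<in> sets (distr M T Y)"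
    then have B[measurable]: "B \<in> sets T" by simp
    have "{x\<in>space M. X x \<in> space S \<and> Y x \<in> B} = Y -` B \<inter> space M"
      using measurable_space[OF has_cond_lawD(1)[OF L]] by auto
    then have "emeasure (distr M T Y) B = emeasure M {x\<in>space M. X x \<in> space S \<and> Y x \<in> B}"
      by (simp add: emeasure_distr)
    also have "\<dots> = (\<integral>\<^sup>+x. indicator (space S) (X x) * emeasure K B \<partial>M)"
      using L by (auto simp: has_cond_law_def)
    also have "\<dots> = (\<integral>\<^sup>+x. emeasure K B \<partial>M)"
      using measurable_space[OF has_cond_lawD(1)[OF L]] by (intro nn_integral_cong) auto
    finally show "emeasure (distr M T Y) B = emeasure K B" by (simp add: M.emeasure_space_1)
  qed (simp add: KT)
  show "indep_of M T Y S X"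
    unfolding indep_of_def 1 using L .
qed

text \<open>Since the kernel already factors through \<open>f\<close>, forgetting the rest of the
  conditioning variable leaves it a version of the conditional law.\<close>

lemma has_cond_law_coarsen:
  assumes M: "prob_space M" and L: "has_cond_law M S X T Y (\<lambda>x. K (f x))"
    and f: "f \<in> measurable S S'" and K: "K \<in> measurable S' (prob_algebra T)"
  shows "has_cond_law M S' (\<lambda>y. f (X y)) T Y K"
  unfolding has_cond_law_def
proof (intro conjI ballI)
  show "(\<lambda>y. f (X y)) \<in> measurable M S'" "Y \<in> measurable M T"
    using measurable_compose[OF has_cond_lawD(1)[OF L] f] has_cond_lawD(2)[OF L] by auto
  fix A B assume "A \<in> sets S'" "B \<in> sets T"
  have Xs: "X y \<in> space S" if "y \<in> space M" for y
    using that by (rule measurable_space[OF has_cond_lawD(1)[OF L]])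
  have "emeasure M {y\<in>space M. f (X y) \<in> A \<and> Y y \<in> B} =
      emeasure M {y\<in>space M. X y \<in> f -` A \<inter> space S \<and> Y y \<in> B}"
    using Xs by (intro arg_cong2[where f=emeasure]) auto
  also have "\<dots> = (\<integral>\<^sup>+y. indicator (f -` A \<inter> space S) (X y) * emeasure (K (f (X y))) B \<partial>M)"
    using L \<open>B \<in> sets T\<close> measurable_sets[OF f \<open>A \<in> sets S'\<close>]
    unfolding has_cond_law_def by (elim conjE) (drule (1) bspec, drule (1) bspec, assumption)
  also have "\<dots> = (\<integral>\<^sup>+y. indicator A (f (X y)) * emeasure (K (f (X y))) B \<partial>M)"
    using Xs by (intro nn_integral_cong) (auto split: split_indicator)
  finally show "emeasure M {y\<in>space M. f (X y) \<in> A \<and> Y y \<in> B} =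
    (\<integral>\<^sup>+y. indicator A (f (X y)) * emeasure (K (f (X y))) B \<partial>M)" .
qed fact

section \<open>Moments of circularly symmetric Gaussians\<close>

lemma prob_space_std_normal: "prob_space (density lborel std_normal_density)"
  by (rule prob_space_normal_density) simp

lemma std_normal_moments:
  "has_bochner_integral (density lborel std_normal_density) (\<lambda>x. 1) (1 :: real)"
  "has_bochner_integral (density lborel std_normal_density) (\<lambda>x. x) 0"
  "has_bochner_integral (density lborel std_normal_density) (\<lambda>x. x ^ 2) 1"
  "has_bochner_integral (density lborel std_normal_density) (\<lambda>x. x ^ 3) 0"
  "has_bochner_integral (density lborel std_normal_density) (\<lambda>x. x ^ 4) 3"
proof -
  have *: "has_bochner_integral (density lborel std_normal_density) f I"
    if "has_bochner_integral lborel (\<lambda>x. std_normal_density x * f x) I" "f \<in> borel_measurable borel" for f :: "real \<Rightarrow> real" and I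
    using that by (intro has_bochner_integral_density) (auto simp: normal_density_nonneg)
  show "has_bochner_integral (density lborel std_normal_density) (\<lambda>x. 1) (1 :: real)"
    using *[of "\<lambda>_. 1" 1] std_normal_moment_even[of 0] by simp
  show "has_bochner_integral (density lborel std_normal_density) (\<lambda>x. x) 0"
    by (rule *) (use std_normal_moment_odd[of 0] in simp_all)
  show "has_bochner_integral (density lborel std_normal_density) (\<lambda>x. x ^ 2) 1"
    by (rule *) (use std_normal_moment_even[of 1] in \<open>simp_all add: fact_numeral\<close>)
  show "has_bochner_integral (density lborel std_normal_density) (\<lambda>x. x ^ 3) 0"
    by (rule *) (use std_normal_moment_odd[of 1] in \<open>simp_all add: numeral_3_eq_3\<close>)
  show "has_bochner_integral (density lborel std_normal_density) (\<lambda>x. x ^ 4) 3"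
    by (rule *) (use std_normal_moment_even[of 2] in \<open>simp_all add: fact_numeral\<close>)
qed

text \<open>1, x and x^2 - 1 are the first Hermite polynomials, orthogonal with squared norms 1, 1
  and 2.\<close>

lemma nn_integral_std_normal_quadratic:
  "(\<integral>\<^sup>+x. ennreal ((a + b * x + c * (x^2 - 1))^2) \<partial>density lborel std_normal_density) =
    ennreal (a^2 + b^2 + 2 * c^2)"
proof -
  have "has_bochner_integral (density lborel std_normal_density)
      (\<lambda>x. (a - c)^2 * 1 + (2 * (a - c) * b) * x + (b^2 + 2 * (a - c) * c) * x ^ 2 + (2 * b * c) * x ^ 3 + c^2 * x ^ 4)
      ((a - c)^2 * 1 + (2 * (a - c) * b) * 0 + (b^2 + 2 * (a - c) * c) * 1 + (2 * b * c) * 0 + c^2 * 3)"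
    by (intro has_bochner_integral_add has_bochner_integral_mult_right std_normal_moments)
  moreover have eq: "(a - c)^2 * 1 + (2 * (a - c) * b) * x + (b^2 + 2 * (a - c) * c) * x ^ 2 + (2 * b * c) * x ^ 3 + c^2 * x ^ 4
      = (a + b * x + c * (x^2 - 1))^2" for x :: real
    by (simp add: power2_eq_square power3_eq_cube power4_eq_xxxx algebra_simps)
  moreover have "(a - c)^2 * 1 + (2 * (a - c) * b) * 0 + (b^2 + 2 * (a - c) * c) * 1 + (2 * b * c) * 0 + c^2 * 3
      = a^2 + b^2 + 2 * c^2"
    by (simp add: power2_eq_square algebra_simps)
  ultimately have "has_bochner_integral (density lborel std_normal_density)
      (\<lambda>x. (a + b * x + c * (x^2 - 1))^2) (a^2 + b^2 + 2 * c^2)"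
    by (simp only:)
  then show ?thesis
    by (subst nn_integral_eq_integral) (auto simp: has_bochner_integral_iff)
qed

lemma cnormal_map_measurable[measurable]:
  "(\<lambda>(x, y). complex_of_real (sqrt (s / 2)) * Complex x y) \<in>
    measurable (density lborel f \<Otimes>\<^sub>M density lborel g) borel"
proof -
  have "(\<lambda>(x, y). complex_of_real (sqrt (s / 2)) * Complex x y) =
      (\<lambda>q. complex_of_real (sqrt (s / 2)) * (complex_of_real (fst q) + \<i> * complex_of_real (snd q)))"
    by (auto simp: fun_eq_iff complex_eq_iff)
  then show ?thesis by simp
qed

lemma sets_cnormal[simp, measurable_cong]: "sets (cnormal s) = sets borel"
  by (simp add: cnormal_def)

lemma space_cnormal[simp]: "space (cnormal s) = UNIV"
  by (simp add: cnormal_def)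

lemma prob_space_cnormal: "prob_space (cnormal s)"
proof -
  interpret A: prob_space "density lborel std_normal_density" by (rule prob_space_std_normal)
  interpret P: pair_prob_space "density lborel std_normal_density" "density lborel std_normal_density" ..
  show ?thesis unfolding cnormal_def by (rule P.prob_space_distr) measurable
qed

lemma emeasure_cnormal_UNIV[simp]: "emeasure (cnormal s) UNIV = 1"
  using prob_space.emeasure_space_1[OF prob_space_cnormal] by simp

lemma emeasure_PiM_cnormal[simp]:
  "emeasure (PiM I (\<lambda>i. cnormal (s i))) (space (PiM I (\<lambda>i. cnormal (s i)))) = 1"
  by (intro prob_space.emeasure_space_1 prob_space_PiM prob_space_cnormal)

lemma nn_integral_cnormal:
  assumes [measurable]: "f \<in> borel_measurable borel"
  shows "(\<integral>\<^sup>+z. f z \<partial>cnormal s) = (\<integral>\<^sup>+x. (\<integral>\<^sup>+y. f (complex_of_real (sqrt (s / 2)) * Complex x y)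
    \<partial>density lborel std_normal_density) \<partial>density lborel std_normal_density)"
proof -
  interpret A: prob_space "density lborel std_normal_density" by (rule prob_space_std_normal)
  have "(\<integral>\<^sup>+z. f z \<partial>cnormal s) = (\<integral>\<^sup>+q. f (case q of (x, y) \<Rightarrow> complex_of_real (sqrt (s / 2)) * Complex x y)
      \<partial>(density lborel std_normal_density \<Otimes>\<^sub>M density lborel std_normal_density))"
    unfolding cnormal_def by (subst nn_integral_distr) auto
  also have "\<dots> = (\<integral>\<^sup>+x. (\<integral>\<^sup>+y. f (complex_of_real (sqrt (s / 2)) * Complex x y)
    \<partial>density lborel std_normal_density) \<partial>density lborel std_normal_density)"
    by (subst A.nn_integral_fst[symmetric]) (auto intro!: measurable_compose[OF cnormal_map_measurable])
  finally show ?thesis .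
qed

lemma Re_cnj_mult_self: "Re (cnj z * z) = (cmod z)^2" "Re (z * cnj z) = (cmod z)^2"
  unfolding cmod_power2 by (simp_all add: power2_eq_square)

lemma cmod_add_squared: "(cmod (a + b))^2 = (cmod a)^2 + 2 * Re (cnj a * b) + (cmod b)^2"
  unfolding cmod_power2 by (simp add: power2_eq_square algebra_simps)

text \<open>The orthogonality of the two summands in the martingale increment of a Gaussian
  quadratic form.\<close>

lemma nn_integral_cnormal_quadratic:
  assumes "0 \<le> s"
  shows "(\<integral>\<^sup>+y. ennreal ((f + 2 * Re (y * c) + \<alpha> * ((cmod y)^2 - s))^2) \<partial>cnormal s) =
    ennreal (f^2 + 2 * s * (cmod c)^2 + \<alpha>^2 * s^2)"
proof -
  define r where "r = sqrt (s / 2)"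
  have r2: "r^2 = s / 2" using assms by (simp add: r_def)
  let ?N = "density lborel std_normal_density"
  have "f + 2 * Re (complex_of_real r * Complex x y * c) + \<alpha> * ((cmod (complex_of_real r * Complex x y))^2 - s) =
      (f + 2 * r * Re c * x + \<alpha> * r^2 * (x^2 - 1)) + (- 2 * r * Im c) * y + (\<alpha> * r^2) * (y^2 - 1)" for x y
  proof -
    have "(cmod (complex_of_real r * Complex x y))^2 = r^2 * (x^2 + y^2)"
      by (simp add: norm_mult power_mult_distrib cmod_power2)
    moreover have "s = 2 * r^2" using r2 by simp
    ultimately show ?thesis by (simp add: algebra_simps)
  qed
  then have "(\<integral>\<^sup>+y. ennreal ((f + 2 * Re (y * c) + \<alpha> * ((cmod y)^2 - s))^2) \<partial>cnormal s) =
    (\<integral>\<^sup>+x. (\<integral>\<^sup>+y. ennreal (((f + 2 * r * Re c * x + \<alpha> * r^2 * (x^2 - 1)) + (- 2 * r * Im c) * y + (\<alpha> * r^2) * (y^2 - 1))^2) \<partial>?N) \<partial>?N)"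
    by (subst nn_integral_cnormal) (simp_all only: r_def[symmetric], measurable)
  also have "\<dots> = (\<integral>\<^sup>+x. ennreal ((f + 2 * r * Re c * x + \<alpha> * r^2 * (x^2 - 1))^2) + ennreal ((- 2 * r * Im c)^2 + 2 * (\<alpha> * r^2)^2) \<partial>?N)"
    unfolding nn_integral_std_normal_quadratic by (simp add: ennreal_plus[symmetric] add.assoc del: ennreal_plus)
  also have "\<dots> = ennreal (f^2 + (2 * r * Re c)^2 + 2 * (\<alpha> * r^2)^2) + ennreal ((- 2 * r * Im c)^2 + 2 * (\<alpha> * r^2)^2)"
    using nn_integral_std_normal_quadratic[of f "2 * r * Re c" "\<alpha> * r^2"] prob_space.emeasure_space_1[OF prob_space_std_normal]
    by (subst nn_integral_add) auto
  also have "\<dots> = ennreal (f^2 + 2 * s * (cmod c)^2 + \<alpha>^2 * s^2)"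
  proof -
    have "(f^2 + (2 * r * Re c)^2 + 2 * (\<alpha> * r^2)^2) + ((- 2 * r * Im c)^2 + 2 * (\<alpha> * r^2)^2)
        = f^2 + 4 * r^2 * ((Re c)^2 + (Im c)^2) + 4 * \<alpha>^2 * (r^2)^2"
      by (simp add: power_mult_distrib algebra_simps)
    also have "\<dots> = f^2 + 2 * s * (cmod c)^2 + \<alpha>^2 * s^2"
      unfolding r2 cmod_power2 by (simp add: power_divide)
    finally show ?thesis by (subst ennreal_plus[symmetric]) (simp_all only: add_nonneg_nonneg zero_le_power2 mult_nonneg_nonneg zero_le_numeral)
  qed
  finally show ?thesis .
qed

text \<open>Choosing the constant term \<open>s\<close>, no linear term and coefficient 1 turns the
  quadratic integrand into |y|^4; its value is s^2 + s^2.\<close>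

lemma nn_integral_cnormal_power4: "0 \<le> s \<Longrightarrow> (\<integral>\<^sup>+y. ennreal ((cmod y) ^ 4) \<partial>cnormal s) = ennreal (2 * s^2)"
  using nn_integral_cnormal_quadratic[of s s 0 1] by (simp flip: power_mult)

text \<open>\<open>centered \<mu> v\<close>: mean zero and variance \<open>v\<close>, in a form that is directly usable under
  iterated nonnegative integrals.\<close>

definition centered :: "complex measure \<Rightarrow> real \<Rightarrow> bool" where
  "centered \<mu> v \<longleftrightarrow> prob_space \<mu> \<and> sets \<mu> = sets borel \<and> 0 \<le> v \<and>
    (\<forall>a b. (\<integral>\<^sup>+y. ennreal ((cmod (a + b * y))^2) \<partial>\<mu>) = ennreal ((cmod a)^2 + (cmod b)^2 * v))"

lemma centeredD:
  assumes "centered \<mu> v"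
  shows "prob_space \<mu>" "sets \<mu> = sets borel" "0 \<le> v"
    "(\<integral>\<^sup>+y. ennreal ((cmod (a + b * y))^2) \<partial>\<mu>) = ennreal ((cmod a)^2 + (cmod b)^2 * v)"
  using assms by (auto simp: centered_def)

text \<open>Real and imaginary part of a + b y are each of the form f + 2 Re (y c), so each falls
  under \<open>nn_integral_cnormal_quadratic\<close> with \<open>\<alpha>\<close> equal to
  0.\<close>

lemma centered_cnormal:
  assumes "0 \<le> s"
  shows "centered (cnormal s) s"
proof -
  have "(\<integral>\<^sup>+y. ennreal ((cmod (a + b * y))^2) \<partial>cnormal s) = ennreal ((cmod a)^2 + (cmod b)^2 * s)" for a b
  proof -
    have "(\<integral>\<^sup>+y. ennreal ((cmod (a + b * y))^2) \<partial>cnormal s) =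
      (\<integral>\<^sup>+y. ennreal ((Re a + 2 * Re (y * (b / 2)) + 0 * ((cmod y)^2 - s))^2) +
        ennreal ((Im a + 2 * Re (y * (- \<i> * b / 2)) + 0 * ((cmod y)^2 - s))^2) \<partial>cnormal s)"
    proof (intro nn_integral_cong)
      fix y
      have "2 * Re (y * (b / 2)) = Re (b * y)" "2 * Re (y * (- \<i> * b / 2)) = Im (b * y)"
        by (simp_all add: field_simps)
      then have "(cmod (a + b * y))^2 = (Re a + 2 * Re (y * (b / 2)) + 0 * ((cmod y)^2 - s))^2 +
          (Im a + 2 * Re (y * (- \<i> * b / 2)) + 0 * ((cmod y)^2 - s))^2"
        by (simp only: cmod_power2) simp
      then show "ennreal ((cmod (a + b * y))^2) = ennreal ((Re a + 2 * Re (y * (b / 2)) + 0 * ((cmod y)^2 - s))^2) +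
        ennreal ((Im a + 2 * Re (y * (- \<i> * b / 2)) + 0 * ((cmod y)^2 - s))^2)"
        by (simp only: ennreal_plus zero_le_power2)
    qed
    also have "\<dots> = ennreal ((Re a)^2 + 2 * s * (cmod (b / 2))^2 + 0^2 * s^2) +
      ennreal ((Im a)^2 + 2 * s * (cmod (- \<i> * b / 2))^2 + 0^2 * s^2)"
      unfolding nn_integral_cnormal_quadratic[OF assms, symmetric]
      by (subst nn_integral_add) auto
    also have "\<dots> = ennreal ((cmod a)^2 + (cmod b)^2 * s)"
      using assms by (subst ennreal_plus[symmetric]) (auto simp: cmod_power2 norm_divide norm_mult power_divide)
    finally show ?thesis .
  qed
  then show ?thesis using assms by (auto simp: centered_def prob_space_cnormal)
qed

text \<open>The cross term of the expanded square vanishes with the mean. A Bochner integral equal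
  to 0 does not show that y is integrable, so integrability is first derived from the second
  moment.\<close>

lemma centeredI:
  fixes \<mu> :: "complex measure"
  assumes "prob_space \<mu>" "sets \<mu> = sets borel" "(\<integral>y. y \<partial>\<mu>) = 0" "integrable \<mu> (\<lambda>y. (cmod y)^2)"
    and v: "(\<integral>y. (cmod y)^2 \<partial>\<mu>) = v"
  shows "centered \<mu> v"
proof -
  interpret prob_space \<mu> by fact
  have [measurable_cong]: "sets \<mu> = sets borel" by fact
  have I: "integrable \<mu> (\<lambda>y. y)"
  proof (rule Bochner_Integration.integrable_bound)
    show "integrable \<mu> (\<lambda>y. 1 + (cmod y)^2)" using assms by simp
    have "cmod y \<le> 1 + (cmod y)^2" for y
      using sum_squares_bound[of 1 "cmod y"] zero_le_power2[of "cmod y"] norm_ge_zero[of y] unfolding one_power2 by linarith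
    then show "AE y in \<mu>. cmod y \<le> norm (1 + (cmod y)^2)" by auto
  qed simp
  have "(\<integral>\<^sup>+y. ennreal ((cmod (a + b * y))^2) \<partial>\<mu>) = ennreal ((cmod a)^2 + (cmod b)^2 * v)" for a b
  proof -
    have eq: "(cmod (a + b * y))^2 = (cmod a)^2 + 2 * Re (cnj a * b * y) + (cmod b)^2 * (cmod y)^2" for y
      by (simp add: cmod_add_squared norm_mult power_mult_distrib mult.assoc)
    have I2: "integrable \<mu> (\<lambda>y. Re (cnj a * b * y))" by (intro integrable_Re integrable_mult_right I)
    have "(\<integral>y. Re (cnj a * b * y) \<partial>\<mu>) = Re (cnj a * b * (\<integral>y. y \<partial>\<mu>))"
      using I by (subst integral_Re) auto
    then have "(\<integral>y. (cmod (a + b * y))^2 \<partial>\<mu>) = (cmod a)^2 + (cmod b)^2 * v"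
      unfolding eq using I2 assms by (simp only: Bochner_Integration.integral_add Bochner_Integration.integrable_add
          integrable_mult_right integrable_const Bochner_Integration.integral_mult_right mult.assoc) (simp add: prob_space assms)
    moreover have "integrable \<mu> (\<lambda>y. (cmod (a + b * y))^2)"
      unfolding eq using I2 assms(4)
      by (simp only: mult.assoc Bochner_Integration.integrable_add integrable_mult_right integrable_const)
    ultimately show ?thesis by (subst nn_integral_eq_integral) auto
  qed
  moreover have "0 \<le> v" unfolding v[symmetric] by simp
  ultimately show ?thesis using assms by (auto simp: centered_def)
qed

lemma product_sigma_finite_prob: "(\<And>i. prob_space (\<mu> i)) \<Longrightarrow> product_sigma_finite \<mu>"
  by (simp add: product_sigma_finite_def prob_space_imp_sigma_finite)

lemma measurable_PiM_borel_sum[measurable]: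
  fixes b :: "'i \<Rightarrow> complex"
  assumes \<mu>: "\<And>i. i \<in> I \<Longrightarrow> sets (\<mu> i) = sets borel"
  shows "(\<lambda>y. \<Sum>i\<in>I. b i * y i) \<in> borel_measurable (PiM I \<mu>)"
  by (intro borel_measurable_sum borel_measurable_times borel_measurable_const)
     (metis \<mu> measurable_component_singleton measurable_cong_sets)

text \<open>Independent centred coordinates are orthogonal: integrating one coordinate at a time
  adds its variance and leaves the remaining sum as the new constant.\<close>

lemma nn_integral_PiM_linear:
  fixes b :: "'i \<Rightarrow> complex" and \<mu> :: "'i \<Rightarrow> complex measure"
  assumes "finite I" and \<mu>: "\<And>i. i \<in> I \<Longrightarrow> centered (\<mu> i) (v i)"
  shows "(\<integral>\<^sup>+y. ennreal ((cmod (a + (\<Sum>i\<in>I. b i * y i)))^2) \<partial>PiM I \<mu>) =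
    ennreal ((cmod a)^2 + (\<Sum>i\<in>I. (cmod (b i))^2 * v i))"
proof -
  \<comment> \<open>\<open>product_sigma_finite\<close> wants a measure at every index, so the
    family is continued by the point mass at 0 outside \<open>I\<close>.\<close>
  define \<mu>' where "\<mu>' = (\<lambda>i. if i \<in> I then \<mu> i else cnormal 0)"
  have \<mu>': "prob_space (\<mu>' i)" "sets (\<mu>' i) = sets borel" for i
    using \<mu> by (auto simp: \<mu>'_def prob_space_cnormal dest: centeredD)
  interpret product_sigma_finite \<mu>' by (intro product_sigma_finite_prob \<mu>')
  have "(\<integral>\<^sup>+y. ennreal ((cmod (a + (\<Sum>i\<in>J. b i * y i)))^2) \<partial>PiM J \<mu>') =
      ennreal ((cmod a)^2 + (\<Sum>i\<in>J. (cmod (b i))^2 * v i))" if "finite J" "J \<subseteq> I" for J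
    using that
  proof (induction J arbitrary: a rule: finite_induct)
    case empty
    then show ?case by (simp add: space_PiM)
  next
    case (insert j J)
    have [measurable]: "(\<lambda>y. \<Sum>i\<in>J. b i * y i) \<in> borel_measurable (PiM J \<mu>')" "(\<lambda>y. y) \<in> borel_measurable (\<mu>' j)"
      by (auto intro!: measurable_PiM_borel_sum \<mu>' measurable_ident_sets)
    have vn: "0 \<le> v i" if "i \<in> I" for i using \<mu>[OF that] by (rule centeredD)
    have "(\<integral>\<^sup>+y. ennreal ((cmod (a + (\<Sum>i\<in>insert j J. b i * y i)))^2) \<partial>PiM (insert j J) \<mu>') =
      (\<integral>\<^sup>+y. (\<integral>\<^sup>+x. ennreal ((cmod (a + (\<Sum>i\<in>insert j J. b i * (x(j := y)) i)))^2) \<partial>PiM J \<mu>') \<partial>\<mu>' j)"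
      using insert.hyps measurable_PiM_borel_sum[of "insert j J" \<mu>' b] \<mu>'
      by (intro product_nn_integral_insert_rev) auto
    also have "\<dots> = (\<integral>\<^sup>+y. (\<integral>\<^sup>+x. ennreal ((cmod ((a + b j * y) + (\<Sum>i\<in>J. b i * x i)))^2) \<partial>PiM J \<mu>') \<partial>\<mu>' j)"
    proof (intro nn_integral_cong)
      fix x y
      have "(\<Sum>i\<in>J. b i * (x(j := y)) i) = (\<Sum>i\<in>J. b i * x i)"
        using insert.hyps by (intro sum.cong) auto
      then show "ennreal ((cmod (a + (\<Sum>i\<in>insert j J. b i * (x(j := y)) i)))^2) =
        ennreal ((cmod ((a + b j * y) + (\<Sum>i\<in>J. b i * x i)))^2)"
        using insert.hyps by (simp add: add.assoc)
    qed
    also have "\<dots> = (\<integral>\<^sup>+y. ennreal ((cmod (a + b j * y))^2 + (\<Sum>i\<in>J. (cmod (b i))^2 * v i)) \<partial>\<mu>' j)"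
      using insert.prems by (simp only: insert.IH[OF order_trans[OF subset_insertI]])
    also have "\<dots> = (\<integral>\<^sup>+y. ennreal ((cmod (a + b j * y))^2) + ennreal (\<Sum>i\<in>J. (cmod (b i))^2 * v i) \<partial>\<mu>' j)"
      using insert.prems vn by (intro nn_integral_cong ennreal_plus sum_nonneg) auto
    also have "\<dots> = ennreal ((cmod a)^2 + (cmod (b j))^2 * v j) + ennreal (\<Sum>i\<in>J. (cmod (b i))^2 * v i)"
    proof -
      have "(\<integral>\<^sup>+y. ennreal ((cmod (a + b j * y))^2) \<partial>\<mu>' j) = ennreal ((cmod a)^2 + (cmod (b j))^2 * v j)"
        using \<mu>[of j] insert.prems by (auto simp: \<mu>'_def dest: centeredD)
      then show ?thesis
        using prob_space.emeasure_space_1[OF \<mu>'(1)] by (subst nn_integral_add) auto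
    qed
    also have "\<dots> = ennreal ((cmod a)^2 + (\<Sum>i\<in>insert j J. (cmod (b i))^2 * v i))"
      using insert.hyps insert.prems vn by (subst ennreal_plus[symmetric]) (auto intro!: sum_nonneg simp: add.assoc)
    finally show ?case .
  qed
  from this[OF assms(1) subset_refl] show ?thesis
    by (simp add: \<mu>'_def cong: PiM_cong)
qed

text \<open>The variance of |A y|^2 is the sum of s_i s_j |(A^H A)_ij|^2. In the induction a new
  coordinate y adds the martingale increment 2 Re (y c) + \<open>\<alpha>\<close> (|y|^2 - s), whose
  two parts are orthogonal to each other and to everything before.\<close>

lemma nn_integral_PiM_quadratic:
  fixes A :: "nat \<Rightarrow> 'i \<Rightarrow> complex"
  assumes "finite J" and s: "\<And>i. 0 \<le> s i"
  shows "(\<integral>\<^sup>+y. ennreal (((\<Sum>k<m. (cmod (\<Sum>i\<in>J. A k i * y i))^2) - (\<Sum>i\<in>J. s i * (\<Sum>k<m. (cmod (A k i))^2)))^2)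
      \<partial>PiM J (\<lambda>i. cnormal (s i))) =
    ennreal (\<Sum>i\<in>J. \<Sum>j\<in>J. s i * s j * (cmod (\<Sum>k<m. cnj (A k i) * A k j))^2)"
  using assms(1)
proof (induction J rule: finite_induct)
  case empty
  then show ?case by (simp add: space_PiM)
next
  case (insert j J)
  let ?\<mu> = "\<lambda>i. cnormal (s i)"
  interpret product_sigma_finite ?\<mu> by (intro product_sigma_finite_prob prob_space_cnormal)
  define F where "F = (\<lambda>y J. (\<Sum>k<m. (cmod (\<Sum>i\<in>J. A k i * y i))^2) - (\<Sum>i\<in>J. s i * (\<Sum>k<m. (cmod (A k i))^2)))"
  \<comment> \<open>Entry (j, j) of the Gram matrix A^H A, and with \<open>g\<close> its row j: the
    coefficients of |y|^2 and of the cross term once coordinate j is added.\<close>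
  define \<alpha> where "\<alpha> = (\<Sum>k<m. (cmod (A k j))^2)"
  define g where "g = (\<lambda>i. \<Sum>k<m. cnj (A k j) * A k i)"
  have [measurable]: "(\<lambda>y. F y K) \<in> borel_measurable (PiM K ?\<mu>)" for K
    unfolding F_def by (intro borel_measurable_diff borel_measurable_sum borel_measurable_power
      borel_measurable_norm measurable_PiM_borel_sum) auto
  have [measurable]: "(\<lambda>y. \<Sum>i\<in>J. g i * y i) \<in> borel_measurable (PiM J ?\<mu>)"
    by (intro measurable_PiM_borel_sum) auto
  have step: "F (x(j := y)) (insert j J) = F x J + 2 * Re (y * cnj (\<Sum>i\<in>J. g i * x i)) + \<alpha> * ((cmod y)^2 - s j)" for x y
  proof -
    have "(\<Sum>i\<in>J. A k i * (x(j := y)) i) = (\<Sum>i\<in>J. A k i * x i)" for k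
      using insert.hyps by (intro sum.cong) auto
    then have 1: "(\<Sum>i\<in>insert j J. A k i * (x(j := y)) i) = (\<Sum>i\<in>J. A k i * x i) + A k j * y" for k
      using insert.hyps by simp
    have "cnj (\<Sum>i\<in>J. g i * x i) = (\<Sum>k<m. A k j * cnj (\<Sum>i\<in>J. A k i * x i))"
      unfolding g_def by (simp add: sum_distrib_left sum_distrib_right mult_ac) (rule sum.swap)
    then have 2: "2 * Re (y * cnj (\<Sum>i\<in>J. g i * x i)) = (\<Sum>k<m. 2 * Re (cnj (\<Sum>i\<in>J. A k i * x i) * (A k j * y)))"
      by (simp only: Re_sum[symmetric] sum_distrib_left[symmetric]) (simp only: sum_distrib_left mult_ac)
    have 3: "(\<Sum>k<m. (cmod (A k j * y))^2) = \<alpha> * (cmod y)^2"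
      by (simp add: \<alpha>_def norm_mult power_mult_distrib sum_distrib_right)
    have "F (x(j := y)) (insert j J) = (\<Sum>k<m. (cmod ((\<Sum>i\<in>J. A k i * x i) + A k j * y))^2) - (s j * \<alpha> + (\<Sum>i\<in>J. s i * (\<Sum>k<m. (cmod (A k i))^2)))"
      unfolding F_def 1 \<alpha>_def using insert.hyps by simp
    then show ?thesis
      unfolding cmod_add_squared sum.distrib 2[symmetric] 3 F_def by (simp add: algebra_simps)
  qed
  have "(\<integral>\<^sup>+y. ennreal ((F y (insert j J))^2) \<partial>PiM (insert j J) ?\<mu>) =
      (\<integral>\<^sup>+x. (\<integral>\<^sup>+y. ennreal ((F (x(j := y)) (insert j J))^2) \<partial>cnormal (s j)) \<partial>PiM J ?\<mu>)"
    using insert.hyps by (intro product_nn_integral_insert) auto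
  also have "\<dots> = (\<integral>\<^sup>+x. ennreal ((F x J)^2) + (ennreal (2 * s j) * ennreal ((cmod (0 + (\<Sum>i\<in>J. g i * x i)))^2) + ennreal (\<alpha>^2 * (s j)^2)) \<partial>PiM J ?\<mu>)"
    unfolding step nn_integral_cnormal_quadratic[OF s] complex_mod_cnj using s
    by (intro nn_integral_cong) (simp add: ennreal_plus[symmetric] ennreal_mult[symmetric] add.assoc del: ennreal_plus)
  also have "\<dots> = (\<integral>\<^sup>+x. ennreal ((F x J)^2) \<partial>PiM J ?\<mu>) +
      (ennreal (2 * s j) * (\<integral>\<^sup>+x. ennreal ((cmod (0 + (\<Sum>i\<in>J. g i * x i)))^2) \<partial>PiM J ?\<mu>) + ennreal (\<alpha>^2 * (s j)^2))"
    using prob_space.emeasure_space_1[OF prob_space_PiM[OF prob_space_cnormal], of J s]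
    by (simp add: nn_integral_add nn_integral_cmult)
  also have "\<dots> = ennreal (\<Sum>i\<in>J. \<Sum>l\<in>J. s i * s l * (cmod (\<Sum>k<m. cnj (A k i) * A k l))^2) +
      (ennreal (2 * s j) * ennreal ((cmod 0)^2 + (\<Sum>i\<in>J. (cmod (g i))^2 * s i)) + ennreal (\<alpha>^2 * (s j)^2))"
    using nn_integral_PiM_linear[of J ?\<mu> s 0 g] s centered_cnormal insert.hyps insert.IH by (simp add: F_def)
  also have "\<dots> = ennreal ((\<Sum>i\<in>J. \<Sum>l\<in>J. s i * s l * (cmod (\<Sum>k<m. cnj (A k i) * A k l))^2) +
      (2 * s j * (\<Sum>i\<in>J. (cmod (g i))^2 * s i) + \<alpha>^2 * (s j)^2))"
    using s by (simp add: ennreal_plus[symmetric] ennreal_mult[symmetric] sum_nonneg del: ennreal_plus)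
  \<comment> \<open>Going from \<open>J\<close> to \<open>insert j J\<close> adds row j, column j
    and one diagonal entry of the double sum. The Gram matrix is Hermitian, so row and column
    contribute equally, which is the factor 2.\<close>
  also have "(\<Sum>i\<in>J. \<Sum>l\<in>J. s i * s l * (cmod (\<Sum>k<m. cnj (A k i) * A k l))^2) +
      (2 * s j * (\<Sum>i\<in>J. (cmod (g i))^2 * s i) + \<alpha>^2 * (s j)^2) =
      (\<Sum>i\<in>insert j J. \<Sum>l\<in>insert j J. s i * s l * (cmod (\<Sum>k<m. cnj (A k i) * A k l))^2)"
  proof -
    define G where "G = (\<lambda>i l. (cmod (\<Sum>k<m. cnj (A k i) * A k l))^2)"
    have "(\<Sum>k<m. cnj (A k j) * A k j) = complex_of_real \<alpha>"
      by (simp add: \<alpha>_def complex_norm_square mult.commute del: of_real_power)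
    then have "G j j = \<alpha>^2" by (simp add: G_def)
    moreover have "G i j = (cmod (g i))^2" for i
    proof -
      have "(\<Sum>k<m. cnj (A k i) * A k j) = cnj (g i)" by (simp add: g_def mult.commute)
      then show ?thesis by (simp add: G_def)
    qed
    moreover have "G j l = (cmod (g l))^2" for l by (simp add: G_def g_def)
    moreover have "(cmod (\<Sum>k<m. cnj (A k i) * A k l))^2 = G i l" for i l by (simp add: G_def)
    moreover have "(\<Sum>l\<in>J. s j * s l * (cmod (g l))^2) = s j * (\<Sum>i\<in>J. (cmod (g i))^2 * s i)"
      "(\<Sum>i\<in>J. s i * s j * (cmod (g i))^2) = s j * (\<Sum>i\<in>J. (cmod (g i))^2 * s i)"
      by (simp_all add: sum_distrib_left mult_ac)
    ultimately show ?thesis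
      using insert.hyps by (simp add: sum.distrib) (simp add: power2_eq_square)
  qed
  finally show ?case by (simp add: F_def)
qed

section \<open>Vectors, Hermitian forms and operator bounds\<close>

lemma norm2_squared: "(norm2 N x)^2 = (\<Sum>i<N. (cmod (x i))^2)"
  by (simp add: norm2_def L2_set_def sum_nonneg)

lemma norm2_nonneg[simp]: "0 \<le> norm2 N x"
  by (simp add: norm2_def L2_set_nonneg)

lemma cdot_self: "cdot N x x = complex_of_real ((norm2 N x)^2)"
  by (simp add: norm2_squared cdot_def complex_norm_square mult.commute del: of_real_power)

lemma cdot_cong: "(\<And>i. i < N \<Longrightarrow> u i = u' i) \<Longrightarrow> (\<And>i. i < N \<Longrightarrow> x i = x' i) \<Longrightarrow> cdot N u x = cdot N u' x'"
  by (simp add: cdot_def)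

lemma norm2_cong: "(\<And>i. i < N \<Longrightarrow> x i = x' i) \<Longrightarrow> norm2 N x = norm2 N x'"
  by (simp add: norm2_def L2_set_def)

lemma cmod_cdot_le: "cmod (cdot N u x) \<le> norm2 N u * norm2 N x"
proof -
  have "cmod (cdot N u x) \<le> (\<Sum>i<N. cmod (cnj (u i) * x i))"
    unfolding cdot_def by (rule norm_sum)
  also have "\<dots> = (\<Sum>i<N. \<bar>cmod (u i)\<bar> * \<bar>cmod (x i)\<bar>)"
    by (simp add: norm_mult)
  also have "\<dots> \<le> norm2 N u * norm2 N x"
    unfolding norm2_def by (rule L2_set_mult_ineq)
  finally show ?thesis .
qed

lemma cmod_cdot_squared_le: "(cmod (cdot N u x))^2 \<le> (norm2 N u)^2 * (norm2 N x)^2"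
  using power_mono[OF cmod_cdot_le, of N u x 2] by (simp add: power_mult_distrib)

lemma norm2_triangle: "norm2 N (\<lambda>i. x i + y i) \<le> norm2 N x + norm2 N y"
proof -
  have "norm2 N (\<lambda>i. x i + y i) \<le> L2_set (\<lambda>i. cmod (x i) + cmod (y i)) {..<N}"
    unfolding norm2_def by (rule L2_set_mono) (auto intro: norm_triangle_ineq)
  also have "\<dots> \<le> norm2 N x + norm2 N y"
    unfolding norm2_def by (rule L2_set_triangle_ineq)
  finally show ?thesis .
qed

lemma norm2_scale: "norm2 N (\<lambda>i. c * x i) = cmod c * norm2 N x"
  by (simp add: norm2_def norm_mult L2_set_left_distrib[symmetric] L2_set_right_distrib[symmetric])

lemma cdot_add_left: "cdot N (\<lambda>i. u i + w i) x = cdot N u x + cdot N w x"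
  by (simp add: cdot_def algebra_simps sum.distrib)

lemma cdot_add_right: "cdot N u (\<lambda>i. x i + y i) = cdot N u x + cdot N u y"
  by (simp add: cdot_def algebra_simps sum.distrib)

lemma cdot_scale_left: "cdot N (\<lambda>i. c * u i) x = cnj c * cdot N u x"
  by (simp add: cdot_def sum_distrib_left algebra_simps)

lemma cdot_scale_right: "cdot N u (\<lambda>i. c * x i) = c * cdot N u x"
  by (simp add: cdot_def sum_distrib_left algebra_simps)

lemma cdot_cnj: "cnj (cdot N u x) = cdot N x u"
  by (simp add: cdot_def mult.commute)

lemma mat_app_eq: "B \<in> carrier_mat N N \<Longrightarrow> i < N \<Longrightarrow> mat_app B x i = (\<Sum>j<N. B $$ (i, j) * x j)"
  by (auto simp: mat_app_def)

lemma mat_app_cong: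
  "B \<in> carrier_mat N N \<Longrightarrow> (\<And>i. i < N \<Longrightarrow> x i = y i) \<Longrightarrow> mat_app B x = mat_app B y"
  by (auto simp: mat_app_def intro!: sum.cong)

definition unitv :: "nat \<Rightarrow> nat \<Rightarrow> complex" where
  "unitv k = (\<lambda>i. if i = k then 1 else 0)"

lemma cdot_unitv: "k < N \<Longrightarrow> cdot N (unitv k) x = x k"
proof -
  assume "k < N"
  have "cdot N (unitv k) x = (\<Sum>i<N. if i = k then x i else 0)"
    unfolding cdot_def unitv_def by (rule sum.cong) auto
  then show ?thesis using \<open>k < N\<close> by simp
qed

lemma norm2_unitv: "k < N \<Longrightarrow> norm2 N (unitv k) = 1"
  using cdot_self[of N "unitv k"] cdot_unitv[of k N "unitv k"]
  by (simp add: unitv_def power2_eq_1_iff del: of_real_power) (use norm2_nonneg[of N "\<lambda>i. if i = k then 1 else 0"] in linarith)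

lemma mat_app_unitv: "B \<in> carrier_mat N N \<Longrightarrow> i < N \<Longrightarrow> k < N \<Longrightarrow> mat_app B (unitv k) i = B $$ (i, k)"
proof -
  assume B: "B \<in> carrier_mat N N" "i < N" "k < N"
  have "mat_app B (unitv k) i = (\<Sum>j<N. if j = k then B $$ (i, j) else 0)"
    unfolding mat_app_eq[OF B(1,2)] unitv_def by (rule sum.cong) auto
  then show ?thesis using B by simp
qed

definition sform :: "nat \<Rightarrow> complex mat \<Rightarrow> (nat \<Rightarrow> complex) \<Rightarrow> (nat \<Rightarrow> complex) \<Rightarrow> complex" where
  "sform N C u w = cdot N u (mat_app C w)"

lemma sform_eq: "C \<in> carrier_mat N N \<Longrightarrow> sform N C u w = (\<Sum>i<N. \<Sum>j<N. cnj (u i) * C $$ (i, j) * w j)"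
  by (simp add: sform_def cdot_def mat_app_eq sum_distrib_left mult.assoc)

lemma cov_mat_carrier: "cov_mat N C \<Longrightarrow> C \<in> carrier_mat N N"
  by (simp add: cov_mat_def)

lemma cov_mat_entry_cnj:
  assumes "cov_mat N C" "i < N" "j < N"
  shows "C $$ (j, i) = cnj (C $$ (i, j))"
proof -
  have C: "C \<in> carrier_mat N N" "mat_adjoint C = C" using assms by (auto simp: cov_mat_def)
  have "mat_adjoint C $$ (j, i) = cnj (C $$ (i, j))"
    using C(1) assms(2,3) by (simp add: mat_adjoint_def mat_of_rows_def)
  then show ?thesis using C(2) by simp
qed

lemma sform_cnj: "cov_mat N C \<Longrightarrow> cnj (sform N C u w) = sform N C w u"
  unfolding sform_eq[OF cov_mat_carrier] cnj_sum
  by (subst sum.swap) (auto intro!: sum.cong simp: cov_mat_entry_cnj[symmetric] mult_ac)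

lemma sform_self: "cov_mat N C \<Longrightarrow> sform N C u u = complex_of_real (Re (sform N C u u))"
  using sform_cnj[of N C u u] by (simp add: complex_eq_iff)

lemma sform_nonneg: "cov_mat N C \<Longrightarrow> 0 \<le> Re (sform N C u u)"
  by (simp add: cov_mat_def sform_def)

lemma sform_add_scale:
  assumes "cov_mat N C"
  shows "Re (sform N C (\<lambda>i. u i + c * w i) (\<lambda>i. u i + c * w i)) =
    Re (sform N C u u) + 2 * Re (c * sform N C u w) + (cmod c)^2 * Re (sform N C w w)"
proof -
  have "sform N C (\<lambda>i. u i + c * w i) (\<lambda>i. u i + c * w i) =
    sform N C u u + c * sform N C u w + cnj c * sform N C w u + cnj c * c * sform N C w w"
    unfolding sform_eq[OF cov_mat_carrier[OF assms]]
    by (simp add: sum.distrib sum_distrib_left algebra_simps)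
  also have "sform N C w u = cnj (sform N C u w)" by (simp add: sform_cnj[OF assms])
  finally have "Re (sform N C (\<lambda>i. u i + c * w i) (\<lambda>i. u i + c * w i)) =
    Re (sform N C u u) + 2 * Re (c * sform N C u w) + Re (cnj c * c * sform N C w w)"
    by simp
  moreover have "cnj c * c = complex_of_real ((cmod c)^2)"
    by (simp add: complex_norm_square mult.commute del: of_real_power)
  ultimately show ?thesis by (simp del: of_real_power)
qed

text \<open>An operator norm bound as a predicate carrying the format of the matrix: such bounds add
  and multiply directly, without a discussion of the supremum in
  \<open>spectral_norm\<close>.\<close>

definition opb :: "nat \<Rightarrow> complex mat \<Rightarrow> real \<Rightarrow> bool" where
  "opb N B c \<longleftrightarrow> B \<in> carrier_mat N N \<and> 0 \<le> c \<and> (\<forall>x. norm2 N (mat_app B x) \<le> c * norm2 N x)"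

lemma opbD:
  assumes "opb N B c"
  shows "B \<in> carrier_mat N N" "0 \<le> c" "norm2 N (mat_app B x) \<le> c * norm2 N x"
    "(norm2 N (mat_app B x))^2 \<le> c^2 * (norm2 N x)^2"
  using assms power_mono[of "norm2 N (mat_app B x)" "c * norm2 N x" 2]
  by (auto simp: opb_def power_mult_distrib)

lemma sform_le:
  assumes "opb N C c"
  shows "cmod (sform N C u w) \<le> c * norm2 N u * norm2 N w"
proof -
  have "cmod (sform N C u w) \<le> norm2 N u * norm2 N (mat_app C w)"
    unfolding sform_def by (rule cmod_cdot_le)
  also have "\<dots> \<le> norm2 N u * (c * norm2 N w)"
    by (intro mult_left_mono opbD[OF assms]) simp
  finally show ?thesis by (simp add: mult_ac)
qed

lemma sform_self_le: "opb N C c \<Longrightarrow> Re (sform N C u u) \<le> c * (norm2 N u)^2"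
  using sform_le[of N C c u u] complex_Re_le_cmod[of "sform N C u u"]
  by (simp add: power2_eq_square mult.assoc)

text \<open>A family \<open>P\<close> of \<open>m\<close> vectors, thought of as the conjugated rows of a matrix of operator
  norm at most \<open>b\<close>.\<close>

definition frame :: "nat \<Rightarrow> nat \<Rightarrow> (nat \<Rightarrow> nat \<Rightarrow> complex) \<Rightarrow> real \<Rightarrow> bool" where
  "frame N m P b \<longleftrightarrow> 0 \<le> b \<and> (\<forall>x. (\<Sum>k<m. (cmod (cdot N (P k) x))^2) \<le> b^2 * (norm2 N x)^2)"

text \<open>The squared Hilbert-Schmidt norm can be summed over columns instead of rows: there are N
  columns, each the image of a unit vector.\<close>

lemma frame_norm_sum:
  assumes "frame N m P b"
  shows "(\<Sum>k<m. (norm2 N (P k))^2) \<le> real N * b^2"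
proof -
  have "(\<Sum>k<m. (norm2 N (P k))^2) = (\<Sum>k<m. \<Sum>j<N. (cmod (cdot N (P k) (unitv j)))^2)"
    unfolding norm2_squared
    by (intro sum.cong refl) (simp add: cdot_unitv flip: cdot_cnj[of N "unitv _"])
  also have "\<dots> = (\<Sum>j<N. \<Sum>k<m. (cmod (cdot N (P k) (unitv j)))^2)" by (rule sum.swap)
  also have "\<dots> \<le> (\<Sum>j<N. b^2 * (norm2 N (unitv j))^2)"
    using assms by (intro sum_mono) (auto simp: frame_def)
  also have "\<dots> = real N * b^2" by (simp add: norm2_unitv)
  finally show ?thesis .
qed

text \<open>For fixed k the inner sum is the frame applied to C P_k, at most b^2 c^2 |P_k|^2. Only
  the outer sum costs a factor N, and this is why variances of quadratic forms grow like N and not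
  N^2.\<close>

lemma frame_sform_sum:
  assumes P: "frame N m P b" and C: "cov_mat N C" "opb N C c"
  shows "(\<Sum>k<m. \<Sum>l<m. (cmod (sform N C (P k) (P l)))^2) \<le> real N * b ^ 4 * c^2"
proof -
  have "(\<Sum>l<m. (cmod (sform N C (P k) (P l)))^2) \<le> b^2 * c^2 * (norm2 N (P k))^2" for k
  proof -
    have "(\<Sum>l<m. (cmod (sform N C (P k) (P l)))^2) = (\<Sum>l<m. (cmod (cdot N (P l) (mat_app C (P k))))^2)"
      unfolding sform_cnj[OF C(1), of "P _" "P k", symmetric] by (simp add: sform_def)
    also have "\<dots> \<le> b^2 * (norm2 N (mat_app C (P k)))^2" using P by (auto simp: frame_def)
    also have "\<dots> \<le> b^2 * (c^2 * (norm2 N (P k))^2)" by (intro mult_left_mono opbD(4)[OF C(2)]) simp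
    finally show ?thesis by (simp add: mult.assoc)
  qed
  then have "(\<Sum>k<m. \<Sum>l<m. (cmod (sform N C (P k) (P l)))^2) \<le> (\<Sum>k<m. b^2 * c^2 * (norm2 N (P k))^2)"
    by (intro sum_mono)
  also have "\<dots> = b^2 * c^2 * (\<Sum>k<m. (norm2 N (P k))^2)" by (simp add: sum_distrib_left)
  also have "\<dots> \<le> b^2 * c^2 * (real N * b^2)"
    using P by (intro mult_left_mono frame_norm_sum) auto
  finally show ?thesis by (simp add: power2_eq_square power4_eq_xxxx mult_ac)
qed

text \<open>Rows are conjugated because \<open>cdot\<close> conjugates its first argument.\<close>

definition crow :: "complex mat \<Rightarrow> nat \<Rightarrow> nat \<Rightarrow> complex" where
  "crow A k = (\<lambda>j. cnj (A $$ (k, j)))"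

lemma cdot_crow: "A \<in> carrier_mat N N \<Longrightarrow> k < N \<Longrightarrow> cdot N (crow A k) x = mat_app A x k"
  by (simp add: cdot_def crow_def mat_app_eq)

lemma sum_cdot_crow: "A \<in> carrier_mat N N \<Longrightarrow> (\<Sum>k<N. (cmod (cdot N (crow A k) x))^2) = (norm2 N (mat_app A x))^2"
  by (simp add: cdot_crow norm2_squared)

lemma frame_crow: "opb N A a \<Longrightarrow> frame N N (crow A) a"
  using opbD(4)[of N A a] opbD(1,2)[of N A a] by (auto simp: frame_def sum_cdot_crow)

lemma frame_unitv: "frame N N unitv 1"
  by (simp add: frame_def cdot_unitv norm2_squared)

lemma frame_add:
  assumes "frame N m P b" "frame N m Q c" "cmod y = 1"
  shows "frame N m (\<lambda>k i. P k i + y * Q k i) (b + c)"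
  unfolding frame_def
proof (intro conjI allI)
  fix x
  \<comment> \<open>For fixed \<open>x\<close> the numbers \<open>cdot N (P k) x\<close> form a
    vector of length \<open>m\<close>, so a frame bound is an l2 bound and the triangle inequality
    adds the constants.\<close>
  have P: "norm2 m (\<lambda>k. cdot N (P k) x) \<le> b * norm2 N x"
    using assms(1) by (intro power2_le_imp_le[of "norm2 m _"]) (auto simp: frame_def norm2_squared power_mult_distrib)
  have Q: "norm2 m (\<lambda>k. cdot N (Q k) x) \<le> c * norm2 N x"
    using assms(2) by (intro power2_le_imp_le[of "norm2 m _"]) (auto simp: frame_def norm2_squared power_mult_distrib)
  have "norm2 m (\<lambda>k. cdot N (\<lambda>i. P k i + y * Q k i) x) \<le>
      norm2 m (\<lambda>k. cdot N (P k) x) + norm2 m (\<lambda>k. cnj y * cdot N (Q k) x)"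
    unfolding cdot_add_left cdot_scale_left by (rule norm2_triangle)
  also have "\<dots> \<le> (b + c) * norm2 N x"
    using P Q assms(3) by (simp add: norm2_scale distrib_right)
  finally have "norm2 m (\<lambda>k. cdot N (\<lambda>i. P k i + y * Q k i) x) \<le> (b + c) * norm2 N x" .
  from power_mono[OF this norm2_nonneg, of 2]
  show "(\<Sum>k<m. (cmod (cdot N (\<lambda>i. P k i + y * Q k i) x))^2) \<le> (b + c)^2 * (norm2 N x)^2"
    by (simp add: norm2_squared power_mult_distrib)
qed (use assms in \<open>auto simp: frame_def\<close>)

section \<open>Quadratic forms of Gaussian vectors\<close>

lemma measurable_cvec_component: "i < N \<Longrightarrow> (\<lambda>x. x i) \<in> borel_measurable (cvec N)"
  unfolding cvec_def by (rule measurable_component_singleton) simp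

lemma measurable_cvec_comp: "X \<in> measurable M (cvec N) \<Longrightarrow> i < N \<Longrightarrow> (\<lambda>x. X x i) \<in> borel_measurable M"
  by (rule measurable_compose[OF _ measurable_cvec_component])

lemma measurable_cvecI:
  "(\<And>i. i < N \<Longrightarrow> (\<lambda>x. X x i) \<in> borel_measurable M) \<Longrightarrow> (\<lambda>x. \<lambda>i\<in>{..<N}. X x i) \<in> measurable M (cvec N)"
  unfolding cvec_def by (rule measurable_restrict) simp

lemma borel_measurable_cdot:
  assumes "\<And>i. i < N \<Longrightarrow> (\<lambda>y. u y i) \<in> borel_measurable M" "\<And>i. i < N \<Longrightarrow> (\<lambda>y. x y i) \<in> borel_measurable M"
  shows "(\<lambda>y. cdot N (u y) (x y)) \<in> borel_measurable M"
  unfolding cdot_def using assms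
  by (intro borel_measurable_sum borel_measurable_times borel_measurable_continuous_on[OF continuous_on_cnj]) (auto intro: continuous_intros)

lemma borel_measurable_norm2:
  assumes "\<And>i. i < N \<Longrightarrow> (\<lambda>y. x y i) \<in> borel_measurable M"
  shows "(\<lambda>y. norm2 N (x y)) \<in> borel_measurable M"
  unfolding norm2_def L2_set_def using assms
  by (intro measurable_compose[OF _ borel_measurable_sqrt] borel_measurable_sum borel_measurable_power borel_measurable_norm) auto

lemma complex_normalD:
  assumes "complex_normal M N C X"
  shows "cov_mat N C" "X \<in> measurable M (cvec N)"
    "distr M borel (\<lambda>x. cdot N u (X x)) = cnormal (Re (sform N C u u))"
  using assms by (auto simp: complex_normal_def sform_def)

lemma has_bochner_integral_gaussian:
  assumes X: "complex_normal M N C X"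
  shows "has_bochner_integral M (\<lambda>x. (cmod (cdot N u (X x)))^2) (Re (sform N C u u))"
    and "has_bochner_integral M (\<lambda>x. (cmod (cdot N u (X x))) ^ 4) (2 * (Re (sform N C u u))^2)"
proof -
  have m[measurable]: "(\<lambda>x. cdot N u (X x)) \<in> borel_measurable M"
    by (intro borel_measurable_cdot measurable_cvec_comp[OF complex_normalD(2)[OF X]]) auto
  have nn: "0 \<le> Re (sform N C u u)" by (rule sform_nonneg[OF complex_normalD(1)[OF X]])
  have *: "(\<integral>\<^sup>+x. f (cdot N u (X x)) \<partial>M) = (\<integral>\<^sup>+y. f y \<partial>cnormal (Re (sform N C u u)))"
    if "f \<in> borel_measurable borel" for f
    unfolding complex_normalD(3)[OF X, symmetric] using that by (subst nn_integral_distr) auto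
  show "has_bochner_integral M (\<lambda>x. (cmod (cdot N u (X x)))^2) (Re (sform N C u u))"
    using *[of "\<lambda>y. ennreal ((cmod y)^2)"] centeredD(4)[OF centered_cnormal[OF nn], of 0 1] nn
    by (intro has_bochner_integral_nn_integral) auto
  show "has_bochner_integral M (\<lambda>x. (cmod (cdot N u (X x))) ^ 4) (2 * (Re (sform N C u u))^2)"
    using *[of "\<lambda>y. ennreal ((cmod y) ^ 4)"] nn_integral_cnormal_power4[OF nn] nn
    by (intro has_bochner_integral_nn_integral) auto
qed

text \<open>Over the four directions the terms linear in p = Re (cnj a * b) and q = Im (cnj a * b)
  cancel, and p^2 + q^2 = |a|^2 |b|^2. This extracts a mixed moment from fourth powers of single
  linear functionals, the ones whose laws \<open>complex_normal\<close> provides.\<close>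

lemma polarize_power4:
  "(cmod (a + b)) ^ 4 + (cmod (a - b)) ^ 4 + (cmod (a + \<i> * b)) ^ 4 + (cmod (a - \<i> * b)) ^ 4 =
    4 * (cmod a) ^ 4 + 4 * (cmod b) ^ 4 + 16 * ((cmod a)^2 * (cmod b)^2)"
proof -
  have 4: "(cmod z) ^ 4 = ((cmod z)^2)^2" for z by (simp flip: power_mult)
  define p q where "p = Re (cnj a * b)" and "q = Im (cnj a * b)"
  have pq: "p^2 + q^2 = (cmod a)^2 * (cmod b)^2"
    using cmod_power2[of "cnj a * b"] by (simp add: p_def q_def norm_mult power_mult_distrib)
  have e: "(cmod (a + b))^2 = (cmod a)^2 + 2 * p + (cmod b)^2"
    "(cmod (a - b))^2 = (cmod a)^2 - 2 * p + (cmod b)^2"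
    "(cmod (a + \<i> * b))^2 = (cmod a)^2 - 2 * q + (cmod b)^2"
    "(cmod (a - \<i> * b))^2 = (cmod a)^2 + 2 * q + (cmod b)^2"
    using cmod_add_squared[of a b] cmod_add_squared[of a "-b"] cmod_add_squared[of a "\<i> * b"] cmod_add_squared[of a "- \<i> * b"]
    by (simp_all add: p_def q_def norm_mult)
  have "(x + 2 * p + y)^2 + (x - 2 * p + y)^2 + (x - 2 * q + y)^2 + (x + 2 * q + y)^2 =
    4 * x^2 + 4 * y^2 + 8 * (x * y) + 8 * (p^2 + q^2)" for x y :: real
    by (simp add: power2_eq_square algebra_simps)
  from this[of "(cmod a)^2" "(cmod b)^2"] show ?thesis unfolding 4 e pq by simp
qed

text \<open>The complex Wick (Isserlis) formula. After polarization each term is a fourth moment 2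
  V^2, and expanding V along the same four directions leaves V(u) V(w) + |u^H C w|^2.\<close>

lemma has_bochner_integral_gaussian_pair:
  assumes X: "complex_normal M N C X"
  shows "has_bochner_integral M (\<lambda>x. (cmod (cdot N u (X x)))^2 * (cmod (cdot N w (X x)))^2)
    (Re (sform N C u u) * Re (sform N C w w) + (cmod (sform N C u w))^2)"
proof -
  define V where "V = (\<lambda>u. Re (sform N C u u))"
  define f where "f = (\<lambda>c x. (cmod (cdot N (\<lambda>i. u i + c * w i) (X x))) ^ 4)"
  define s where "s = sform N C u w"
  have f: "has_bochner_integral M (f c) (2 * (V (\<lambda>i. u i + c * w i))^2)" for c
    unfolding f_def V_def by (rule has_bochner_integral_gaussian[OF X])
  have fu: "has_bochner_integral M (\<lambda>x. (cmod (cdot N u (X x))) ^ 4) (2 * (V u)^2)" for u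
    unfolding V_def by (rule has_bochner_integral_gaussian[OF X])
  have "has_bochner_integral M
    (\<lambda>x. (1/16) * (f 1 x + f (-1) x + f (-\<i>) x + f \<i> x) - (1/4) * ((cmod (cdot N u (X x))) ^ 4 + (cmod (cdot N w (X x))) ^ 4))
    ((1/16) * (2 * (V (\<lambda>i. u i + 1 * w i))^2 + 2 * (V (\<lambda>i. u i + (-1) * w i))^2 + 2 * (V (\<lambda>i. u i + (-\<i>) * w i))^2 + 2 * (V (\<lambda>i. u i + \<i> * w i))^2) -
      (1/4) * (2 * (V u)^2 + 2 * (V w)^2))"
    by (intro has_bochner_integral_diff has_bochner_integral_add has_bochner_integral_mult_right f fu)
  moreover have "(1/16) * (f 1 x + f (-1) x + f (-\<i>) x + f \<i> x) - (1/4) * ((cmod (cdot N u (X x))) ^ 4 + (cmod (cdot N w (X x))) ^ 4) =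
      (cmod (cdot N u (X x)))^2 * (cmod (cdot N w (X x)))^2" for x
  proof -
    have "f 1 x + f (-1) x + f (-\<i>) x + f \<i> x =
      4 * (cmod (cdot N u (X x))) ^ 4 + 4 * (cmod (cdot N w (X x))) ^ 4 + 16 * ((cmod (cdot N u (X x)))^2 * (cmod (cdot N w (X x)))^2)"
      unfolding f_def cdot_add_left cdot_scale_left polarize_power4[symmetric] by simp
    then show ?thesis by (simp add: field_simps)
  qed
  moreover have "(1/16) * (2 * (V (\<lambda>i. u i + 1 * w i))^2 + 2 * (V (\<lambda>i. u i + (-1) * w i))^2 + 2 * (V (\<lambda>i. u i + (-\<i>) * w i))^2 + 2 * (V (\<lambda>i. u i + \<i> * w i))^2) -
      (1/4) * (2 * (V u)^2 + 2 * (V w)^2) = V u * V w + (cmod s)^2"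
  proof -
    have V: "V (\<lambda>i. u i + c * w i) = V u + 2 * Re (c * s) + (cmod c)^2 * V w" for c
      unfolding V_def s_def by (rule sform_add_scale[OF complex_normalD(1)[OF X]])
    show ?thesis unfolding V cmod_power2[of s]
      by (simp add: power2_eq_square algebra_simps)
  qed
  ultimately show ?thesis
    by (simp only: V_def s_def)
qed

text \<open>Once the products of means are subtracted, each pair keeps only the Wick covariance; the
  variance is the squared Frobenius norm of the Gram matrix of the \<open>P k\<close> with respect
  to \<open>C\<close>.\<close>

lemma has_bochner_integral_gaussian_quadratic:
  assumes M: "prob_space M" and X: "complex_normal M N C X"
  shows "has_bochner_integral M
    (\<lambda>y. ((\<Sum>k<m. (cmod (cdot N (P k) (X y)))^2) - (\<Sum>k<m. Re (sform N C (P k) (P k))))^2)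
    (\<Sum>k<m. \<Sum>l<m. (cmod (sform N C (P k) (P l)))^2)"
proof -
  interpret prob_space M by fact
  define q where "q = (\<lambda>k y. (cmod (cdot N (P k) (X y)))^2)"
  define V where "V = (\<lambda>k. Re (sform N C (P k) (P k)))"
  have c: "has_bochner_integral M (\<lambda>y. x) x" for x :: real
    by (simp add: has_bochner_integral_iff prob_space)
  have "has_bochner_integral M (\<lambda>y. \<Sum>k<m. \<Sum>l<m. q k y * q l y - V l * q k y - V k * q l y + V k * V l)
      (\<Sum>k<m. \<Sum>l<m. (V k * V l + (cmod (sform N C (P k) (P l)))^2) - V l * V k - V k * V l + V k * V l)"
    unfolding q_def V_def
    by (intro has_bochner_integral_sum has_bochner_integral_add has_bochner_integral_diff
        has_bochner_integral_mult_right has_bochner_integral_gaussian_pair[OF X]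
        has_bochner_integral_gaussian[OF X] c)
  moreover have "(\<Sum>k<m. \<Sum>l<m. q k y * q l y - V l * q k y - V k * q l y + V k * V l) =
      ((\<Sum>k<m. q k y) - (\<Sum>k<m. V k))^2" for y
  proof -
    have "((\<Sum>k<m. q k y) - (\<Sum>k<m. V k))^2 = (\<Sum>k<m. q k y - V k) * (\<Sum>l<m. q l y - V l)"
      by (simp add: power2_eq_square sum_subtractf)
    also have "\<dots> = (\<Sum>k<m. \<Sum>l<m. (q k y - V k) * (q l y - V l))" by (rule sum_product)
    finally show ?thesis by (simp add: algebra_simps)
  qed
  ultimately show ?thesis unfolding q_def V_def by (simp add: mult.commute)
qed

lemma nn_integral_gaussian_quadratic_le:
  assumes M: "prob_space M" and X: "complex_normal M N C X" and P: "frame N m P b" and C: "opb N C c"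
  shows "(\<integral>\<^sup>+x. ennreal (((\<Sum>k<m. (cmod (cdot N (P k) (X x)))^2) - (\<Sum>k<m. Re (sform N C (P k) (P k))))^2) \<partial>M)
    \<le> ennreal (real N * b ^ 4 * c^2)"
proof -
  note h = has_bochner_integral_gaussian_quadratic[OF M X, of P m]
  have "(\<integral>\<^sup>+x. ennreal (((\<Sum>k<m. (cmod (cdot N (P k) (X x)))^2) - (\<Sum>k<m. Re (sform N C (P k) (P k))))^2) \<partial>M)
      = ennreal (\<Sum>k<m. \<Sum>l<m. (cmod (sform N C (P k) (P l)))^2)"
    using h by (subst nn_integral_eq_integral) (auto simp: has_bochner_integral_iff)
  then show ?thesis using frame_sform_sum[OF P complex_normalD(1)[OF X] C] by (simp add: ennreal_leI)
qed

text \<open>The bilinear form reduces to quadratic ones by the polarization identity.\<close>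

lemma nn_integral_gaussian_bilinear_le:
  assumes M: "prob_space M" and X: "complex_normal M N C X"
    and U: "frame N m U b" and W: "frame N m W b'" and C: "opb N C c"
  shows "(\<integral>\<^sup>+\<omega>. ennreal ((cmod ((\<Sum>k<m. cdot N (U k) (X \<omega>) * cnj (cdot N (W k) (X \<omega>))) - (\<Sum>k<m. sform N C (U k) (W k))))^2) \<partial>M)
    \<le> ennreal (real N * (b + b') ^ 4 * c^2)"
proof -
  define F where "F = (\<lambda>c \<omega>. (\<Sum>k<m. (cmod (cdot N (\<lambda>i. U k i + c * W k i) (X \<omega>)))^2) -
    (\<Sum>k<m. Re (sform N C (\<lambda>i. U k i + c * W k i) (\<lambda>i. U k i + c * W k i))))"
  define D where "D = (\<lambda>\<omega>. (\<Sum>k<m. cdot N (U k) (X \<omega>) * cnj (cdot N (W k) (X \<omega>))) - (\<Sum>k<m. sform N C (U k) (W k)))"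
  define G where "G = (\<lambda>\<omega>. (\<Sum>k<m. (cmod (cdot N (U k) (X \<omega>)))^2) - (\<Sum>k<m. Re (sform N C (U k) (U k))) +
    (\<Sum>k<m. (cmod (cdot N (W k) (X \<omega>)))^2) - (\<Sum>k<m. Re (sform N C (W k) (W k))))"
  have F: "F c \<omega> = G \<omega> + 2 * Re (c * D \<omega>)" if "cmod c = 1" for c \<omega>
  proof -
    have "(cmod (cdot N (\<lambda>i. U k i + c * W k i) (X \<omega>)))^2 =
      (cmod (cdot N (U k) (X \<omega>)))^2 + 2 * Re (c * (cdot N (U k) (X \<omega>) * cnj (cdot N (W k) (X \<omega>)))) + (cmod (cdot N (W k) (X \<omega>)))^2" for k
    proof -
      have "Re (cnj x * (cnj c * y)) = Re (c * (x * cnj y))" for x y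
        by (simp add: algebra_simps)
      then show ?thesis
        unfolding cdot_add_left cdot_scale_left cmod_add_squared using that by (simp only: norm_mult complex_mod_cnj mult_1)
    qed
    moreover have "Re (sform N C (\<lambda>i. U k i + c * W k i) (\<lambda>i. U k i + c * W k i)) =
      Re (sform N C (U k) (U k)) + 2 * Re (c * sform N C (U k) (W k)) + Re (sform N C (W k) (W k))" for k
      using sform_add_scale[OF complex_normalD(1)[OF X]] that by simp
    moreover have "Re (c * D \<omega>) = (\<Sum>k<m. Re (c * (cdot N (U k) (X \<omega>) * cnj (cdot N (W k) (X \<omega>))))) - (\<Sum>k<m. Re (c * sform N C (U k) (W k)))"
      unfolding D_def right_diff_distrib sum_distrib_left minus_complex.simps Re_sum ..
    moreover have "p + 2 * q + r - (s + 2 * t + w) = p - s + r - w + 2 * (q - t)" for p q r s t w :: real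
      by simp
    ultimately show ?thesis
      unfolding F_def G_def by (simp only: sum.distrib sum_distrib_left[symmetric])
  qed
  define B where "B = ennreal (real N * (b + b') ^ 4 * c^2)"
  have [measurable]: "(\<lambda>\<omega>. (F x \<omega>)^2) \<in> borel_measurable M" for x
    unfolding F_def using has_bochner_integral_gaussian_quadratic[OF M X]
    by (rule borel_measurable_has_bochner_integral)
  have le: "(\<integral>\<^sup>+\<omega>. ennreal ((F x \<omega>)^2) \<partial>M) \<le> B" if "cmod x = 1" for x
    unfolding F_def B_def by (rule nn_integral_gaussian_quadratic_le[OF M X frame_add[OF U W that] C])
  \<comment> \<open>F c = G + 2 Re (c D). Over c = 1, -1, i, -i the mixed terms cancel and the
    squares add up to 4 G^2 + 8 |D|^2; the nonnegative G^2 is dropped.\<close>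
  have "(cmod (D \<omega>))^2 \<le> (1/8) * ((F 1 \<omega>)^2 + (F (-1) \<omega>)^2 + (F \<i> \<omega>)^2 + (F (-\<i>) \<omega>)^2)" for \<omega>
  proof -
    have "(F 1 \<omega>)^2 + (F (-1) \<omega>)^2 + (F \<i> \<omega>)^2 + (F (-\<i>) \<omega>)^2 = 4 * (G \<omega>)^2 + 8 * (cmod (D \<omega>))^2"
      by (simp add: F cmod_power2) (simp add: power2_eq_square algebra_simps)
    then show ?thesis by simp
  qed
  then have "(\<integral>\<^sup>+\<omega>. ennreal ((cmod (D \<omega>))^2) \<partial>M) \<le>
      (\<integral>\<^sup>+\<omega>. ennreal (1/8) * (ennreal ((F 1 \<omega>)^2) + ennreal ((F (-1) \<omega>)^2) + ennreal ((F \<i> \<omega>)^2) + ennreal ((F (-\<i>) \<omega>)^2)) \<partial>M)"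
    by (intro nn_integral_mono) (simp add: ennreal_plus[symmetric] ennreal_mult[symmetric] del: ennreal_plus)
  also have "\<dots> = ennreal (1/8) * ((\<integral>\<^sup>+\<omega>. ennreal ((F 1 \<omega>)^2) \<partial>M) + (\<integral>\<^sup>+\<omega>. ennreal ((F (-1) \<omega>)^2) \<partial>M) +
      (\<integral>\<^sup>+\<omega>. ennreal ((F \<i> \<omega>)^2) \<partial>M) + (\<integral>\<^sup>+\<omega>. ennreal ((F (-\<i>) \<omega>)^2) \<partial>M))"
    by (simp add: nn_integral_cmult nn_integral_add)
  also have "\<dots> \<le> ennreal (1/8) * (B + B + B + B)"
    by (intro mult_left_mono add_mono le) auto
  also have "\<dots> \<le> B"
    unfolding B_def by (simp add: ennreal_plus[symmetric] ennreal_mult[symmetric] del: ennreal_plus)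
  finally show ?thesis unfolding B_def D_def .
qed

lemma sum_unitv_crow:
  assumes "A \<in> carrier_mat N N"
  shows "(\<Sum>k<N. cdot N (crow A k) x * cnj (cdot N (unitv k) x)) = cdot N x (mat_app A x)"
  unfolding cdot_def[of N x] using assms
  by (intro sum.cong refl) (simp add: cdot_crow cdot_unitv mult.commute)

lemma nn_integral_gaussian_pow4:
  assumes M: "prob_space M" and X: "complex_normal M N C X" and C: "opb N C c"
  shows "(\<integral>\<^sup>+x. ennreal ((cmod (cdot N u (X x))) ^ 4) \<partial>M) \<le> ennreal (2 * c^2 * (norm2 N u) ^ 4)"
proof -
  have "(\<integral>\<^sup>+x. ennreal ((cmod (cdot N u (X x))) ^ 4) \<partial>M) = ennreal (2 * (Re (sform N C u u))^2)"
    using has_bochner_integral_gaussian(2)[OF X, of u]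
    by (subst nn_integral_eq_integral) (auto simp: has_bochner_integral_iff)
  also have "\<dots> \<le> ennreal (2 * (c * (norm2 N u)^2)^2)"
    by (intro ennreal_leI mult_left_mono power_mono sform_self_le[OF C] sform_nonneg[OF complex_normalD(1)[OF X]]) auto
  finally show ?thesis by (simp add: power_mult_distrib mult.assoc flip: power_mult)
qed

lemma nn_integral_gaussian_norm2:
  assumes M: "prob_space M" and X: "complex_normal M N C X" and C: "opb N C c"
  shows "(\<integral>\<^sup>+y. ennreal ((norm2 N (X y))^2) \<partial>M) \<le> ennreal (real N * c)"
    and "(\<integral>\<^sup>+y. ennreal ((norm2 N (X y)) ^ 4) \<partial>M) \<le> ennreal (4 * (real N)^2 * c^2)"
proof -
  note mX = measurable_cvec_comp[OF complex_normalD(2)[OF X]]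
  have [measurable]: "(\<lambda>y. (cmod (X y k))^2) \<in> borel_measurable M" if "k < N" for k
    using mX[OF that] by measurable
  have e: "(norm2 N (X y))^2 = (\<Sum>k<N. (cmod (cdot N (unitv k) (X y)))^2)" for y
    by (simp add: norm2_squared cdot_unitv)
  have h1: "has_bochner_integral M (\<lambda>y. (norm2 N (X y))^2) (\<Sum>k<N. Re (sform N C (unitv k) (unitv k)))"
    unfolding e by (intro has_bochner_integral_sum has_bochner_integral_gaussian[OF X])
  define T where "T = (\<Sum>k<N. Re (sform N C (unitv k) (unitv k)))"
  have T: "T \<le> real N * c"
  proof -
    have "T \<le> (\<Sum>k<N. c * (norm2 N (unitv k))^2)"
      unfolding T_def by (intro sum_mono sform_self_le[OF C])
    then show ?thesis by (simp add: norm2_unitv)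
  qed
  have T0: "0 \<le> T" unfolding T_def by (intro sum_nonneg sform_nonneg[OF complex_normalD(1)[OF X]])
  show "(\<integral>\<^sup>+y. ennreal ((norm2 N (X y))^2) \<partial>M) \<le> ennreal (real N * c)"
    using h1 T unfolding T_def[symmetric]
    by (subst nn_integral_eq_integral) (auto simp: has_bochner_integral_iff intro: ennreal_leI)
  \<comment> \<open>The fourth moment of the norm splits into the variance of the squared norm, of
    order N, and the square of its mean \<open>T\<close>, of order N^2.\<close>
  have "(norm2 N (X y)) ^ 4 \<le> 2 * ((norm2 N (X y))^2 - T)^2 + 2 * T^2" for y
  proof -
    have "x^2 \<le> 2 * (x - T)^2 + 2 * T^2" for x
      using zero_le_power2[of "x - 2 * T"] by (simp add: power2_eq_square algebra_simps)
    from this[of "(norm2 N (X y))^2"] show ?thesis by (simp flip: power_mult)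
  qed
  then have "(\<integral>\<^sup>+y. ennreal ((norm2 N (X y)) ^ 4) \<partial>M) \<le>
      (\<integral>\<^sup>+y. ennreal 2 * ennreal (((norm2 N (X y))^2 - T)^2) + ennreal (2 * T^2) \<partial>M)"
    by (intro nn_integral_mono) (simp add: ennreal_plus[symmetric] ennreal_mult[symmetric] ennreal_leI del: ennreal_plus ennreal_numeral)
  also have "\<dots> = ennreal 2 * (\<integral>\<^sup>+y. ennreal (((norm2 N (X y))^2 - T)^2) \<partial>M) + ennreal (2 * T^2)"
  proof -
    have [measurable]: "(\<lambda>y. norm2 N (X y)) \<in> borel_measurable M" by (rule borel_measurable_norm2[OF mX])
    show ?thesis
      using prob_space.emeasure_space_1[OF M] by (simp add: nn_integral_add nn_integral_cmult)
  qed
  also have "\<dots> \<le> ennreal 2 * ennreal (real N * 1 ^ 4 * c^2) + ennreal (2 * (real N * c)^2)"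
    using T T0 nn_integral_gaussian_quadratic_le[OF M X frame_unitv C]
    by (intro add_mono mult_left_mono ennreal_leI power_mono) (auto simp: e T_def)
  also have "\<dots> \<le> ennreal (4 * (real N)^2 * c^2)"
  proof -
    have "real N \<le> (real N)^2" by (cases N) (auto simp: power2_eq_square)
    then have "real N * c^2 \<le> (real N)^2 * c^2" by (intro mult_right_mono) auto
    then have "2 * (real N * c^2) + 2 * (real N * c)^2 \<le> 4 * (real N)^2 * c^2"
      by (simp add: power_mult_distrib mult_ac)
    then show ?thesis by (simp add: ennreal_plus[symmetric] ennreal_mult[symmetric] ennreal_leI del: ennreal_plus ennreal_numeral)
  qed
  finally show "(\<integral>\<^sup>+y. ennreal ((norm2 N (X y)) ^ 4) \<partial>M) \<le> ennreal (4 * (real N)^2 * c^2)" .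
qed

text \<open>Independence freezes \<open>u (Y s)\<close>, and the functional of \<open>X\<close> then
  has second moment u^H C u. Cross terms between a Gaussian vector and the rest of the signal are
  handled this way, with no condition on the law of the rest.\<close>

lemma nn_integral_gaussian_indep:
  assumes M: "prob_space M" and X: "complex_normal M N C X" and C: "opb N C c"
    and I: "indep_of M (cvec N) X T Y" and u: "\<And>i. i < N \<Longrightarrow> (\<lambda>y. u y i) \<in> borel_measurable T"
    and q: "q \<in> borel_measurable T"
  shows "(\<integral>\<^sup>+s. q (Y s) * ennreal ((cmod (cdot N (u (Y s)) (X s)))^2) \<partial>M) \<le>
    (\<integral>\<^sup>+s. q (Y s) * ennreal (c * (norm2 N (u (Y s)))^2) \<partial>M)"
proof -
  have [measurable]: "(\<lambda>(x, y). cdot N (u y) x) \<in> borel_measurable (cvec N \<Otimes>\<^sub>M T)"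
    unfolding case_prod_beta'
    by (intro borel_measurable_cdot measurable_compose[OF measurable_snd u] measurable_compose[OF measurable_fst measurable_cvec_component])
  note [measurable] = q
  have mX: "(\<lambda>s. cdot N w (X s)) \<in> borel_measurable M" for w
    by (intro borel_measurable_cdot measurable_cvec_comp[OF complex_normalD(2)[OF X]]) auto
  have "(\<integral>\<^sup>+s. q (Y s) * ennreal ((cmod (cdot N (u (Y s)) (X s)))^2) \<partial>M) =
      (\<integral>\<^sup>+s. (\<integral>\<^sup>+s'. q (Y s) * ennreal ((cmod (cdot N (u (Y s)) (X s')))^2) \<partial>M) \<partial>M)"
    by (rule nn_integral_indep_of[OF M I, of "\<lambda>x y. q y * ennreal ((cmod (cdot N (u y) x))^2)"]) measurable
  also have "\<dots> = (\<integral>\<^sup>+s. q (Y s) * ennreal (Re (sform N C (u (Y s)) (u (Y s)))) \<partial>M)"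
  proof (intro nn_integral_cong)
    fix s
    have "(\<integral>\<^sup>+s'. ennreal ((cmod (cdot N (u (Y s)) (X s')))^2) \<partial>M) = ennreal (Re (sform N C (u (Y s)) (u (Y s))))"
      using has_bochner_integral_gaussian(1)[OF X, of "u (Y s)"]
      by (subst nn_integral_eq_integral) (auto simp: has_bochner_integral_iff)
    then show "(\<integral>\<^sup>+s'. q (Y s) * ennreal ((cmod (cdot N (u (Y s)) (X s')))^2) \<partial>M) =
      q (Y s) * ennreal (Re (sform N C (u (Y s)) (u (Y s))))"
      using mX by (subst nn_integral_cmult) auto
  qed
  also have "\<dots> \<le> (\<integral>\<^sup>+s. q (Y s) * ennreal (c * (norm2 N (u (Y s)))^2) \<partial>M)"
    by (intro nn_integral_mono mult_left_mono ennreal_leI sform_self_le[OF C]) auto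
  finally show ?thesis .
qed

section \<open>Second moment bounds\<close>

text \<open>The bound is put on the nonnegative integral, so integrability is a consequence; a bound
  on the Bochner integral would also hold for a non-integrable square, whose integral is 0 by
  convention.\<close>

definition L2le :: "'a measure \<Rightarrow> ('a \<Rightarrow> 'b::{real_normed_vector, second_countable_topology}) \<Rightarrow> real \<Rightarrow> bool" where
  "L2le M f B \<longleftrightarrow> f \<in> borel_measurable M \<and> 0 \<le> B \<and> (\<integral>\<^sup>+x. ennreal ((norm (f x))^2) \<partial>M) \<le> ennreal B"

lemma L2leD:
  assumes "L2le M f B"
  shows "f \<in> borel_measurable M" "0 \<le> B" "(\<integral>\<^sup>+x. ennreal ((norm (f x))^2) \<partial>M) \<le> ennreal B"
  using assms by (auto simp: L2le_def)

lemma L2le_mono: "L2le M f B \<Longrightarrow> B \<le> B' \<Longrightarrow> L2le M f B'"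
  unfolding L2le_def using ennreal_leI[of B B'] by (auto intro: order_trans)

lemma L2le_bound:
  assumes "L2le M f B" "g \<in> borel_measurable M" "0 \<le> c" "\<And>x. x \<in> space M \<Longrightarrow> norm (g x) \<le> c * norm (f x)"
  shows "L2le M g (c^2 * B)"
proof -
  note [measurable] = L2leD(1)[OF assms(1)]
  have "(\<integral>\<^sup>+x. ennreal ((norm (g x))^2) \<partial>M) \<le> (\<integral>\<^sup>+x. ennreal (c^2) * ennreal ((norm (f x))^2) \<partial>M)"
  proof (intro nn_integral_mono)
    fix x assume "x \<in> space M"
    then have "(norm (g x))^2 \<le> (c * norm (f x))^2" using assms(4) by (intro power_mono) auto
    then show "ennreal ((norm (g x))^2) \<le> ennreal (c^2) * ennreal ((norm (f x))^2)"
      by (simp add: ennreal_mult[symmetric] power_mult_distrib ennreal_leI)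
  qed
  also have "\<dots> \<le> ennreal (c^2) * ennreal B"
    using L2leD[OF assms(1)] by (subst nn_integral_cmult) (auto intro: mult_left_mono)
  finally show ?thesis
    using assms(2) L2leD(2)[OF assms(1)] by (auto simp: L2le_def ennreal_mult)
qed

lemma L2le_add:
  assumes "L2le M f B" "L2le M g B'"
  shows "L2le M (\<lambda>s. f s + g s) (2 * B + 2 * B')"
proof -
  note [measurable] = L2leD(1)[OF assms(1)] L2leD(1)[OF assms(2)]
  note nn = L2leD(2)[OF assms(1)] L2leD(2)[OF assms(2)]
  have "(norm (x + y))^2 \<le> 2 * (norm x)^2 + 2 * (norm y)^2" for x y :: 'b
  proof -
    have "(norm (x + y))^2 \<le> (norm x + norm y)^2" by (intro power_mono norm_triangle_ineq) auto
    also have "\<dots> \<le> 2 * (norm x)^2 + 2 * (norm y)^2"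
      using zero_le_power2[of "norm x - norm y"] by (simp add: power2_eq_square algebra_simps)
    finally show ?thesis .
  qed
  then have "(\<integral>\<^sup>+s. ennreal ((norm (f s + g s))^2) \<partial>M) \<le>
      (\<integral>\<^sup>+s. ennreal 2 * ennreal ((norm (f s))^2) + ennreal 2 * ennreal ((norm (g s))^2) \<partial>M)"
    by (intro nn_integral_mono) (simp add: ennreal_plus[symmetric] ennreal_mult[symmetric] ennreal_leI del: ennreal_plus ennreal_numeral)
  also have "\<dots> = ennreal 2 * (\<integral>\<^sup>+s. ennreal ((norm (f s))^2) \<partial>M) + ennreal 2 * (\<integral>\<^sup>+s. ennreal ((norm (g s))^2) \<partial>M)"
    by (simp add: nn_integral_add nn_integral_cmult)
  also have "\<dots> \<le> ennreal 2 * ennreal B + ennreal 2 * ennreal B'"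
    by (intro add_mono mult_left_mono L2leD(3) assms) auto
  also have "\<dots> = ennreal (2 * B + 2 * B')" using nn by (simp add: ennreal_mult)
  finally show ?thesis using nn by (auto simp: L2le_def)
qed

lemma L2le_integrable:
  assumes "L2le M f B"
  shows "integrable M (\<lambda>x. (norm (f x))^2)" "(\<integral>x. (norm (f x))^2 \<partial>M) \<le> B"
proof -
  note [measurable] = L2leD(1)[OF assms]
  show I: "integrable M (\<lambda>x. (norm (f x))^2)"
    using L2leD(3)[OF assms] by (intro integrableI_bounded) (auto simp: less_top[symmetric] top_unique)
  have "ennreal (\<integral>x. (norm (f x))^2 \<partial>M) \<le> ennreal B"
    using L2leD(3)[OF assms] nn_integral_eq_integral[OF I] by simp
  then show "(\<integral>x. (norm (f x))^2 \<partial>M) \<le> B" using L2leD(2)[OF assms] by (simp add: ennreal_le_iff)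
qed

text \<open>Cauchy-Schwarz: the mean of (s |f| - t |g|)^2 is a nonnegative quadratic form in (s, t),
  and taking (s, t) = (y, z) gives y (x y - z^2) >= 0.\<close>

lemma L2le_mult_integrable:
  fixes f :: "'a \<Rightarrow> 'b::{real_normed_vector, second_countable_topology}"
    and g :: "'a \<Rightarrow> 'c::{real_normed_vector, second_countable_topology}"
  assumes "L2le M f B" "L2le M g B'"
  shows "integrable M (\<lambda>\<omega>. norm (f \<omega>) * norm (g \<omega>))"
    and "(\<integral>\<omega>. norm (f \<omega>) * norm (g \<omega>) \<partial>M) \<le> sqrt (B * B')"
proof -
  note [measurable] = L2leD(1)[OF assms(1)] L2leD(1)[OF assms(2)]
  note nn = L2leD(2)[OF assms(1)] L2leD(2)[OF assms(2)]
  note I = L2le_integrable[OF assms(1)] L2le_integrable[OF assms(2)]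
  have am: "norm x * norm y \<le> (norm x)^2 + (norm y)^2" for x :: 'b and y :: 'c
    using sum_squares_bound[of "norm x" "norm y"] mult_nonneg_nonneg[OF norm_ge_zero[of x] norm_ge_zero[of y]] by linarith
  show J: "integrable M (\<lambda>\<omega>. norm (f \<omega>) * norm (g \<omega>))"
    by (rule Bochner_Integration.integrable_bound[OF Bochner_Integration.integrable_add[OF I(1) I(3)]])
       (auto simp: am)
  define x y z where "x = (\<integral>\<omega>. (norm (f \<omega>))^2 \<partial>M)" and "y = (\<integral>\<omega>. (norm (g \<omega>))^2 \<partial>M)"
    and "z = (\<integral>\<omega>. norm (f \<omega>) * norm (g \<omega>) \<partial>M)"
  have q: "0 \<le> s^2 * x - 2 * s * t * z + t^2 * y" for s t :: real
  proof -
    have "0 \<le> (\<integral>\<omega>. (s * norm (f \<omega>) - t * norm (g \<omega>))^2 \<partial>M)" by simp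
    also have "\<dots> = (\<integral>\<omega>. s^2 * (norm (f \<omega>))^2 - (2 * s * t) * (norm (f \<omega>) * norm (g \<omega>)) + t^2 * (norm (g \<omega>))^2 \<partial>M)"
      by (intro Bochner_Integration.integral_cong) (auto simp: power2_eq_square algebra_simps)
    also have "\<dots> = s^2 * x - (2 * s * t) * z + t^2 * y"
      using I J unfolding x_def y_def z_def by simp
    finally show ?thesis .
  qed
  have x0: "0 \<le> x" "0 \<le> y" "0 \<le> z" unfolding x_def y_def z_def by (auto intro: integral_nonneg_AE)
  have "z^2 \<le> x * y"
  proof (cases "y = 0")
    case True
    have "z = 0"
    proof (rule ccontr)
      assume "z \<noteq> 0"
      \<comment> \<open>For \<open>y = 0\<close> the form is affine in t, and this choice makes its
        value x - (x + 1).\<close>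
      then show False using q[of 1 "(x + 1) / (2 * z)"] True by simp
    qed
    then show ?thesis using True by simp
  next
    case False
    have "0 \<le> y * (x * y - z^2)"
      using q[of y z] by (simp add: power2_eq_square algebra_simps)
    then show ?thesis using False x0(2) by (simp add: zero_le_mult_iff)
  qed
  also have "x * y \<le> B * B'" using I x0 nn unfolding x_def y_def by (intro mult_mono) auto
  finally have "sqrt (z^2) \<le> sqrt (B * B')" by (rule real_sqrt_le_mono)
  then show "(\<integral>\<omega>. norm (f \<omega>) * norm (g \<omega>) \<partial>M) \<le> sqrt (B * B')" using x0 unfolding z_def by simp
qed

lemma nn_integral_mult_const_le:
  assumes "f \<in> borel_measurable M" "(\<integral>\<^sup>+x. f x \<partial>M) \<le> ennreal B" "0 \<le> c" "0 \<le> B"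
  shows "(\<integral>\<^sup>+x. ennreal c * f x \<partial>M) \<le> ennreal (c * B)"
  using assms by (subst nn_integral_cmult) (auto simp: ennreal_mult intro: mult_left_mono)

section \<open>Columns and adjoints\<close>

definition col_of :: "complex mat \<Rightarrow> nat \<Rightarrow> nat \<Rightarrow> complex" where
  "col_of A j = (\<lambda>k. A $$ (k, j))"

definition adj_app :: "nat \<Rightarrow> complex mat \<Rightarrow> (nat \<Rightarrow> complex) \<Rightarrow> nat \<Rightarrow> complex" where
  "adj_app N A y = (\<lambda>j. cdot N (col_of A j) y)"

lemma mat_app_col: "A \<in> carrier_mat N N \<Longrightarrow> k < N \<Longrightarrow> mat_app A x k = (\<Sum>j<N. x j * col_of A j k)"
  by (simp add: mat_app_eq col_of_def mult.commute)

lemma cdot_mat_app: "A \<in> carrier_mat N N \<Longrightarrow> cdot N y (mat_app A x) = (\<Sum>j<N. cdot N y (col_of A j) * x j)"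
  unfolding cdot_def by (simp add: mat_app_col sum_distrib_left sum_distrib_right mult_ac) (rule sum.swap)

lemma cdot_adj_app: "A \<in> carrier_mat N N \<Longrightarrow> cdot N (adj_app N A y) x = cdot N y (mat_app A x)"
  by (simp add: cdot_mat_app) (simp add: cdot_def adj_app_def mult_ac flip: cdot_cnj[of N "col_of A _" y])

text \<open>|A^H y|^2 = y^H A (A^H y) is at most |y| a |A^H y|; one factor is cancelled unless it is
  zero.\<close>

lemma norm2_adj_app:
  assumes "opb N A a"
  shows "norm2 N (adj_app N A y) \<le> a * norm2 N y"
proof (cases "norm2 N (adj_app N A y) = 0")
  case False
  define c where "c = adj_app N A y"
  have "(norm2 N c)^2 = cmod (cdot N y (mat_app A c))"
    using cdot_adj_app[OF opbD(1)[OF assms], of y c] cdot_self[of N c] by (simp add: c_def del: of_real_power)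
  also have "\<dots> \<le> norm2 N y * (a * norm2 N c)"
    using cmod_cdot_le opbD(3)[OF assms] by (meson mult_left_mono norm2_nonneg order_trans)
  finally have "norm2 N c * norm2 N c \<le> (a * norm2 N y) * norm2 N c"
    by (simp add: power2_eq_square mult_ac)
  moreover have "0 < norm2 N c" using False norm2_nonneg[of N c] by (simp add: c_def less_le)
  ultimately have "norm2 N c \<le> a * norm2 N y" by (rule mult_right_le_imp_le)
  then show ?thesis by (simp add: c_def)
next
  case True
  show ?thesis unfolding True using opbD(2)[OF assms] by simp
qed

lemma norm2_col_of:
  assumes "opb N A a" "j < N"
  shows "norm2 N (col_of A j) \<le> a"
proof -
  have "norm2 N (col_of A j) = norm2 N (mat_app A (unitv j))"
    using assms opbD(1)[OF assms(1)] by (intro norm2_cong) (simp add: col_of_def mat_app_unitv)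
  also have "\<dots> \<le> a" using opbD(3)[OF assms(1), of "unitv j"] assms(2) by (simp add: norm2_unitv)
  finally show ?thesis .
qed

lemma sum_cdot_col:
  assumes "opb N A a"
  shows "(\<Sum>j<N. (cmod (cdot N (col_of A j) y))^2) \<le> a^2 * (norm2 N y)^2"
  using power_mono[OF norm2_adj_app[OF assms, of y] norm2_nonneg, of 2]
  by (simp add: norm2_squared[of N "adj_app N A y"] power_mult_distrib) (simp add: adj_app_def)

text \<open>This is the squared Frobenius norm of A^H A: row i is A^H applied to a column of norm at
  most a, hence has norm at most a^2.\<close>

lemma sum_cdot_col_col:
  assumes "opb N A a"
  shows "(\<Sum>i<N. \<Sum>j<N. (cmod (cdot N (col_of A i) (col_of A j)))^2) \<le> real N * a ^ 4"
proof -
  have "(\<Sum>j<N. (cmod (cdot N (col_of A i) (col_of A j)))^2) \<le> a ^ 4" if "i < N" for i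
  proof -
    have "(\<Sum>j<N. (cmod (cdot N (col_of A i) (col_of A j)))^2) = (\<Sum>j<N. (cmod (cdot N (col_of A j) (col_of A i)))^2)"
      by (intro sum.cong refl) (metis cdot_cnj complex_mod_cnj)
    also have "\<dots> \<le> a^2 * (norm2 N (col_of A i))^2" by (rule sum_cdot_col[OF assms])
    also have "\<dots> \<le> a^2 * a^2" using norm2_col_of[OF assms that] by (intro mult_left_mono power_mono) auto
    finally show ?thesis by (simp flip: power_add)
  qed
  then have "(\<Sum>i<N. \<Sum>j<N. (cmod (cdot N (col_of A i) (col_of A j)))^2) \<le> (\<Sum>i<N. a ^ 4)"
    by (intro sum_mono) auto
  then show ?thesis by simp
qed

lemma mat_app_add: "A \<in> carrier_mat N N \<Longrightarrow> i < N \<Longrightarrow> mat_app A (\<lambda>i. x i + y i) i = mat_app A x i + mat_app A y i"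
  by (simp add: mat_app_eq sum.distrib algebra_simps)

lemma mat_app_scale: "A \<in> carrier_mat N N \<Longrightarrow> i < N \<Longrightarrow> mat_app A (\<lambda>i. c * x i) i = c * mat_app A x i"
  by (simp add: mat_app_eq sum_distrib_left algebra_simps)

lemma borel_measurable_mat_app:
  assumes "A \<in> carrier_mat N N" "\<And>i. i < N \<Longrightarrow> (\<lambda>y. x y i) \<in> borel_measurable M" "k < N"
  shows "(\<lambda>y. mat_app A (x y) k) \<in> borel_measurable M"
  unfolding mat_app_eq[OF assms(1,3)] using assms(2)
  by (intro borel_measurable_sum borel_measurable_times) auto

section \<open>The received pilot signal\<close>

lemma sets_distortion_law:
  "sets (distortion_law N \<kappa>t \<kappa>r p x) = sets (borel \<Otimes>\<^sub>M cvec N)"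
  unfolding distortion_law_def cvec_def by (intro sets_pair_measure_cong sets_PiM_cong) auto

lemma nn_integral_distortion_law:
  assumes f: "f \<in> borel_measurable (borel \<Otimes>\<^sub>M cvec N)"
  shows "(\<integral>\<^sup>+y. f y \<partial>distortion_law N \<kappa>t \<kappa>r p x) =
    (\<integral>\<^sup>+e. (\<integral>\<^sup>+y. f (e, y) \<partial>PiM {..<N} (\<lambda>i. cnormal (\<kappa>r * p * (cmod (x i))^2))) \<partial>cnormal (\<kappa>t * p))"
proof -
  interpret P: prob_space "PiM {..<N} (\<lambda>i. cnormal (\<kappa>r * p * (cmod (x i))^2))"
    by (intro prob_space_PiM prob_space_cnormal)
  have "f \<in> borel_measurable (cnormal (\<kappa>t * p) \<Otimes>\<^sub>M PiM {..<N} (\<lambda>i. cnormal (\<kappa>r * p * (cmod (x i))^2)))"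
    using f measurable_cong_sets[OF sets_distortion_law[of N \<kappa>t \<kappa>r p x] refl, of borel]
    unfolding distortion_law_def by blast
  then show ?thesis
    unfolding distortion_law_def by (rule P.nn_integral_fst[symmetric])
qed

lemma prob_space_distortion_law: "prob_space (distortion_law N \<kappa>t \<kappa>r p x)"
proof -
  interpret A: prob_space "cnormal (\<kappa>t * p)" by (rule prob_space_cnormal)
  interpret B: prob_space "PiM {..<N} (\<lambda>i. cnormal (\<kappa>r * p * (cmod (x i))^2))"
    by (intro prob_space_PiM prob_space_cnormal)
  interpret Q: pair_prob_space "cnormal (\<kappa>t * p)" "PiM {..<N} (\<lambda>i. cnormal (\<kappa>r * p * (cmod (x i))^2))" ..
  show ?thesis unfolding distortion_law_def by (rule Q.P.prob_space_axioms)
qed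

lemma nn_integral_cnormal_shift_pow4:
  assumes "0 \<le> s"
  shows "(\<integral>\<^sup>+e. ennreal ((cmod (d + e)) ^ 4) \<partial>cnormal s) \<le> ennreal (8 * (cmod d) ^ 4 + 16 * s^2)"
proof -
  have "(cmod (d + e)) ^ 4 \<le> 8 * (cmod d) ^ 4 + 8 * (cmod e) ^ 4" for e
  proof -
    have *: "(x + y)^2 \<le> 2 * x^2 + 2 * y^2" for x y :: real
      using zero_le_power2[of "x - y"] by (simp add: power2_eq_square algebra_simps)
    have "(cmod (d + e))^2 \<le> 2 * (cmod d)^2 + 2 * (cmod e)^2"
      by (rule order_trans[OF power_mono[OF norm_triangle_ineq norm_ge_zero] *])
    then have "((cmod (d + e))^2)^2 \<le> (2 * (cmod d)^2 + 2 * (cmod e)^2)^2" by (intro power_mono) auto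
    also have "\<dots> \<le> 2 * (2 * (cmod d)^2)^2 + 2 * (2 * (cmod e)^2)^2" by (rule *)
    finally show ?thesis by (simp add: power_mult_distrib flip: power_mult)
  qed
  then have "(\<integral>\<^sup>+e. ennreal ((cmod (d + e)) ^ 4) \<partial>cnormal s) \<le> (\<integral>\<^sup>+e. ennreal (8 * (cmod d) ^ 4) + ennreal 8 * ennreal ((cmod e) ^ 4) \<partial>cnormal s)"
    by (intro nn_integral_mono) (simp add: ennreal_plus[symmetric] ennreal_mult[symmetric] ennreal_leI del: ennreal_plus ennreal_numeral)
  also have "\<dots> = ennreal (8 * (cmod d) ^ 4) + ennreal 8 * ennreal (2 * s^2)"
    using nn_integral_cnormal_power4[OF assms]
    by (simp add: nn_integral_add nn_integral_cmult)
  also have "\<dots> = ennreal (8 * (cmod d) ^ 4 + 16 * s^2)"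
    by (simp add: ennreal_plus[symmetric] ennreal_mult[symmetric] del: ennreal_plus ennreal_numeral)
  finally show ?thesis .
qed

text \<open>The received pilot signal is \<open>(d + \<eta>) h + \<eta>r + w\<close>, with \<open>w\<close> collecting noise and
  interference.\<close>

locale pilot =
  fixes M :: "'a measure" and N :: nat and R Cw A :: "complex mat"
    and h w :: "'a \<Rightarrow> nat \<Rightarrow> complex" and \<eta> :: "'a \<Rightarrow> complex" and \<eta>r :: "'a \<Rightarrow> nat \<Rightarrow> complex"
    and d :: complex and \<kappa>t \<kappa>r p r cw a :: real
  assumes M: "prob_space M"
    and h: "complex_normal M N R h" and w: "complex_normal M N Cw w"
    and opR: "opb N R r" and opC: "opb N Cw cw" and opA: "opb N A a"
    and nonneg: "0 \<le> \<kappa>t" "0 \<le> \<kappa>r" "0 \<le> p"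
    and w_indep: "indep_of M (cvec N) w (cvec N \<Otimes>\<^sub>M borel \<Otimes>\<^sub>M cvec N) (\<lambda>x. (h x, \<eta> x, \<eta>r x))"
    and distortion: "has_cond_law M (cvec N) h (borel \<Otimes>\<^sub>M cvec N) (\<lambda>x. (\<eta> x, \<eta>r x)) (distortion_law N \<kappa>t \<kappa>r p)"
begin

sublocale prob_space M by (rule M)

definition e2 where "e2 = (cmod d)^2 + \<kappa>t * p"
definition e4 where "e4 = 8 * (cmod d) ^ 4 + 16 * (\<kappa>t * p)^2"
definition \<kappa> where "\<kappa> = \<kappa>r * p"

lemma const_nonneg: "0 \<le> e2" "0 \<le> e4" "0 \<le> \<kappa>" "0 \<le> r" "0 \<le> cw" "0 \<le> a"
  using nonneg opbD(2)[OF opR] opbD(2)[OF opC] opbD(2)[OF opA] by (auto simp: e2_def e4_def \<kappa>_def)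

lemma carrier: "R \<in> carrier_mat N N" "Cw \<in> carrier_mat N N" "A \<in> carrier_mat N N"
  using opbD(1)[OF opR] opbD(1)[OF opC] opbD(1)[OF opA] by auto

lemma measurable_h: "i < N \<Longrightarrow> (\<lambda>x. h x i) \<in> borel_measurable M"
  by (rule measurable_cvec_comp[OF complex_normalD(2)[OF h]])

lemma measurable_w: "i < N \<Longrightarrow> (\<lambda>x. w x i) \<in> borel_measurable M"
  by (rule measurable_cvec_comp[OF complex_normalD(2)[OF w]])

lemma measurable_\<eta>[measurable]: "\<eta> \<in> borel_measurable M"
  using measurable_compose[OF has_cond_lawD(2)[OF distortion] measurable_fst] by simp

lemma measurable_\<eta>r: "i < N \<Longrightarrow> (\<lambda>x. \<eta>r x i) \<in> borel_measurable M"
  using measurable_compose[OF measurable_compose[OF has_cond_lawD(2)[OF distortion] measurable_snd] measurable_cvec_component] by simp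

lemma nn_integral_pilot:
  assumes "(\<lambda>(x, e, y). f x e y) \<in> borel_measurable (cvec N \<Otimes>\<^sub>M borel \<Otimes>\<^sub>M cvec N)"
  shows "(\<integral>\<^sup>+s. f (h s) (\<eta> s) (\<eta>r s) \<partial>M) =
    (\<integral>\<^sup>+s. (\<integral>\<^sup>+e. (\<integral>\<^sup>+y. f (h s) e y \<partial>PiM {..<N} (\<lambda>i. cnormal (\<kappa> * (cmod (h s i))^2))) \<partial>cnormal (\<kappa>t * p)) \<partial>M)"
proof -
  have "(\<integral>\<^sup>+s. f (h s) (\<eta> s) (\<eta>r s) \<partial>M) = (\<integral>\<^sup>+s. (\<integral>\<^sup>+q. f (h s) (fst q) (snd q) \<partial>distortion_law N \<kappa>t \<kappa>r p (h s)) \<partial>M)"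
    using nn_integral_cond_law[OF M distortion, of "\<lambda>(x, e, y). f x e y"] assms by (simp add: case_prod_beta')
  also have "\<dots> = (\<integral>\<^sup>+s. (\<integral>\<^sup>+e. (\<integral>\<^sup>+y. f (h s) e y \<partial>PiM {..<N} (\<lambda>i. cnormal (\<kappa> * (cmod (h s i))^2))) \<partial>cnormal (\<kappa>t * p)) \<partial>M)"
  proof (intro nn_integral_cong)
    fix s assume "s \<in> space M"
    then have "h s \<in> space (cvec N)" by (rule measurable_space[OF complex_normalD(2)[OF h]])
    from measurable_compose[OF measurable_Pair1'[OF this] assms]
    have "(\<lambda>q. f (h s) (fst q) (snd q)) \<in> borel_measurable (borel \<Otimes>\<^sub>M cvec N)"
      by (simp add: case_prod_beta')
    then show "(\<integral>\<^sup>+q. f (h s) (fst q) (snd q) \<partial>distortion_law N \<kappa>t \<kappa>r p (h s)) =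
      (\<integral>\<^sup>+e. (\<integral>\<^sup>+y. f (h s) e y \<partial>PiM {..<N} (\<lambda>i. cnormal (\<kappa> * (cmod (h s i))^2))) \<partial>cnormal (\<kappa>t * p))"
      by (subst nn_integral_distortion_law) (auto simp: \<kappa>_def)
  qed
  finally show ?thesis .
qed

lemma measurable_arg:
  "i < N \<Longrightarrow> (\<lambda>q. fst q i) \<in> borel_measurable (cvec N \<Otimes>\<^sub>M borel \<Otimes>\<^sub>M cvec N)"
  "i < N \<Longrightarrow> (\<lambda>q. snd (snd q) i) \<in> borel_measurable (cvec N \<Otimes>\<^sub>M borel \<Otimes>\<^sub>M cvec N)"
  by (intro measurable_compose[OF measurable_fst measurable_cvec_component]
      measurable_compose[OF measurable_snd measurable_compose[OF measurable_snd measurable_cvec_component]]; assumption)+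

lemma L2le_h: "L2le M (\<lambda>x. norm2 N (h x)) (real N * r)"
  unfolding L2le_def using nn_integral_gaussian_norm2(1)[OF M h opR] const_nonneg
  by (auto intro: borel_measurable_norm2[OF measurable_h])

text \<open>The first factor of the distortion law does not involve the channel, so
  \<open>\<eta>\<close> and \<open>h\<close> integrate separately.\<close>

lemma nn_integral_\<eta>_h:
  assumes [measurable]: "f \<in> borel_measurable borel" and g: "g \<in> borel_measurable (cvec N)"
  shows "(\<integral>\<^sup>+s. f (\<eta> s) * g (h s) \<partial>M) = (\<integral>\<^sup>+e. f e \<partial>cnormal (\<kappa>t * p)) * (\<integral>\<^sup>+s. g (h s) \<partial>M)"
proof -
  note [measurable] = g
  have "(\<integral>\<^sup>+s. f (\<eta> s) * g (h s) \<partial>M) =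
    (\<integral>\<^sup>+s. (\<integral>\<^sup>+e. (\<integral>\<^sup>+y. f e * g (h s) \<partial>PiM {..<N} (\<lambda>i. cnormal (\<kappa> * (cmod (h s i))^2))) \<partial>cnormal (\<kappa>t * p)) \<partial>M)"
    by (rule nn_integral_pilot[of "\<lambda>x e y. f e * g x"]) measurable
  also have "\<dots> = (\<integral>\<^sup>+s. (\<integral>\<^sup>+e. f e \<partial>cnormal (\<kappa>t * p)) * g (h s) \<partial>M)"
    by (intro nn_integral_cong) (simp add: nn_integral_multc)
  also have "\<dots> = (\<integral>\<^sup>+e. f e \<partial>cnormal (\<kappa>t * p)) * (\<integral>\<^sup>+s. g (h s) \<partial>M)"
    using measurable_compose[OF complex_normalD(2)[OF h] g] by (rule nn_integral_cmult)
  finally show ?thesis .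
qed

lemma nn_integral_\<eta>:
  assumes "f \<in> borel_measurable borel"
  shows "(\<integral>\<^sup>+x. f (\<eta> x) \<partial>M) = (\<integral>\<^sup>+e. f e \<partial>cnormal (\<kappa>t * p))"
  using nn_integral_\<eta>_h[OF assms, of "\<lambda>_. 1"] by (simp add: emeasure_space_1)

lemma nn_e2: "(\<integral>\<^sup>+e. ennreal ((cmod (d + e))^2) \<partial>cnormal (\<kappa>t * p)) = ennreal e2"
  using centeredD(4)[OF centered_cnormal[of "\<kappa>t * p"], of d 1] nonneg by (simp add: e2_def)

lemma nn_e4: "(\<integral>\<^sup>+e. ennreal ((cmod (d + e)) ^ 4) \<partial>cnormal (\<kappa>t * p)) \<le> ennreal e4"
  using nn_integral_cnormal_shift_pow4[of "\<kappa>t * p" d] nonneg by (simp add: e4_def)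

lemma L2le_\<eta>_h:
  assumes "L2le M (\<lambda>x. g (h x)) B" "g \<in> borel_measurable (cvec N)"
  shows "L2le M (\<lambda>x. (d + \<eta> x) * complex_of_real (g (h x))) (e2 * B)"
    and "L2le M (\<lambda>x. (cmod (d + \<eta> x))^2 * g (h x)) (e4 * B)"
proof -
  note [measurable] = assms(2) complex_normalD(2)[OF h]
  have "(\<integral>\<^sup>+x. ennreal ((norm ((d + \<eta> x) * complex_of_real (g (h x))))^2) \<partial>M) =
    (\<integral>\<^sup>+x. ennreal ((cmod (d + \<eta> x))^2) * ennreal ((g (h x))^2) \<partial>M)"
    by (simp add: norm_mult power_mult_distrib ennreal_mult)
  also have "\<dots> = ennreal e2 * (\<integral>\<^sup>+x. ennreal ((g (h x))^2) \<partial>M)"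
    unfolding nn_e2[symmetric] by (rule nn_integral_\<eta>_h) measurable
  also have "\<dots> \<le> ennreal e2 * ennreal B"
    using L2leD(3)[OF assms(1)] by (intro mult_left_mono) auto
  finally show "L2le M (\<lambda>x. (d + \<eta> x) * complex_of_real (g (h x))) (e2 * B)"
    using L2leD(2)[OF assms(1)] const_nonneg by (auto simp: L2le_def ennreal_mult)
  have "(\<integral>\<^sup>+x. ennreal ((norm ((cmod (d + \<eta> x))^2 * g (h x)))^2) \<partial>M) =
    (\<integral>\<^sup>+x. ennreal ((cmod (d + \<eta> x)) ^ 4) * ennreal ((g (h x))^2) \<partial>M)"
    by (simp add: abs_mult power_mult_distrib ennreal_mult flip: power_mult)
  also have "\<dots> = (\<integral>\<^sup>+e. ennreal ((cmod (d + e)) ^ 4) \<partial>cnormal (\<kappa>t * p)) * (\<integral>\<^sup>+x. ennreal ((g (h x))^2) \<partial>M)"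
    by (rule nn_integral_\<eta>_h) measurable
  also have "\<dots> \<le> ennreal e4 * ennreal B"
    using L2leD(3)[OF assms(1)] nn_e4 by (intro mult_mono) auto
  finally show "L2le M (\<lambda>x. (cmod (d + \<eta> x))^2 * g (h x)) (e4 * B)"
    using L2leD(2)[OF assms(1)] const_nonneg by (auto simp: L2le_def ennreal_mult)
qed

lemma nn_integral_pair_h:
  "(\<integral>\<^sup>+x. ennreal ((cmod (cdot N u (h x)))^2 * (cmod (cdot N v (h x)))^2) \<partial>M) \<le>
    ennreal (2 * r^2 * (norm2 N u)^2 * (norm2 N v)^2)"
proof -
  have "(\<integral>\<^sup>+x. ennreal ((cmod (cdot N u (h x)))^2 * (cmod (cdot N v (h x)))^2) \<partial>M) =
      ennreal (Re (sform N R u u) * Re (sform N R v v) + (cmod (sform N R u v))^2)"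
    using has_bochner_integral_gaussian_pair[OF h, of u v]
    by (subst nn_integral_eq_integral) (auto simp: has_bochner_integral_iff)
  also have "\<dots> \<le> ennreal ((r * (norm2 N u)^2) * (r * (norm2 N v)^2) + (r * norm2 N u * norm2 N v)^2)"
    using const_nonneg
    by (intro ennreal_leI add_mono mult_mono power_mono sform_self_le[OF opR] sform_le[OF opR]
        sform_nonneg[OF complex_normalD(1)[OF h]]) auto
  finally show ?thesis by (simp add: power2_eq_square algebra_simps)
qed

end

section \<open>Linear forms in the receiver distortion\<close>

context pilot
begin

text \<open>Given \<open>h\<close> the coordinates of \<open>\<eta>r\<close> are independent with
  variances \<open>\<kappa>\<close> |h_i|^2, while the coefficients are linear in \<open>h\<close>.
  Each of the N terms thus has as mean a Gaussian pair moment of order 1.\<close>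

lemma L2le_\<eta>r_linear:
  assumes G: "\<And>i. i < N \<Longrightarrow> norm2 N (G i) \<le> \<gamma>" and "0 \<le> \<gamma>"
  shows "L2le M (\<lambda>s. (d + \<eta> s) * (\<Sum>i<N. cnj (cdot N (G i) (h s)) * \<eta>r s i)) (e2 * (\<kappa> * (2 * r^2 * \<gamma>^2) * real N))"
    and "L2le M (\<lambda>s. \<Sum>i<N. cnj (cdot N (G i) (h s)) * \<eta>r s i) (\<kappa> * (2 * r^2 * \<gamma>^2) * real N)"
proof -
  have mc: "(\<lambda>x. cdot N (G i) x) \<in> borel_measurable (cvec N)" for i
    by (intro borel_measurable_cdot measurable_cvec_component) auto
  have cn: "cnj \<in> borel_measurable borel" by (intro borel_measurable_continuous_onI continuous_intros)
  have m[measurable]: "(\<lambda>q. \<Sum>i<N. cnj (cdot N (G i) (fst q)) * snd (snd q) i) \<in> borel_measurable (cvec N \<Otimes>\<^sub>M borel \<Otimes>\<^sub>M cvec N)"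
    using measurable_compose[OF measurable_compose[OF measurable_fst mc] cn]
    by (intro borel_measurable_sum borel_measurable_times measurable_arg) auto
  have mM: "(\<lambda>s. \<Sum>i<N. cnj (cdot N (G i) (h s)) * \<eta>r s i) \<in> borel_measurable M"
    using measurable_compose[OF measurable_compose[OF complex_normalD(2)[OF h] mc] cn]
    by (intro borel_measurable_sum borel_measurable_times measurable_\<eta>r) auto
  note [measurable] = mM
  have bound: "(\<integral>\<^sup>+s. ennreal (\<Sum>i<N. (cmod (cdot N (G i) (h s)))^2 * (\<kappa> * (cmod (h s i))^2)) \<partial>M) \<le>
      ennreal (\<kappa> * (2 * r^2 * \<gamma>^2) * real N)"
  proof -
    have [measurable]: "(\<lambda>s. cdot N v (h s)) \<in> borel_measurable M" for v
      by (intro borel_measurable_cdot measurable_h) auto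
    have "(\<integral>\<^sup>+s. ennreal (\<Sum>i<N. (cmod (cdot N (G i) (h s)))^2 * (\<kappa> * (cmod (h s i))^2)) \<partial>M) =
      (\<integral>\<^sup>+s. (\<Sum>i<N. ennreal \<kappa> * ennreal ((cmod (cdot N (G i) (h s)))^2 * (cmod (cdot N (unitv i) (h s)))^2)) \<partial>M)"
    proof (intro nn_integral_cong)
      fix s
      have "ennreal (\<Sum>i<N. (cmod (cdot N (G i) (h s)))^2 * (\<kappa> * (cmod (h s i))^2)) =
          (\<Sum>i<N. ennreal ((cmod (cdot N (G i) (h s)))^2 * (\<kappa> * (cmod (h s i))^2)))"
        using const_nonneg by (subst sum_ennreal) auto
      also have "\<dots> = (\<Sum>i<N. ennreal \<kappa> * ennreal ((cmod (cdot N (G i) (h s)))^2 * (cmod (cdot N (unitv i) (h s)))^2))"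
        using const_nonneg by (intro sum.cong refl) (simp add: cdot_unitv mult.left_commute flip: ennreal_mult)
      finally show "ennreal (\<Sum>i<N. (cmod (cdot N (G i) (h s)))^2 * (\<kappa> * (cmod (h s i))^2)) = \<dots>" .
    qed
    also have "\<dots> = (\<Sum>i<N. ennreal \<kappa> * (\<integral>\<^sup>+s. ennreal ((cmod (cdot N (G i) (h s)))^2 * (cmod (cdot N (unitv i) (h s)))^2) \<partial>M))"
      by (subst nn_integral_sum) (auto intro!: sum.cong nn_integral_cmult)
    also have "\<dots> \<le> (\<Sum>i<N. ennreal \<kappa> * ennreal (2 * r^2 * \<gamma>^2))"
    proof (intro sum_mono mult_left_mono)
      fix i assume "i \<in> {..<N}"
      then have "2 * r^2 * (norm2 N (G i))^2 * (norm2 N (unitv i))^2 \<le> 2 * r^2 * \<gamma>^2"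
        using power_mono[OF G norm2_nonneg, of i 2] by (simp add: norm2_unitv mult_left_mono)
      then show "(\<integral>\<^sup>+s. ennreal ((cmod (cdot N (G i) (h s)))^2 * (cmod (cdot N (unitv i) (h s)))^2) \<partial>M) \<le> ennreal (2 * r^2 * \<gamma>^2)"
        by (rule order_trans[OF nn_integral_pair_h ennreal_leI])
    qed simp
    also have "\<dots> = ennreal (\<kappa> * (2 * r^2 * \<gamma>^2) * real N)"
      using const_nonneg by (simp add: ennreal_mult[symmetric] ennreal_of_nat_eq_real_of_nat mult_ac)
    finally show ?thesis .
  qed
  have inner: "(\<integral>\<^sup>+y. ennreal ((cmod (\<Sum>i<N. cnj (cdot N (G i) (h s)) * y i))^2) \<partial>PiM {..<N} (\<lambda>i. cnormal (\<kappa> * (cmod (h s i))^2))) =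
      ennreal (\<Sum>i<N. (cmod (cdot N (G i) (h s)))^2 * (\<kappa> * (cmod (h s i))^2))" for s
    using nn_integral_PiM_linear[of "{..<N}" "\<lambda>i. cnormal (\<kappa> * (cmod (h s i))^2)" "\<lambda>i. \<kappa> * (cmod (h s i))^2" 0 "\<lambda>i. cnj (cdot N (G i) (h s))"] const_nonneg
    by (simp add: centered_cnormal)
  have mi: "(\<lambda>y. \<Sum>i<N. cnj (cdot N (G i) (h s)) * y i) \<in> borel_measurable (PiM {..<N} (\<lambda>i. cnormal (\<kappa> * (cmod (h s i))^2)))" for s
    by (intro measurable_PiM_borel_sum) auto
  note [measurable] = mi
  have mh: "(\<lambda>s. ennreal (\<Sum>i<N. (cmod (cdot N (G i) (h s)))^2 * (\<kappa> * (cmod (h s i))^2))) \<in> borel_measurable M"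
    using measurable_h measurable_compose[OF complex_normalD(2)[OF h] mc]
    by (intro measurable_compose[OF _ measurable_ennreal] borel_measurable_sum borel_measurable_times borel_measurable_power borel_measurable_const borel_measurable_norm) auto
  have "(\<integral>\<^sup>+s. ennreal ((norm ((d + \<eta> s) * (\<Sum>i<N. cnj (cdot N (G i) (h s)) * \<eta>r s i)))^2) \<partial>M) =
    (\<integral>\<^sup>+s. (\<integral>\<^sup>+e. (\<integral>\<^sup>+y. ennreal ((cmod (d + e))^2) * ennreal ((cmod (\<Sum>i<N. cnj (cdot N (G i) (h s)) * y i))^2)
      \<partial>PiM {..<N} (\<lambda>i. cnormal (\<kappa> * (cmod (h s i))^2))) \<partial>cnormal (\<kappa>t * p)) \<partial>M)"
    unfolding norm_mult power_mult_distrib ennreal_mult[OF zero_le_power2 zero_le_power2]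
    by (rule nn_integral_pilot[of "\<lambda>x e y. ennreal ((cmod (d + e))^2) * ennreal ((cmod (\<Sum>i<N. cnj (cdot N (G i) x) * y i))^2)"])
       (simp add: case_prod_beta')
  also have "\<dots> = (\<integral>\<^sup>+s. ennreal e2 * ennreal (\<Sum>i<N. (cmod (cdot N (G i) (h s)))^2 * (\<kappa> * (cmod (h s i))^2)) \<partial>M)"
    by (simp add: nn_integral_cmult nn_integral_multc inner nn_e2)
  also have "\<dots> \<le> ennreal (e2 * (\<kappa> * (2 * r^2 * \<gamma>^2) * real N))"
    using const_nonneg by (intro nn_integral_mult_const_le mh bound) auto
  finally show "L2le M (\<lambda>s. (d + \<eta> s) * (\<Sum>i<N. cnj (cdot N (G i) (h s)) * \<eta>r s i)) (e2 * (\<kappa> * (2 * r^2 * \<gamma>^2) * real N))"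
    using const_nonneg by (auto simp: L2le_def)
  have "(\<integral>\<^sup>+s. ennreal ((norm (\<Sum>i<N. cnj (cdot N (G i) (h s)) * \<eta>r s i))^2) \<partial>M) =
    (\<integral>\<^sup>+s. (\<integral>\<^sup>+e. (\<integral>\<^sup>+y. ennreal ((cmod (\<Sum>i<N. cnj (cdot N (G i) (h s)) * y i))^2)
      \<partial>PiM {..<N} (\<lambda>i. cnormal (\<kappa> * (cmod (h s i))^2))) \<partial>cnormal (\<kappa>t * p)) \<partial>M)"
    by (rule nn_integral_pilot[of "\<lambda>x e y. ennreal ((cmod (\<Sum>i<N. cnj (cdot N (G i) x) * y i))^2)"])
       (simp add: case_prod_beta')
  also have "\<dots> = (\<integral>\<^sup>+s. ennreal (\<Sum>i<N. (cmod (cdot N (G i) (h s)))^2 * (\<kappa> * (cmod (h s i))^2)) \<partial>M)"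
    by (simp add: inner)
  also note bound
  finally show "L2le M (\<lambda>s. \<Sum>i<N. cnj (cdot N (G i) (h s)) * \<eta>r s i) (\<kappa> * (2 * r^2 * \<gamma>^2) * real N)"
    using const_nonneg by (auto simp: L2le_def)
qed

end

lemma sform_scale:
  assumes "C \<in> carrier_mat N N"
  shows "sform N C (\<lambda>i. c * u i) (\<lambda>i. c * w i) = complex_of_real ((cmod c)^2) * sform N C u w"
  unfolding sform_eq[OF assms] complex_norm_square by (simp add: sum_distrib_left mult_ac)

lemma sform_unitv: "C \<in> carrier_mat N N \<Longrightarrow> i < N \<Longrightarrow> j < N \<Longrightarrow> sform N C (unitv i) (unitv j) = C $$ (i, j)"
  by (simp add: sform_def cdot_unitv mat_app_unitv)

lemma norm2_add_squared:
  "(norm2 N (\<lambda>i. x i + y i))^2 = (norm2 N x)^2 + 2 * Re (cdot N x y) + (norm2 N y)^2"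
  unfolding norm2_squared cmod_add_squared cdot_def by (simp add: sum.distrib sum_distrib_left)

section \<open>Concentration of |A z|^2 and of h^H A z\<close>

context pilot
begin

definition z :: "'a \<Rightarrow> nat \<Rightarrow> complex" where
  "z x = (\<lambda>i. ((d + \<eta> x) * h x i + \<eta>r x i) + w x i)"

text \<open>\<open>TR\<close>, \<open>Tw\<close>, \<open>TD\<close> and \<open>trAR\<close> are tr(A
  R A^H), tr(A Cw A^H), tr(A Rdiag A^H) and tr(A R), written as sums that match the Gaussian moment
  formulas. \<open>\<tau>\<close> is then the mean of |A z|^2 given the transmitter
  distortion.\<close>

definition TR :: real where "TR = (\<Sum>k<N. Re (sform N R (crow A k) (crow A k)))"
definition Tw :: real where "Tw = (\<Sum>k<N. Re (sform N Cw (crow A k) (crow A k)))"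
definition TD :: real where "TD = (\<Sum>i<N. (norm2 N (col_of A i))^2 * Re (R $$ (i, i)))"
definition trAR :: complex where "trAR = (\<Sum>k<N. sform N R (crow A k) (unitv k))"

definition \<tau> :: "'a \<Rightarrow> real" where
  "\<tau> x = (cmod (d + \<eta> x))^2 * TR + \<kappa> * TD + Tw"

lemma measurable_z: "i < N \<Longrightarrow> (\<lambda>x. z x i) \<in> borel_measurable M"
  unfolding z_def using measurable_h measurable_\<eta>r measurable_w by measurable

lemma measurable_Az: "k < N \<Longrightarrow> (\<lambda>x. mat_app A (z x) k) \<in> borel_measurable M"
  by (rule borel_measurable_mat_app[OF carrier(3) measurable_z])

lemma L2le_Ah: "L2le M (\<lambda>x. (norm2 N (mat_app A (h x)))^2 - TR) (real N * a ^ 4 * r^2)"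
  using nn_integral_gaussian_quadratic_le[OF M h frame_crow[OF opA] opR] const_nonneg
  unfolding L2le_def TR_def sum_cdot_crow[OF carrier(3)]
  by (auto intro!: borel_measurable_diff borel_measurable_power borel_measurable_norm2 borel_measurable_mat_app[OF carrier(3)] measurable_h)

lemma L2le_Aw: "L2le M (\<lambda>x. (norm2 N (mat_app A (w x)))^2 - Tw) (real N * a ^ 4 * cw^2)"
  using nn_integral_gaussian_quadratic_le[OF M w frame_crow[OF opA] opC] const_nonneg
  unfolding L2le_def Tw_def sum_cdot_crow[OF carrier(3)]
  by (auto intro!: borel_measurable_diff borel_measurable_power borel_measurable_norm2 borel_measurable_mat_app[OF carrier(3)] measurable_w)

lemma L2le_w: "L2le M (\<lambda>x. norm2 N (w x)) (real N * cw)"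
  unfolding L2le_def using nn_integral_gaussian_norm2(1)[OF M w opC] const_nonneg
  by (auto intro: borel_measurable_norm2[OF measurable_w])

text \<open>The second centring of the distortion term: the mean of |A \<open>\<eta>r\<close>|^2
  given \<open>h\<close> is itself a quadratic form in \<open>h\<close>, whose frame is the diagonal
  matrix of the column norms of A, of operator norm at most a.\<close>

lemma L2le_diag_h:
  "L2le M (\<lambda>y. (\<Sum>i<N. (norm2 N (col_of A i))^2 * (cmod (h y i))^2) - TD) (real N * a ^ 4 * r^2)"
proof -
  define P where "P = (\<lambda>i j. complex_of_real (norm2 N (col_of A i)) * unitv i j)"
  have c: "cdot N (P i) x = complex_of_real (norm2 N (col_of A i)) * x i" if "i < N" for i x
    unfolding P_def cdot_scale_left using that by (simp add: cdot_unitv)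
  have P: "frame N N P a"
    unfolding frame_def
  proof (intro conjI allI const_nonneg)
    fix x
    have "(\<Sum>k<N. (cmod (cdot N (P k) x))^2) \<le> (\<Sum>k<N. a^2 * (cmod (x k))^2)"
      using power_mono[OF norm2_col_of[OF opA] norm2_nonneg, of _ 2]
      by (intro sum_mono) (auto simp: c norm_mult power_mult_distrib intro: mult_right_mono)
    then show "(\<Sum>k<N. (cmod (cdot N (P k) x))^2) \<le> a^2 * (norm2 N x)^2"
      by (simp add: norm2_squared sum_distrib_left)
  qed
  have "(\<Sum>k<N. (cmod (cdot N (P k) (h y)))^2) = (\<Sum>i<N. (norm2 N (col_of A i))^2 * (cmod (h y i))^2)" for y
    by (intro sum.cong refl) (simp add: c norm_mult power_mult_distrib)
  moreover have "(\<Sum>k<N. Re (sform N R (P k) (P k))) = TD"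
    unfolding TD_def P_def sform_scale[OF carrier(1)]
    by (intro sum.cong refl) (simp add: sform_unitv[OF carrier(1)] del: of_real_power)
  ultimately show ?thesis
    using nn_integral_gaussian_quadratic_le[OF M h P opR] const_nonneg measurable_h
    unfolding L2le_def
    by (auto intro!: borel_measurable_diff borel_measurable_sum borel_measurable_times borel_measurable_power borel_measurable_norm)
qed

text \<open>\<open>\<eta>r\<close> is Gaussian only given \<open>h\<close>, so the centring is at
  the mean given \<open>h\<close>. The conditional variance weights |h_i|^2 |h_j|^2 by |(A^H
  A)_ij|^2, and these weights sum to order N.\<close>

lemma L2le_A\<eta>r:
  "L2le M (\<lambda>s. (norm2 N (mat_app A (\<eta>r s)))^2 - \<kappa> * (\<Sum>i<N. (norm2 N (col_of A i))^2 * (cmod (h s i))^2))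
    (\<kappa>^2 * (2 * r^2) * (real N * a ^ 4))"
proof -
  define F where "F = (\<lambda>x y. (norm2 N (mat_app A y))^2 - \<kappa> * (\<Sum>i<N. (norm2 N (col_of A i))^2 * (cmod (x i))^2))"
  have mF[measurable]: "(\<lambda>q. F (fst q) (snd (snd q))) \<in> borel_measurable (cvec N \<Otimes>\<^sub>M borel \<Otimes>\<^sub>M cvec N)"
    unfolding F_def
    by (intro borel_measurable_diff borel_measurable_sum borel_measurable_times borel_measurable_power
      borel_measurable_const measurable_compose[OF _ borel_measurable_norm] borel_measurable_norm2 borel_measurable_mat_app[OF carrier(3)])
       (auto intro: measurable_arg)
  have mM: "(\<lambda>s. F (h s) (\<eta>r s)) \<in> borel_measurable M"
    unfolding F_def
    by (intro borel_measurable_diff borel_measurable_sum borel_measurable_times borel_measurable_power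
      borel_measurable_const measurable_compose[OF _ borel_measurable_norm] borel_measurable_norm2 borel_measurable_mat_app[OF carrier(3)])
       (auto intro: measurable_h measurable_\<eta>r)
  define g where "g = (\<lambda>i j. (cmod (cdot N (col_of A i) (col_of A j)))^2)"
  have g0: "0 \<le> g i j" for i j by (simp add: g_def)
  have inner: "(\<integral>\<^sup>+y. ennreal ((F (h s) y)^2) \<partial>PiM {..<N} (\<lambda>i. cnormal (\<kappa> * (cmod (h s i))^2))) =
      (\<Sum>i<N. \<Sum>j<N. ennreal (\<kappa>^2 * g i j) * ennreal ((cmod (cdot N (unitv i) (h s)))^2 * (cmod (cdot N (unitv j) (h s)))^2))" for s
  proof -
    have "F (h s) y = (\<Sum>k<N. (cmod (\<Sum>i<N. A $$ (k, i) * y i))^2) -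
        (\<Sum>i<N. (\<kappa> * (cmod (h s i))^2) * (\<Sum>k<N. (cmod (A $$ (k, i)))^2))" for y
      unfolding F_def norm2_squared
      by (simp add: mat_app_eq[OF carrier(3)] col_of_def sum_distrib_left mult_ac)
    then have "(\<integral>\<^sup>+y. ennreal ((F (h s) y)^2) \<partial>PiM {..<N} (\<lambda>i. cnormal (\<kappa> * (cmod (h s i))^2))) =
      ennreal (\<Sum>i<N. \<Sum>j<N. (\<kappa> * (cmod (h s i))^2) * (\<kappa> * (cmod (h s j))^2) * (cmod (\<Sum>k<N. cnj (A $$ (k, i)) * A $$ (k, j)))^2)"
      using nn_integral_PiM_quadratic[of "{..<N}" "\<lambda>i. \<kappa> * (cmod (h s i))^2" "\<lambda>k i. A $$ (k, i)" N] const_nonneg by simp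
    also have "\<dots> = ennreal (\<Sum>i<N. \<Sum>j<N. (\<kappa>^2 * g i j) * ((cmod (cdot N (unitv i) (h s)))^2 * (cmod (cdot N (unitv j) (h s)))^2))"
      unfolding g_def
      by (intro arg_cong[where f=ennreal] sum.cong refl)
         (simp add: cdot_unitv col_of_def cdot_def[of N "\<lambda>k. A $$ (k, _)"] power2_eq_square mult_ac)
    also have "\<dots> = (\<Sum>i<N. \<Sum>j<N. ennreal (\<kappa>^2 * g i j) * ennreal ((cmod (cdot N (unitv i) (h s)))^2 * (cmod (cdot N (unitv j) (h s)))^2))"
      using g0 by (subst sum_ennreal[symmetric]) (auto intro!: sum_nonneg sum.cong simp: sum_ennreal[symmetric] ennreal_mult)
    finally show ?thesis .
  qed
  have mc: "(\<lambda>s. cdot N (unitv i) (h s)) \<in> borel_measurable M" for i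
    by (intro borel_measurable_cdot measurable_h) auto
  note [measurable] = mc
  have "(\<integral>\<^sup>+s. ennreal ((norm (F (h s) (\<eta>r s)))^2) \<partial>M) =
    (\<integral>\<^sup>+s. (\<integral>\<^sup>+e. (\<integral>\<^sup>+y. ennreal ((F (h s) y)^2) \<partial>PiM {..<N} (\<lambda>i. cnormal (\<kappa> * (cmod (h s i))^2))) \<partial>cnormal (\<kappa>t * p)) \<partial>M)"
    unfolding real_norm_def power2_abs
    by (rule nn_integral_pilot[of "\<lambda>x e y. ennreal ((F x y)^2)"]) (simp add: case_prod_beta')
  also have "\<dots> = (\<integral>\<^sup>+s. (\<Sum>i<N. \<Sum>j<N. ennreal (\<kappa>^2 * g i j) * ennreal ((cmod (cdot N (unitv i) (h s)))^2 * (cmod (cdot N (unitv j) (h s)))^2)) \<partial>M)"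
    unfolding inner by simp
  also have "\<dots> = (\<Sum>i<N. \<Sum>j<N. ennreal (\<kappa>^2 * g i j) * (\<integral>\<^sup>+s. ennreal ((cmod (cdot N (unitv i) (h s)))^2 * (cmod (cdot N (unitv j) (h s)))^2) \<partial>M))"
    by (simp add: nn_integral_sum nn_integral_cmult)
  also have "\<dots> \<le> (\<Sum>i<N. \<Sum>j<N. ennreal (\<kappa>^2 * g i j) * ennreal (2 * r^2))"
  proof (intro sum_mono mult_left_mono)
    fix i j assume "i \<in> {..<N}" "j \<in> {..<N}"
    then show "(\<integral>\<^sup>+s. ennreal ((cmod (cdot N (unitv i) (h s)))^2 * (cmod (cdot N (unitv j) (h s)))^2) \<partial>M) \<le> ennreal (2 * r^2)"
      using nn_integral_pair_h[of "unitv i" "unitv j"] by (simp add: norm2_unitv)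
  qed simp
  also have "\<dots> = ennreal (\<Sum>i<N. \<Sum>j<N. \<kappa>^2 * g i j * (2 * r^2))"
    using g0 by (subst sum_ennreal[symmetric]) (auto intro!: sum_nonneg sum.cong simp: sum_ennreal[symmetric] ennreal_mult)
  also have "\<dots> \<le> ennreal (\<kappa>^2 * (2 * r^2) * (real N * a ^ 4))"
  proof (rule ennreal_leI)
    have "(\<Sum>i<N. \<Sum>j<N. \<kappa>^2 * g i j * (2 * r^2)) = \<kappa>^2 * (2 * r^2) * (\<Sum>i<N. \<Sum>j<N. g i j)"
      unfolding sum_distrib_left by (intro sum.cong refl) (simp add: mult_ac)
    also have "\<dots> \<le> \<kappa>^2 * (2 * r^2) * (real N * a ^ 4)"
      unfolding g_def by (intro mult_left_mono sum_cdot_col_col[OF opA]) auto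
    finally show "(\<Sum>i<N. \<Sum>j<N. \<kappa>^2 * g i j * (2 * r^2)) \<le> \<dots>" .
  qed
  finally show ?thesis
    using mM const_nonneg unfolding L2le_def F_def by auto
qed

lemma L2le_\<eta>r: "L2le M (\<lambda>\<omega>. norm2 N (\<eta>r \<omega>)) (\<kappa> * (real N * r))"
proof -
  have mi: "(\<lambda>y. y i) \<in> borel_measurable (PiM {..<N} (\<lambda>i. cnormal (s i)))" if "i < N" for i s
    using measurable_component_singleton[of i "{..<N}" "\<lambda>i. cnormal (s i)"] that by simp
  have inner: "(\<integral>\<^sup>+y. ennreal ((norm2 N y)^2) \<partial>PiM {..<N} (\<lambda>i. cnormal (\<kappa> * (cmod (h \<omega> i))^2))) = ennreal \<kappa> * ennreal ((norm2 N (h \<omega>))^2)" for \<omega>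
  proof -
    have "(\<integral>\<^sup>+y. ennreal ((norm2 N y)^2) \<partial>PiM {..<N} (\<lambda>i. cnormal (\<kappa> * (cmod (h \<omega> i))^2))) =
      (\<integral>\<^sup>+y. (\<Sum>i<N. ennreal ((cmod (y i))^2)) \<partial>PiM {..<N} (\<lambda>i. cnormal (\<kappa> * (cmod (h \<omega> i))^2)))"
      unfolding norm2_squared by (intro nn_integral_cong) simp
    also have "\<dots> = (\<Sum>i<N. \<integral>\<^sup>+y. ennreal ((cmod (y i))^2) \<partial>PiM {..<N} (\<lambda>i. cnormal (\<kappa> * (cmod (h \<omega> i))^2)))"
      using mi by (intro nn_integral_sum) auto
    also have "\<dots> = (\<Sum>i<N. ennreal (\<kappa> * (cmod (h \<omega> i))^2))"
    proof (intro sum.cong refl)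
      fix i assume i: "i \<in> {..<N}"
      have "(\<Sum>j<N. unitv i j * y j) = y i" for y
        using i cdot_unitv[of i N y] by (simp add: cdot_def unitv_def if_distrib cong: if_cong)
      moreover have "(\<Sum>j<N. (cmod (unitv i j))^2 * (\<kappa> * (cmod (h \<omega> j))^2)) = \<kappa> * (cmod (h \<omega> i))^2"
        using i by (simp add: unitv_def if_distrib[of cmod] if_distrib[of "\<lambda>x. x^2"] if_distrib[of "\<lambda>x. x * _"] cong: if_cong)
      ultimately show "(\<integral>\<^sup>+y. ennreal ((cmod (y i))^2) \<partial>PiM {..<N} (\<lambda>i. cnormal (\<kappa> * (cmod (h \<omega> i))^2))) = ennreal (\<kappa> * (cmod (h \<omega> i))^2)"
        using nn_integral_PiM_linear[of "{..<N}" "\<lambda>i. cnormal (\<kappa> * (cmod (h \<omega> i))^2)" "\<lambda>i. \<kappa> * (cmod (h \<omega> i))^2" 0 "unitv i"] const_nonneg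
        by (simp add: centered_cnormal)
    qed
    also have "\<dots> = ennreal \<kappa> * ennreal ((norm2 N (h \<omega>))^2)"
      using const_nonneg by (simp add: norm2_squared sum_distrib_left ennreal_mult[symmetric] sum_nonneg)
    finally show ?thesis .
  qed
  have [measurable]: "(\<lambda>q. norm2 N (snd (snd q))) \<in> borel_measurable (cvec N \<Otimes>\<^sub>M borel \<Otimes>\<^sub>M cvec N)"
    by (intro borel_measurable_norm2 measurable_arg)
  have "(\<integral>\<^sup>+\<omega>. ennreal ((norm (norm2 N (\<eta>r \<omega>)))^2) \<partial>M) =
    (\<integral>\<^sup>+\<omega>. (\<integral>\<^sup>+e. (\<integral>\<^sup>+y. ennreal ((norm2 N y)^2) \<partial>PiM {..<N} (\<lambda>i. cnormal (\<kappa> * (cmod (h \<omega> i))^2))) \<partial>cnormal (\<kappa>t * p)) \<partial>M)"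
    unfolding real_norm_def power2_abs
    by (rule nn_integral_pilot[of "\<lambda>x e y. ennreal ((norm2 N y)^2)"]) (simp add: case_prod_beta')
  also have "\<dots> = (\<integral>\<^sup>+\<omega>. ennreal \<kappa> * ennreal ((norm2 N (h \<omega>))^2) \<partial>M)" unfolding inner by simp
  also have "\<dots> \<le> ennreal (\<kappa> * (real N * r))"
    using const_nonneg L2leD(3)[OF L2le_h] borel_measurable_norm2[OF measurable_h]
    by (intro nn_integral_mult_const_le) auto
  finally show ?thesis
    using const_nonneg borel_measurable_norm2[OF measurable_\<eta>r] by (auto simp: L2le_def)
qed

lemma L2le_signal: "L2le M (\<lambda>x. norm2 N (\<lambda>i. (d + \<eta> x) * h x i + \<eta>r x i)) (2 * (e2 * (real N * r)) + 2 * (\<kappa> * (real N * r)))"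
proof -
  have 1: "L2le M (\<lambda>x. (d + \<eta> x) * complex_of_real (norm2 N (h x))) (e2 * (real N * r))"
    by (intro L2le_\<eta>_h L2le_h borel_measurable_norm2 measurable_cvec_component)
  have 2: "L2le M (\<lambda>x. cmod ((d + \<eta> x) * complex_of_real (norm2 N (h x)))) (1^2 * (e2 * (real N * r)))"
    using L2leD(1)[OF 1] by (intro L2le_bound[OF 1]) auto
  have "L2le M (\<lambda>x. norm2 N (\<lambda>i. (d + \<eta> x) * h x i + \<eta>r x i)) (1^2 * (2 * (1^2 * (e2 * (real N * r))) + 2 * (\<kappa> * (real N * r))))"
  proof (rule L2le_bound[OF L2le_add[OF 2 L2le_\<eta>r]])
    show "(\<lambda>x. norm2 N (\<lambda>i. (d + \<eta> x) * h x i + \<eta>r x i)) \<in> borel_measurable M"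
      using measurable_h measurable_\<eta>r by (intro borel_measurable_norm2 borel_measurable_add borel_measurable_times) auto
    show "norm (norm2 N (\<lambda>i. (d + \<eta> x) * h x i + \<eta>r x i)) \<le>
        1 * norm (cmod ((d + \<eta> x) * complex_of_real (norm2 N (h x))) + norm2 N (\<eta>r x))" for x
      using norm2_triangle[of N "\<lambda>i. (d + \<eta> x) * h x i" "\<eta>r x"] by (simp add: norm2_scale norm_mult)
  qed simp
  then show ?thesis by simp
qed

text \<open>\<open>w\<close> is independent of channel and distortions; with these frozen, the cross
  term is the linear functional of \<open>w\<close> given by A^H A s for the signal s.\<close>

lemma L2le_cross_w:
  "L2le M (\<lambda>x. cdot N (mat_app A (\<lambda>i. (d + \<eta> x) * h x i + \<eta>r x i)) (mat_app A (w x)))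
    (cw * a ^ 4 * (2 * (e2 * (real N * r)) + 2 * (\<kappa> * (real N * r))))"
proof -
  define s :: "(nat \<Rightarrow> complex) \<times> complex \<times> (nat \<Rightarrow> complex) \<Rightarrow> nat \<Rightarrow> complex"
    where "s = (\<lambda>q i. (d + fst (snd q)) * fst q i + snd (snd q) i)"
  have ms: "i < N \<Longrightarrow> (\<lambda>q. s q i) \<in> borel_measurable (cvec N \<Otimes>\<^sub>M borel \<Otimes>\<^sub>M cvec N)" for i
    unfolding s_def by (intro borel_measurable_add borel_measurable_times measurable_arg) auto
  define u where "u = (\<lambda>q. adj_app N A (mat_app A (s q)))"
  have mu: "i < N \<Longrightarrow> (\<lambda>q. u q i) \<in> borel_measurable (cvec N \<Otimes>\<^sub>M borel \<Otimes>\<^sub>M cvec N)" for i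
    unfolding u_def adj_app_def by (intro borel_measurable_cdot borel_measurable_mat_app[OF carrier(3)] ms) auto
  have eq: "cdot N (u (h x, \<eta> x, \<eta>r x)) (w x) = cdot N (mat_app A (\<lambda>i. (d + \<eta> x) * h x i + \<eta>r x i)) (mat_app A (w x))" for x
    unfolding u_def cdot_adj_app[OF carrier(3)] by (simp add: s_def)
  have "(\<integral>\<^sup>+x. 1 * ennreal ((cmod (cdot N (u (h x, \<eta> x, \<eta>r x)) (w x)))^2) \<partial>M) \<le>
      (\<integral>\<^sup>+x. 1 * ennreal (cw * (norm2 N (u (h x, \<eta> x, \<eta>r x)))^2) \<partial>M)"
    by (rule nn_integral_gaussian_indep[OF M w opC w_indep, where u=u and q="\<lambda>_. 1"]) (auto intro: mu)
  also have "\<dots> \<le> (\<integral>\<^sup>+x. ennreal (cw * a ^ 4) * ennreal ((norm (norm2 N (\<lambda>i. (d + \<eta> x) * h x i + \<eta>r x i)))^2) \<partial>M)"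
  proof (intro nn_integral_mono)
    fix x
    have "norm2 N (u (h x, \<eta> x, \<eta>r x)) \<le> a * (a * norm2 N (s (h x, \<eta> x, \<eta>r x)))"
      unfolding u_def using norm2_adj_app[OF opA] opbD(3)[OF opA] const_nonneg by (meson mult_left_mono order_trans)
    from power_mono[OF this norm2_nonneg, of 2]
    have "(norm2 N (u (h x, \<eta> x, \<eta>r x)))^2 \<le> a ^ 4 * (norm2 N (s (h x, \<eta> x, \<eta>r x)))^2"
      by (simp add: power_mult_distrib mult.assoc[symmetric] flip: power_add)
    then have "cw * (norm2 N (u (h x, \<eta> x, \<eta>r x)))^2 \<le> cw * (a ^ 4 * (norm2 N (s (h x, \<eta> x, \<eta>r x)))^2)"
      using const_nonneg by (intro mult_left_mono)
    then show "1 * ennreal (cw * (norm2 N (u (h x, \<eta> x, \<eta>r x)))^2) \<le>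
      ennreal (cw * a ^ 4) * ennreal ((norm (norm2 N (\<lambda>i. (d + \<eta> x) * h x i + \<eta>r x i)))^2)"
      using const_nonneg by (simp add: ennreal_mult[symmetric] ennreal_leI s_def mult.assoc)
  qed
  also have "\<dots> \<le> ennreal (cw * a ^ 4 * (2 * (e2 * (real N * r)) + 2 * (\<kappa> * (real N * r))))"
    using L2leD[OF L2le_signal] const_nonneg by (intro nn_integral_mult_const_le) auto
  finally have "(\<integral>\<^sup>+x. ennreal ((norm (cdot N (mat_app A (\<lambda>i. (d + \<eta> x) * h x i + \<eta>r x i)) (mat_app A (w x))))^2) \<partial>M) \<le>
    ennreal (cw * a ^ 4 * (2 * (e2 * (real N * r)) + 2 * (\<kappa> * (real N * r))))"
    unfolding eq by simp
  moreover have "(\<lambda>x. cdot N (mat_app A (\<lambda>i. (d + \<eta> x) * h x i + \<eta>r x i)) (mat_app A (w x))) \<in> borel_measurable M"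
    using measurable_h measurable_\<eta>r measurable_w
    by (intro borel_measurable_cdot borel_measurable_mat_app[OF carrier(3)] borel_measurable_add borel_measurable_times) auto
  ultimately show ?thesis using const_nonneg by (auto simp: L2le_def)
qed

text \<open>Expanding A \<open>\<eta>r\<close> over the columns a_i of A gives a linear form in
  \<open>\<eta>r\<close> whose coefficients are linear in \<open>h\<close> through the vectors A^H
  a_i, of norm at most a^2.\<close>

lemma L2le_cross_\<eta>r:
  "L2le M (\<lambda>x. (d + \<eta> x) * cdot N (mat_app A (h x)) (mat_app A (\<eta>r x))) (e2 * (\<kappa> * (2 * r^2 * (a^2)^2) * real N))"
proof -
  define G where "G = (\<lambda>i. adj_app N A (col_of A i))"
  have "norm2 N (G i) \<le> a^2" if "i < N" for i
    unfolding G_def power2_eq_square using norm2_adj_app[OF opA] norm2_col_of[OF opA that] const_nonneg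
    by (meson mult_left_mono order_trans)
  from L2le_\<eta>r_linear(1)[OF this]
  have "L2le M (\<lambda>x. (d + \<eta> x) * (\<Sum>i<N. cnj (cdot N (G i) (h x)) * \<eta>r x i)) (e2 * (\<kappa> * (2 * r^2 * (a^2)^2) * real N))"
    by simp
  moreover have "(\<Sum>i<N. cnj (cdot N (G i) (h x)) * \<eta>r x i) = cdot N (mat_app A (h x)) (mat_app A (\<eta>r x))" for x
    unfolding cdot_mat_app[OF carrier(3), of "mat_app A (h x)"] G_def cdot_adj_app[OF carrier(3)] by (simp add: cdot_cnj)
  ultimately show ?thesis by simp
qed

lemma Az_eq:
  "i < N \<Longrightarrow> mat_app A (z x) i = ((d + \<eta> x) * mat_app A (h x) i + mat_app A (\<eta>r x) i) + mat_app A (w x) i"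
  unfolding z_def by (simp only: mat_app_add[OF carrier(3)] mat_app_scale[OF carrier(3)])

text \<open>An exact splitting into six pieces, each of which has mean square of order N by one of
  the preceding estimates.\<close>

lemma norm2_Az:
  "(norm2 N (mat_app A (z x)))^2 - \<tau> x =
    (cmod (d + \<eta> x))^2 * ((norm2 N (mat_app A (h x)))^2 - TR) +
    ((norm2 N (mat_app A (\<eta>r x)))^2 - \<kappa> * (\<Sum>i<N. (norm2 N (col_of A i))^2 * (cmod (h x i))^2)) +
    \<kappa> * ((\<Sum>i<N. (norm2 N (col_of A i))^2 * (cmod (h x i))^2) - TD) +
    2 * Re (cnj (d + \<eta> x) * cdot N (mat_app A (h x)) (mat_app A (\<eta>r x))) +
    ((norm2 N (mat_app A (w x)))^2 - Tw) +
    2 * Re (cdot N (mat_app A (\<lambda>i. (d + \<eta> x) * h x i + \<eta>r x i)) (mat_app A (w x)))"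
proof -
  define y where "y = mat_app A (\<lambda>i. (d + \<eta> x) * h x i + \<eta>r x i)"
  have y: "y i = (d + \<eta> x) * mat_app A (h x) i + mat_app A (\<eta>r x) i" if "i < N" for i
    unfolding y_def using that by (simp only: mat_app_add[OF carrier(3)] mat_app_scale[OF carrier(3)])
  have "norm2 N (mat_app A (z x)) = norm2 N (\<lambda>i. y i + mat_app A (w x) i)"
    by (intro norm2_cong) (simp add: Az_eq y)
  then have 1: "(norm2 N (mat_app A (z x)))^2 = (norm2 N y)^2 + 2 * Re (cdot N y (mat_app A (w x))) + (norm2 N (mat_app A (w x)))^2"
    by (simp only: norm2_add_squared)
  have "norm2 N y = norm2 N (\<lambda>i. (d + \<eta> x) * mat_app A (h x) i + mat_app A (\<eta>r x) i)"
    by (intro norm2_cong) (simp add: y)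
  then have 2: "(norm2 N y)^2 = (cmod (d + \<eta> x))^2 * (norm2 N (mat_app A (h x)))^2 +
      2 * Re (cnj (d + \<eta> x) * cdot N (mat_app A (h x)) (mat_app A (\<eta>r x))) + (norm2 N (mat_app A (\<eta>r x)))^2"
    by (simp only: norm2_add_squared norm2_scale cdot_scale_left power_mult_distrib)
  show ?thesis
    unfolding 1 2 \<tau>_def y_def[symmetric] by (simp only: right_diff_distrib)
qed

text \<open>The nested factors 2 record the successive uses of \<open>L2le_add\<close> in
  \<open>L2le_norm2_Az\<close>; each 2^2 stems from the factor in 2 Re.\<close>

definition Kb :: real where
  "Kb = 2 * (2 * (2 * (2 * (2 * (e4 * (a ^ 4 * r^2)) + 2 * (\<kappa>^2 * (2 * r^2) * a ^ 4)) + 2 * (\<kappa>^2 * (a ^ 4 * r^2)))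
    + 2 * (2^2 * (e2 * (\<kappa> * (2 * r^2 * (a^2)^2))))) + 2 * (a ^ 4 * cw^2)) + 2 * (2^2 * (cw * a ^ 4 * (2 * (e2 * r) + 2 * (\<kappa> * r))))"

lemma L2le_norm2_Az: "L2le M (\<lambda>y. (norm2 N (mat_app A (z y)))^2 - \<tau> y) (real N * Kb)"
proof -
  have 1: "L2le M (\<lambda>y. (cmod (d + \<eta> y))^2 * ((norm2 N (mat_app A (h y)))^2 - TR)) (e4 * (real N * a ^ 4 * r^2))"
    by (rule L2le_\<eta>_h(2)[OF L2le_Ah])
       (auto intro!: borel_measurable_diff borel_measurable_power borel_measurable_norm2 borel_measurable_mat_app[OF carrier(3)] measurable_cvec_component)
  have 3: "L2le M (\<lambda>y. \<kappa> * ((\<Sum>i<N. (norm2 N (col_of A i))^2 * (cmod (h y i))^2) - TD)) (\<kappa>^2 * (real N * a ^ 4 * r^2))"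
    using const_nonneg L2leD(1)[OF L2le_diag_h] by (intro L2le_bound[OF L2le_diag_h]) (auto simp: abs_mult)
  have 4: "L2le M (\<lambda>y. 2 * Re (cnj (d + \<eta> y) * cdot N (mat_app A (h y)) (mat_app A (\<eta>r y)))) (2^2 * (e2 * (\<kappa> * (2 * r^2 * (a^2)^2) * real N)))"
  proof (rule L2le_bound[OF L2le_cross_\<eta>r])
    have cn: "cnj \<in> borel_measurable borel" by (intro borel_measurable_continuous_onI continuous_intros)
    have "(\<lambda>y. cdot N (mat_app A (h y)) (mat_app A (\<eta>r y))) \<in> borel_measurable M"
      using measurable_h measurable_\<eta>r by (intro borel_measurable_cdot borel_measurable_mat_app[OF carrier(3)]) auto
    moreover have "(\<lambda>y. cnj (d + \<eta> y)) \<in> borel_measurable M"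
      by (rule measurable_compose[OF _ cn]) simp
    ultimately show "(\<lambda>y. 2 * Re (cnj (d + \<eta> y) * cdot N (mat_app A (h y)) (mat_app A (\<eta>r y)))) \<in> borel_measurable M"
      by (intro borel_measurable_times borel_measurable_const measurable_compose[OF _ borel_measurable_Re]) auto
    show "norm (2 * Re (cnj (d + \<eta> y) * cdot N (mat_app A (h y)) (mat_app A (\<eta>r y)))) \<le>
      2 * norm ((d + \<eta> y) * cdot N (mat_app A (h y)) (mat_app A (\<eta>r y)))" for y
      using abs_Re_le_cmod[of "cnj (d + \<eta> y) * cdot N (mat_app A (h y)) (mat_app A (\<eta>r y))"]
      by (simp only: norm_mult complex_mod_cnj real_norm_def abs_mult abs_numeral)
  qed simp
  have 6: "L2le M (\<lambda>y. 2 * Re (cdot N (mat_app A (\<lambda>i. (d + \<eta> y) * h y i + \<eta>r y i)) (mat_app A (w y))))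
      (2^2 * (cw * a ^ 4 * (2 * (e2 * (real N * r)) + 2 * (\<kappa> * (real N * r)))))"
  proof (rule L2le_bound[OF L2le_cross_w])
    show "(\<lambda>y. 2 * Re (cdot N (mat_app A (\<lambda>i. (d + \<eta> y) * h y i + \<eta>r y i)) (mat_app A (w y)))) \<in> borel_measurable M"
      using L2leD(1)[OF L2le_cross_w] by (intro borel_measurable_times borel_measurable_const measurable_compose[OF _ borel_measurable_Re]) auto
    show "norm (2 * Re x) \<le> 2 * norm x" for x :: complex
      using abs_Re_le_cmod[of x] by (simp add: abs_mult)
  qed simp
  show ?thesis
    unfolding norm2_Az
    by (rule L2le_mono[OF L2le_add[OF L2le_add[OF L2le_add[OF L2le_add[OF L2le_add[OF 1 L2le_A\<eta>r] 3] 4] L2le_Aw] 6]])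
       (simp add: Kb_def algebra_simps)
qed

text \<open>The power of a + 1 comes from the bilinear form h^H A h, polarized from the frames
  \<open>crow A\<close> and \<open>unitv\<close> with bounds a and 1.\<close>

definition Ka :: real where
  "Ka = 2 * (2 * (e2 * ((a + 1) ^ 4 * r^2)) + 2 * (\<kappa> * (2 * r^2 * a^2))) + 2 * (r * a^2 * cw)"

text \<open>Three pieces: d + \<open>\<eta>\<close> times the quadratic form h^H A h centred at tr(A
  R); a form linear in \<open>\<eta>r\<close> with coefficients linear in \<open>h\<close>; and h^H
  A w, where \<open>w\<close> is frozen and \<open>h\<close> is integrated.\<close>

lemma L2le_hAz: "L2le M (\<lambda>y. cdot N (h y) (mat_app A (z y)) - (d + \<eta> y) * trAR) (real N * Ka)"
proof -
  have mq: "(\<lambda>x. cdot N x (mat_app A x) - trAR) \<in> borel_measurable (cvec N)"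
    by (intro borel_measurable_diff borel_measurable_cdot borel_measurable_mat_app[OF carrier(3)] measurable_cvec_component) auto
  have q: "L2le M (\<lambda>y. cdot N (h y) (mat_app A (h y)) - trAR) (real N * (a + 1) ^ 4 * r^2)"
    using nn_integral_gaussian_bilinear_le[OF M h frame_crow[OF opA] frame_unitv opR] const_nonneg
      measurable_compose[OF complex_normalD(2)[OF h] mq]
    unfolding L2le_def trAR_def sum_unitv_crow[OF carrier(3)] by auto
  have "L2le M (\<lambda>y. cmod (cdot N (h y) (mat_app A (h y)) - trAR)) (1^2 * (real N * (a + 1) ^ 4 * r^2))"
    using L2leD(1)[OF q] by (intro L2le_bound[OF q]) auto
  from L2le_\<eta>_h(1)[OF this] mq
  have 1: "L2le M (\<lambda>y. (d + \<eta> y) * complex_of_real (cmod (cdot N (h y) (mat_app A (h y)) - trAR))) (e2 * (real N * (a + 1) ^ 4 * r^2))"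
    by simp
  have 1: "L2le M (\<lambda>y. (d + \<eta> y) * (cdot N (h y) (mat_app A (h y)) - trAR)) (1^2 * (e2 * (real N * (a + 1) ^ 4 * r^2)))"
    using L2leD(1)[OF q] by (intro L2le_bound[OF 1]) (auto simp: norm_mult)
  have 2: "L2le M (\<lambda>y. cdot N (h y) (mat_app A (\<eta>r y))) (\<kappa> * (2 * r^2 * a^2) * real N)"
    using L2le_\<eta>r_linear(2)[OF norm2_col_of[OF opA] const_nonneg(6)]
    unfolding cdot_mat_app[OF carrier(3)] by (simp add: cdot_cnj)
  have 3: "L2le M (\<lambda>y. cdot N (h y) (mat_app A (w y))) (r * a^2 * (real N * cw))"
  proof -
    have I: "indep_of M (cvec N) h (cvec N) w"
      using indep_of_compose[OF M indep_of_sym[OF M w_indep] measurable_fst measurable_ident] by (simp add: id_def)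
    have "(\<integral>\<^sup>+y. 1 * ennreal ((cmod (cdot N (mat_app A (w y)) (h y)))^2) \<partial>M) \<le>
        (\<integral>\<^sup>+y. 1 * ennreal (r * (norm2 N (mat_app A (w y)))^2) \<partial>M)"
      by (rule nn_integral_gaussian_indep[OF M h opR I, of "mat_app A" "\<lambda>_. 1"])
         (auto intro!: borel_measurable_mat_app[OF carrier(3)] measurable_cvec_component)
    also have "\<dots> \<le> (\<integral>\<^sup>+y. ennreal (r * a^2) * ennreal ((norm (norm2 N (w y)))^2) \<partial>M)"
      using const_nonneg opbD(4)[OF opA]
      by (intro nn_integral_mono) (auto simp: ennreal_mult[symmetric] mult.assoc intro!: ennreal_leI mult_left_mono)
    also have "\<dots> \<le> ennreal (r * a^2 * (real N * cw))"
      using L2leD[OF L2le_w] const_nonneg by (intro nn_integral_mult_const_le) auto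
    finally have "(\<integral>\<^sup>+y. ennreal ((cmod (cdot N (mat_app A (w y)) (h y)))^2) \<partial>M) \<le> ennreal (r * a^2 * (real N * cw))" by simp
    moreover have "cmod (cdot N (mat_app A (w y)) (h y)) = cmod (cdot N (h y) (mat_app A (w y)))" for y
      by (metis cdot_cnj complex_mod_cnj)
    moreover have "(\<lambda>y. cdot N (h y) (mat_app A (w y))) \<in> borel_measurable M"
      using measurable_h measurable_w by (intro borel_measurable_cdot borel_measurable_mat_app[OF carrier(3)]) auto
    ultimately show ?thesis using const_nonneg by (auto simp: L2le_def)
  qed
  have "cdot N (h y) (mat_app A (z y)) - (d + \<eta> y) * trAR =
    (d + \<eta> y) * (cdot N (h y) (mat_app A (h y)) - trAR) + cdot N (h y) (mat_app A (\<eta>r y)) + cdot N (h y) (mat_app A (w y))" for y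
  proof -
    have "cdot N (h y) (mat_app A (z y)) = cdot N (h y) (\<lambda>i. ((d + \<eta> y) * mat_app A (h y) i + mat_app A (\<eta>r y) i) + mat_app A (w y) i)"
      by (intro cdot_cong Az_eq) auto
    then show ?thesis by (simp only: cdot_add_right cdot_scale_right right_diff_distrib) simp
  qed
  then show ?thesis
    by (simp only:) (rule L2le_mono[OF L2le_add[OF L2le_add[OF 1 2] 3]], simp add: Ka_def algebra_simps)
qed

end

section \<open>Normalised correlations\<close>

text \<open>The hypothesis |x|^2 <= H^2 b keeps both quotients by b under control and forces x = 0
  when b = 0. Every actual division is by t, whose lower bound c is known.\<close>

lemma ratio_pointwise:
  fixes x y :: complex and b t H :: real
  assumes b: "0 \<le> b" and t: "0 < c" "c \<le> t" and H: "0 \<le> H" "(cmod x)^2 \<le> H^2 * b"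
  shows "\<bar>(cmod x)^2 / b - (cmod y)^2 / t\<bar> \<le> (H^2 * \<bar>b - t\<bar> + cmod (x - y) * (cmod (x - y) + 2 * cmod y)) / c"
    and "cmod (x / complex_of_real (sqrt b) - y / complex_of_real (sqrt t)) \<le> H * \<bar>b - t\<bar> / c + cmod (x - y) / sqrt c"
    and "(cmod x)^2 / b \<le> H^2" and "cmod (x / complex_of_real (sqrt b)) \<le> H"
proof -
  have tp: "0 < t" using t by simp
  define q where "q = (cmod x)^2 / b"
  have x0: "x = 0" if "b = 0" using H that by simp
  have q: "q * b = (cmod x)^2" "0 \<le> q" "q \<le> H^2"
  proof -
    show "q * b = (cmod x)^2" unfolding q_def using x0 by (cases "b = 0") auto
    show "0 \<le> q" unfolding q_def using b by simp
    show "q \<le> H^2"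
    proof (cases "b = 0")
      case False
      then show ?thesis unfolding q_def using H b by (simp add: pos_divide_le_eq less_le)
    qed (simp add: q_def)
  qed
  show "(cmod x)^2 / b \<le> H^2" using q by (simp add: q_def)
  have xy: "\<bar>(cmod x)^2 - (cmod y)^2\<bar> \<le> cmod (x - y) * (cmod (x - y) + 2 * cmod y)"
  proof -
    have "\<bar>(cmod x)^2 - (cmod y)^2\<bar> = \<bar>cmod x - cmod y\<bar> * \<bar>cmod x + cmod y\<bar>"
      unfolding abs_mult[symmetric] by (simp add: power2_eq_square algebra_simps)
    also have "\<dots> \<le> cmod (x - y) * (cmod (x - y) + 2 * cmod y)"
      using norm_triangle_ineq2[of x y] norm_triangle_ineq3[of x y] by (intro mult_mono) auto
    finally show ?thesis .
  qed
  have "q - (cmod y)^2 / t = (q * (t - b) + ((cmod x)^2 - (cmod y)^2)) / t"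
    using tp unfolding q(1)[symmetric] by (simp add: field_simps)
  then have "\<bar>q - (cmod y)^2 / t\<bar> = \<bar>q * (t - b) + ((cmod x)^2 - (cmod y)^2)\<bar> / t" using tp by simp
  also have "\<dots> \<le> (H^2 * \<bar>b - t\<bar> + cmod (x - y) * (cmod (x - y) + 2 * cmod y)) / t"
  proof (intro divide_right_mono)
    have "\<bar>q * (t - b)\<bar> \<le> H^2 * \<bar>b - t\<bar>"
      unfolding abs_mult using q by (intro mult_mono) auto
    then show "\<bar>q * (t - b) + ((cmod x)^2 - (cmod y)^2)\<bar> \<le> H^2 * \<bar>b - t\<bar> + cmod (x - y) * (cmod (x - y) + 2 * cmod y)"
      using xy by linarith
  qed (use tp in simp)
  also have "\<dots> \<le> (H^2 * \<bar>b - t\<bar> + cmod (x - y) * (cmod (x - y) + 2 * cmod y)) / c"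
    using t by (intro divide_left_mono) auto
  finally show "\<bar>(cmod x)^2 / b - (cmod y)^2 / t\<bar> \<le> (H^2 * \<bar>b - t\<bar> + cmod (x - y) * (cmod (x - y) + 2 * cmod y)) / c"
    by (simp add: q_def)
  define u where "u = x / complex_of_real (sqrt b)"
  have u: "u * complex_of_real (sqrt b) = x" unfolding u_def using x0 b by (cases "b = 0") auto
  have "(cmod u)^2 = q" unfolding u_def q_def using b by (simp add: norm_divide power_divide)
  then have "(cmod u)^2 \<le> H^2" using q by simp
  then have uH: "cmod u \<le> H" using H(1) by (rule power2_le_imp_le)
  then show "cmod (x / complex_of_real (sqrt b)) \<le> H" by (simp add: u_def)
  have st: "0 < sqrt t" using tp by simp
  have "u - y / complex_of_real (sqrt t) = (u * complex_of_real (sqrt t - sqrt b) + (x - y)) / complex_of_real (sqrt t)"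
    using tp unfolding u[symmetric] by (simp add: field_simps)
  then have "cmod (u - y / complex_of_real (sqrt t)) = cmod (u * complex_of_real (sqrt t - sqrt b) + (x - y)) / sqrt t"
    using st by (simp add: norm_divide)
  also have "\<dots> \<le> (cmod u * \<bar>sqrt t - sqrt b\<bar> + cmod (x - y)) / sqrt t"
    using st norm_triangle_ineq[of "u * complex_of_real (sqrt t - sqrt b)" "x - y"]
    by (intro divide_right_mono) (auto simp: norm_mult simp del: of_real_diff)
  also have "\<dots> \<le> (H * (\<bar>b - t\<bar> / sqrt t) + cmod (x - y)) / sqrt t"
  proof (intro divide_right_mono add_right_mono mult_mono)
    \<comment> \<open>sqrt t - sqrt b = (t - b) / (sqrt t + sqrt b); discarding sqrt b in the
      denominator leaves a division by sqrt t only.\<close>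
    have "(sqrt t - sqrt b) * (sqrt t + sqrt b) = t - b" using tp b by (simp add: algebra_simps)
    then have "\<bar>sqrt t - sqrt b\<bar> * (sqrt t + sqrt b) = \<bar>b - t\<bar>"
      using st b by (metis abs_minus_commute abs_mult abs_of_nonneg add_nonneg_nonneg less_imp_le real_sqrt_ge_zero)
    moreover have "\<bar>sqrt t - sqrt b\<bar> * sqrt t \<le> \<bar>sqrt t - sqrt b\<bar> * (sqrt t + sqrt b)" using b by (intro mult_left_mono) auto
    ultimately show "\<bar>sqrt t - sqrt b\<bar> \<le> \<bar>b - t\<bar> / sqrt t" using st by (simp add: pos_le_divide_eq)
  qed (use uH H st in auto)
  also have "\<dots> = H * \<bar>b - t\<bar> / t + cmod (x - y) / sqrt t"
    using tp by (simp add: field_simps) 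
  also have "\<dots> \<le> H * \<bar>b - t\<bar> / c + cmod (x - y) / sqrt c"
    using t H tp by (intro add_mono divide_left_mono) auto
  finally show "cmod (x / complex_of_real (sqrt b) - y / complex_of_real (sqrt t)) \<le> H * \<bar>b - t\<bar> / c + cmod (x - y) / sqrt c"
    by (simp add: u_def)
qed

text \<open>The pointwise bounds are integrated with Cauchy-Schwarz. Separating H^2 from |b - t| is
  what calls for the fourth moment of the channel norm, \<open>B4\<close>.\<close>

lemma ratio_integral:
  fixes x y :: "'a \<Rightarrow> complex" and b t H :: "'a \<Rightarrow> real"
  assumes M: "prob_space M" and c: "0 < c"
    and b: "\<And>s. 0 \<le> b s" and t: "\<And>s. c \<le> t s" and H: "\<And>s. 0 \<le> H s" "\<And>s. (cmod (x s))^2 \<le> (H s)^2 * b s"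
    and [measurable]: "x \<in> borel_measurable M" "b \<in> borel_measurable M" "t \<in> borel_measurable M"
    and B1: "L2le M (\<lambda>s. x s - y s) B1" and B2: "L2le M (\<lambda>s. b s - t s) B2"
    and B3: "L2le M H B3" and B4: "L2le M (\<lambda>s. (H s)^2) B4" and B5: "L2le M y B5"
  shows "integrable M (\<lambda>s. (cmod (x s))^2 / b s)" "integrable M (\<lambda>s. (cmod (y s))^2 / t s)"
    and "\<bar>(\<integral>s. (cmod (x s))^2 / b s \<partial>M) - (\<integral>s. (cmod (y s))^2 / t s \<partial>M)\<bar> \<le> (sqrt (B4 * B2) + sqrt (B1 * (2 * B1 + 8 * B5))) / c"
    and "integrable M (\<lambda>s. x s / complex_of_real (sqrt (b s)))" "integrable M (\<lambda>s. y s / complex_of_real (sqrt (t s)))"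
    and "cmod ((\<integral>s. x s / complex_of_real (sqrt (b s)) \<partial>M) - (\<integral>s. y s / complex_of_real (sqrt (t s)) \<partial>M)) \<le> sqrt (B3 * B2) / c + sqrt B1 / sqrt c"
proof -
  interpret prob_space M by fact
  note [measurable] = L2leD(1)[OF B5] L2leD(1)[OF B3]
  have tp: "0 < t s" for s using c t[of s] by simp
  note pw = ratio_pointwise[OF b c t H(1) H(2)]
  note IH = L2le_integrable(1)[OF B3]
  show I1: "integrable M (\<lambda>s. (cmod (x s))^2 / b s)"
    by (rule Bochner_Integration.integrable_bound[OF IH]) (use pw(3) b in auto)
  show I2: "integrable M (\<lambda>s. (cmod (y s))^2 / t s)"
  proof (rule Bochner_Integration.integrable_bound[OF integrable_mult_left[OF L2le_integrable(1)[OF B5], of "1 / c"]])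
    show "AE s in M. norm ((cmod (y s))^2 / t s) \<le> norm ((norm (y s))^2 * (1 / c))"
      using t c tp by (auto intro!: divide_left_mono AE_I2 simp: less_imp_le)
  qed simp
  have L1: "L2le M (\<lambda>s. cmod (x s - y s)) (1^2 * B1)"
    by (rule L2le_bound[OF B1]) auto
  have L5: "L2le M (\<lambda>s. 2 * cmod (y s)) (2^2 * B5)"
    by (rule L2le_bound[OF B5]) auto
  note L15 = L2le_add[OF L1 L5]
  have J1: "integrable M (\<lambda>s. (H s)^2 * \<bar>b s - t s\<bar>)" "(\<integral>s. (H s)^2 * \<bar>b s - t s\<bar> \<partial>M) \<le> sqrt (B4 * B2)"
    using L2le_mult_integrable[OF B4 B2] by (simp_all add: H(1))
  have J2: "integrable M (\<lambda>s. cmod (x s - y s) * (cmod (x s - y s) + 2 * cmod (y s)))"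
    "(\<integral>s. cmod (x s - y s) * (cmod (x s - y s) + 2 * cmod (y s)) \<partial>M) \<le> sqrt (B1 * (2 * B1 + 8 * B5))"
    using L2le_mult_integrable[OF L1 L15] by simp_all
  have "\<bar>(\<integral>s. (cmod (x s))^2 / b s \<partial>M) - (\<integral>s. (cmod (y s))^2 / t s \<partial>M)\<bar> = \<bar>\<integral>s. (cmod (x s))^2 / b s - (cmod (y s))^2 / t s \<partial>M\<bar>"
    using I1 I2 by simp
  also have "\<dots> \<le> (\<integral>s. ((H s)^2 * \<bar>b s - t s\<bar> + cmod (x s - y s) * (cmod (x s - y s) + 2 * cmod (y s))) / c \<partial>M)"
    using I1 I2 J1 J2 pw(1) by (intro order_trans[OF integral_abs_bound] integral_mono) auto
  also have "\<dots> = ((\<integral>s. (H s)^2 * \<bar>b s - t s\<bar> \<partial>M) + (\<integral>s. cmod (x s - y s) * (cmod (x s - y s) + 2 * cmod (y s)) \<partial>M)) / c"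
    using J1 J2 by simp
  also have "\<dots> \<le> (sqrt (B4 * B2) + sqrt (B1 * (2 * B1 + 8 * B5))) / c"
    using J1 J2 c by (intro divide_right_mono add_mono) auto
  finally show "\<bar>(\<integral>s. (cmod (x s))^2 / b s \<partial>M) - (\<integral>s. (cmod (y s))^2 / t s \<partial>M)\<bar> \<le> (sqrt (B4 * B2) + sqrt (B1 * (2 * B1 + 8 * B5))) / c" .
  have one: "L2le M (\<lambda>_. 1 :: real) 1" by (simp add: L2le_def emeasure_space_1)
  have IHa: "integrable M H" using L2le_mult_integrable(1)[OF B3 one] by (simp add: H(1))
  show I3: "integrable M (\<lambda>s. x s / complex_of_real (sqrt (b s)))"
    by (rule Bochner_Integration.integrable_bound[OF IHa]) (use pw(4) H(1) in auto)
  have J3: "integrable M (\<lambda>s. H s * \<bar>b s - t s\<bar>)" "(\<integral>s. H s * \<bar>b s - t s\<bar> \<partial>M) \<le> sqrt (B3 * B2)"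
    using L2le_mult_integrable[OF B3 B2] by (simp_all add: H(1))
  have J4: "integrable M (\<lambda>s. cmod (x s - y s))" "(\<integral>s. cmod (x s - y s) \<partial>M) \<le> sqrt B1"
    using L2le_mult_integrable[OF B1 one] by simp_all
  have J34: "integrable M (\<lambda>s. H s * \<bar>b s - t s\<bar> / c + cmod (x s - y s) / sqrt c)"
    using J3 J4 by simp
  have D: "integrable M (\<lambda>s. x s / complex_of_real (sqrt (b s)) - y s / complex_of_real (sqrt (t s)))"
    by (rule Bochner_Integration.integrable_bound[OF J34])
       (use pw(2) in \<open>auto intro!: AE_I2 intro: order_trans[OF _ abs_ge_self]\<close>)
  from Bochner_Integration.integrable_diff[OF I3 D]
  show I4: "integrable M (\<lambda>s. y s / complex_of_real (sqrt (t s)))" by simp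
  have "cmod ((\<integral>s. x s / complex_of_real (sqrt (b s)) \<partial>M) - (\<integral>s. y s / complex_of_real (sqrt (t s)) \<partial>M)) =
      cmod (\<integral>s. x s / complex_of_real (sqrt (b s)) - y s / complex_of_real (sqrt (t s)) \<partial>M)"
    using I3 I4 by simp
  also have "\<dots> \<le> (\<integral>s. cmod (x s / complex_of_real (sqrt (b s)) - y s / complex_of_real (sqrt (t s))) \<partial>M)"
    by (rule integral_norm_bound)
  also have "\<dots> \<le> (\<integral>s. H s * \<bar>b s - t s\<bar> / c + cmod (x s - y s) / sqrt c \<partial>M)"
    using D J34 pw(2) by (intro integral_mono integrable_norm) auto
  also have "\<dots> = (\<integral>s. H s * \<bar>b s - t s\<bar> \<partial>M) / c + (\<integral>s. cmod (x s - y s) \<partial>M) / sqrt c"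
    using J3 J4 by simp
  also have "\<dots> \<le> sqrt (B3 * B2) / c + sqrt B1 / sqrt c"
    using J3 J4 c by (intro add_mono divide_right_mono) auto
  finally show "cmod ((\<integral>s. x s / complex_of_real (sqrt (b s)) \<partial>M) - (\<integral>s. y s / complex_of_real (sqrt (t s)) \<partial>M)) \<le> sqrt (B3 * B2) / c + sqrt B1 / sqrt c" .
qed

text \<open>Orders of growth: fluctuations of mean square n, y of mean square n^2, fourth moment of
  the norm n^2 and denominator c n give an error of order sqrt n for the squared correlation and of
  order 1 for its mean.\<close>

lemma ratio_scaling:
  fixes n :: real
  assumes n: "1 \<le> n" and k: "0 \<le> k1" "0 \<le> k2" "0 \<le> k3" "0 \<le> k4" "0 \<le> k5" and c: "0 < c"
  shows "(sqrt (n^2 * k4 * (n * k2)) + sqrt (n * k1 * (2 * (n * k1) + 8 * (n^2 * k5)))) / (c * n) \<le>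
      (sqrt (k4 * k2) + sqrt (k1 * (2 * k1 + 8 * k5))) / c * sqrt n"
    and "sqrt (n * k3 * (n * k2)) / (c * n) + sqrt (n * k1) / sqrt (c * n) = sqrt (k3 * k2) / c + sqrt (k1 / c)"
proof -
  have s: "sqrt (n^2 * n) = n * sqrt n" using n by (simp add: real_sqrt_mult)
  have "sqrt (n^2 * k4 * (n * k2)) = n * sqrt n * sqrt (k4 * k2)"
    unfolding s[symmetric] real_sqrt_mult[symmetric] by (simp add: mult_ac)
  moreover have "sqrt (n * k1 * (2 * (n * k1) + 8 * (n^2 * k5))) \<le> n * sqrt n * sqrt (k1 * (2 * k1 + 8 * k5))"
  proof -
    \<comment> \<open>The lower-order summand is raised from n to n^2 so that both scale
      alike.\<close>
    have "n \<le> n^2" using n by (simp add: power2_eq_square)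
    then have "n * k1 * (2 * (n * k1) + 8 * (n^2 * k5)) \<le> n * k1 * (2 * (n^2 * k1) + 8 * (n^2 * k5))"
      using k n by (intro mult_left_mono add_right_mono mult_right_mono) auto
    also have "\<dots> = n^2 * n * (k1 * (2 * k1 + 8 * k5))" by (simp add: algebra_simps)
    finally show ?thesis unfolding s[symmetric] real_sqrt_mult[symmetric] by (rule real_sqrt_le_mono)
  qed
  ultimately have "(sqrt (n^2 * k4 * (n * k2)) + sqrt (n * k1 * (2 * (n * k1) + 8 * (n^2 * k5)))) / (c * n) \<le>
      (n * sqrt n * sqrt (k4 * k2) + n * sqrt n * sqrt (k1 * (2 * k1 + 8 * k5))) / (c * n)"
    using c n by (intro divide_right_mono) auto
  also have "\<dots> = (sqrt (k4 * k2) + sqrt (k1 * (2 * k1 + 8 * k5))) / c * sqrt n"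
    using n c by (simp add: field_simps)
  finally show "(sqrt (n^2 * k4 * (n * k2)) + sqrt (n * k1 * (2 * (n * k1) + 8 * (n^2 * k5)))) / (c * n) \<le>
      (sqrt (k4 * k2) + sqrt (k1 * (2 * k1 + 8 * k5))) / c * sqrt n" .
  have "sqrt (n * k3 * (n * k2)) = n * sqrt (k3 * k2)"
    using n by (simp add: real_sqrt_mult mult_ac)
  moreover have "sqrt (n * k1) / sqrt (c * n) = sqrt (k1 / c)"
    unfolding real_sqrt_divide[symmetric] using n by (simp add: field_simps)
  ultimately show "sqrt (n * k3 * (n * k2)) / (c * n) + sqrt (n * k1) / sqrt (c * n) = sqrt (k3 * k2) / c + sqrt (k1 / c)"
    using n by simp
qed

section \<open>The normalised combining vector\<close>

definition normalize :: "nat \<Rightarrow> (nat \<Rightarrow> complex) \<Rightarrow> nat \<Rightarrow> complex" where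
  "normalize N x = (\<lambda>i. x i / complex_of_real (norm2 N x))"

lemma cdot_normalize: "cdot N u (normalize N x) = cdot N u x / complex_of_real (sqrt ((norm2 N x)^2))"
  by (simp add: normalize_def cdot_def sum_divide_distrib)

text \<open>Equality fails for the zero vector only, which is normalised to itself because x / 0 =
  0.\<close>

lemma norm2_normalize_le: "norm2 N (normalize N x) \<le> 1"
proof -
  have "normalize N x = (\<lambda>i. complex_of_real (1 / norm2 N x) * x i)"
    by (simp add: normalize_def fun_eq_iff)
  then have "norm2 N (normalize N x) = cmod (complex_of_real (1 / norm2 N x)) * norm2 N x" by (simp only: norm2_scale)
  then show ?thesis by (simp add: norm_divide)
qed

lemma norm_component_le: "k < N \<Longrightarrow> cmod (x k) \<le> norm2 N x"
  using cmod_cdot_le[of N "unitv k" x] by (simp add: cdot_unitv norm2_unitv)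

lemma L2le_gaussian_norm_sq:
  assumes M: "prob_space M" and X: "complex_normal M N C X" and C: "opb N C c"
  shows "L2le M (\<lambda>x. norm2 N (X x)) (real N * c)" "L2le M (\<lambda>x. (norm2 N (X x))^2) ((real N)^2 * (4 * c^2))"
proof -
  note [measurable] = borel_measurable_norm2[OF measurable_cvec_comp[OF complex_normalD(2)[OF X]]]
  show "L2le M (\<lambda>x. norm2 N (X x)) (real N * c)"
    using nn_integral_gaussian_norm2(1)[OF M X C] opbD(2)[OF C] by (auto simp: L2le_def)
  have "(norm ((norm2 N (X x))^2))^2 = norm2 N (X x) ^ 4" for x by (simp flip: power_mult)
  then show "L2le M (\<lambda>x. (norm2 N (X x))^2) ((real N)^2 * (4 * c^2))"
    using nn_integral_gaussian_norm2(2)[OF M X C] by (auto simp: L2le_def mult.left_commute mult.assoc)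
qed

text \<open>A vector of norm at most 1 that is independent of \<open>X\<close> picks up one
  direction of \<open>X\<close>, hence a power that does not grow with N.\<close>

lemma L2le_gaussian_indep_unit:
  assumes M: "prob_space M" and X: "complex_normal M N C X" and C: "opb N C c"
    and I: "indep_of M (cvec N) X (cvec N) V" and V: "\<And>y. norm2 N (V y) \<le> 1"
  shows "L2le M (\<lambda>y. cdot N (X y) (V y)) c"
proof -
  interpret prob_space M by fact
  note m = measurable_cvec_comp[OF complex_normalD(2)[OF X]] measurable_cvec_comp[OF indep_of_measurable(2)[OF I]]
  have "(\<integral>\<^sup>+y. 1 * ennreal ((cmod (cdot N (V y) (X y)))^2) \<partial>M) \<le> (\<integral>\<^sup>+y. 1 * ennreal (c * (norm2 N (V y))^2) \<partial>M)"
    by (rule nn_integral_gaussian_indep[OF M X C I, where u="\<lambda>x. x" and q="\<lambda>_. 1"]) (auto intro: measurable_cvec_component)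
  also have "\<dots> \<le> (\<integral>\<^sup>+y. ennreal c \<partial>M)"
    using power_le_one[OF norm2_nonneg V] opbD(2)[OF C] by (intro nn_integral_mono) (auto intro!: ennreal_leI mult_left_le)
  finally have "(\<integral>\<^sup>+y. ennreal ((cmod (cdot N (V y) (X y)))^2) \<partial>M) \<le> ennreal c" by (simp add: emeasure_space_1)
  moreover have "cmod (cdot N (V y) (X y)) = cmod (cdot N (X y) (V y))" for y by (metis cdot_cnj complex_mod_cnj)
  ultimately show ?thesis using opbD(2)[OF C] m by (auto simp: L2le_def intro: borel_measurable_cdot)
qed

context pilot
begin

lemma measurable_\<tau>[measurable]: "\<tau> \<in> borel_measurable M"
  unfolding \<tau>_def by measurable

text \<open>One estimate for all correlations with the combining vector: \<open>X\<close> is the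
  channel of the user or of a co-user in the pilot, and \<open>y\<close> the approximation of X^H A
  z that contains no channel.\<close>

lemma correlation_bounds:
  assumes N: "0 < N" and c: "0 < c" and \<tau>: "\<And>x. c * real N \<le> \<tau> x"
    and X: "complex_normal M N C X" and C: "opb N C \<rho>"
    and y: "L2le M y ((real N)^2 * k5)" "L2le M (\<lambda>x. cdot N (X x) (mat_app A (z x)) - y x) (real N * k1)"
  defines "v \<equiv> \<lambda>x. normalize N (mat_app A (z x))"
  shows "integrable M (\<lambda>x. (cmod (cdot N (X x) (v x)))^2)" "integrable M (\<lambda>x. (cmod (y x))^2 / \<tau> x)"
    and "\<bar>(\<integral>x. (cmod (cdot N (X x) (v x)))^2 \<partial>M) - (\<integral>x. (cmod (y x))^2 / \<tau> x \<partial>M)\<bar> \<le>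
      (sqrt (4 * \<rho>^2 * Kb) + sqrt (k1 * (2 * k1 + 8 * k5))) / c * sqrt (real N)"
    and "integrable M (\<lambda>x. cdot N (X x) (v x))" "integrable M (\<lambda>x. y x / complex_of_real (sqrt (\<tau> x)))"
    and "cmod ((\<integral>x. cdot N (X x) (v x) \<partial>M) - (\<integral>x. y x / complex_of_real (sqrt (\<tau> x)) \<partial>M)) \<le> sqrt (\<rho> * Kb) / c + sqrt (k1 / c)"
    and "(\<integral>x. (cmod (cdot N (X x) (v x)))^2 \<partial>M) \<le> real N * \<rho>"
proof -
  have Np: "0 < real N" "1 \<le> real N" using N by auto
  have rho: "0 \<le> \<rho>" using opbD(2)[OF C] .
  have Kb: "0 \<le> Kb" and k1: "0 \<le> k1" using L2leD(2)[OF L2le_norm2_Az] L2leD(2)[OF y(2)] Np by (auto simp: zero_le_mult_iff)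
  have k5: "0 \<le> k5" using L2leD(2)[OF y(1)] Np by (auto simp: zero_le_mult_iff)
  define b where "b = (\<lambda>x. (norm2 N (mat_app A (z x)))^2)"
  have mX: "i < N \<Longrightarrow> (\<lambda>x. X x i) \<in> borel_measurable M" for i
    by (rule measurable_cvec_comp[OF complex_normalD(2)[OF X]])
  have mx: "(\<lambda>x. cdot N (X x) (mat_app A (z x))) \<in> borel_measurable M"
    by (intro borel_measurable_cdot mX measurable_Az)
  have mb: "b \<in> borel_measurable M"
    unfolding b_def by (intro borel_measurable_power borel_measurable_norm2 measurable_Az)
  have cs: "(cmod (cdot N (X x) (mat_app A (z x))))^2 \<le> (norm2 N (X x))^2 * b x" for x
    unfolding b_def by (rule cmod_cdot_squared_le)
  have b0: "0 \<le> b x" for x by (simp add: b_def)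
  have cN: "0 < c * real N" using c Np by simp
  note rat = ratio_integral[OF M cN b0 \<tau> norm2_nonneg cs mx mb measurable_\<tau> y(2) L2le_norm2_Az[folded b_def[THEN fun_cong]]
      L2le_gaussian_norm_sq[OF M X C] y(1)]
  have v1: "cdot N (X x) (v x) = cdot N (X x) (mat_app A (z x)) / complex_of_real (sqrt (b x))" for x
    unfolding v_def b_def by (rule cdot_normalize)
  have v2: "(cmod (cdot N (X x) (v x)))^2 = (cmod (cdot N (X x) (mat_app A (z x))))^2 / b x" for x
    unfolding v1 using b0[of x] by (simp add: norm_divide power_divide)
  show I: "integrable M (\<lambda>x. (cmod (cdot N (X x) (v x)))^2)" unfolding v2 by (rule rat)
  show "integrable M (\<lambda>x. (cmod (y x))^2 / \<tau> x)" "integrable M (\<lambda>x. y x / complex_of_real (sqrt (\<tau> x)))" by (rule rat)+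
  show "integrable M (\<lambda>x. cdot N (X x) (v x))" unfolding v1 by (rule rat)
  show "\<bar>(\<integral>x. (cmod (cdot N (X x) (v x)))^2 \<partial>M) - (\<integral>x. (cmod (y x))^2 / \<tau> x \<partial>M)\<bar> \<le>
      (sqrt (4 * \<rho>^2 * Kb) + sqrt (k1 * (2 * k1 + 8 * k5))) / c * sqrt (real N)"
    unfolding v2 using order_trans[OF rat(3) ratio_scaling(1)[OF Np(2) k1 Kb rho _ k5 c]] rho by simp
  show "cmod ((\<integral>x. cdot N (X x) (v x) \<partial>M) - (\<integral>x. y x / complex_of_real (sqrt (\<tau> x)) \<partial>M)) \<le> sqrt (\<rho> * Kb) / c + sqrt (k1 / c)"
    unfolding v1 using rat(6) ratio_scaling(2)[OF Np(2) k1 Kb rho rho k5 c] by simp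
  have "(\<integral>x. (cmod (cdot N (X x) (v x)))^2 \<partial>M) \<le> (\<integral>x. (norm (norm2 N (X x)))^2 \<partial>M)"
  proof (intro integral_mono I L2le_integrable(1)[OF L2le_gaussian_norm_sq(1)[OF M X C]])
    fix x
    have "(cmod (cdot N (X x) (v x)))^2 \<le> (norm2 N (X x))^2 * (norm2 N (v x))^2" by (rule cmod_cdot_squared_le)
    also have "\<dots> \<le> (norm2 N (X x))^2 * 1"
      unfolding v_def by (intro mult_left_mono power_le_one norm2_normalize_le) auto
    finally show "(cmod (cdot N (X x) (v x)))^2 \<le> (norm (norm2 N (X x)))^2" by simp
  qed
  also have "\<dots> \<le> real N * \<rho>" by (rule L2le_integrable(2)[OF L2le_gaussian_norm_sq(1)[OF M X C]])
  finally show "(\<integral>x. (cmod (cdot N (X x) (v x)))^2 \<partial>M) \<le> real N * \<rho>" .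
qed

lemma cmod_trAR: "cmod trAR \<le> real N * (a * r)"
proof -
  have "cmod trAR \<le> (\<Sum>k<N. cmod (sform N R (crow A k) (unitv k)))" unfolding trAR_def by (rule norm_sum)
  also have "\<dots> \<le> (\<Sum>k<N. a * r)"
  proof (intro sum_mono)
    fix k assume "k \<in> {..<N}"
    then have k: "k < N" by simp
    have "cmod (sform N R (crow A k) (unitv k)) \<le> norm2 N (mat_app A (mat_app R (unitv k)))"
      unfolding sform_def cdot_crow[OF carrier(3) k] by (rule norm_component_le[OF k])
    also have "\<dots> \<le> a * (r * norm2 N (unitv k))"
      using opbD(3)[OF opA] opbD(3)[OF opR] const_nonneg by (meson mult_left_mono order_trans)
    finally show "cmod (sform N R (crow A k) (unitv k)) \<le> a * r" using k by (simp add: norm2_unitv)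
  qed
  finally show ?thesis by simp
qed

lemma L2le_\<eta>: "L2le M (\<lambda>y. (d + \<eta> y) * x) (e2 * (cmod x)^2)"
proof -
  have "L2le M (\<lambda>y. d + \<eta> y) e2"
    using nn_e2 nn_integral_\<eta>[of "\<lambda>e. ennreal ((cmod (d + e))^2)"] const_nonneg by (auto simp: L2le_def)
  from L2le_bound[OF this, of "\<lambda>y. (d + \<eta> y) * x" "cmod x"] show ?thesis
    by (simp add: norm_mult mult.commute)
qed

end

text \<open>A co-user transmitting \<open>dl\<close> in parallel with the pilot; \<open>z'\<close> is the rest of the received
  signal.\<close>

locale pilot_couser = pilot +
  fixes hl z' :: "'a \<Rightarrow> nat \<Rightarrow> complex" and dl :: "'a \<Rightarrow> complex" and Rl :: "complex mat" and rl \<rho> pl :: real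
  assumes hl: "complex_normal M N Rl hl" and opRl: "opb N Rl rl"
    and z_decomp: "\<And>x i. i < N \<Longrightarrow> z x i = z' x i + dl x * hl x i"
    and hl_indep_z: "indep_of M (cvec N) hl (cvec N) (\<lambda>x. \<lambda>i\<in>{..<N}. z' x i)"
    and z'_L2: "L2le M (\<lambda>x. norm2 N (z' x)) (real N * \<rho>)"
    and hl_indep_dl: "indep_of M (cvec N) hl borel dl"
    and dl_L2: "L2le M dl pl"
begin

definition trARl where "trARl = (\<Sum>k<N. sform N Rl (crow A k) (unitv k))"

definition Kl :: real where "Kl = 2 * (rl * a^2 * \<rho>) + 2 * (pl * ((a + 1) ^ 4 * rl^2))"

text \<open>hl^H A z = hl^H A z' + dl hl^H A hl. The first term is linear in \<open>hl\<close> with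
  \<open>z'\<close> frozen; in the second, \<open>dl\<close> is independent of \<open>hl\<close>, so
  the second moments of \<open>dl\<close> and of the centred quadratic form multiply.\<close>

lemma L2le_hlAz: "L2le M (\<lambda>s. cdot N (hl s) (mat_app A (z s)) - dl s * trARl) (real N * Kl)"
proof -
  have rl: "0 \<le> rl" using opbD(2)[OF opRl] .
  have pl: "0 \<le> pl" using L2leD(2)[OF dl_L2] .
  note mhl = measurable_cvec_comp[OF complex_normalD(2)[OF hl]]
  have mz': "i < N \<Longrightarrow> (\<lambda>s. z' s i) \<in> borel_measurable M" for i
    using measurable_cvec_comp[OF indep_of_measurable(2)[OF hl_indep_z], of i] by simp
  have mdl[measurable]: "dl \<in> borel_measurable M" using indep_of_measurable(2)[OF hl_indep_dl] .
  have c: "mat_app A (\<lambda>i\<in>{..<N}. z' s i) = mat_app A (z' s)" for s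
    by (rule mat_app_cong[OF carrier(3)]) simp
  have 1: "L2le M (\<lambda>s. cdot N (hl s) (mat_app A (z' s))) (rl * a^2 * (real N * \<rho>))"
  proof -
    have "(\<integral>\<^sup>+s. 1 * ennreal ((cmod (cdot N (mat_app A (\<lambda>i\<in>{..<N}. z' s i)) (hl s)))^2) \<partial>M) \<le>
        (\<integral>\<^sup>+s. 1 * ennreal (rl * (norm2 N (mat_app A (\<lambda>i\<in>{..<N}. z' s i)))^2) \<partial>M)"
      by (rule nn_integral_gaussian_indep[OF M hl opRl hl_indep_z, where u="mat_app A" and q="\<lambda>_. 1"])
         (auto intro!: borel_measurable_mat_app[OF carrier(3)] measurable_cvec_component)
    also have "\<dots> \<le> (\<integral>\<^sup>+s. ennreal (rl * a^2) * ennreal ((norm (norm2 N (z' s)))^2) \<partial>M)"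
      using rl opbD(4)[OF opA] unfolding c
      by (intro nn_integral_mono) (auto simp: ennreal_mult[symmetric] mult.assoc intro!: ennreal_leI mult_left_mono)
    also have "\<dots> \<le> ennreal (rl * a^2 * (real N * \<rho>))"
      using L2leD[OF z'_L2] rl by (intro nn_integral_mult_const_le) auto
    finally have "(\<integral>\<^sup>+s. ennreal ((cmod (cdot N (mat_app A (z' s)) (hl s)))^2) \<partial>M) \<le> ennreal (rl * a^2 * (real N * \<rho>))"
      unfolding c by simp
    moreover have "cmod (cdot N (mat_app A (z' s)) (hl s)) = cmod (cdot N (hl s) (mat_app A (z' s)))" for s
      by (metis cdot_cnj complex_mod_cnj)
    moreover have "(\<lambda>s. cdot N (hl s) (mat_app A (z' s))) \<in> borel_measurable M"
      by (intro borel_measurable_cdot borel_measurable_mat_app[OF carrier(3)] mhl mz')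
    ultimately show ?thesis using rl L2leD(2)[OF z'_L2] by (auto simp: L2le_def)
  qed
  define q where "q = (\<lambda>x. cdot N x (mat_app A x) - trARl)"
  have mq[measurable]: "q \<in> borel_measurable (cvec N)"
    unfolding q_def
    by (intro borel_measurable_diff borel_measurable_cdot borel_measurable_mat_app[OF carrier(3)] measurable_cvec_component) auto
  have mqh[measurable]: "(\<lambda>s. q (hl s)) \<in> borel_measurable M" by (rule measurable_compose[OF complex_normalD(2)[OF hl] mq])
  have q: "(\<integral>\<^sup>+s. ennreal ((cmod (q (hl s)))^2) \<partial>M) \<le> ennreal (real N * (a + 1) ^ 4 * rl^2)"
    using nn_integral_gaussian_bilinear_le[OF M hl frame_crow[OF opA] frame_unitv opRl]
    unfolding q_def trARl_def sum_unitv_crow[OF carrier(3)] .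
  have 2: "L2le M (\<lambda>s. dl s * q (hl s)) (pl * (real N * (a + 1) ^ 4 * rl^2))"
  proof -
    have "(\<integral>\<^sup>+s. ennreal ((cmod (dl s))^2) * ennreal ((cmod (q (hl s)))^2) \<partial>M) =
      (\<integral>\<^sup>+s. (\<integral>\<^sup>+s'. ennreal ((cmod (dl s))^2) * ennreal ((cmod (q (hl s')))^2) \<partial>M) \<partial>M)"
      by (rule nn_integral_indep_of[OF M hl_indep_dl, of "\<lambda>x y. ennreal ((cmod y)^2) * ennreal ((cmod (q x))^2)"]) measurable
    also have "\<dots> = (\<integral>\<^sup>+s. ennreal ((cmod (dl s))^2) \<partial>M) * (\<integral>\<^sup>+s. ennreal ((cmod (q (hl s)))^2) \<partial>M)"
      by (simp add: nn_integral_cmult nn_integral_multc)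
    also have "\<dots> \<le> ennreal pl * ennreal (real N * (a + 1) ^ 4 * rl^2)"
      using L2leD(3)[OF dl_L2] q by (intro mult_mono) auto
    finally show ?thesis
      using pl const_nonneg by (simp add: L2le_def norm_mult power_mult_distrib ennreal_mult[symmetric])
  qed
  have eq: "cdot N (hl s) (mat_app A (z s)) - dl s * trARl = cdot N (hl s) (mat_app A (z' s)) + dl s * q (hl s)" for s
  proof -
    have "mat_app A (z s) = mat_app A (\<lambda>i. z' s i + dl s * hl s i)"
      by (rule mat_app_cong[OF carrier(3)]) (rule z_decomp)
    then have "cdot N (hl s) (mat_app A (z s)) = cdot N (hl s) (\<lambda>i. mat_app A (z' s) i + dl s * mat_app A (hl s) i)"
      by (intro cdot_cong) (simp_all only: mat_app_add[OF carrier(3)] mat_app_scale[OF carrier(3)])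
    then show ?thesis by (simp add: cdot_add_right cdot_scale_right q_def algebra_simps)
  qed
  show ?thesis
    unfolding eq by (rule L2le_mono[OF L2le_add[OF 1 2]]) (simp add: Kl_def algebra_simps)
qed

end

section \<open>Gaussian shifts and the test channel\<close>

text \<open>The Cameron-Martin formula on the line: translating the Gaussian is reweighting it by
  the quotient of the two densities.\<close>

lemma nn_integral_std_normal_shift:
  assumes [measurable]: "f \<in> borel_measurable borel"
  shows "(\<integral>\<^sup>+x. f (a + x) \<partial>density lborel std_normal_density) =
    (\<integral>\<^sup>+x. f x * ennreal (exp (a * x - a^2 / 2)) \<partial>density lborel std_normal_density)"
proof -
  have "(\<integral>\<^sup>+x. f (a + x) \<partial>density lborel std_normal_density) = (\<integral>\<^sup>+x. ennreal (std_normal_density x) * f (a + x) \<partial>lborel)"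
    by (subst nn_integral_density) auto
  also have "\<dots> = (\<integral>\<^sup>+x. ennreal (std_normal_density (x - a)) * f x \<partial>lborel)"
    by (subst nn_integral_real_affine[where c=1 and t=a and f="\<lambda>x. ennreal (std_normal_density (x - a)) * f x"]) auto
  also have "\<dots> = (\<integral>\<^sup>+x. ennreal (std_normal_density x) * (f x * ennreal (exp (a * x - a^2 / 2))) \<partial>lborel)"
  proof (intro nn_integral_cong)
    fix x
    have "- ((x - a)^2) / 2 = - (x^2) / 2 + (a * x - a^2 / 2)" by (simp add: power2_eq_square field_simps)
    then have "exp (- ((x - a)^2) / 2) = exp (- (x^2) / 2) * exp (a * x - a^2 / 2)"
      by (simp only: exp_add)
    then have "std_normal_density (x - a) = std_normal_density x * exp (a * x - a^2 / 2)"
      unfolding std_normal_density_def by simp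
    then show "ennreal (std_normal_density (x - a)) * f x = ennreal (std_normal_density x) * (f x * ennreal (exp (a * x - a^2 / 2)))"
      by (simp add: ennreal_mult mult_ac)
  qed
  also have "\<dots> = (\<integral>\<^sup>+x. f x * ennreal (exp (a * x - a^2 / 2)) \<partial>density lborel std_normal_density)"
    by (subst nn_integral_density) auto
  finally show ?thesis .
qed

text \<open>The logarithm of the density of CN(m, s) with respect to CN(0, s) at
  \<open>z\<close>.\<close>

definition shift_exponent :: "real \<Rightarrow> complex \<Rightarrow> complex \<Rightarrow> real" where
  "shift_exponent s m z = (2 * Re (cnj m * z) - (cmod m)^2) / s"

lemma borel_measurable_Complex[measurable]:
  "f \<in> borel_measurable M \<Longrightarrow> g \<in> borel_measurable M \<Longrightarrow> (\<lambda>x. Complex (f x) (g x)) \<in> borel_measurable M"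
proof -
  assume [measurable]: "f \<in> borel_measurable M" "g \<in> borel_measurable M"
  have "(\<lambda>x. Complex (f x) (g x)) = (\<lambda>x. complex_of_real (f x) + \<i> * complex_of_real (g x))"
    by (auto simp: complex_eq_iff)
  then show ?thesis by simp
qed

lemma nn_integral_cnormal_shift:
  assumes [measurable]: "f \<in> borel_measurable borel" and s: "0 < s"
  shows "(\<integral>\<^sup>+z. f (m + z) \<partial>cnormal s) = (\<integral>\<^sup>+z. f z * ennreal (exp (shift_exponent s m z)) \<partial>cnormal s)"
proof -
  let ?N = "density lborel std_normal_density"
  interpret N: prob_space ?N by (rule prob_space_std_normal)
  define q where "q = sqrt (s / 2)"
  have q: "0 < q" "q^2 = s / 2" using s by (auto simp: q_def)
  define a b where "a = Re m / q" and "b = Im m / q"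
  have m: "m = complex_of_real q * Complex a b" using q by (simp add: a_def b_def complex_eq_iff)
  have se: "shift_exponent s m (complex_of_real q * Complex x y) = (a * x - a^2 / 2) + (b * y - b^2 / 2)" for x y
  proof -
    have "shift_exponent s m (complex_of_real q * Complex x y) = (q^2 / s) * (2 * (a * x + b * y) - (a^2 + b^2))"
      unfolding shift_exponent_def m cmod_power2 by (simp add: power2_eq_square field_simps)
    moreover have "q^2 / s = 1 / 2" using q s by simp
    ultimately show ?thesis by (simp only:) (simp add: field_simps)
  qed
  have "(\<integral>\<^sup>+z. f (m + z) \<partial>cnormal s) = (\<integral>\<^sup>+x. (\<integral>\<^sup>+y. f (m + complex_of_real q * Complex x y) \<partial>?N) \<partial>?N)"
    unfolding q_def by (rule nn_integral_cnormal) measurable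
  also have "\<dots> = (\<integral>\<^sup>+x. (\<integral>\<^sup>+y. f (complex_of_real q * Complex (a + x) (b + y)) \<partial>?N) \<partial>?N)"
    by (intro nn_integral_cong arg_cong[where f=f]) (simp add: m complex_eq_iff algebra_simps)
  also have "\<dots> = (\<integral>\<^sup>+x. (\<integral>\<^sup>+y. f (complex_of_real q * Complex (a + x) y) * ennreal (exp (b * y - b^2 / 2)) \<partial>?N) \<partial>?N)"
    by (intro nn_integral_cong nn_integral_std_normal_shift) measurable
  also have "\<dots> = (\<integral>\<^sup>+x. (\<integral>\<^sup>+y. f (complex_of_real q * Complex x y) * ennreal (exp (b * y - b^2 / 2)) \<partial>?N) * ennreal (exp (a * x - a^2 / 2)) \<partial>?N)"
    by (rule nn_integral_std_normal_shift[of "\<lambda>x. \<integral>\<^sup>+y. f (complex_of_real q * Complex x y) * ennreal (exp (b * y - b^2 / 2)) \<partial>?N"]) measurable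
  also have "\<dots> = (\<integral>\<^sup>+x. (\<integral>\<^sup>+y. f (complex_of_real q * Complex x y) * ennreal (exp (shift_exponent s m (complex_of_real q * Complex x y))) \<partial>?N) \<partial>?N)"
    unfolding se exp_add
    by (intro nn_integral_cong, subst nn_integral_multc[symmetric]) (auto simp: ennreal_mult mult_ac intro!: nn_integral_cong)
  also have "\<dots> = (\<integral>\<^sup>+z. f z * ennreal (exp (shift_exponent s m z)) \<partial>cnormal s)"
  proof -
    have [measurable]: "(\<lambda>z. shift_exponent s m z) \<in> borel_measurable borel" unfolding shift_exponent_def by measurable
    show ?thesis unfolding q_def by (rule nn_integral_cnormal[symmetric]) measurable
  qed
  finally show ?thesis .
qed

lemma borel_measurable_shift_exponent[measurable]:
  "f \<in> borel_measurable M \<Longrightarrow> g \<in> borel_measurable M \<Longrightarrow> (\<lambda>x. shift_exponent s (f x) (g x)) \<in> borel_measurable M"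
proof -
  assume [measurable]: "f \<in> borel_measurable M" "g \<in> borel_measurable M"
  have "cnj \<in> borel_measurable borel" by (intro borel_measurable_continuous_onI continuous_intros)
  then have [measurable]: "(\<lambda>x. cnj (f x)) \<in> borel_measurable M" by (rule measurable_compose[rotated]) measurable
  show ?thesis unfolding shift_exponent_def by measurable
qed

text \<open>Both come from a square, |z - m|^2 >= 0 and |z + m|^2 >= 0. The upper bound is uniform
  in m and makes the output densities finite; the lower one makes them positive.\<close>

lemma shift_exponent_bounds:
  assumes "0 < s"
  shows "shift_exponent s m z \<le> (cmod z)^2 / s" "- ((cmod z)^2 + 2 * (cmod m)^2) / s \<le> shift_exponent s m z"
proof -
  have "0 \<le> (cmod (- m + z))^2" "0 \<le> (cmod (m + z))^2" by simp_all
  then have "2 * Re (cnj m * z) - (cmod m)^2 \<le> (cmod z)^2" "- ((cmod z)^2 + 2 * (cmod m)^2) \<le> 2 * Re (cnj m * z) - (cmod m)^2"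
    unfolding cmod_add_squared by (simp_all del: zero_le_power2)
  then show "shift_exponent s m z \<le> (cmod z)^2 / s" "- ((cmod z)^2 + 2 * (cmod m)^2) / s \<le> shift_exponent s m z"
    unfolding shift_exponent_def using assms by (auto intro!: divide_right_mono)
qed

text \<open>The coordinates are shifted one at a time; Fubini brings the new coordinate inside,
  where the one-dimensional formula applies.\<close>

lemma nn_integral_PiM_cnormal_shift:
  assumes "finite J" and f: "f \<in> borel_measurable (PiM J (\<lambda>_. borel))" and s: "0 < s"
  shows "(\<integral>\<^sup>+y. f (\<lambda>i\<in>J. m i + y i) \<partial>PiM J (\<lambda>_. cnormal s)) =
    (\<integral>\<^sup>+y. f y * ennreal (exp (\<Sum>i\<in>J. shift_exponent s (m i) (y i))) \<partial>PiM J (\<lambda>_. cnormal s))"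
  using assms(1) f
proof (induction J arbitrary: f rule: finite_induct)
  case empty
  show ?case by (simp add: PiM_empty nn_integral_count_space_finite)
next
  case (insert j J)
  let ?\<mu> = "\<lambda>_. cnormal s"
  interpret product_sigma_finite ?\<mu> by (intro product_sigma_finite_prob prob_space_cnormal)
  have sets: "sets (PiM K ?\<mu>) = sets (PiM K (\<lambda>_. borel))" for K :: "'a set" by (intro sets_PiM_cong) auto
  have fm: "f \<in> borel_measurable (PiM (insert j J) ?\<mu>)"
    using insert.prems by (simp add: measurable_cong_sets[OF sets refl])
  have comp: "(\<lambda>y. y i) \<in> borel_measurable (PiM K ?\<mu>)" if "i \<in> K" for i K
    using measurable_component_singleton[OF that, of ?\<mu>] by (simp only: measurable_cong_sets[OF refl sets_cnormal])
  have f1: "(\<lambda>y. f (\<lambda>i\<in>insert j J. m i + y i)) \<in> borel_measurable (PiM (insert j J) ?\<mu>)"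
    by (rule measurable_compose[OF measurable_restrict insert.prems]) (intro borel_measurable_add borel_measurable_const comp)
  have upd: "(\<lambda>x. x(j := y)) \<in> measurable (PiM J (\<lambda>_. borel)) (PiM (insert j J) (\<lambda>_. borel))" for y :: complex
    by (rule measurable_fun_upd[of _ J]) auto
  have updM: "(\<lambda>p. (fst p)(j := snd p)) \<in> measurable (PiM J (\<lambda>_. borel) \<Otimes>\<^sub>M borel) (PiM (insert j J) (\<lambda>_. borel :: complex measure))"
    by (rule measurable_fun_upd[of _ J]) auto
  have fy: "(\<lambda>y. f (x(j := y))) \<in> borel_measurable borel" if "x \<in> space (PiM J ?\<mu>)" for x
  proof -
    have "x \<in> space (PiM J (\<lambda>_. borel))" using that by (simp add: space_PiM)
    from measurable_compose[OF measurable_Pair1'[OF this] measurable_compose[OF updM insert.prems]]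
    show ?thesis by (simp add: fun_upd_def)
  qed
  have "(\<integral>\<^sup>+y. f (\<lambda>i\<in>insert j J. m i + y i) \<partial>PiM (insert j J) ?\<mu>) =
      (\<integral>\<^sup>+y. (\<integral>\<^sup>+x. f (\<lambda>i\<in>insert j J. m i + (x(j := y)) i) \<partial>PiM J ?\<mu>) \<partial>cnormal s)"
    using insert.hyps f1 by (intro product_nn_integral_insert_rev) auto
  also have "\<dots> = (\<integral>\<^sup>+y. (\<integral>\<^sup>+x. f ((\<lambda>i\<in>J. m i + x i)(j := m j + y)) \<partial>PiM J ?\<mu>) \<partial>cnormal s)"
    using insert.hyps by (intro nn_integral_cong arg_cong[where f=f]) (auto simp: fun_eq_iff)
  also have "\<dots> = (\<integral>\<^sup>+y. (\<integral>\<^sup>+x. f (x(j := m j + y)) * ennreal (exp (\<Sum>i\<in>J. shift_exponent s (m i) (x i))) \<partial>PiM J ?\<mu>) \<partial>cnormal s)"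
    by (intro nn_integral_cong insert.IH measurable_compose[OF upd insert.prems])
  also have "\<dots> = (\<integral>\<^sup>+x. (\<integral>\<^sup>+y. f (x(j := m j + y)) * ennreal (exp (\<Sum>i\<in>J. shift_exponent s (m i) (x i))) \<partial>cnormal s) \<partial>PiM J ?\<mu>)"
  proof -
    interpret A: prob_space "cnormal s" by (rule prob_space_cnormal)
    interpret B: prob_space "PiM J ?\<mu>" by (intro prob_space_PiM prob_space_cnormal)
    interpret pair_sigma_finite "PiM J ?\<mu>" "cnormal s" ..
    have "(\<lambda>p. f ((fst p)(j := m j + snd p))) \<in> borel_measurable (PiM J (\<lambda>_. borel) \<Otimes>\<^sub>M borel)"
      by (rule measurable_compose[OF measurable_fun_upd[of _ J] insert.prems]) auto
    moreover have "(\<lambda>p. ennreal (exp (\<Sum>i\<in>J. shift_exponent s (m i) (fst p i)))) \<in> borel_measurable (PiM J (\<lambda>_. borel) \<Otimes>\<^sub>M (borel :: complex measure))"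
      by (intro measurable_compose[OF _ measurable_ennreal] measurable_compose[OF _ borel_measurable_exp] borel_measurable_sum
         borel_measurable_shift_exponent borel_measurable_const measurable_compose[OF measurable_fst measurable_component_singleton]) auto
    ultimately have "(\<lambda>p. f ((fst p)(j := m j + snd p)) * ennreal (exp (\<Sum>i\<in>J. shift_exponent s (m i) (fst p i)))) \<in>
        borel_measurable (PiM J ?\<mu> \<Otimes>\<^sub>M cnormal s)"
      by (subst measurable_cong_sets[OF sets_pair_measure_cong[OF sets sets_cnormal] refl]) (rule borel_measurable_times_ennreal)
    from Fubini'[OF _] this show ?thesis by (simp add: case_prod_beta')
  qed
  also have "\<dots> = (\<integral>\<^sup>+x. (\<integral>\<^sup>+y. f (x(j := y)) * ennreal (exp (\<Sum>i\<in>insert j J. shift_exponent s (m i) ((x(j := y)) i))) \<partial>cnormal s) \<partial>PiM J ?\<mu>)"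
  proof (rule nn_integral_cong)
    fix x assume x: "x \<in> space (PiM J ?\<mu>)"
    note [measurable] = fy[OF x]
    have e: "(\<Sum>i\<in>insert j J. shift_exponent s (m i) ((x(j := y)) i)) = shift_exponent s (m j) y + (\<Sum>i\<in>J. shift_exponent s (m i) (x i))" for y
    proof -
      have "(\<Sum>i\<in>J. shift_exponent s (m i) ((x(j := y)) i)) = (\<Sum>i\<in>J. shift_exponent s (m i) (x i))"
        using insert.hyps by (intro sum.cong) auto
      then show ?thesis using insert.hyps by simp
    qed
    have "(\<integral>\<^sup>+y. f (x(j := m j + y)) * ennreal (exp (\<Sum>i\<in>J. shift_exponent s (m i) (x i))) \<partial>cnormal s) =
        (\<integral>\<^sup>+y. f (x(j := y)) * ennreal (exp (\<Sum>i\<in>J. shift_exponent s (m i) (x i))) * ennreal (exp (shift_exponent s (m j) y)) \<partial>cnormal s)"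
      using s by (intro nn_integral_cnormal_shift[of "\<lambda>y. f (x(j := y)) * ennreal (exp (\<Sum>i\<in>J. shift_exponent s (m i) (x i)))"]) auto
    also have "\<dots> = (\<integral>\<^sup>+y. f (x(j := y)) * ennreal (exp (\<Sum>i\<in>insert j J. shift_exponent s (m i) ((x(j := y)) i))) \<partial>cnormal s)"
      unfolding e exp_add by (intro nn_integral_cong) (simp add: ennreal_mult mult_ac)
    finally show "(\<integral>\<^sup>+y. f (x(j := m j + y)) * ennreal (exp (\<Sum>i\<in>J. shift_exponent s (m i) (x i))) \<partial>cnormal s) = \<dots>" .
  qed
  also have "\<dots> = (\<integral>\<^sup>+y. f y * ennreal (exp (\<Sum>i\<in>insert j J. shift_exponent s (m i) (y i))) \<partial>PiM (insert j J) ?\<mu>)"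
    using insert.hyps fm
    by (intro product_nn_integral_insert[symmetric] borel_measurable_times_ennreal measurable_compose[OF _ measurable_ennreal]
        measurable_compose[OF _ borel_measurable_exp] borel_measurable_sum borel_measurable_shift_exponent comp) auto
  finally show ?case .
qed

text \<open>The integrand is the density of the normal law with mean \<open>\<mu>\<close> and
  variance t relative to the standard one, so its integral is a total mass.\<close>

lemma nn_integral_std_normal_tilt:
  assumes "0 < t"
  shows "(\<integral>\<^sup>+x. ennreal (1 / sqrt t * exp (- ((x - \<mu>)^2) / (2 * t) + x^2 / 2)) \<partial>density lborel std_normal_density) = 1"
proof -
  have "(\<integral>\<^sup>+x. ennreal (1 / sqrt t * exp (- ((x - \<mu>)^2) / (2 * t) + x^2 / 2)) \<partial>density lborel std_normal_density) =
      (\<integral>\<^sup>+x. ennreal (normal_density \<mu> (sqrt t) x) \<partial>lborel)"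
  proof (subst nn_integral_density)
    show "(\<integral>\<^sup>+x. ennreal (std_normal_density x) * ennreal (1 / sqrt t * exp (- ((x - \<mu>)^2) / (2 * t) + x^2 / 2)) \<partial>lborel) =
        (\<integral>\<^sup>+x. ennreal (normal_density \<mu> (sqrt t) x) \<partial>lborel)"
    proof (intro nn_integral_cong)
      fix x
      have "std_normal_density x * (1 / sqrt t * exp (- ((x - \<mu>)^2) / (2 * t) + x^2 / 2)) = normal_density \<mu> (sqrt t) x"
      proof -
        have "- (x^2) / 2 + (- ((x - \<mu>)^2) / (2 * t) + x^2 / 2) = - ((x - \<mu>)^2) / (2 * (sqrt t)^2)" using assms by simp
        then have "exp (- (x^2) / 2) * exp (- ((x - \<mu>)^2) / (2 * t) + x^2 / 2) = exp (- ((x - \<mu>)^2) / (2 * (sqrt t)^2))"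
          by (simp only: exp_add[symmetric])
        then show ?thesis
          unfolding std_normal_density_def normal_density_def using assms by (simp add: real_sqrt_mult)
      qed
      then show "ennreal (std_normal_density x) * ennreal (1 / sqrt t * exp (- ((x - \<mu>)^2) / (2 * t) + x^2 / 2)) = ennreal (normal_density \<mu> (sqrt t) x)"
        by (metis ennreal_mult' normal_density_nonneg)
    qed
  qed auto
  also have "\<dots> = 1"
    using prob_space.emeasure_space_1[OF prob_space_normal_density[of "sqrt t" \<mu>]] assms
    by (simp add: emeasure_density)
  finally show ?thesis .
qed

text \<open>The integrand is the density of CN(u, p t) relative to CN(0, p). This normalises the
  likelihood ratio of the test channel in which the input, given the output, is Gaussian around the
  estimate \<open>u\<close>.\<close>

lemma nn_integral_cnormal_tilt:
  assumes p: "0 < p" and t: "0 < t"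
  shows "(\<integral>\<^sup>+s. ennreal (1 / t * exp (- ((cmod (s - u))^2) / (p * t) + (cmod s)^2 / p)) \<partial>cnormal p) = 1"
proof -
  let ?N = "density lborel std_normal_density"
  interpret N: prob_space ?N by (rule prob_space_std_normal)
  define q where "q = sqrt (p / 2)"
  have q: "0 < q" "q^2 = p / 2" using p by (auto simp: q_def)
  define a b where "a = Re u / q" and "b = Im u / q"
  have u: "u = complex_of_real q * Complex a b" using q by (simp add: a_def b_def complex_eq_iff)
  define G where "G = (\<lambda>\<mu> x. 1 / sqrt t * exp (- ((x - \<mu>)^2) / (2 * t) + x^2 / 2))"
  have G0: "0 \<le> G \<mu> x" for \<mu> x using t by (simp add: G_def)
  have [measurable]: "G \<mu> \<in> borel_measurable borel" for \<mu> unfolding G_def by measurable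
  have e: "1 / t * exp (- ((cmod (complex_of_real q * Complex x y - u))^2) / (p * t) + (cmod (complex_of_real q * Complex x y))^2 / p) = G a x * G b y" for x y
  proof -
    have 1: "(cmod (complex_of_real q * Complex x y - u))^2 = q^2 * ((x - a)^2 + (y - b)^2)"
      unfolding u cmod_power2 by (simp add: power2_eq_square algebra_simps)
    have 2: "(cmod (complex_of_real q * Complex x y))^2 = q^2 * (x^2 + y^2)"
      unfolding cmod_power2 by (simp add: power2_eq_square algebra_simps)
    have "- (q^2 * ((x - a)^2 + (y - b)^2)) / (p * t) + q^2 * (x^2 + y^2) / p =
      (- ((x - a)^2) / (2 * t) + x^2 / 2) + (- ((y - b)^2) / (2 * t) + y^2 / 2)"
      unfolding q(2) using p t by (simp add: field_simps)
    then have 3: "exp (- (q^2 * ((x - a)^2 + (y - b)^2)) / (p * t) + q^2 * (x^2 + y^2) / p) =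
      exp (- ((x - a)^2) / (2 * t) + x^2 / 2) * exp (- ((y - b)^2) / (2 * t) + y^2 / 2)"
      by (simp only: exp_add)
    show ?thesis unfolding 1 2 3 G_def using t by simp
  qed
  have "(\<integral>\<^sup>+s. ennreal (1 / t * exp (- ((cmod (s - u))^2) / (p * t) + (cmod s)^2 / p)) \<partial>cnormal p) =
    (\<integral>\<^sup>+x. (\<integral>\<^sup>+y. ennreal (1 / t * exp (- ((cmod (complex_of_real q * Complex x y - u))^2) / (p * t) + (cmod (complex_of_real q * Complex x y))^2 / p)) \<partial>?N) \<partial>?N)"
    unfolding q_def by (rule nn_integral_cnormal) measurable
  also have "\<dots> = (\<integral>\<^sup>+x. (\<integral>\<^sup>+y. ennreal (G a x) * ennreal (G b y) \<partial>?N) \<partial>?N)"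
    unfolding e by (intro nn_integral_cong ennreal_mult G0)
  also have "\<dots> = (\<integral>\<^sup>+x. ennreal (G a x) \<partial>?N) * (\<integral>\<^sup>+y. ennreal (G b y) \<partial>?N)"
    by (simp add: nn_integral_cmult nn_integral_multc)
  also have "\<dots> = 1" unfolding G_def nn_integral_std_normal_tilt[OF t] by simp
  finally show ?thesis .
qed

section \<open>Lower bound on the mutual information\<close>

text \<open>Donsker--Varadhan: \<open>f ln f \<ge> f T + f - exp T\<close> pointwise. The upper bound \<open>G\<close> makes the
  divergence integral, which is a Bochner integral, meaningful.\<close>

lemma integral_entropy_ge:
  fixes f T G :: "'a \<Rightarrow> real"
  assumes f: "integrable Q f" "\<And>x. 0 \<le> f x" "(\<integral>x. f x \<partial>Q) = 1"
    and T[measurable]: "T \<in> borel_measurable Q" and eT: "(\<integral>\<^sup>+x. ennreal (exp (T x)) \<partial>Q) \<le> 1"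
    and fT: "integrable Q (\<lambda>x. f x * T x)"
    and G: "integrable Q G" "\<And>x. x \<in> space Q \<Longrightarrow> f x * ln (f x) \<le> G x"
  shows "(\<integral>x. f x * T x \<partial>Q) / ln 2 \<le> (\<integral>x. f x * log 2 (f x) \<partial>Q)"
proof -
  have [measurable]: "f \<in> borel_measurable Q" using f by auto
  have IeT: "integrable Q (\<lambda>x. exp (T x))"
    using eT by (intro integrableI_bounded) (auto simp: less_top[symmetric] top_unique)
  have eT1: "(\<integral>x. exp (T x) \<partial>Q) \<le> 1"
  proof -
    have "ennreal (\<integral>x. exp (T x) \<partial>Q) \<le> 1" using eT nn_integral_eq_integral[OF IeT] by simp
    then show ?thesis by (simp add: ennreal_le_1)
  qed
  have pw: "f x * T x + f x - exp (T x) \<le> f x * ln (f x)" for x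
  proof (cases "f x = 0")
    case False
    then have fx: "0 < f x" using f(2)[of x] by simp
    have "ln (exp (T x) / f x) \<le> exp (T x) / f x - 1" using fx by (intro ln_le_minus_one) simp
    then have "T x - ln (f x) \<le> exp (T x) / f x - 1" using fx by (simp add: ln_div)
    then have "f x * (T x - ln (f x)) \<le> f x * (exp (T x) / f x - 1)" using fx by (intro mult_left_mono) auto
    also have "\<dots> = exp (T x) - f x" using fx by (simp add: field_simps)
    finally show ?thesis by (simp add: algebra_simps)
  qed simp
  have IL: "integrable Q (\<lambda>x. f x * T x + f x - exp (T x))" using fT f IeT by simp
  have I: "integrable Q (\<lambda>x. f x * ln (f x))"
  proof (rule Bochner_Integration.integrable_bound)
    show "integrable Q (\<lambda>x. \<bar>f x * T x + f x - exp (T x)\<bar> + \<bar>G x\<bar>)" using IL G by simp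
    have "\<bar>f x * ln (f x)\<bar> \<le> \<bar>f x * T x + f x - exp (T x)\<bar> + \<bar>G x\<bar>" if "x \<in> space Q" for x
      using pw[of x] G(2)[OF that] by (simp add: abs_le_iff) linarith
    then show "AE x in Q. norm (f x * ln (f x)) \<le> norm (\<bar>f x * T x + f x - exp (T x)\<bar> + \<bar>G x\<bar>)" by (intro AE_I2) simp
  qed measurable
  have "(\<integral>x. f x * T x \<partial>Q) \<le> (\<integral>x. f x * T x \<partial>Q) + 1 - (\<integral>x. exp (T x) \<partial>Q)" using eT1 by simp
  also have "\<dots> = (\<integral>x. f x * T x + f x - exp (T x) \<partial>Q)" using fT f IeT by simp
  also have "\<dots> \<le> (\<integral>x. f x * ln (f x) \<partial>Q)" using IL I pw by (intro integral_mono)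
  finally have "(\<integral>x. f x * T x \<partial>Q) / ln 2 \<le> (\<integral>x. f x * ln (f x) \<partial>Q) / ln 2" by (intro divide_right_mono) auto
  also have "\<dots> = (\<integral>x. f x * log 2 (f x) \<partial>Q)" by (simp add: log_def)
  finally show ?thesis .
qed

text \<open>A channel with Gaussian input law \<open>cnormal p\<close> and additive noise that contains an
  independent white Gaussian part; \<open>J\<close> is the joint law of input and output, \<open>mm s W\<close> the
  noise-free output.\<close>

locale awgn =
  fixes N :: nat and p \<sigma>2 E0 :: real and LW :: "'w measure" and mm :: "complex \<Rightarrow> 'w \<Rightarrow> nat \<Rightarrow> complex"
    and J :: "(complex \<times> (nat \<Rightarrow> complex)) measure" and PY :: "(nat \<Rightarrow> complex) measure"
  assumes p: "0 < p" and \<sigma>2: "0 < \<sigma>2" and LW: "prob_space LW"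
    and mm: "\<And>i. i < N \<Longrightarrow> (\<lambda>q. mm (fst q) (snd q) i) \<in> borel_measurable (borel \<Otimes>\<^sub>M LW)"
    and sets_J: "sets J = sets (borel \<Otimes>\<^sub>M cvec N)" and sets_PY: "sets PY = sets (cvec N)"
    and J: "\<And>f. f \<in> borel_measurable (borel \<Otimes>\<^sub>M cvec N) \<Longrightarrow> (\<integral>\<^sup>+q. f q \<partial>J) =
      (\<integral>\<^sup>+s. (\<integral>\<^sup>+W. (\<integral>\<^sup>+y. f (s, \<lambda>i\<in>{..<N}. mm s W i + y i) \<partial>PiM {..<N} (\<lambda>_. cnormal \<sigma>2)) \<partial>LW) \<partial>cnormal p)"
    and PY: "\<And>f. f \<in> borel_measurable (cvec N) \<Longrightarrow> (\<integral>\<^sup>+y. f y \<partial>PY) = (\<integral>\<^sup>+q. f (snd q) \<partial>J)"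
    and E0: "(\<integral>\<^sup>+s. (\<integral>\<^sup>+W. ennreal ((norm2 N (mm s W))^2) \<partial>LW) \<partial>cnormal p) \<le> ennreal E0" "0 \<le> E0"
begin

abbreviation "L\<nu> \<equiv> PiM {..<N} (\<lambda>_. cnormal \<sigma>2)"

text \<open>\<open>\<rho>\<close>, \<open>k\<close> and \<open>m\<close> are densities of the output
  relative to the white-noise law \<open>L\<nu>\<close>: given the input and all other disturbances,
  given the input, and unconditionally. \<open>f\<close> is the resulting density of the joint law
  relative to the product of the marginals.\<close>

definition \<rho> :: "complex \<Rightarrow> 'w \<Rightarrow> (nat \<Rightarrow> complex) \<Rightarrow> ennreal" where
  "\<rho> s W y = ennreal (exp (\<Sum>i<N. shift_exponent \<sigma>2 (mm s W i) (y i)))"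

definition k :: "complex \<Rightarrow> (nat \<Rightarrow> complex) \<Rightarrow> ennreal" where
  "k s y = (\<integral>\<^sup>+W. \<rho> s W y \<partial>LW)"

definition m :: "(nat \<Rightarrow> complex) \<Rightarrow> ennreal" where
  "m y = (\<integral>\<^sup>+s. k s y \<partial>cnormal p)"

definition f :: "complex \<times> (nat \<Rightarrow> complex) \<Rightarrow> real" where
  "f q = enn2real (k (fst q) (snd q)) / enn2real (m (snd q))"

sublocale LW: prob_space LW by (rule LW)
sublocale F: prob_space "cnormal p" by (rule prob_space_cnormal)
sublocale L\<nu>: prob_space L\<nu> by (intro prob_space_PiM prob_space_cnormal)

lemma sets_L\<nu>[measurable_cong]: "sets L\<nu> = sets (cvec N)"
  unfolding cvec_def by (intro sets_PiM_cong) auto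

lemma space_L\<nu>: "space L\<nu> = space (cvec N)"
  by (rule sets_eq_imp_space_eq[OF sets_L\<nu>])

lemma borel_measurable_\<rho>:
  "(\<lambda>q. \<rho> (fst (fst q)) (snd q) (snd (fst q))) \<in> borel_measurable ((borel \<Otimes>\<^sub>M cvec N) \<Otimes>\<^sub>M LW)"
proof -
  have "(\<lambda>q. shift_exponent \<sigma>2 (mm (fst (fst q)) (snd q) i) (snd (fst q) i)) \<in> borel_measurable ((borel \<Otimes>\<^sub>M cvec N) \<Otimes>\<^sub>M LW)"
    if "i < N" for i
  proof (rule borel_measurable_shift_exponent)
    have "(\<lambda>q. (fst (fst q), snd q)) \<in> measurable ((borel \<Otimes>\<^sub>M cvec N) \<Otimes>\<^sub>M LW) (borel \<Otimes>\<^sub>M LW)" by measurable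
    from measurable_compose[OF this mm[OF that]]
    show "(\<lambda>q. mm (fst (fst q)) (snd q) i) \<in> borel_measurable ((borel \<Otimes>\<^sub>M cvec N) \<Otimes>\<^sub>M LW)" by simp
    show "(\<lambda>q. snd (fst q) i) \<in> borel_measurable ((borel \<Otimes>\<^sub>M cvec N) \<Otimes>\<^sub>M LW)"
      by (rule measurable_compose[OF measurable_compose[OF measurable_fst measurable_snd] measurable_cvec_component[OF that]])
  qed
  then show ?thesis unfolding \<rho>_def by (intro measurable_compose[OF _ measurable_ennreal] measurable_compose[OF _ borel_measurable_exp] borel_measurable_sum) auto
qed

lemma borel_measurable_k[measurable]: "(\<lambda>q. k (fst q) (snd q)) \<in> borel_measurable (borel \<Otimes>\<^sub>M cvec N)"
  unfolding k_def by (rule LW.borel_measurable_nn_integral) (use borel_measurable_\<rho> in \<open>simp add: case_prod_beta'\<close>)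

lemma borel_measurable_m[measurable]: "m \<in> borel_measurable (cvec N)"
proof -
  have "(\<lambda>q. k (snd q) (fst q)) \<in> borel_measurable (cvec N \<Otimes>\<^sub>M borel)"
    using measurable_compose[OF measurable_pair_swap' borel_measurable_k] by (simp add: case_prod_beta')
  then have "(\<lambda>q. k (snd q) (fst q)) \<in> borel_measurable (cvec N \<Otimes>\<^sub>M cnormal p)"
    by (simp cong: measurable_cong_sets)
  then have "(\<lambda>y. \<integral>\<^sup>+s. k s y \<partial>cnormal p) \<in> borel_measurable (cvec N)"
    by (intro F.borel_measurable_nn_integral) (simp add: case_prod_beta')
  then show ?thesis unfolding m_def[abs_def] .
qed

lemma \<rho>_le: "\<rho> s W y \<le> ennreal (exp ((norm2 N y)^2 / \<sigma>2))"
proof -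
  have "(\<Sum>i<N. shift_exponent \<sigma>2 (mm s W i) (y i)) \<le> (\<Sum>i<N. (cmod (y i))^2 / \<sigma>2)"
    by (intro sum_mono shift_exponent_bounds \<sigma>2)
  then show ?thesis unfolding \<rho>_def norm2_squared sum_divide_distrib by (intro ennreal_leI) simp
qed

lemma k_le: "k s y \<le> ennreal (exp ((norm2 N y)^2 / \<sigma>2))"
proof -
  have "k s y \<le> (\<integral>\<^sup>+W. ennreal (exp ((norm2 N y)^2 / \<sigma>2)) \<partial>LW)" unfolding k_def by (intro nn_integral_mono \<rho>_le)
  then show ?thesis by (simp add: LW.emeasure_space_1)
qed

lemma m_le: "m y \<le> ennreal (exp ((norm2 N y)^2 / \<sigma>2))"
proof -
  have "m y \<le> (\<integral>\<^sup>+s. ennreal (exp ((norm2 N y)^2 / \<sigma>2)) \<partial>cnormal p)" unfolding m_def by (intro nn_integral_mono k_le)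
  then show ?thesis by simp
qed

lemma finite: "k s y < \<top>" "m y < \<top>"
  using k_le[of s y] m_le[of y] by (auto intro: le_less_trans)

lemma measurable_mm2:
  assumes "s \<in> UNIV"
  shows "(\<lambda>W. ennreal ((norm2 N (mm s W))^2)) \<in> borel_measurable LW"
proof -
  have "(\<lambda>W. mm s W i) \<in> borel_measurable LW" if "i < N" for i
    using measurable_compose[OF measurable_Pair1' mm[OF that], of s] by simp
  then show ?thesis by (intro measurable_compose[OF _ measurable_ennreal] borel_measurable_power borel_measurable_norm2)
qed

lemma measurable_mm_pair: "(\<lambda>q. ennreal ((norm2 N (mm (fst q) (snd q)))^2)) \<in> borel_measurable (cnormal p \<Otimes>\<^sub>M LW)"
proof -
  have "(\<lambda>q. ennreal ((norm2 N (mm (fst q) (snd q)))^2)) \<in> borel_measurable (borel \<Otimes>\<^sub>M LW)"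
    by (intro measurable_compose[OF _ measurable_ennreal] borel_measurable_power borel_measurable_norm2 mm)
  then show ?thesis by (simp cong: measurable_cong_sets)
qed

text \<open>Jensen's inequality by hand: exp lies above its tangent at \<open>c\<close>, and the
  mean of the exponent is at least \<open>c\<close> because the noise-free output has power at most
  \<open>E0\<close>. Positivity of \<open>m\<close> permits division by it, and its explicit size
  bounds ln f.\<close>

lemma m_ge:
  assumes y: "y \<in> space (cvec N)"
  shows "exp (- ((norm2 N y)^2 + 2 * E0) / \<sigma>2) \<le> enn2real (m y)"
proof -
  define c where "c = - ((norm2 N y)^2 + 2 * E0) / \<sigma>2"
  \<comment> \<open>The tangent inequality with its negative part moved to the other side, so that
    all terms are nonnegative and can be integrated in \<open>ennreal\<close>.\<close>
  have pw: "ennreal (exp c + exp c * (2 * E0 / \<sigma>2)) \<le> \<rho> s W y + ennreal (exp c * (2 / \<sigma>2)) * ennreal ((norm2 N (mm s W))^2)" for s W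
  proof -
    define \<phi> where "\<phi> = (\<Sum>i<N. shift_exponent \<sigma>2 (mm s W i) (y i))"
    have "- ((norm2 N y)^2 + 2 * (norm2 N (mm s W))^2) / \<sigma>2 = (\<Sum>i<N. - ((cmod (y i))^2 + 2 * (cmod (mm s W i))^2) / \<sigma>2)"
      unfolding norm2_squared sum_divide_distrib[symmetric] sum_negf sum.distrib sum_distrib_left[symmetric] by simp
    also have "\<dots> \<le> \<phi>" unfolding \<phi>_def by (intro sum_mono shift_exponent_bounds \<sigma>2)
    finally have 1: "- ((norm2 N y)^2 + 2 * (norm2 N (mm s W))^2) / \<sigma>2 \<le> \<phi>" .
    have "c + 2 * (E0 - (norm2 N (mm s W))^2) / \<sigma>2 \<le> \<phi>"
      using 1 \<sigma>2 unfolding c_def by (simp add: field_simps)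
    then have "2 * (E0 - (norm2 N (mm s W))^2) / \<sigma>2 \<le> \<phi> - c" by simp
    also have "\<dots> \<le> exp (\<phi> - c) - 1" using exp_ge_add_one_self[of "\<phi> - c"] by linarith
    finally have "exp c * (2 * (E0 - (norm2 N (mm s W))^2) / \<sigma>2) \<le> exp c * (exp (\<phi> - c) - 1)" by (intro mult_left_mono) auto
    also have "\<dots> = exp \<phi> - exp c" by (simp add: exp_diff right_diff_distrib)
    finally have "exp c + exp c * (2 * E0 / \<sigma>2) \<le> exp \<phi> + exp c * (2 / \<sigma>2) * (norm2 N (mm s W))^2"
      by (simp add: right_diff_distrib diff_divide_distrib mult_ac)
    then show ?thesis
      using \<sigma>2 unfolding \<rho>_def \<phi>_def[symmetric]
      by (simp add: ennreal_plus[symmetric] ennreal_mult[symmetric] ennreal_leI del: ennreal_plus)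
  qed
  have rW: "(\<lambda>W. \<rho> s W y) \<in> borel_measurable LW" for s
    using measurable_compose[OF measurable_Pair1'[of "(s, y)" "borel \<Otimes>\<^sub>M cvec N"] borel_measurable_\<rho>] y
    by (simp add: space_pair_measure)
  have kS: "(\<lambda>s. k s y) \<in> borel_measurable (cnormal p)"
    using measurable_compose[OF measurable_Pair2'[of y "cvec N" borel] borel_measurable_k] y by simp
  have mS: "(\<lambda>s. \<integral>\<^sup>+W. ennreal ((norm2 N (mm s W))^2) \<partial>LW) \<in> borel_measurable (cnormal p)"
    using measurable_mm_pair by (intro LW.borel_measurable_nn_integral) (simp add: case_prod_beta')
  have "ennreal (exp c + exp c * (2 * E0 / \<sigma>2)) = (\<integral>\<^sup>+s. (\<integral>\<^sup>+W. ennreal (exp c + exp c * (2 * E0 / \<sigma>2)) \<partial>LW) \<partial>cnormal p)"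
    by (simp add: LW.emeasure_space_1)
  also have "\<dots> \<le> (\<integral>\<^sup>+s. (\<integral>\<^sup>+W. \<rho> s W y + ennreal (exp c * (2 / \<sigma>2)) * ennreal ((norm2 N (mm s W))^2) \<partial>LW) \<partial>cnormal p)"
    by (intro nn_integral_mono pw)
  also have "\<dots> = (\<integral>\<^sup>+s. k s y + ennreal (exp c * (2 / \<sigma>2)) * (\<integral>\<^sup>+W. ennreal ((norm2 N (mm s W))^2) \<partial>LW) \<partial>cnormal p)"
    unfolding k_def using rW measurable_mm2
    by (intro nn_integral_cong) (simp add: nn_integral_add nn_integral_cmult)
  also have "\<dots> = m y + ennreal (exp c * (2 / \<sigma>2)) * (\<integral>\<^sup>+s. (\<integral>\<^sup>+W. ennreal ((norm2 N (mm s W))^2) \<partial>LW) \<partial>cnormal p)"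
    unfolding m_def using kS mS by (simp add: nn_integral_add nn_integral_cmult)
  also have "\<dots> \<le> m y + ennreal (exp c * (2 / \<sigma>2)) * ennreal E0"
    by (intro add_left_mono mult_left_mono E0) simp
  also have "\<dots> = ennreal (enn2real (m y) + exp c * (2 / \<sigma>2) * E0)"
    using finite(2)[of y] \<sigma>2 E0(2) by (simp add: ennreal_mult[symmetric])
  finally have "exp c + exp c * (2 * E0 / \<sigma>2) \<le> enn2real (m y) + exp c * (2 / \<sigma>2) * E0"
    using \<sigma>2 E0(2) by (subst (asm) ennreal_le_iff) auto
  then show ?thesis using \<sigma>2 unfolding c_def[symmetric] by (simp add: field_simps)
qed

text \<open>The white noise is shifted by the noise-free output. The shift formula replaces this by
  the density \<open>\<rho>\<close>, and Fubini averages \<open>\<rho>\<close> over the other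
  disturbances into \<open>k\<close>.\<close>

lemma nn_integral_J:
  assumes g: "g \<in> borel_measurable (borel \<Otimes>\<^sub>M cvec N)"
  shows "(\<integral>\<^sup>+q. g q \<partial>J) = (\<integral>\<^sup>+s. (\<integral>\<^sup>+y. g (s, y) * k s y \<partial>L\<nu>) \<partial>cnormal p)"
proof -
  interpret LL: pair_sigma_finite LW L\<nu> ..
  have gs: "(\<lambda>y. g (s, y)) \<in> borel_measurable (cvec N)" for s
    using measurable_compose[OF measurable_Pair1' g, of s] by simp
  have "(\<integral>\<^sup>+q. g q \<partial>J) = (\<integral>\<^sup>+s. (\<integral>\<^sup>+W. (\<integral>\<^sup>+y. g (s, \<lambda>i\<in>{..<N}. mm s W i + y i) \<partial>L\<nu>) \<partial>LW) \<partial>cnormal p)"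
    by (rule J[OF g])
  also have "\<dots> = (\<integral>\<^sup>+s. (\<integral>\<^sup>+W. (\<integral>\<^sup>+y. g (s, y) * \<rho> s W y \<partial>L\<nu>) \<partial>LW) \<partial>cnormal p)"
    unfolding \<rho>_def using gs \<sigma>2
    by (intro nn_integral_cong nn_integral_PiM_cnormal_shift[of "{..<N}" "\<lambda>y. g (_, y)"]) (auto simp: cvec_def)
  also have "\<dots> = (\<integral>\<^sup>+s. (\<integral>\<^sup>+y. (\<integral>\<^sup>+W. g (s, y) * \<rho> s W y \<partial>LW) \<partial>L\<nu>) \<partial>cnormal p)"
  proof (intro nn_integral_cong)
    fix s :: complex
    have "(\<lambda>q. ((s, snd q), fst q)) \<in> measurable (LW \<Otimes>\<^sub>M cvec N) ((borel \<Otimes>\<^sub>M cvec N) \<Otimes>\<^sub>M LW)" by measurable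
    from measurable_compose[OF this borel_measurable_\<rho>]
    have "(\<lambda>q. \<rho> s (fst q) (snd q)) \<in> borel_measurable (LW \<Otimes>\<^sub>M cvec N)" by simp
    moreover have "(\<lambda>q. g (s, snd q)) \<in> borel_measurable (LW \<Otimes>\<^sub>M cvec N)"
      by (rule measurable_compose[OF measurable_snd gs])
    ultimately have "(\<lambda>q. g (s, snd q) * \<rho> s (fst q) (snd q)) \<in> borel_measurable (LW \<Otimes>\<^sub>M cvec N)"
      by (rule borel_measurable_times_ennreal[rotated])
    then have "(\<lambda>q. g (s, snd q) * \<rho> s (fst q) (snd q)) \<in> borel_measurable (LW \<Otimes>\<^sub>M L\<nu>)"
      by (simp cong: measurable_cong_sets)
    then show "(\<integral>\<^sup>+W. (\<integral>\<^sup>+y. g (s, y) * \<rho> s W y \<partial>L\<nu>) \<partial>LW) = (\<integral>\<^sup>+y. (\<integral>\<^sup>+W. g (s, y) * \<rho> s W y \<partial>LW) \<partial>L\<nu>)"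
      by (intro LL.Fubini'[symmetric]) (simp add: case_prod_beta')
  qed
  also have "\<dots> = (\<integral>\<^sup>+s. (\<integral>\<^sup>+y. g (s, y) * k s y \<partial>L\<nu>) \<partial>cnormal p)"
  proof (rule nn_integral_cong, rule nn_integral_cong)
    fix s y assume "y \<in> space L\<nu>"
    then have "(\<lambda>W. \<rho> s W y) \<in> borel_measurable LW"
      using measurable_compose[OF measurable_Pair1'[of "(s, y)" "borel \<Otimes>\<^sub>M cvec N"] borel_measurable_\<rho>]
      by (simp add: space_pair_measure space_L\<nu>)
    then show "(\<integral>\<^sup>+W. g (s, y) * \<rho> s W y \<partial>LW) = g (s, y) * k s y"
      unfolding k_def by (rule nn_integral_cmult)
  qed
  finally show ?thesis .
qed

lemma nn_integral_PY:
  assumes g: "g \<in> borel_measurable (cvec N)"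
  shows "(\<integral>\<^sup>+y. g y \<partial>PY) = (\<integral>\<^sup>+y. g y * m y \<partial>L\<nu>)"
proof -
  interpret FL: pair_sigma_finite "cnormal p" L\<nu> ..
  have "(\<integral>\<^sup>+y. g y \<partial>PY) = (\<integral>\<^sup>+q. g (snd q) \<partial>J)" by (rule PY[OF g])
  also have "\<dots> = (\<integral>\<^sup>+s. (\<integral>\<^sup>+y. g y * k s y \<partial>L\<nu>) \<partial>cnormal p)"
    using nn_integral_J[OF measurable_compose[OF measurable_snd g]] by simp
  also have "\<dots> = (\<integral>\<^sup>+y. (\<integral>\<^sup>+s. g y * k s y \<partial>cnormal p) \<partial>L\<nu>)"
  proof -
    have "(\<lambda>q. g (snd q) * k (fst q) (snd q)) \<in> borel_measurable (borel \<Otimes>\<^sub>M cvec N)"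
      using measurable_compose[OF measurable_snd g] by measurable
    then have "(\<lambda>q. g (snd q) * k (fst q) (snd q)) \<in> borel_measurable (cnormal p \<Otimes>\<^sub>M L\<nu>)"
      by (simp cong: measurable_cong_sets)
    then show ?thesis by (intro FL.Fubini'[symmetric]) (simp add: case_prod_beta')
  qed
  also have "\<dots> = (\<integral>\<^sup>+y. g y * m y \<partial>L\<nu>)"
  proof (rule nn_integral_cong)
    fix y assume y: "y \<in> space L\<nu>"
    have "(\<lambda>s. k s y) \<in> borel_measurable (cnormal p)"
      using measurable_compose[OF measurable_Pair2'[of y "cvec N" borel] borel_measurable_k] y by (simp add: space_L\<nu>)
    then show "(\<integral>\<^sup>+s. g y * k s y \<partial>cnormal p) = g y * m y" unfolding m_def by (rule nn_integral_cmult)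
  qed
  finally show ?thesis .
qed

lemma emeasure_J: "emeasure J (space J) = 1"
proof -
  have "emeasure J (space J) = (\<integral>\<^sup>+q. 1 \<partial>J)" by simp
  also have "\<dots> = 1" by (subst J) (auto simp: LW.emeasure_space_1)
  finally show ?thesis .
qed

lemma prob_space_PY: "prob_space PY"
proof
  have "emeasure PY (space PY) = (\<integral>\<^sup>+y. 1 \<partial>PY)" by simp
  also have "\<dots> = (\<integral>\<^sup>+q. 1 \<partial>J)" by (subst PY) auto
  finally show "emeasure PY (space PY) = 1" by (simp add: emeasure_J)
qed

sublocale PY: prob_space PY by (rule prob_space_PY)

abbreviation "Qm \<equiv> cnormal p \<Otimes>\<^sub>M PY"

lemma sets_Qm: "sets Qm = sets (borel \<Otimes>\<^sub>M cvec N)"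
  by (intro sets_pair_measure_cong sets_cnormal sets_PY)

lemmas measurable_Qm = measurable_cong_sets[OF sets_Qm refl]
lemmas measurable_J = measurable_cong_sets[OF sets_J refl]

lemma f_nonneg: "0 \<le> f q"
  by (simp add: f_def)

lemma borel_measurable_f[measurable]: "f \<in> borel_measurable (borel \<Otimes>\<^sub>M cvec N)"
  unfolding f_def[abs_def] by measurable

lemma f_times_m: "y \<in> space (cvec N) \<Longrightarrow> ennreal (f (s, y)) * m y = k s y"
proof -
  assume y: "y \<in> space (cvec N)"
  have mp: "0 < enn2real (m y)" using m_ge[OF y] by (rule less_le_trans[OF exp_gt_zero])
  have "m y = ennreal (enn2real (m y))" "k s y = ennreal (enn2real (k s y))" using finite by auto
  moreover have "f (s, y) * enn2real (m y) = enn2real (k s y)" unfolding f_def using mp by simp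
  ultimately show ?thesis by (metis ennreal_mult' enn2real_nonneg f_nonneg mult.commute)
qed

lemma J_eq_density: "J = density Qm (\<lambda>q. ennreal (f q))"
proof (rule measure_eqI)
  show "sets J = sets (density Qm (\<lambda>q. ennreal (f q)))" by (simp only: sets_J sets_Qm sets_density)
  fix B assume "B \<in> sets J"
  then have B[measurable]: "B \<in> sets (borel \<Otimes>\<^sub>M cvec N)" by (simp add: sets_J)
  have fB: "(\<lambda>q. ennreal (f q) * indicator B q) \<in> borel_measurable (borel \<Otimes>\<^sub>M cvec N)" by measurable
  have "emeasure (density Qm (\<lambda>q. ennreal (f q))) B = (\<integral>\<^sup>+q. ennreal (f q) * indicator B q \<partial>Qm)"
    by (rule emeasure_density) (simp_all only: measurable_Qm sets_Qm, measurable)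
  also have "\<dots> = (\<integral>\<^sup>+s. (\<integral>\<^sup>+y. ennreal (f (s, y)) * indicator B (s, y) \<partial>PY) \<partial>cnormal p)"
    using fB by (intro PY.nn_integral_fst[symmetric, of "\<lambda>q. ennreal (f q) * indicator B q", simplified]) (simp only: measurable_Qm)
  also have "\<dots> = (\<integral>\<^sup>+s. (\<integral>\<^sup>+y. ennreal (f (s, y)) * indicator B (s, y) * m y \<partial>L\<nu>) \<partial>cnormal p)"
    by (intro nn_integral_cong nn_integral_PY measurable_compose[OF measurable_Pair1' fB]) simp
  also have "\<dots> = (\<integral>\<^sup>+s. (\<integral>\<^sup>+y. indicator B (s, y) * k s y \<partial>L\<nu>) \<partial>cnormal p)"
    by (intro nn_integral_cong) (simp add: f_times_m[symmetric] space_L\<nu> mult_ac)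
  also have "\<dots> = (\<integral>\<^sup>+q. indicator B q \<partial>J)" by (rule nn_integral_J[symmetric]) measurable
  also have "\<dots> = emeasure J B" using \<open>B \<in> sets J\<close> by simp
  finally show "emeasure J B = emeasure (density Qm (\<lambda>q. ennreal (f q))) B" by simp
qed

lemma integrable_J_iff:
  fixes g :: "_ \<Rightarrow> real"
  assumes g: "g \<in> borel_measurable (borel \<Otimes>\<^sub>M cvec N)"
  shows "integrable J g \<longleftrightarrow> integrable Qm (\<lambda>q. f q * g q)" "(\<integral>q. g q \<partial>J) = (\<integral>q. f q * g q \<partial>Qm)"
proof -
  have gQ: "g \<in> borel_measurable Qm" using g by (simp only: measurable_Qm)
  have fQ: "f \<in> borel_measurable Qm" using borel_measurable_f by (simp only: measurable_Qm)
  show "integrable J g \<longleftrightarrow> integrable Qm (\<lambda>q. f q * g q)"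
    unfolding J_eq_density using integrable_density[OF gQ fQ] f_nonneg by simp
  show "(\<integral>q. g q \<partial>J) = (\<integral>q. f q * g q \<partial>Qm)"
    unfolding J_eq_density using integral_density[OF gQ fQ] f_nonneg by simp
qed

text \<open>\<open>T\<close> is the log-likelihood ratio of the input law CN(u^T y, p e0) against
  CN(0, p). For each fixed output y, exp T has mean 1 under the input law, hence also under the
  product law; under \<open>J\<close> the mean of \<open>T\<close> is - ln e0 - e / e0 + 1. The
  parameter \<open>e0\<close> is kept apart from the error \<open>e\<close> because later
  \<open>e\<close> varies with the channel realization while \<open>e0\<close> is a
  constant.\<close>

theorem KL_divergence_ge:
  assumes y2: "(\<integral>\<^sup>+q. ennreal ((norm2 N (snd q))^2) \<partial>J) < \<top>"
    and s2: "(\<integral>\<^sup>+q. ennreal ((cmod (fst q))^2) \<partial>J) = ennreal p"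
    and e: "(\<integral>\<^sup>+q. ennreal ((cmod (fst q - (\<Sum>i<N. u i * snd q i)))^2) \<partial>J) = ennreal (p * e)" "0 \<le> e"
    and e0: "0 < e0"
  shows "(- ln e0 - e / e0 + 1) / ln 2 \<le> KL_divergence 2 Qm J"
proof -
  interpret Q: pair_prob_space "cnormal p" PY ..
  have my: "(\<lambda>q. snd q i) \<in> borel_measurable (borel \<Otimes>\<^sub>M cvec N)" if "i < N" for i
    by (rule measurable_compose[OF measurable_snd measurable_cvec_component[OF that]])
  have mu: "(\<lambda>q. fst q - (\<Sum>i<N. u i * snd q i)) \<in> borel_measurable (borel \<Otimes>\<^sub>M cvec N)"
    using my by (intro borel_measurable_diff borel_measurable_sum borel_measurable_times) auto
  have mn: "(\<lambda>q. norm2 N (snd q)) \<in> borel_measurable (borel \<Otimes>\<^sub>M cvec N)" by (rule borel_measurable_norm2[OF my])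
  note [measurable] = mu mn
  have cJ: "g \<in> borel_measurable J" if "g \<in> borel_measurable (borel \<Otimes>\<^sub>M cvec N)" for g :: "_ \<Rightarrow> real"
    using that by (simp only: measurable_J)
  have cQ: "g \<in> borel_measurable Qm" if "g \<in> borel_measurable (borel \<Otimes>\<^sub>M cvec N)" for g :: "_ \<Rightarrow> real"
    using that by (simp only: measurable_Qm)
  define A1 where "A1 = (\<lambda>q :: complex \<times> (nat \<Rightarrow> complex). (cmod (fst q - (\<Sum>i<N. u i * snd q i)))^2)"
  define A2 where "A2 = (\<lambda>q :: complex \<times> (nat \<Rightarrow> complex). (cmod (fst q))^2)"
  define A3 where "A3 = (\<lambda>q :: complex \<times> (nat \<Rightarrow> complex). (norm2 N (snd q))^2)"
  have [measurable]: "A1 \<in> borel_measurable (borel \<Otimes>\<^sub>M cvec N)" "A2 \<in> borel_measurable (borel \<Otimes>\<^sub>M cvec N)" "A3 \<in> borel_measurable (borel \<Otimes>\<^sub>M cvec N)"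
    unfolding A1_def A2_def A3_def by measurable
  have I1: "has_bochner_integral J A1 (p * e)"
    using e p by (intro has_bochner_integral_nn_integral cJ) (auto simp: A1_def)
  have I2: "has_bochner_integral J A2 p"
    using s2 p by (intro has_bochner_integral_nn_integral cJ) (auto simp: A2_def)
  have I3: "integrable J A3"
    using y2 by (intro integrableI_bounded cJ) (auto simp: A3_def)
  interpret PJ: prob_space J by standard (rule emeasure_J)
  define T where "T = (\<lambda>q. - ln e0 - A1 q / (p * e0) + A2 q / p)"
  have [measurable]: "T \<in> borel_measurable (borel \<Otimes>\<^sub>M cvec N)" unfolding T_def by measurable
  have T: "has_bochner_integral J T (- ln e0 - (p * e) / (p * e0) + p / p)"
  proof -
    have "has_bochner_integral J (\<lambda>q. - ln e0) (- ln e0)" by (simp add: has_bochner_integral_iff PJ.prob_space)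
    then show ?thesis unfolding T_def
      by (intro has_bochner_integral_add has_bochner_integral_diff has_bochner_integral_divide_zero I1 I2)
  qed
  \<comment> \<open>ln f = ln k - ln m, with ln k at most |y|^2 / \<open>\<sigma>2\<close> and - ln
    m at most (|y|^2 + 2 E0) / \<open>\<sigma>2\<close>; the sum is integrable under
    \<open>J\<close> because the output has finite power.\<close>
  define G where "G = (\<lambda>q. f q * ((2 * A3 q + 2 * E0) / \<sigma>2))"
  have "(\<integral>q. f q * T q \<partial>Qm) / ln 2 \<le> (\<integral>q. f q * log 2 (f q) \<partial>Qm)"
  proof (rule integral_entropy_ge)
    have "integrable J (\<lambda>_. 1 :: real)" by simp
    then show "integrable Qm f" using integrable_J_iff(1)[of "\<lambda>_. 1"] by simp
    show "(\<integral>q. f q \<partial>Qm) = 1" using integrable_J_iff(2)[of "\<lambda>_. 1"] by (simp add: PJ.prob_space)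
    show "0 \<le> f q" for q by (rule f_nonneg)
    show "T \<in> borel_measurable Qm" by (rule cQ) measurable
    show "integrable Qm (\<lambda>q. f q * T q)"
      using T integrable_J_iff(1)[of T] by (auto simp: has_bochner_integral_iff)
    show "(\<integral>\<^sup>+q. ennreal (exp (T q)) \<partial>Qm) \<le> 1"
    proof -
      have "(\<integral>\<^sup>+q. ennreal (exp (T q)) \<partial>Qm) = (\<integral>\<^sup>+y. (\<integral>\<^sup>+s. ennreal (exp (T (s, y))) \<partial>cnormal p) \<partial>PY)"
        by (intro Q.nn_integral_snd[symmetric, of "\<lambda>q. ennreal (exp (T q))", simplified]) (simp only: measurable_Qm, measurable)
      also have "\<dots> = (\<integral>\<^sup>+y. 1 \<partial>PY)"
      proof (intro nn_integral_cong)
        fix y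
        have "exp (T (s, y)) = 1 / e0 * exp (- ((cmod (s - (\<Sum>i<N. u i * y i)))^2) / (p * e0) + (cmod s)^2 / p)" for s
        proof -
          have "exp (T (s, y)) = exp (- ln e0) * exp (- ((cmod (s - (\<Sum>i<N. u i * y i)))^2) / (p * e0) + (cmod s)^2 / p)"
            unfolding T_def A1_def A2_def exp_add[symmetric] by simp
          then show ?thesis using e0 by (simp add: exp_minus inverse_eq_divide)
        qed
        then show "(\<integral>\<^sup>+s. ennreal (exp (T (s, y))) \<partial>cnormal p) = 1"
          using nn_integral_cnormal_tilt[OF p e0, of "\<Sum>i<N. u i * y i"] by simp
      qed
      finally show ?thesis by (simp add: PY.emeasure_space_1)
    qed
    show "integrable Qm G"
      unfolding G_def using I3 by (subst integrable_J_iff(1)[symmetric]) auto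
    show "f q * ln (f q) \<le> G q" if "q \<in> space Qm" for q
    proof (cases "f q = 0")
      case True
      then show ?thesis unfolding G_def by simp
    next
      case False
      obtain s y where q: "q = (s, y)" by (cases q)
      have y: "y \<in> space (cvec N)" using that sets_eq_imp_space_eq[OF sets_PY] by (simp add: q space_pair_measure)
      define K where "K = enn2real (k s y)"
      have mp: "0 < enn2real (m y)" using m_ge[OF y] by (rule less_le_trans[OF exp_gt_zero])
      have K: "0 < K" using False mp unfolding f_def K_def q by (simp add: less_le)
      have "K \<le> exp ((norm2 N y)^2 / \<sigma>2)" unfolding K_def by (rule enn2real_leI[OF _ k_le]) simp
      then have "ln K \<le> (norm2 N y)^2 / \<sigma>2" using K ln_le_cancel_iff[of K "exp ((norm2 N y)^2 / \<sigma>2)"] by simp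
      moreover have "- ((norm2 N y)^2 + 2 * E0) / \<sigma>2 \<le> ln (enn2real (m y))"
        using m_ge[OF y] mp by (simp add: ln_ge_iff)
      moreover have "ln (f q) = ln K - ln (enn2real (m y))"
        unfolding f_def q K_def[symmetric] using K mp by (simp add: ln_div K_def)
      ultimately have "ln (f q) \<le> (norm2 N y)^2 / \<sigma>2 - - ((norm2 N y)^2 + 2 * E0) / \<sigma>2" by linarith
      also have "\<dots> = (2 * A3 q + 2 * E0) / \<sigma>2" by (simp add: A3_def q diff_divide_distrib add_divide_distrib)
      finally show ?thesis unfolding G_def by (intro mult_left_mono f_nonneg)
    qed
  qed
  also have "(\<integral>q. f q * log 2 (f q) \<partial>Qm) = KL_divergence 2 Qm J"
    unfolding J_eq_density using f_nonneg cQ[OF borel_measurable_f]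
    by (intro Q.P.KL_density[symmetric]) auto
  also have "(\<integral>q. f q * T q \<partial>Qm) = - ln e0 - e / e0 + 1"
    using T integrable_J_iff(2)[of T] p by (simp add: has_bochner_integral_iff)
  finally show ?thesis .
qed

end

section \<open>The uplink at fixed channels as a channel with additive white noise\<close>

definition noise_free :: "'u set \<Rightarrow> (nat \<Rightarrow> complex) \<Rightarrow> ('u \<Rightarrow> nat \<Rightarrow> complex) \<Rightarrow> complex
    \<Rightarrow> (complex \<times> (nat \<Rightarrow> complex)) \<times> ('u \<Rightarrow> complex) \<Rightarrow> nat \<Rightarrow> complex" where
  "noise_free U x g s W i = x i * (s + fst (fst W)) + snd (fst W) i + (\<Sum>l\<in>U. snd W l * g l i)"

lemma received_eq:
  "received N U x g s w = (\<lambda>i\<in>{..<N}. noise_free U x g s (fst w, snd (snd w)) i + fst (snd w) i)"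
  by (auto simp: received_def noise_free_def split_beta fun_eq_iff)

lemma borel_measurable_noise_free:
  assumes "i < N"
  shows "(\<lambda>q. noise_free U x g (fst q) (snd q) i) \<in> borel_measurable (borel \<Otimes>\<^sub>M ((borel \<Otimes>\<^sub>M cvec N) \<Otimes>\<^sub>M PiM U (\<lambda>_. borel)))"
proof -
  have "(\<lambda>q. snd (fst (snd q)) i) \<in> borel_measurable (borel \<Otimes>\<^sub>M ((borel \<Otimes>\<^sub>M cvec N) \<Otimes>\<^sub>M PiM U (\<lambda>_. borel)))"
    by (rule measurable_compose[OF _ measurable_cvec_component[OF assms]]) measurable
  moreover have "(\<lambda>q. snd (snd q) l) \<in> borel_measurable (borel \<Otimes>\<^sub>M ((borel \<Otimes>\<^sub>M cvec N) \<Otimes>\<^sub>M PiM U (\<lambda>_. borel)))" if "l \<in> U" for l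
    by (rule measurable_compose[OF _ measurable_component_singleton[OF that]]) measurable
  ultimately show ?thesis
    unfolding noise_free_def by (intro borel_measurable_add borel_measurable_sum borel_measurable_times) auto
qed

lemma measurable_received:
  "(\<lambda>y. received N U x g (fst y) (snd y)) \<in> measurable (borel \<Otimes>\<^sub>M disturbance_space N U) (cvec N)"
  unfolding received_eq disturbance_space_def
proof (rule measurable_cvecI, rule borel_measurable_add)
  fix i assume i: "i < N"
  have "(\<lambda>y. (fst y, fst (snd y), snd (snd (snd y)))) \<in> measurable (borel \<Otimes>\<^sub>M (borel \<Otimes>\<^sub>M cvec N) \<Otimes>\<^sub>M cvec N \<Otimes>\<^sub>M PiM U (\<lambda>_. borel))
    (borel \<Otimes>\<^sub>M ((borel \<Otimes>\<^sub>M cvec N) \<Otimes>\<^sub>M PiM U (\<lambda>_. borel)))" by measurable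
  from measurable_compose[OF this borel_measurable_noise_free[OF i]]
  show "(\<lambda>y. noise_free U x g (fst y) (fst (snd y), snd (snd (snd y))) i) \<in>
    borel_measurable (borel \<Otimes>\<^sub>M (borel \<Otimes>\<^sub>M cvec N) \<Otimes>\<^sub>M cvec N \<Otimes>\<^sub>M PiM U (\<lambda>_. borel))" by simp
  show "(\<lambda>y. fst (snd (snd y)) i) \<in> borel_measurable (borel \<Otimes>\<^sub>M (borel \<Otimes>\<^sub>M cvec N) \<Otimes>\<^sub>M cvec N \<Otimes>\<^sub>M PiM U (\<lambda>_. borel))"
    by (rule measurable_compose[OF _ measurable_cvec_component[OF i]]) measurable
qed

locale uplink_channel =
  fixes N :: nat and U :: "'u set" and x :: "nat \<Rightarrow> complex" and g :: "'u \<Rightarrow> nat \<Rightarrow> complex"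
    and p \<sigma>2 \<kappa>t \<kappa>r :: real and D :: "'u \<Rightarrow> complex measure"
  assumes U: "finite U" and p: "0 < p" and \<sigma>2: "0 < \<sigma>2" and nonneg: "0 \<le> \<kappa>t" "0 \<le> \<kappa>r"
    and D: "\<And>l. l \<in> U \<Longrightarrow> centered (D l) p"
begin

abbreviation "Ld \<equiv> distortion_law N \<kappa>t \<kappa>r p x"
abbreviation "Lc \<equiv> PiM U D"
abbreviation "Lnoise \<equiv> PiM {..<N} (\<lambda>_. cnormal \<sigma>2)"
abbreviation "LW \<equiv> Ld \<Otimes>\<^sub>M Lc"
abbreviation "L \<equiv> disturbance_law N U \<kappa>t \<kappa>r p \<sigma>2 D x"

lemma prob_spaces: "prob_space Ld" "prob_space Lc" "prob_space Lnoise"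
proof -
  show "prob_space Ld" by (rule prob_space_distortion_law)
  show "prob_space Lnoise" by (intro prob_space_PiM prob_space_cnormal)
  define D' where "D' = (\<lambda>l. if l \<in> U then D l else cnormal 0)"
  have "prob_space (D' l)" for l using centeredD(1)[OF D] by (auto simp: D'_def prob_space_cnormal)
  then have "prob_space (PiM U D')" by (rule prob_space_PiM)
  moreover have "PiM U D' = Lc" by (intro PiM_cong) (auto simp: D'_def)
  ultimately show "prob_space Lc" by simp
qed

sublocale Ld: prob_space Ld by (rule prob_spaces)
sublocale Lc: prob_space Lc by (rule prob_spaces)
sublocale Lnoise: prob_space Lnoise by (rule prob_spaces)
sublocale F: prob_space "cnormal p" by (rule prob_space_cnormal)

lemma sets_L: "sets Lc = sets (PiM U (\<lambda>_. borel))" "sets Lnoise = sets (cvec N)" "sets Ld = sets (borel \<Otimes>\<^sub>M cvec N)"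
    "sets LW = sets ((borel \<Otimes>\<^sub>M cvec N) \<Otimes>\<^sub>M PiM U (\<lambda>_. borel))" "sets L = sets (disturbance_space N U)"
proof -
  show 1: "sets Lc = sets (PiM U (\<lambda>_. borel))" by (intro sets_PiM_cong centeredD(2)[OF D]) auto
  show 2: "sets Lnoise = sets (cvec N)" unfolding cvec_def by (intro sets_PiM_cong) auto
  show 3: "sets Ld = sets (borel \<Otimes>\<^sub>M cvec N)" by (rule sets_distortion_law)
  show "sets LW = sets ((borel \<Otimes>\<^sub>M cvec N) \<Otimes>\<^sub>M PiM U (\<lambda>_. borel))"
    by (intro sets_pair_measure_cong 1 3)
  show "sets L = sets (disturbance_space N U)"
    unfolding disturbance_law_def disturbance_space_def by (intro sets_pair_measure_cong 1 2 3)
qed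

lemma prob_space_LW: "prob_space LW"
proof -
  interpret Q: pair_prob_space Ld Lc ..
  show ?thesis by (rule Q.P.prob_space_axioms)
qed

lemma prob_space_L: "prob_space L"
proof -
  interpret A: pair_prob_space Lnoise Lc ..
  interpret B: pair_prob_space Ld "Lnoise \<Otimes>\<^sub>M Lc" ..
  show ?thesis unfolding disturbance_law_def by (rule B.P.prob_space_axioms)
qed

text \<open>The second moment of t s + sum u_i y_i for input s and noise-free output y. With t = 1
  it yields the error of a linear estimate of the input, with t = 0 and a unit vector the power at
  one antenna.\<close>

definition V :: "complex \<Rightarrow> (nat \<Rightarrow> complex) \<Rightarrow> real" where
  "V t u = (cmod (t + (\<Sum>i<N. u i * x i)))^2 * p + (cmod (\<Sum>i<N. u i * x i))^2 * (\<kappa>t * p)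
    + (\<Sum>i<N. (cmod (u i))^2 * (\<kappa>r * p * (cmod (x i))^2)) + (\<Sum>l\<in>U. (cmod (\<Sum>i<N. u i * g l i))^2 * p)"

lemma V_nonneg: "0 \<le> V t u"
  unfolding V_def using p nonneg by (intro add_nonneg_nonneg sum_nonneg mult_nonneg_nonneg) auto

lemma nn_integral_linear_W:
  "(\<integral>\<^sup>+s. (\<integral>\<^sup>+W. ennreal ((cmod (t * s + (\<Sum>i<N. u i * noise_free U x g s W i)))^2) \<partial>LW) \<partial>cnormal p) = ennreal (V t u)"
proof -
  define A1 where "A1 = (\<Sum>i<N. u i * x i)"
  define B where "B = (\<lambda>l. \<Sum>i<N. u i * g l i)"
  define vr where "vr = (\<Sum>i<N. (cmod (u i))^2 * (\<kappa>r * p * (cmod (x i))^2))"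
  define vc where "vc = (\<Sum>l\<in>U. (cmod (B l))^2 * p)"
  have vn: "0 \<le> vr" "0 \<le> vc" unfolding vr_def vc_def using p nonneg by (auto intro!: sum_nonneg)
  \<comment> \<open>The input enters directly and through the channel, hence the coefficient t + A1;
    grouping by independent sources makes their variances add.\<close>
  have eq: "t * s + (\<Sum>i<N. u i * noise_free U x g s (q, c) i) =
    ((t + A1) * s + A1 * fst q + (\<Sum>i<N. u i * snd q i)) + (\<Sum>l\<in>U. B l * c l)" for s q c
  proof -
    have "(\<Sum>i<N. u i * (\<Sum>l\<in>U. c l * g l i)) = (\<Sum>l\<in>U. B l * c l)"
      unfolding B_def sum_distrib_left sum_distrib_right by (subst sum.swap) (simp add: mult_ac)
    then show ?thesis
      by (simp add: noise_free_def A1_def algebra_simps sum.distrib sum_distrib_left sum_distrib_right)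
  qed
  have q1: "(\<lambda>q. ((t + A1) * s + A1 * fst q + (\<Sum>i<N. u i * snd q i))) \<in> borel_measurable (borel \<Otimes>\<^sub>M cvec N)" for s
    by (intro borel_measurable_add borel_measurable_sum borel_measurable_times borel_measurable_const
        measurable_compose[OF measurable_snd measurable_cvec_component]) auto
  have "(\<integral>\<^sup>+s. (\<integral>\<^sup>+W. ennreal ((cmod (t * s + (\<Sum>i<N. u i * noise_free U x g s W i)))^2) \<partial>LW) \<partial>cnormal p) =
    (\<integral>\<^sup>+s. (\<integral>\<^sup>+q. (\<integral>\<^sup>+c. ennreal ((cmod (((t + A1) * s + A1 * fst q + (\<Sum>i<N. u i * snd q i)) + (\<Sum>l\<in>U. B l * c l)))^2) \<partial>Lc) \<partial>Ld) \<partial>cnormal p)"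
  proof (intro nn_integral_cong)
    fix s :: complex
    have "(\<lambda>W. \<Sum>i<N. u i * noise_free U x g s W i) \<in> borel_measurable ((borel \<Otimes>\<^sub>M cvec N) \<Otimes>\<^sub>M PiM U (\<lambda>_. borel))"
    proof (intro borel_measurable_sum borel_measurable_times borel_measurable_const)
      fix i assume "i \<in> {..<N}"
      then have "i < N" by simp
      from measurable_compose[OF measurable_Pair1'[of s borel] borel_measurable_noise_free[OF this]]
      show "(\<lambda>W. noise_free U x g s W i) \<in> borel_measurable ((borel \<Otimes>\<^sub>M cvec N) \<Otimes>\<^sub>M PiM U (\<lambda>_. borel))" by simp
    qed
    then have "(\<lambda>W. ennreal ((cmod (t * s + (\<Sum>i<N. u i * noise_free U x g s W i)))^2)) \<in> borel_measurable LW"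
      by (subst measurable_cong_sets[OF sets_L(4) refl])
         (intro measurable_compose[OF _ measurable_ennreal] borel_measurable_power measurable_compose[OF _ borel_measurable_norm]
           borel_measurable_add borel_measurable_const)
    from Lc.nn_integral_fst[OF this, symmetric]
    show "(\<integral>\<^sup>+W. ennreal ((cmod (t * s + (\<Sum>i<N. u i * noise_free U x g s W i)))^2) \<partial>LW) =
      (\<integral>\<^sup>+q. (\<integral>\<^sup>+c. ennreal ((cmod (((t + A1) * s + A1 * fst q + (\<Sum>i<N. u i * snd q i)) + (\<Sum>l\<in>U. B l * c l)))^2) \<partial>Lc) \<partial>Ld)"
      unfolding eq .
  qed
  also have "\<dots> = (\<integral>\<^sup>+s. (\<integral>\<^sup>+q. ennreal ((cmod ((t + A1) * s + A1 * fst q + (\<Sum>i<N. u i * snd q i)))^2) + ennreal vc \<partial>Ld) \<partial>cnormal p)"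
    using nn_integral_PiM_linear[OF U D] vn by (simp add: vc_def)
  also have "\<dots> = (\<integral>\<^sup>+s. (\<integral>\<^sup>+e. (\<integral>\<^sup>+y. ennreal ((cmod (((t + A1) * s + A1 * e) + (\<Sum>i<N. u i * y i)))^2) + ennreal vc
      \<partial>PiM {..<N} (\<lambda>i. cnormal (\<kappa>r * p * (cmod (x i))^2))) \<partial>cnormal (\<kappa>t * p)) \<partial>cnormal p)"
    using q1 by (subst nn_integral_distortion_law) (auto intro!: borel_measurable_add measurable_compose[OF _ measurable_ennreal])
  also have "\<dots> = (\<integral>\<^sup>+s. (\<integral>\<^sup>+e. ennreal ((cmod ((t + A1) * s + A1 * e))^2) + ennreal vr + ennreal vc \<partial>cnormal (\<kappa>t * p)) \<partial>cnormal p)"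
  proof (intro nn_integral_cong)
    fix s e
    have "(\<integral>\<^sup>+y. ennreal ((cmod (((t + A1) * s + A1 * e) + (\<Sum>i<N. u i * y i)))^2) \<partial>PiM {..<N} (\<lambda>i. cnormal (\<kappa>r * p * (cmod (x i))^2))) =
      ennreal ((cmod ((t + A1) * s + A1 * e))^2) + ennreal vr"
      using vn nonneg p unfolding vr_def
      by (subst nn_integral_PiM_linear[where v="\<lambda>i. \<kappa>r * p * (cmod (x i))^2"]) (auto intro!: centered_cnormal)
    moreover have "(\<lambda>y. ennreal ((cmod (((t + A1) * s + A1 * e) + (\<Sum>i<N. u i * y i)))^2)) \<in> borel_measurable (PiM {..<N} (\<lambda>i. cnormal (\<kappa>r * p * (cmod (x i))^2)))"
      by (intro measurable_compose[OF _ measurable_ennreal] borel_measurable_power measurable_compose[OF _ borel_measurable_norm] borel_measurable_add measurable_PiM_borel_sum) auto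
    ultimately show "(\<integral>\<^sup>+y. ennreal ((cmod (((t + A1) * s + A1 * e) + (\<Sum>i<N. u i * y i)))^2) + ennreal vc
      \<partial>PiM {..<N} (\<lambda>i. cnormal (\<kappa>r * p * (cmod (x i))^2))) = ennreal ((cmod ((t + A1) * s + A1 * e))^2) + ennreal vr + ennreal vc"
      by (subst nn_integral_add) auto
  qed
  also have "\<dots> = (\<integral>\<^sup>+s. ennreal ((cmod (0 + (t + A1) * s))^2) + ennreal ((cmod A1)^2 * (\<kappa>t * p)) + ennreal vr + ennreal vc \<partial>cnormal p)"
    using centeredD(4)[OF centered_cnormal[of "\<kappa>t * p"]] nonneg p
    by (intro nn_integral_cong) (simp add: nn_integral_add)
  also have "\<dots> = ennreal ((cmod (t + A1))^2 * p) + ennreal ((cmod A1)^2 * (\<kappa>t * p)) + ennreal vr + ennreal vc"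
    using centeredD(4)[OF centered_cnormal[of p], of 0 "t + A1"] p
    by (simp add: nn_integral_add)
  also have "\<dots> = ennreal (V t u)"
    using vn p nonneg unfolding V_def A1_def[symmetric] vr_def[symmetric] vc_def[unfolded B_def, symmetric]
    by (simp add: ennreal_plus[symmetric] del: ennreal_plus)
  finally show ?thesis .
qed

definition J where "J = distr (cnormal p \<Otimes>\<^sub>M L) (borel \<Otimes>\<^sub>M cvec N) (\<lambda>y. (fst y, received N U x g (fst y) (snd y)))"
definition PY where "PY = distr (cnormal p \<Otimes>\<^sub>M L) (cvec N) (\<lambda>y. received N U x g (fst y) (snd y))"

lemma measurable_received_L: "(\<lambda>y. received N U x g (fst y) (snd y)) \<in> measurable (cnormal p \<Otimes>\<^sub>M L) (cvec N)"
  using measurable_received by (simp only: measurable_cong_sets[OF sets_pair_measure_cong[OF sets_cnormal sets_L(5)] refl])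

lemma measurable_pair_L: "(\<lambda>y. (fst y, received N U x g (fst y) (snd y))) \<in> measurable (cnormal p \<Otimes>\<^sub>M L) (borel \<Otimes>\<^sub>M cvec N)"
proof (rule measurable_Pair[OF _ measurable_received_L])
  have "fst \<in> measurable (cnormal p \<Otimes>\<^sub>M L) (cnormal p)" by (rule measurable_fst)
  then show "fst \<in> borel_measurable (cnormal p \<Otimes>\<^sub>M L)" by (simp only: measurable_cong_sets[OF refl sets_cnormal])
qed

text \<open>In the disturbance law the white noise sits between the distortions and the co-user
  signals; Fubini moves it innermost, the form that \<open>awgn\<close> asks for.\<close>

lemma nn_integral_J:
  assumes f: "f \<in> borel_measurable (borel \<Otimes>\<^sub>M cvec N)"
  shows "(\<integral>\<^sup>+q. f q \<partial>J) = (\<integral>\<^sup>+s. (\<integral>\<^sup>+W. (\<integral>\<^sup>+y. f (s, \<lambda>i\<in>{..<N}. noise_free U x g s W i + y i) \<partial>Lnoise) \<partial>LW) \<partial>cnormal p)"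
proof -
  interpret L: prob_space L by (rule prob_space_L)
  interpret A: pair_prob_space Lnoise Lc ..
  define h where "h = (\<lambda>s q \<nu> c. f (s, \<lambda>i\<in>{..<N}. noise_free U x g s (q, c) i + \<nu> i))"
  have hm: "(\<lambda>\<omega>. h (fst \<omega>) (fst (snd \<omega>)) (fst (snd (snd \<omega>))) (snd (snd (snd \<omega>)))) \<in> borel_measurable (borel \<Otimes>\<^sub>M disturbance_space N U)"
  proof -
    have "(\<lambda>\<omega>. (fst \<omega>, received N U x g (fst \<omega>) (snd \<omega>))) \<in> measurable (borel \<Otimes>\<^sub>M disturbance_space N U) (borel \<Otimes>\<^sub>M cvec N)"
      by (rule measurable_Pair[OF measurable_fst measurable_received])
    from measurable_compose[OF this f] show ?thesis by (simp add: h_def received_eq)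
  qed
  have h1: "(\<lambda>w. h s (fst w) (fst (snd w)) (snd (snd w))) \<in> borel_measurable (Ld \<Otimes>\<^sub>M Lnoise \<Otimes>\<^sub>M Lc)" for s
    using measurable_compose[OF measurable_Pair1' hm, of s] sets_L(5)
    by (simp add: measurable_cong_sets[OF sets_L(5)[symmetric] refl] disturbance_law_def)
  have "(\<integral>\<^sup>+q. f q \<partial>J) = (\<integral>\<^sup>+\<omega>. f (fst \<omega>, received N U x g (fst \<omega>) (snd \<omega>)) \<partial>(cnormal p \<Otimes>\<^sub>M L))"
    unfolding J_def using f by (subst nn_integral_distr[OF measurable_pair_L]) auto
  also have "\<dots> = (\<integral>\<^sup>+s. (\<integral>\<^sup>+w. h s (fst w) (fst (snd w)) (snd (snd w)) \<partial>L) \<partial>cnormal p)"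
    using L.nn_integral_fst[OF measurable_compose[OF measurable_pair_L f], symmetric] by (simp add: h_def received_eq)
  also have "\<dots> = (\<integral>\<^sup>+s. (\<integral>\<^sup>+q. (\<integral>\<^sup>+\<nu>. (\<integral>\<^sup>+c. h s q \<nu> c \<partial>Lc) \<partial>Lnoise) \<partial>Ld) \<partial>cnormal p)"
  proof (rule nn_integral_cong)
    fix s :: complex
    have "(\<integral>\<^sup>+w. h s (fst w) (fst (snd w)) (snd (snd w)) \<partial>L) = (\<integral>\<^sup>+q. (\<integral>\<^sup>+r. h s q (fst r) (snd r) \<partial>(Lnoise \<Otimes>\<^sub>M Lc)) \<partial>Ld)"
      unfolding disturbance_law_def using A.P.nn_integral_fst[OF h1[of s], symmetric] by simp
    also have "\<dots> = (\<integral>\<^sup>+q. (\<integral>\<^sup>+\<nu>. (\<integral>\<^sup>+c. h s q \<nu> c \<partial>Lc) \<partial>Lnoise) \<partial>Ld)"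
    proof (rule nn_integral_cong)
      fix q assume "q \<in> space Ld"
      from Lc.nn_integral_fst[OF measurable_compose[OF measurable_Pair1'[OF this] h1[of s]], symmetric]
      show "(\<integral>\<^sup>+r. h s q (fst r) (snd r) \<partial>(Lnoise \<Otimes>\<^sub>M Lc)) = (\<integral>\<^sup>+\<nu>. (\<integral>\<^sup>+c. h s q \<nu> c \<partial>Lc) \<partial>Lnoise)" by simp
    qed
    finally show "(\<integral>\<^sup>+w. h s (fst w) (fst (snd w)) (snd (snd w)) \<partial>L) = (\<integral>\<^sup>+q. (\<integral>\<^sup>+\<nu>. (\<integral>\<^sup>+c. h s q \<nu> c \<partial>Lc) \<partial>Lnoise) \<partial>Ld)" .
  qed
  also have "\<dots> = (\<integral>\<^sup>+s. (\<integral>\<^sup>+q. (\<integral>\<^sup>+c. (\<integral>\<^sup>+\<nu>. h s q \<nu> c \<partial>Lnoise) \<partial>Lc) \<partial>Ld) \<partial>cnormal p)"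
  proof (rule nn_integral_cong, rule nn_integral_cong)
    fix s q assume "q \<in> space Ld"
    from measurable_compose[OF measurable_Pair1'[OF this] h1[of s]]
    have "(\<lambda>(\<nu>, c). h s q \<nu> c) \<in> borel_measurable (Lnoise \<Otimes>\<^sub>M Lc)" by (simp add: case_prod_beta')
    then show "(\<integral>\<^sup>+\<nu>. (\<integral>\<^sup>+c. h s q \<nu> c \<partial>Lc) \<partial>Lnoise) = (\<integral>\<^sup>+c. (\<integral>\<^sup>+\<nu>. h s q \<nu> c \<partial>Lnoise) \<partial>Lc)"
      by (rule A.Fubini'[symmetric])
  qed
  also have "\<dots> = (\<integral>\<^sup>+s. (\<integral>\<^sup>+W. (\<integral>\<^sup>+\<nu>. h s (fst W) \<nu> (snd W) \<partial>Lnoise) \<partial>LW) \<partial>cnormal p)"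
  proof (rule nn_integral_cong)
    fix s :: complex
    have "(\<lambda>w. (fst (fst w), snd w, snd (fst w))) \<in> measurable (LW \<Otimes>\<^sub>M Lnoise) (Ld \<Otimes>\<^sub>M Lnoise \<Otimes>\<^sub>M Lc)" by measurable
    from measurable_compose[OF this h1[of s]]
    have "(\<lambda>W. \<integral>\<^sup>+\<nu>. h s (fst W) \<nu> (snd W) \<partial>Lnoise) \<in> borel_measurable LW"
      by (intro Lnoise.borel_measurable_nn_integral) (simp add: case_prod_beta')
    from Lc.nn_integral_fst[OF this]
    show "(\<integral>\<^sup>+q. (\<integral>\<^sup>+c. (\<integral>\<^sup>+\<nu>. h s q \<nu> c \<partial>Lnoise) \<partial>Lc) \<partial>Ld) = (\<integral>\<^sup>+W. (\<integral>\<^sup>+\<nu>. h s (fst W) \<nu> (snd W) \<partial>Lnoise) \<partial>LW)" by simp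
  qed
  finally show ?thesis by (simp add: h_def)
qed

lemma nn_integral_linear_J:
  "(\<integral>\<^sup>+q. ennreal ((cmod (t * fst q + (\<Sum>i<N. u i * snd q i)))^2) \<partial>J) = ennreal (V t u + (\<Sum>i<N. (cmod (u i))^2 * \<sigma>2))"
proof -
  have m: "(\<lambda>q. ennreal ((cmod (t * fst q + (\<Sum>i<N. u i * snd q i)))^2)) \<in> borel_measurable (borel \<Otimes>\<^sub>M cvec N)"
    by (intro measurable_compose[OF _ measurable_ennreal] borel_measurable_power measurable_compose[OF _ borel_measurable_norm] borel_measurable_add
       borel_measurable_sum borel_measurable_times borel_measurable_const measurable_compose[OF measurable_snd measurable_cvec_component]) auto
  define v where "v = (\<Sum>i<N. (cmod (u i))^2 * \<sigma>2)"
  have v: "0 \<le> v" unfolding v_def using \<sigma>2 by (auto intro!: sum_nonneg)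
  define H :: "complex \<times> (complex \<times> (nat \<Rightarrow> complex)) \<times> ('u \<Rightarrow> complex) \<Rightarrow> ennreal"
    where "H = (\<lambda>q. ennreal ((cmod (t * fst q + (\<Sum>i<N. u i * noise_free U x g (fst q) (snd q) i)))^2))"
  have mH: "H \<in> borel_measurable (cnormal p \<Otimes>\<^sub>M LW)"
  proof -
    have "H \<in> borel_measurable (borel \<Otimes>\<^sub>M ((borel \<Otimes>\<^sub>M cvec N) \<Otimes>\<^sub>M PiM U (\<lambda>_. borel)))"
      unfolding H_def by (intro measurable_compose[OF _ measurable_ennreal] borel_measurable_power measurable_compose[OF _ borel_measurable_norm] borel_measurable_add
         borel_measurable_sum borel_measurable_times borel_measurable_const borel_measurable_noise_free) auto
    then show ?thesis by (simp only: measurable_cong_sets[OF sets_pair_measure_cong[OF sets_cnormal sets_L(4)] refl])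
  qed
  interpret LW: prob_space LW by (rule prob_space_LW)
  have "(\<integral>\<^sup>+q. ennreal ((cmod (t * fst q + (\<Sum>i<N. u i * snd q i)))^2) \<partial>J) =
    (\<integral>\<^sup>+s. (\<integral>\<^sup>+W. (\<integral>\<^sup>+y. ennreal ((cmod ((t * s + (\<Sum>i<N. u i * noise_free U x g s W i)) + (\<Sum>i<N. u i * y i)))^2) \<partial>Lnoise) \<partial>LW) \<partial>cnormal p)"
    unfolding nn_integral_J[OF m] by (simp add: sum.distrib algebra_simps)
  also have "\<dots> = (\<integral>\<^sup>+s. (\<integral>\<^sup>+W. H (s, W) + ennreal v \<partial>LW) \<partial>cnormal p)"
  proof (rule nn_integral_cong, rule nn_integral_cong)
    fix s W
    show "(\<integral>\<^sup>+y. ennreal ((cmod ((t * s + (\<Sum>i<N. u i * noise_free U x g s W i)) + (\<Sum>i<N. u i * y i)))^2) \<partial>Lnoise) = H (s, W) + ennreal v"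
      using v \<sigma>2 unfolding v_def H_def
      by (subst nn_integral_PiM_linear[where v="\<lambda>_. \<sigma>2"]) (auto intro!: centered_cnormal)
  qed
  also have "\<dots> = (\<integral>\<^sup>+s. (\<integral>\<^sup>+W. H (s, W) \<partial>LW) + ennreal v \<partial>cnormal p)"
  proof (rule nn_integral_cong)
    fix s assume "s \<in> space (cnormal p)"
    from measurable_compose[OF measurable_Pair1'[OF this] mH]
    show "(\<integral>\<^sup>+W. H (s, W) + ennreal v \<partial>LW) = (\<integral>\<^sup>+W. H (s, W) \<partial>LW) + ennreal v"
      by (simp add: nn_integral_add LW.emeasure_space_1)
  qed
  also have "\<dots> = (\<integral>\<^sup>+s. (\<integral>\<^sup>+W. H (s, W) \<partial>LW) \<partial>cnormal p) + ennreal v"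
    using LW.borel_measurable_nn_integral[of "\<lambda>s W. H (s, W)"] mH by (simp add: nn_integral_add case_prod_beta')
  also have "(\<integral>\<^sup>+s. (\<integral>\<^sup>+W. H (s, W) \<partial>LW) \<partial>cnormal p) = ennreal (V t u)"
    unfolding H_def using nn_integral_linear_W[of t u] by simp
  finally show ?thesis using v V_nonneg[of t u] by (simp add: v_def)
qed

lemma uplink_mi_eq: "uplink_mi N U x g (cnormal p) L = KL_divergence 2 (cnormal p \<Otimes>\<^sub>M PY) J"
proof -
  interpret L: prob_space L by (rule prob_space_L)
  interpret P: pair_prob_space "cnormal p" L ..
  have "distr (cnormal p \<Otimes>\<^sub>M L) borel fst = distr (cnormal p \<Otimes>\<^sub>M L) (cnormal p) fst"
    by (intro distr_cong) auto
  also have "\<dots> = cnormal p" by (rule L.distr_pair_fst)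
  finally have 1: "distr (cnormal p \<Otimes>\<^sub>M L) borel fst = cnormal p" .
  show ?thesis
    unfolding uplink_mi_def P.P.mutual_information_def 1 J_def PY_def by (simp add: case_prod_beta')
qed

definition E0 :: real where "E0 = (\<Sum>i<N. V 0 (unitv i))"

lemma sum_unitv: "i < N \<Longrightarrow> (\<Sum>j<N. unitv i j * y j) = y i"
  using cdot_unitv[of i N y] by (simp add: cdot_def unitv_def if_distrib cong: if_cong)

text \<open>The linear estimate of the input is c v^H y. Its mean square error is p e: |1 - c
  \<open>\<alpha>\<close>|^2 is the mismatch of the signal, and |c|^2 q collects transmitter
  distortion, receiver distortion, interference and thermal noise.\<close>

theorem uplink_mi_ge:
  fixes v :: "nat \<Rightarrow> complex" and c :: complex
  assumes e0: "0 < e0"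
  defines "\<alpha> \<equiv> cdot N v x"
  defines "q \<equiv> \<kappa>t * (cmod \<alpha>)^2 + \<kappa>r * (\<Sum>i<N. (cmod (x i))^2 * (cmod (v i))^2) + (\<Sum>l\<in>U. (cmod (cdot N v (g l)))^2) + \<sigma>2 * (norm2 N v)^2 / p"
  defines "e \<equiv> (cmod (1 - c * \<alpha>))^2 + (cmod c)^2 * q"
  shows "(- ln e0 - e / e0 + 1) / ln 2 \<le> uplink_mi N U x g (cnormal p) L"
proof -
  have lmm: "(\<integral>\<^sup>+s. (\<integral>\<^sup>+W. ennreal ((norm2 N (noise_free U x g s W))^2) \<partial>LW) \<partial>cnormal p) = ennreal E0"
  proof -
    interpret LW: prob_space LW by (rule prob_space_LW)
    have mi: "(\<lambda>q. ennreal ((cmod (noise_free U x g (fst q) (snd q) i))^2)) \<in> borel_measurable (cnormal p \<Otimes>\<^sub>M LW)" if "i < N" for i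
    proof -
      have "(\<lambda>q. ennreal ((cmod (noise_free U x g (fst q) (snd q) i))^2)) \<in> borel_measurable (borel \<Otimes>\<^sub>M ((borel \<Otimes>\<^sub>M cvec N) \<Otimes>\<^sub>M PiM U (\<lambda>_. borel)))"
        by (intro measurable_compose[OF _ measurable_ennreal] borel_measurable_power measurable_compose[OF _ borel_measurable_norm] borel_measurable_noise_free that)
      then show ?thesis by (simp only: measurable_cong_sets[OF sets_pair_measure_cong[OF sets_cnormal sets_L(4)] refl])
    qed
    have mi1: "(\<lambda>W. ennreal ((cmod (noise_free U x g s W i))^2)) \<in> borel_measurable LW" if "i < N" for i s
      using measurable_compose[OF measurable_Pair1' mi[OF that], of s] by simp
    have mi2: "(\<lambda>s. \<integral>\<^sup>+W. ennreal ((cmod (noise_free U x g s W i))^2) \<partial>LW) \<in> borel_measurable (cnormal p)" if "i < N" for i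
      using mi[OF that] by (intro LW.borel_measurable_nn_integral) (simp add: case_prod_beta')
    have "(\<integral>\<^sup>+s. (\<integral>\<^sup>+W. ennreal ((norm2 N (noise_free U x g s W))^2) \<partial>LW) \<partial>cnormal p) =
      (\<integral>\<^sup>+s. (\<integral>\<^sup>+W. (\<Sum>i<N. ennreal ((cmod (noise_free U x g s W i))^2)) \<partial>LW) \<partial>cnormal p)"
      by (simp add: norm2_squared)
    also have "\<dots> = (\<integral>\<^sup>+s. (\<Sum>i<N. \<integral>\<^sup>+W. ennreal ((cmod (noise_free U x g s W i))^2) \<partial>LW) \<partial>cnormal p)"
      using mi1 by (intro nn_integral_cong nn_integral_sum) auto
    also have "\<dots> = (\<Sum>i<N. \<integral>\<^sup>+s. (\<integral>\<^sup>+W. ennreal ((cmod (noise_free U x g s W i))^2) \<partial>LW) \<partial>cnormal p)"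
      using mi2 by (intro nn_integral_sum) auto
    also have "\<dots> = (\<Sum>i<N. ennreal (V 0 (unitv i)))"
    proof (intro sum.cong refl)
      fix i assume "i \<in> {..<N}"
      then show "(\<integral>\<^sup>+s. (\<integral>\<^sup>+W. ennreal ((cmod (noise_free U x g s W i))^2) \<partial>LW) \<partial>cnormal p) = ennreal (V 0 (unitv i))"
        using nn_integral_linear_W[of 0 "unitv i"] by (simp add: sum_unitv)
    qed
    also have "\<dots> = ennreal E0" unfolding E0_def using V_nonneg by (subst sum_ennreal) auto
    finally show ?thesis .
  qed
  have E0: "0 \<le> E0" unfolding E0_def by (intro sum_nonneg V_nonneg)
  interpret awgn N p \<sigma>2 E0 LW "noise_free U x g" J PY
  proof (intro awgn.intro)
    show "0 < p" "0 < \<sigma>2" "0 \<le> E0" by (rule p \<sigma>2 E0)+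
    show "prob_space LW" by (rule prob_space_LW)
    show "(\<lambda>q. noise_free U x g (fst q) (snd q) i) \<in> borel_measurable (borel \<Otimes>\<^sub>M LW)" if "i < N" for i
      using borel_measurable_noise_free[OF that] by (simp only: measurable_cong_sets[OF sets_pair_measure_cong[OF refl sets_L(4)] refl])
    show "sets J = sets (borel \<Otimes>\<^sub>M cvec N)" "sets PY = sets (cvec N)" by (simp_all add: J_def PY_def)
    show "(\<integral>\<^sup>+q. f q \<partial>J) = (\<integral>\<^sup>+s. (\<integral>\<^sup>+W. (\<integral>\<^sup>+y. f (s, \<lambda>i\<in>{..<N}. noise_free U x g s W i + y i) \<partial>Lnoise) \<partial>LW) \<partial>cnormal p)"
      if "f \<in> borel_measurable (borel \<Otimes>\<^sub>M cvec N)" for f by (rule nn_integral_J[OF that])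
    show "(\<integral>\<^sup>+y. f y \<partial>PY) = (\<integral>\<^sup>+q. f (snd q) \<partial>J)" if f: "f \<in> borel_measurable (cvec N)" for f
      unfolding PY_def J_def using f measurable_compose[OF measurable_snd f, of borel]
      by (simp add: nn_integral_distr[OF measurable_received_L] nn_integral_distr[OF measurable_pair_L])
    show "(\<integral>\<^sup>+s. (\<integral>\<^sup>+W. ennreal ((norm2 N (noise_free U x g s W))^2) \<partial>LW) \<partial>cnormal p) \<le> ennreal E0"
      by (simp add: lmm)
  qed
  have y2: "(\<integral>\<^sup>+q. ennreal ((norm2 N (snd q))^2) \<partial>J) < \<top>"
  proof -
    have mi: "(\<lambda>q. ennreal ((cmod (snd q i))^2)) \<in> borel_measurable J" if "i < N" for i
      unfolding J_def measurable_distr_eq1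
      by (intro measurable_compose[OF _ measurable_ennreal] borel_measurable_power measurable_compose[OF _ borel_measurable_norm]
         measurable_compose[OF measurable_snd measurable_cvec_component] that)
    have "(\<integral>\<^sup>+q. ennreal ((norm2 N (snd q))^2) \<partial>J) = (\<Sum>i<N. \<integral>\<^sup>+q. ennreal ((cmod (snd q i))^2) \<partial>J)"
      unfolding norm2_squared using mi by (subst nn_integral_sum[symmetric]) auto
    also have "\<dots> = (\<Sum>i<N. ennreal (V 0 (unitv i) + (\<Sum>j<N. (cmod (unitv i j))^2 * \<sigma>2)))"
    proof (intro sum.cong refl)
      fix i assume "i \<in> {..<N}"
      then show "(\<integral>\<^sup>+q. ennreal ((cmod (snd q i))^2) \<partial>J) = ennreal (V 0 (unitv i) + (\<Sum>j<N. (cmod (unitv i j))^2 * \<sigma>2))"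
        using nn_integral_linear_J[of 0 "unitv i"] by (simp add: sum_unitv)
    qed
    also have "\<dots> < \<top>" by (simp add: ennreal_sum_less_top)
    finally show ?thesis .
  qed
  have s2: "(\<integral>\<^sup>+q. ennreal ((cmod (fst q))^2) \<partial>J) = ennreal p"
    using nn_integral_linear_J[of 1 "\<lambda>_. 0"] by (simp add: V_def)
  have q0: "0 \<le> q" unfolding q_def using nonneg p \<sigma>2 by (intro add_nonneg_nonneg mult_nonneg_nonneg sum_nonneg) auto
  have ee: "(\<integral>\<^sup>+qq. ennreal ((cmod (fst qq - (\<Sum>i<N. (c * cnj (v i)) * snd qq i)))^2) \<partial>J) = ennreal (p * e)"
  proof -
    have cs: "(\<Sum>i<N. - (c * cnj (v i)) * y i) = - (c * cdot N v y)" for y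
      by (simp add: cdot_def sum_distrib_left sum_negf mult.assoc)
    have "V 1 (\<lambda>i. - (c * cnj (v i))) + (\<Sum>i<N. (cmod (- (c * cnj (v i))))^2 * \<sigma>2) = p * e"
    proof -
      have "(\<Sum>i<N. (cmod (- (c * cnj (v i))))^2 * (\<kappa>r * p * (cmod (x i))^2)) = (cmod c)^2 * (p * (\<kappa>r * (\<Sum>i<N. (cmod (x i))^2 * (cmod (v i))^2)))"
        by (simp add: norm_mult power_mult_distrib sum_distrib_left mult_ac)
      moreover have "(\<Sum>i<N. (cmod (- (c * cnj (v i))))^2 * \<sigma>2) = (cmod c)^2 * (\<sigma>2 * (norm2 N v)^2)"
        by (simp add: norm_mult power_mult_distrib norm2_squared sum_distrib_left mult_ac)
      moreover have "(\<Sum>l\<in>U. (cmod (- (c * cdot N v (g l))))^2 * p) = (cmod c)^2 * (p * (\<Sum>l\<in>U. (cmod (cdot N v (g l)))^2))"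
        by (simp add: norm_mult power_mult_distrib sum_distrib_left mult_ac)
      moreover have "p * (\<sigma>2 * (norm2 N v)^2 / p) = \<sigma>2 * (norm2 N v)^2" using p by simp
      ultimately show ?thesis
        using p unfolding V_def cs \<alpha>_def[symmetric] e_def q_def
        by (simp add: norm_mult power_mult_distrib algebra_simps)
    qed
    then show ?thesis
      using nn_integral_linear_J[of 1 "\<lambda>i. - (c * cnj (v i))"] by (simp add: sum_negf)
  qed
  have "0 \<le> e" unfolding e_def using q0 by simp
  from KL_divergence_ge[OF y2 s2 ee this e0] show ?thesis by (simp add: uplink_mi_eq)
qed

end

section \<open>The capacity dominates the bound\<close>

text \<open>\<open>ennreal\<close> cuts off negative values, so the right side integrates the
  positive part. This matters because the lower bound on the mutual information can be negative at
  single realizations.\<close>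

lemma ennreal_integral_le_nn_integral:
  fixes f :: "'a \<Rightarrow> real"
  assumes "integrable M f"
  shows "ennreal (\<integral>x. f x \<partial>M) \<le> (\<integral>\<^sup>+x. ennreal (f x) \<partial>M)"
proof -
  have I: "integrable M (\<lambda>x. max 0 (f x))" using assms by simp
  have "(\<integral>x. f x \<partial>M) \<le> (\<integral>x. max 0 (f x) \<partial>M)" by (intro integral_mono assms I) simp
  then have "ennreal (\<integral>x. f x \<partial>M) \<le> ennreal (\<integral>x. max 0 (f x) \<partial>M)" by (rule ennreal_leI)
  also have "\<dots> = (\<integral>\<^sup>+x. ennreal (max 0 (f x)) \<partial>M)" using I by (subst nn_integral_eq_integral) auto
  also have "\<dots> = (\<integral>\<^sup>+x. ennreal (f x) \<partial>M)" by (intro nn_integral_cong) (simp add: max_def ennreal_neg)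
  finally show ?thesis .
qed

lemma const_input_law: "0 \<le> p \<Longrightarrow> (\<lambda>_. cnormal p) \<in> input_laws SUE p"
proof -
  assume p: "0 \<le> p"
  have "(\<integral>\<^sup>+s. ennreal ((cmod s)^2) \<partial>cnormal p) = ennreal p"
    using centeredD(4)[OF centered_cnormal[OF p], of 0 1] by simp
  moreover have "(\<lambda>_. cnormal p) \<in> measurable SUE (prob_algebra borel)"
    by (intro measurable_const) (simp add: space_prob_algebra prob_space_cnormal)
  ultimately show ?thesis by (simp add: input_laws_def)
qed

lemma interference_form:
  fixes hl :: "'u \<Rightarrow> nat \<Rightarrow> complex"
  assumes U: "finite U"
  shows "Re (cdot N v (mat_app (Matrix.mat N N (\<lambda>(i, j). complex_of_real p * (\<Sum>l\<in>U. hl l i * cnj (hl l j))) + complex_of_real s \<cdot>\<^sub>m 1\<^sub>m N) v)) =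
    p * (\<Sum>l\<in>U. (cmod (cdot N (hl l) v))^2) + s * (norm2 N v)^2"
proof -
  define B where "B = Matrix.mat N N (\<lambda>(i, j). complex_of_real p * (\<Sum>l\<in>U. hl l i * cnj (hl l j))) + complex_of_real s \<cdot>\<^sub>m 1\<^sub>m N"
  have Bc: "B \<in> carrier_mat N N" by (simp add: B_def)
  have Be: "B $$ (i, j) = complex_of_real p * (\<Sum>l\<in>U. hl l i * cnj (hl l j)) + (if i = j then complex_of_real s else 0)"
    if "i < N" "j < N" for i j using that by (simp add: B_def)
  have "cdot N v (mat_app B v) = (\<Sum>i<N. \<Sum>j<N. cnj (v i) * B $$ (i, j) * v j)"
    using sform_eq[OF Bc] by (simp add: sform_def)
  also have "\<dots> = (\<Sum>i<N. \<Sum>j<N. complex_of_real p * (\<Sum>l\<in>U. (cnj (v i) * hl l i) * (cnj (hl l j) * v j)) + (if i = j then complex_of_real s * (cnj (v i) * v j) else 0))"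
    by (intro sum.cong refl) (simp add: Be algebra_simps sum_distrib_left)
  also have "\<dots> = complex_of_real p * (\<Sum>i<N. \<Sum>j<N. \<Sum>l\<in>U. (cnj (v i) * hl l i) * (cnj (hl l j) * v j)) + complex_of_real s * (\<Sum>i<N. cnj (v i) * v i)"
    by (simp add: sum.distrib sum_distrib_left)
  also have "(\<Sum>i<N. \<Sum>j<N. \<Sum>l\<in>U. (cnj (v i) * hl l i) * (cnj (hl l j) * v j)) = (\<Sum>l\<in>U. cdot N v (hl l) * cdot N (hl l) v)"
  proof -
    have "(\<Sum>i<N. \<Sum>j<N. \<Sum>l\<in>U. (cnj (v i) * hl l i) * (cnj (hl l j) * v j)) = (\<Sum>i<N. \<Sum>l\<in>U. \<Sum>j<N. (cnj (v i) * hl l i) * (cnj (hl l j) * v j))"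
      by (intro sum.cong refl sum.swap)
    also have "\<dots> = (\<Sum>l\<in>U. \<Sum>i<N. \<Sum>j<N. (cnj (v i) * hl l i) * (cnj (hl l j) * v j))" by (rule sum.swap)
    finally show ?thesis by (simp add: cdot_def sum_product)
  qed
  also have "(\<Sum>l\<in>U. cdot N v (hl l) * cdot N (hl l) v) = complex_of_real (\<Sum>l\<in>U. (cmod (cdot N (hl l) v))^2)"
    unfolding of_real_sum complex_norm_square by (intro sum.cong refl) (simp add: cdot_cnj mult.commute)
  also have "(\<Sum>i<N. cnj (v i) * v i) = complex_of_real ((norm2 N v)^2)"
    using cdot_self[of N v] by (simp add: cdot_def)
  finally have "cdot N v (mat_app B v) = complex_of_real (p * (\<Sum>l\<in>U. (cmod (cdot N (hl l) v))^2) + s * (norm2 N v)^2)" by simp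
  then show ?thesis unfolding B_def by (simp only: Re_complex_of_real)
qed

text \<open>The second bound is Cauchy-Schwarz together with |v_i|^4 <= |v_i|^2, so that the fourth
  powers of v sum to at most 1.\<close>

lemma norm2_unit_sum_le:
  assumes "norm2 N v \<le> 1"
  shows "(\<Sum>i<N. (cmod (x i))^2 * (cmod (v i))^2) \<le> (norm2 N x)^2"
    and "(\<Sum>i<N. (cmod (x i))^2 * (cmod (v i))^2) \<le> sqrt (\<Sum>i<N. (cmod (x i)) ^ 4)"
    and "i < N \<Longrightarrow> cmod (v i) \<le> 1"
proof -
  have v1: "cmod (v i) \<le> 1" if "i < N" for i using norm_component_le[OF that, of v] assms by simp
  then show "i < N \<Longrightarrow> cmod (v i) \<le> 1" .
  have v2: "(cmod (v i))^2 \<le> 1" if "i < N" for i using v1[OF that] by (intro power_le_one) auto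
  show "(\<Sum>i<N. (cmod (x i))^2 * (cmod (v i))^2) \<le> (norm2 N x)^2"
    unfolding norm2_squared using v2 by (intro sum_mono mult_left_le) auto
  have "(\<Sum>i<N. (cmod (v i)) ^ 4) \<le> (\<Sum>i<N. (cmod (v i))^2)"
    using v1 by (intro sum_mono power_decreasing) auto
  also have "\<dots> \<le> 1" unfolding norm2_squared[symmetric] using assms by (intro power_le_one) auto
  finally have v4: "sqrt (\<Sum>i<N. (cmod (v i)) ^ 4) \<le> 1" by simp
  have "(\<Sum>i<N. (cmod (x i))^2 * (cmod (v i))^2) = (\<Sum>i<N. \<bar>(cmod (x i))^2\<bar> * \<bar>(cmod (v i))^2\<bar>)" by simp
  also have "\<dots> \<le> L2_set (\<lambda>i. (cmod (x i))^2) {..<N} * L2_set (\<lambda>i. (cmod (v i))^2) {..<N}" by (rule L2_set_mult_ineq)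
  also have "\<dots> = sqrt (\<Sum>i<N. (cmod (x i)) ^ 4) * sqrt (\<Sum>i<N. (cmod (v i)) ^ 4)"
    unfolding L2_set_def by (simp flip: power_mult)
  also have "\<dots> \<le> sqrt (\<Sum>i<N. (cmod (x i)) ^ 4) * 1" using v4 by (intro mult_left_mono) (auto intro: sum_nonneg)
  finally show "(\<Sum>i<N. (cmod (x i))^2 * (cmod (v i))^2) \<le> sqrt (\<Sum>i<N. (cmod (x i)) ^ 4)" by simp
qed

section \<open>Averaging over the channel realizations\<close>

locale combining =
  fixes M :: "'a measure" and N :: nat and U :: "'u set" and h v :: "'a \<Rightarrow> nat \<Rightarrow> complex"
    and hl :: "'u \<Rightarrow> 'a \<Rightarrow> nat \<Rightarrow> complex" and p \<sigma>2 \<kappa>t \<kappa>r :: real and Q :: "'a \<Rightarrow> complex mat"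
  assumes M: "prob_space M" and U: "finite U" and p: "0 < p" and \<sigma>2: "0 < \<sigma>2" and nonneg: "0 \<le> \<kappa>t" "0 \<le> \<kappa>r"
    and mh: "\<And>i. i < N \<Longrightarrow> (\<lambda>x. h x i) \<in> borel_measurable M"
    and mv: "\<And>i. i < N \<Longrightarrow> (\<lambda>x. v x i) \<in> borel_measurable M"
    and mhl: "\<And>l i. l \<in> U \<Longrightarrow> i < N \<Longrightarrow> (\<lambda>x. hl l x i) \<in> borel_measurable M"
    and h2: "integrable M (\<lambda>x. (norm2 N (h x))^2)" and hl2: "\<And>l. l \<in> U \<Longrightarrow> integrable M (\<lambda>x. (norm2 N (hl l x))^2)"
    and v: "\<And>x. norm2 N (v x) \<le> 1"
    and Q: "\<And>x. Q x = Matrix.mat N N (\<lambda>(i, j). complex_of_real p * (\<Sum>l\<in>U. hl l x i * cnj (hl l x j)))"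
begin

sublocale prob_space M by (rule M)

definition X where "X x = cdot N (h x) (v x)"
definition Hv where "Hv x = (\<Sum>i<N. (cmod (h x i))^2 * (cmod (v x i))^2)"
definition Il where "Il l x = (cmod (cdot N (hl l x) (v x)))^2"

lemma v2: "(norm2 N (v x))^2 \<le> 1"
  using v by (intro power_le_one) auto

lemma integrables:
  "integrable M X" "integrable M (\<lambda>s. (cmod (X s))^2)" "integrable M Hv" "\<And>l. l \<in> U \<Longrightarrow> integrable M (Il l)"
  "integrable M (\<lambda>s. (norm2 N (v s))^2)" "\<And>i. i < N \<Longrightarrow> integrable M (\<lambda>s. (cmod (h s i))^2 * (cmod (v s i))^2)"
proof -
  have mX[measurable]: "X \<in> borel_measurable M" unfolding X_def[abs_def] by (intro borel_measurable_cdot mh mv)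
  have le: "(cmod (cdot N x (v s)))^2 \<le> (norm2 N x)^2" for x s
    by (rule order_trans[OF cmod_cdot_squared_le]) (simp add: mult_left_le v2)
  have leX: "(cmod (X s))^2 \<le> (norm2 N (h s))^2" for s unfolding X_def by (rule le)
  show X2: "integrable M (\<lambda>s. (cmod (X s))^2)"
    by (rule Bochner_Integration.integrable_bound[OF h2]) (use leX in auto)
  show "integrable M X"
  proof (rule Bochner_Integration.integrable_bound[of _ "\<lambda>s. 1 + (cmod (X s))^2"])
    have "cmod y \<le> 1 + (cmod y)^2" for y :: complex
      using zero_le_power2[of "cmod y - 1"] norm_ge_zero[of y] unfolding power2_diff by (simp add: algebra_simps del: norm_ge_zero)
    then show "AE s in M. norm (X s) \<le> norm (1 + (cmod (X s))^2)" by (auto intro!: AE_I2)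
  qed (use X2 in auto)
  show I: "integrable M (\<lambda>s. (cmod (h s i))^2 * (cmod (v s i))^2)" if i: "i < N" for i
  proof (rule Bochner_Integration.integrable_bound[OF h2])
    show "(\<lambda>s. (cmod (h s i))^2 * (cmod (v s i))^2) \<in> borel_measurable M" using mh[OF i] mv[OF i] by measurable
    have "(cmod (h s i))^2 * (cmod (v s i))^2 \<le> (norm2 N (h s))^2" for s
    proof -
      have "(cmod (h s i))^2 * (cmod (v s i))^2 \<le> (\<Sum>i<N. (cmod (h s i))^2 * (cmod (v s i))^2)"
        using i by (intro member_le_sum) auto
      then show ?thesis using norm2_unit_sum_le(1)[OF v[of s], of "h s"] by simp
    qed
    then show "AE s in M. norm ((cmod (h s i))^2 * (cmod (v s i))^2) \<le> norm ((norm2 N (h s))^2)" by (auto intro!: AE_I2)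
  qed
  show "integrable M Hv" unfolding Hv_def[abs_def] using I by (intro Bochner_Integration.integrable_sum) auto
  show "integrable M (Il l)" if l: "l \<in> U" for l
    by (rule Bochner_Integration.integrable_bound[OF hl2[OF l]])
       (use l in \<open>auto simp: Il_def[abs_def] le intro!: borel_measurable_power measurable_compose[OF _ borel_measurable_norm] borel_measurable_cdot mhl mv\<close>)
  show "integrable M (\<lambda>s. (norm2 N (v s))^2)"
    by (rule Bochner_Integration.integrable_bound[of _ "\<lambda>_. 1 :: real"])
       (use v2 in \<open>auto intro!: AE_I2 borel_measurable_power borel_measurable_norm2 mv\<close>)
qed

definition Den where
  "Den = (1 + \<kappa>t) * (\<integral>x. (cmod (X x))^2 \<partial>M) - (cmod (\<integral>x. X x \<partial>M))^2 + \<kappa>r * (\<integral>x. Hv x \<partial>M)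
    + (\<Sum>l\<in>U. \<integral>x. Il l x \<partial>M) + \<sigma>2 * (\<integral>x. (norm2 N (v x))^2 \<partial>M) / p"

lemma uplink_lower_bound_eq:
  "uplink_lower_bound Tdata Tcoher M N p \<kappa>t \<kappa>r \<sigma>2 Q h v =
    Tdata / Tcoher * log 2 (1 + (cmod (\<integral>x. X x \<partial>M))^2 / Den)"
proof -
  have "(\<integral>x. Re (cdot N (v x) (mat_app (Q x + complex_of_real \<sigma>2 \<cdot>\<^sub>m 1\<^sub>m N) (v x))) \<partial>M) =
      (\<integral>x. p * (\<Sum>l\<in>U. Il l x) + \<sigma>2 * (norm2 N (v x))^2 \<partial>M)"
    unfolding Q interference_form[OF U] Il_def ..
  also have "\<dots> = p * (\<Sum>l\<in>U. \<integral>x. Il l x \<partial>M) + \<sigma>2 * (\<integral>x. (norm2 N (v x))^2 \<partial>M)"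
    using integrables by simp
  finally have 1: "(\<integral>x. Re (cdot N (v x) (mat_app (Q x + complex_of_real \<sigma>2 \<cdot>\<^sub>m 1\<^sub>m N) (v x))) \<partial>M) / p =
      (\<Sum>l\<in>U. \<integral>x. Il l x \<partial>M) + \<sigma>2 * (\<integral>x. (norm2 N (v x))^2 \<partial>M) / p"
    using p by (simp add: add_divide_distrib)
  have 2: "(\<Sum>i<N. \<integral>x. (cmod (h x i))^2 * (cmod (v x i))^2 \<partial>M) = (\<integral>x. Hv x \<partial>M)"
    unfolding Hv_def using integrables(6) by (subst Bochner_Integration.integral_sum) auto
  show ?thesis
    unfolding uplink_lower_bound_def 1 2 X_def[symmetric] Den_def by (simp add: add.assoc)
qed

text \<open>The supremum over inputs is at least the Gaussian value, which
  \<open>uplink_mi_ge\<close> bounds with the same \<open>c\<close> and \<open>e0\<close> at every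
  realization. Since the mean of \<open>e c\<close> is \<open>e0\<close>, the terms - e / e0 + 1
  average to 0 and - ln e0 = ln (B / Den) is left.\<close>

theorem uplink_capacity_ge:
  assumes T: "0 \<le> Tdata" "0 < Tcoher"
    and D: "\<And>l. l \<in> U \<Longrightarrow> centered (D l) p" and K: "K = (\<lambda>(x, _, _, _). disturbance_law N U \<kappa>t \<kappa>r p \<sigma>2 D x)"
    and g: "\<And>y l. l \<in> U \<Longrightarrow> g y l = hl l y"
  shows "ennreal (uplink_lower_bound Tdata Tcoher M N p \<kappa>t \<kappa>r \<sigma>2 Q h v) \<le>
    uplink_capacity Tdata Tcoher M N U p SUE K h g hBS hUE"
proof -
  define \<mu> where "\<mu> = (\<integral>y. X y \<partial>M)"
  define q where "q = (\<lambda>y. \<kappa>t * (cmod (X y))^2 + \<kappa>r * Hv y + (\<Sum>l\<in>U. Il l y) + \<sigma>2 * (norm2 N (v y))^2 / p)"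
  have q0: "0 \<le> q y" for y
    unfolding q_def Hv_def Il_def using nonneg p \<sigma>2 by (intro add_nonneg_nonneg sum_nonneg mult_nonneg_nonneg divide_nonneg_pos) auto
  have Iq: "integrable M q" unfolding q_def[abs_def] using integrables by simp
  define B where "B = (\<integral>y. (cmod (X y))^2 \<partial>M) + (\<integral>y. q y \<partial>M)"
  have Eq: "(\<integral>y. q y \<partial>M) = \<kappa>t * (\<integral>y. (cmod (X y))^2 \<partial>M) + \<kappa>r * (\<integral>y. Hv y \<partial>M) + (\<Sum>l\<in>U. \<integral>y. Il l y \<partial>M) + \<sigma>2 * (\<integral>y. (norm2 N (v y))^2 \<partial>M) / p"
    unfolding q_def using integrables by simp
  have Den: "Den = B - (cmod \<mu>)^2" unfolding Den_def B_def Eq \<mu>_def by (simp add: algebra_simps)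
  define e where "e = (\<lambda>c y. (cmod (1 - c * cnj (X y)))^2 + (cmod c)^2 * q y)"
  have e_eq: "e c y = 1 - 2 * Re (cnj c * X y) + (cmod c)^2 * ((cmod (X y))^2 + q y)" for c y
    using cmod_add_squared[of 1 "- (c * cnj (X y))"] unfolding e_def
    by (simp add: norm_mult power_mult_distrib algebra_simps)
  have Ie: "integrable M (e c)" for c
    unfolding e_eq[abs_def] using integrables(1,2) Iq
    by (intro Bochner_Integration.integrable_add Bochner_Integration.integrable_diff integrable_mult_right integrable_Re) auto
  have Ee: "(\<integral>y. e c y \<partial>M) = 1 - 2 * Re (cnj c * \<mu>) + (cmod c)^2 * B" for c
  proof -
    have "(\<integral>y. Re (cnj c * X y) \<partial>M) = Re (cnj c * \<mu>)"
      unfolding \<mu>_def using integrables(1) by (subst integral_Re) auto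
    moreover have "integrable M (\<lambda>y. Re (cnj c * X y))" using integrables(1) by (intro integrable_Re) auto
    ultimately show ?thesis
      unfolding e_eq B_def using integrables(2) Iq
      by (simp only: Bochner_Integration.integral_add Bochner_Integration.integral_diff Bochner_Integration.integrable_add
          Bochner_Integration.integrable_diff integrable_mult_right integrable_const Bochner_Integration.integral_mult_right)
         (simp add: prob_space)
  qed
  show ?thesis
  proof (cases "\<mu> = 0 \<or> Den \<le> 0")
    case True
    \<comment> \<open>The degenerate case. The averaged error at \<open>c\<close> = t
      \<open>\<mu>\<close> is a nonnegative polynomial in t, which yields |\<open>\<mu>\<close>|^2
      <= B, so \<open>Den\<close> cannot be negative. Division by 0 gives 0, and the bound collapses
      to log 1.\<close>
    have "Den = 0" if "\<mu> \<noteq> 0"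
    proof (rule antisym)
      show "Den \<le> 0" using True that by simp
      have "(cmod \<mu>)^2 \<le> B"
      proof -
        have "0 \<le> (\<integral>y. e (of_real t * \<mu>) y \<partial>M)" for t
          unfolding e_def using q0 by (intro integral_nonneg_AE) auto
        note ge0 = this
        have le: "0 \<le> 1 - 2 * t * (cmod \<mu>)^2 + t^2 * (cmod \<mu>)^2 * B" for t
        proof -
          have "Re (cnj (complex_of_real t * \<mu>) * \<mu>) = t * (cmod \<mu>)^2"
            unfolding cmod_power2 by (simp add: power2_eq_square algebra_simps)
          then show ?thesis
            using ge0[of t] unfolding Ee by (simp only: norm_mult power_mult_distrib norm_of_real power2_abs mult.assoc)
        qed
        have Bnn: "0 \<le> B" unfolding B_def using q0 by (intro add_nonneg_nonneg integral_nonneg_AE) auto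
        show ?thesis
        proof (cases "B = 0")
          case True
          have "0 \<le> 1 - 2 * (1 / (cmod \<mu>)^2) * (cmod \<mu>)^2" using le[of "1 / (cmod \<mu>)^2"] True by simp
          then show ?thesis using that by simp
        next
          case False
          then have Bp: "0 < B" using Bnn by simp
          have "0 \<le> 1 - (cmod \<mu>)^2 / B"
            using le[of "1 / B"] Bp by (simp add: power2_eq_square field_simps)
          then show "(cmod \<mu>)^2 \<le> B" using Bp by (simp add: field_simps)
        qed
      qed
      then show "0 \<le> Den" unfolding Den by simp
    qed
    then have z: "(cmod \<mu>)^2 / Den = 0" by (cases "\<mu> = 0") auto
    have "uplink_lower_bound Tdata Tcoher M N p \<kappa>t \<kappa>r \<sigma>2 Q h v = 0"
      by (simp only: uplink_lower_bound_eq \<mu>_def[symmetric] z) simp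
    then show ?thesis by simp
  next
    case False
    then have DenP: "0 < Den" and \<mu>0: "\<mu> \<noteq> 0" by auto
    have BP: "0 < B" using DenP unfolding Den using zero_le_power2[of "cmod \<mu>"] by linarith
    \<comment> \<open>The minimiser of the averaged error 1 - 2 Re (cnj c * \<open>\<mu>\<close>) +
      |c|^2 B; the minimum is 1 - |\<open>\<mu>\<close>|^2 / B = Den / B.\<close>
    define c where "c = \<mu> / complex_of_real B"
    define e0 where "e0 = Den / B"
    have e0: "0 < e0" unfolding e0_def using DenP BP by simp
    have Ee0: "(\<integral>y. e c y \<partial>M) = e0"
    proof -
      have "Re (cnj c * \<mu>) = (cmod \<mu>)^2 / B"
        unfolding c_def using Re_cnj_mult_self(1)[of \<mu>] by (simp add: Re_divide_of_real)
      moreover have "(cmod c)^2 * B = (cmod \<mu>)^2 / B"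
        unfolding c_def using BP by (simp add: norm_divide power_divide power2_eq_square)
      ultimately show ?thesis unfolding Ee e0_def Den using BP by (simp add: field_simps)
    qed
    define L where "L = (\<lambda>y. (- ln e0 - e c y / e0 + 1) / ln 2)"
    have IL: "integrable M L" unfolding L_def using Ie by simp
    have EL: "(\<integral>y. L y \<partial>M) = - ln e0 / ln 2"
      unfolding L_def using Ie[of c] Ee0 e0 by (simp add: prob_space)
    have pw: "L y \<le> uplink_mi N U (h y) (g y) (cnormal p) (K (h y, g y, hBS y, hUE y))" for y
    proof -
      interpret C: uplink_channel N U "h y" "g y" p \<sigma>2 \<kappa>t \<kappa>r D
        by (intro uplink_channel.intro U p \<sigma>2 nonneg D)
      have "cmod (cdot N (v y) (h y)) = cmod (X y)" unfolding X_def by (metis cdot_cnj complex_mod_cnj)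
      moreover have "(\<Sum>l\<in>U. (cmod (cdot N (v y) (g y l)))^2) = (\<Sum>l\<in>U. Il l y)"
        unfolding Il_def by (intro sum.cong refl) (metis cdot_cnj complex_mod_cnj g)
      moreover have "cdot N (v y) (h y) = cnj (X y)" unfolding X_def by (simp add: cdot_cnj)
      ultimately show ?thesis
        using C.uplink_mi_ge[OF e0, of c "v y"] unfolding L_def e_def q_def Hv_def K by simp
    qed
    have "(\<integral>y. L y \<partial>M) = log 2 (1 + (cmod \<mu>)^2 / Den)"
    proof -
      have "1 + (cmod \<mu>)^2 / Den = 1 / e0" unfolding e0_def using DenP BP Den by (simp add: field_simps)
      then show ?thesis unfolding EL log_def using e0 by (simp add: ln_div)
    qed
    then have "ennreal (uplink_lower_bound Tdata Tcoher M N p \<kappa>t \<kappa>r \<sigma>2 Q h v) = ennreal (Tdata / Tcoher) * ennreal (\<integral>y. L y \<partial>M)"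
      unfolding uplink_lower_bound_eq \<mu>_def[symmetric] using T by (subst ennreal_mult'[symmetric]) auto
    also have "\<dots> \<le> ennreal (Tdata / Tcoher) * (\<integral>\<^sup>+y. ennreal (L y) \<partial>M)"
      by (intro mult_left_mono ennreal_integral_le_nn_integral IL) auto
    also have "\<dots> \<le> uplink_capacity Tdata Tcoher M N U p SUE K h g hBS hUE"
      unfolding uplink_capacity_def
    proof (intro mult_left_mono nn_integral_mono)
      fix y
      have "ennreal (L y) \<le> ennreal (uplink_mi N U (h y) (g y) (cnormal p) (K (h y, g y, hBS y, hUE y)))"
        by (rule ennreal_leI[OF pw])
      also have "\<dots> \<le> (SUP f\<in>input_laws SUE p. ennreal (uplink_mi N U (h y) (g y) (f (hUE y)) (K (h y, g y, hBS y, hUE y))))"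
        using p by (intro SUP_upper2[OF const_input_law]) auto
      finally show "ennreal (L y) \<le> \<dots>" .
    qed simp
    finally show ?thesis .
  qed
qed

end

section \<open>Matrix estimates\<close>

lemma mult_mat_entry:
  assumes "A \<in> carrier_mat N N" "B \<in> carrier_mat N N" "i < N" "j < N"
  shows "(A * B) $$ (i, j) = (\<Sum>k<N. A $$ (i, k) * B $$ (k, j))"
  using assms by (simp add: scalar_prod_def lessThan_atLeast0)

lemma mat_app_mult:
  assumes "A \<in> carrier_mat N N" "B \<in> carrier_mat N N" "i < N"
  shows "mat_app (A * B) x i = mat_app A (mat_app B x) i"
proof -
  have "mat_app (A * B) x i = (\<Sum>j<N. \<Sum>k<N. A $$ (i, k) * B $$ (k, j) * x j)"
    unfolding mat_app_eq[OF mult_carrier_mat[OF assms(1,2)] assms(3)]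
    by (intro sum.cong refl) (simp add: mult_mat_entry[OF assms] sum_distrib_right del: index_mult_mat)
  also have "\<dots> = (\<Sum>k<N. \<Sum>j<N. A $$ (i, k) * B $$ (k, j) * x j)" by (rule sum.swap)
  also have "\<dots> = mat_app A (mat_app B x) i"
    unfolding mat_app_eq[OF assms(1,3)]
    by (intro sum.cong refl) (simp add: mat_app_eq[OF assms(2)] sum_distrib_left mult.assoc)
  finally show ?thesis .
qed

lemma mat_app_add_mat:
  "A \<in> carrier_mat N N \<Longrightarrow> B \<in> carrier_mat N N \<Longrightarrow> i < N \<Longrightarrow> mat_app (A + B) x i = mat_app A x i + mat_app B x i"
  by (subst mat_app_eq[OF add_carrier_mat]) (auto simp: mat_app_eq distrib_right sum.distrib)

lemma mat_app_smult_mat: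
  "A \<in> carrier_mat N N \<Longrightarrow> i < N \<Longrightarrow> mat_app (c \<cdot>\<^sub>m A) x i = c * mat_app A x i"
  by (subst mat_app_eq[OF smult_carrier_mat]) (auto simp: mat_app_eq sum_distrib_left mult.assoc intro!: sum.cong)

lemma mat_app_one: "i < N \<Longrightarrow> mat_app (1\<^sub>m N) x i = x i"
proof -
  assume i: "i < N"
  have "mat_app (1\<^sub>m N) x i = (\<Sum>j<N. if j = i then x j else 0)"
    unfolding mat_app_eq[OF one_carrier_mat i]
  proof (rule sum.cong[OF refl])
    fix j assume "j \<in> {..<N}"
    then show "1\<^sub>m N $$ (i, j) * x j = (if j = i then x j else 0)" using i by (cases "j = i") auto
  qed
  also have "\<dots> = x i" using i by (subst sum.delta) auto
  finally show ?thesis .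
qed

lemma Re_of_real_mult: "Re (complex_of_real c * z) = c * Re z"
  by simp

lemma norm2_zero: "(\<And>i. i < N \<Longrightarrow> x i = 0) \<Longrightarrow> norm2 N x = 0"
  by (simp add: norm2_def L2_set_def)

lemma norm2_eq_0: "norm2 N x = 0 \<Longrightarrow> i < N \<Longrightarrow> x i = 0"
  using norm_component_le[of i N x] by simp

text \<open>A real supremum is an upper bound only over a set that is bounded above; the Frobenius
  norm \<open>F\<close> supplies this. Vectors outside the unit ball are reached by scaling.\<close>

lemma opb_spectral_norm:
  assumes A: "A \<in> carrier_mat N N"
  shows "opb N A (spectral_norm A)"
proof -
  define F where "F = sqrt (\<Sum>i<N. (norm2 N (crow A i))^2)"
  have F: "norm2 N (mat_app A x) \<le> F * norm2 N x" for x
  proof (rule power2_le_imp_le)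
    have "(norm2 N (mat_app A x))^2 = (\<Sum>k<N. (cmod (cdot N (crow A k) x))^2)" by (rule sum_cdot_crow[OF A, symmetric])
    also have "\<dots> \<le> (\<Sum>k<N. (norm2 N (crow A k))^2 * (norm2 N x)^2)" by (intro sum_mono cmod_cdot_squared_le)
    also have "\<dots> = (F * norm2 N x)^2" by (simp add: F_def power_mult_distrib sum_nonneg sum_distrib_right)
    finally show "(norm2 N (mat_app A x))^2 \<le> (F * norm2 N x)^2" .
  qed (simp add: F_def sum_nonneg)
  have F0: "0 \<le> F" by (simp add: F_def sum_nonneg)
  define f where "f = (\<lambda>x. norm2 (dim_row A) (mat_app A x))"
  have d: "dim_row A = N" "dim_col A = N" using A by auto
  have bdd: "bdd_above (f ` {x. norm2 (dim_col A) x \<le> 1})"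
  proof (rule bdd_aboveI2)
    fix x assume "x \<in> {x. norm2 (dim_col A) x \<le> 1}"
    then have "norm2 N x \<le> 1" by (simp add: d)
    then show "f x \<le> F" unfolding f_def d using F[of x] mult_left_le[OF _ F0] by (meson order_trans)
  qed
  have up: "f x \<le> spectral_norm A" if "norm2 N x \<le> 1" for x
  proof -
    have "x \<in> {x. norm2 (dim_col A) x \<le> 1}" using that by (simp add: d)
    from cSUP_upper[OF this bdd] show ?thesis unfolding spectral_norm_def f_def .
  qed
  have "0 \<le> f (\<lambda>_. 0)" by (simp add: f_def)
  also have "\<dots> \<le> spectral_norm A" by (rule up) (simp add: norm2_zero)
  finally have s0: "0 \<le> spectral_norm A" .
  have "norm2 N (mat_app A x) \<le> spectral_norm A * norm2 N x" for x
  proof (cases "norm2 N x = 0")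
    case True
    then show ?thesis using F[of x] by simp
  next
    case False
    then have n: "0 < norm2 N x" using norm2_nonneg[of N x] by (simp add: less_le)
    define y where "y = (\<lambda>i. complex_of_real (1 / norm2 N x) * x i)"
    have "norm2 N y = 1" unfolding y_def norm2_scale using n by (simp add: norm_divide)
    then have "f y \<le> spectral_norm A" by (intro up) simp
    moreover have "f y = (1 / norm2 N x) * norm2 N (mat_app A x)"
    proof -
      have "f y = norm2 N (\<lambda>i. complex_of_real (1 / norm2 N x) * mat_app A x i)"
        unfolding f_def d y_def by (intro norm2_cong mat_app_scale[OF A])
      then show ?thesis unfolding norm2_scale using n by (simp add: norm_divide)
    qed
    ultimately show ?thesis using n by (simp add: field_simps)
  qed
  then show ?thesis using A s0 by (simp add: opb_def)
qed

lemma opb_mono: "opb N A c \<Longrightarrow> c \<le> c' \<Longrightarrow> opb N A c'"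
  unfolding opb_def using mult_right_mono[of c c' "norm2 N _"] by (meson norm2_nonneg order_trans)

lemma opb_add:
  assumes "opb N A a" "opb N B b"
  shows "opb N (A + B) (a + b)"
proof -
  have "norm2 N (mat_app (A + B) x) \<le> (a + b) * norm2 N x" for x
  proof -
    have "norm2 N (mat_app (A + B) x) = norm2 N (\<lambda>i. mat_app A x i + mat_app B x i)"
      by (intro norm2_cong mat_app_add_mat[OF opbD(1)[OF assms(1)] opbD(1)[OF assms(2)]])
    then show ?thesis
      using norm2_triangle[of N "mat_app A x" "mat_app B x"] opbD(3)[OF assms(1), of x] opbD(3)[OF assms(2), of x]
      by (simp add: distrib_right)
  qed
  then show ?thesis using opbD(1,2)[OF assms(1)] opbD(1,2)[OF assms(2)] by (auto simp: opb_def)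
qed

lemma opb_smult:
  assumes "opb N A a"
  shows "opb N (c \<cdot>\<^sub>m A) (cmod c * a)"
proof -
  have "norm2 N (mat_app (c \<cdot>\<^sub>m A) x) = cmod c * norm2 N (mat_app A x)" for x
    unfolding norm2_scale[symmetric] by (intro norm2_cong mat_app_smult_mat[OF opbD(1)[OF assms]])
  then show ?thesis using opbD(1-3)[OF assms] by (auto simp: opb_def mult.assoc intro: mult_left_mono)
qed

lemma opb_one: "opb N (1\<^sub>m N) 1"
proof -
  have "norm2 N (mat_app (1\<^sub>m N) x) = norm2 N x" for x by (intro norm2_cong mat_app_one)
  then show ?thesis by (simp add: opb_def)
qed

lemma opb_mult:
  assumes "opb N A a" "opb N B b"
  shows "opb N (A * B) (a * b)"
proof -
  have "norm2 N (mat_app (A * B) x) \<le> a * b * norm2 N x" for x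
  proof -
    have "norm2 N (mat_app (A * B) x) = norm2 N (mat_app A (mat_app B x))"
      by (intro norm2_cong mat_app_mult[OF opbD(1)[OF assms(1)] opbD(1)[OF assms(2)]])
    also have "\<dots> \<le> a * (b * norm2 N x)"
      using opbD(3)[OF assms(1)] opbD(3)[OF assms(2)] opbD(2)[OF assms(1)] by (meson mult_left_mono order_trans)
    finally show ?thesis by (simp add: mult.assoc)
  qed
  then show ?thesis using opbD(1,2)[OF assms(1)] opbD(1,2)[OF assms(2)] by (auto simp: opb_def)
qed

lemma opb_sum_mat:
  assumes "finite I" "\<And>l. l \<in> I \<Longrightarrow> opb N (B l) (b l)"
  shows "opb N (Matrix.mat N N (\<lambda>(i, j). c * (\<Sum>l\<in>I. B l $$ (i, j)))) (cmod c * (\<Sum>l\<in>I. b l))"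
  using assms
proof (induction I rule: finite_induct)
  case empty
  have "norm2 N (mat_app (Matrix.mat N N (\<lambda>(i, j). c * (\<Sum>l\<in>{}. B l $$ (i, j)))) x) = 0" for x
    by (rule norm2_zero, subst mat_app_eq[OF mat_carrier]) auto
  then show ?case unfolding opb_def by auto
next
  case (insert l I)
  have Bl: "B l \<in> carrier_mat N N" using opbD(1)[OF insert.prems[of l]] by simp
  have "Matrix.mat N N (\<lambda>(i, j). c * (\<Sum>l\<in>insert l I. B l $$ (i, j))) =
      c \<cdot>\<^sub>m B l + Matrix.mat N N (\<lambda>(i, j). c * (\<Sum>l\<in>I. B l $$ (i, j)))"
    using insert.hyps Bl by (intro eq_matI) (auto simp: algebra_simps)
  moreover have "opb N (c \<cdot>\<^sub>m B l + Matrix.mat N N (\<lambda>(i, j). c * (\<Sum>l\<in>I. B l $$ (i, j)))) (cmod c * b l + cmod c * (\<Sum>l\<in>I. b l))"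
    by (intro opb_add opb_smult insert.IH insert.prems) auto
  ultimately show ?case unfolding sum.insert[OF insert.hyps] distrib_left by (simp only: distrib_left)
qed

text \<open>A diagonal entry is e_i^H R e_i, hence at most r in modulus, and a diagonal matrix has
  the norm of its largest entry.\<close>

lemma opb_diag:
  assumes "opb N R r"
  shows "opb N (mat_diag N (\<lambda>i. R $$ (i, i))) r"
proof -
  have Rc: "R \<in> carrier_mat N N" "0 \<le> r" using opbD[OF assms] by auto
  have app: "mat_app (mat_diag N (\<lambda>i. R $$ (i, i))) x i = R $$ (i, i) * x i" if "i < N" for x i
  proof -
    have "mat_app (mat_diag N (\<lambda>i. R $$ (i, i))) x i = (\<Sum>j<N. if j = i then R $$ (i, i) * x j else 0)"
      unfolding mat_app_eq[OF mat_diag_dim that] using that by (intro sum.cong refl) (simp add: mat_diag_def)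
    then show ?thesis using that by simp
  qed
  have dr: "cmod (R $$ (i, i)) \<le> r" if "i < N" for i
    using sform_le[OF assms, of "unitv i" "unitv i"] that by (simp add: sform_unitv[OF Rc(1)] norm2_unitv)
  have "norm2 N (mat_app (mat_diag N (\<lambda>i. R $$ (i, i))) x) \<le> r * norm2 N x" for x
  proof (rule power2_le_imp_le)
    have "(norm2 N (mat_app (mat_diag N (\<lambda>i. R $$ (i, i))) x))^2 \<le> (\<Sum>i<N. r^2 * (cmod (x i))^2)"
      unfolding norm2_squared using dr
      by (intro sum_mono) (auto simp: app norm_mult power_mult_distrib intro!: mult_right_mono power_mono)
    then show "(norm2 N (mat_app (mat_diag N (\<lambda>i. R $$ (i, i))) x))^2 \<le> (r * norm2 N x)^2"
      by (simp add: norm2_squared power_mult_distrib sum_distrib_left)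
  qed (use Rc in simp)
  then show ?thesis using Rc by (simp add: opb_def)
qed

lemma cov_matI:
  assumes "C \<in> carrier_mat N N" "\<And>i j. i < N \<Longrightarrow> j < N \<Longrightarrow> C $$ (j, i) = cnj (C $$ (i, j))"
    "\<And>x. 0 \<le> Re (sform N C x x)"
  shows "cov_mat N C"
proof -
  have "mat_adjoint C = C"
  proof (rule eq_matI)
    fix i j assume "i < dim_row C" "j < dim_col C"
    then show "mat_adjoint C $$ (i, j) = C $$ (i, j)"
      using assms(1) assms(2)[of j i] by (simp add: mat_adjoint_def mat_of_rows_def)
  qed (use assms(1) in \<open>auto simp: mat_adjoint_def\<close>)
  then show ?thesis using assms by (simp add: cov_mat_def sform_def)
qed

lemma sform_add_mat:
  "A \<in> carrier_mat N N \<Longrightarrow> B \<in> carrier_mat N N \<Longrightarrow> sform N (A + B) u w = sform N A u w + sform N B u w"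
  unfolding sform_def cdot_def by (simp add: mat_app_add_mat distrib_left sum.distrib)

lemma sform_smult_mat: "A \<in> carrier_mat N N \<Longrightarrow> sform N (c \<cdot>\<^sub>m A) u w = c * sform N A u w"
  unfolding sform_def cdot_def by (simp add: mat_app_smult_mat sum_distrib_left mult_ac)

lemma sform_one: "sform N (1\<^sub>m N) u w = cdot N u w"
  unfolding sform_def cdot_def by (simp add: mat_app_one)

lemma sform_sum_mat:
  assumes "finite I" "\<And>l. l \<in> I \<Longrightarrow> B l \<in> carrier_mat N N"
  shows "sform N (Matrix.mat N N (\<lambda>(i, j). c * (\<Sum>l\<in>I. B l $$ (i, j)))) u w = c * (\<Sum>l\<in>I. sform N (B l) u w)"
proof -
  have "sform N (Matrix.mat N N (\<lambda>(i, j). c * (\<Sum>l\<in>I. B l $$ (i, j)))) u w = (\<Sum>i<N. \<Sum>j<N. \<Sum>l\<in>I. c * (cnj (u i) * B l $$ (i, j) * w j))"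
    by (subst sform_eq) (auto simp: sum_distrib_left sum_distrib_right mult_ac intro!: sum.cong)
  also have "\<dots> = (\<Sum>i<N. \<Sum>l\<in>I. \<Sum>j<N. c * (cnj (u i) * B l $$ (i, j) * w j))" by (intro sum.cong refl sum.swap)
  also have "\<dots> = (\<Sum>l\<in>I. \<Sum>i<N. \<Sum>j<N. c * (cnj (u i) * B l $$ (i, j) * w j))" by (rule sum.swap)
  also have "\<dots> = c * (\<Sum>l\<in>I. sform N (B l) u w)"
    using assms(2) by (simp add: sform_eq sum_distrib_left)
  finally show ?thesis .
qed

lemma sform_diag: "sform N (mat_diag N f) u w = (\<Sum>i<N. f i * (cnj (u i) * w i))"
proof -
  have "sform N (mat_diag N f) u w = (\<Sum>i<N. \<Sum>j<N. if j = i then f i * (cnj (u i) * w j) else 0)"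
    unfolding sform_eq[OF mat_diag_dim] by (intro sum.cong refl) (auto simp: mat_diag_def)
  then show ?thesis by simp
qed

lemma mtrace_conj:
  assumes A: "A \<in> carrier_mat N N" and B: "B \<in> carrier_mat N N"
  shows "mtrace (A * B * mat_adjoint A) = (\<Sum>k<N. sform N B (crow A k) (crow A k))"
proof -
  have adj: "mat_adjoint A \<in> carrier_mat N N" using A by (auto simp: mat_adjoint_def)
  have AB: "A * B \<in> carrier_mat N N" by (rule mult_carrier_mat[OF A B])
  have "mtrace (A * B * mat_adjoint A) = (\<Sum>k<N. (A * B * mat_adjoint A) $$ (k, k))"
    unfolding mtrace_def using carrier_matD[OF A] by simp
  also have "\<dots> = (\<Sum>k<N. \<Sum>j<N. (\<Sum>i<N. A $$ (k, i) * B $$ (i, j)) * cnj (A $$ (k, j)))"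
  proof (intro sum.cong refl)
    fix k assume "k \<in> {..<N}"
    then have k: "k < N" by simp
    have "(A * B * mat_adjoint A) $$ (k, k) = (\<Sum>j<N. (A * B) $$ (k, j) * mat_adjoint A $$ (j, k))"
      by (rule mult_mat_entry[OF AB adj k k])
    also have "\<dots> = (\<Sum>j<N. (\<Sum>i<N. A $$ (k, i) * B $$ (i, j)) * cnj (A $$ (k, j)))"
    proof (intro sum.cong refl)
      fix j assume "j \<in> {..<N}"
      then have j: "j < N" by simp
      show "(A * B) $$ (k, j) * mat_adjoint A $$ (j, k) = (\<Sum>i<N. A $$ (k, i) * B $$ (i, j)) * cnj (A $$ (k, j))"
        unfolding mult_mat_entry[OF A B k j] using carrier_matD[OF A] k j by (simp add: mat_adjoint_def mat_of_rows_def)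
    qed
    finally show "(A * B * mat_adjoint A) $$ (k, k) = (\<Sum>j<N. (\<Sum>i<N. A $$ (k, i) * B $$ (i, j)) * cnj (A $$ (k, j)))" .
  qed
  also have "\<dots> = (\<Sum>k<N. sform N B (crow A k) (crow A k))"
  proof (intro sum.cong refl)
    fix k
    show "(\<Sum>j<N. (\<Sum>i<N. A $$ (k, i) * B $$ (i, j)) * cnj (A $$ (k, j))) = sform N B (crow A k) (crow A k)"
      unfolding sform_eq[OF B] crow_def complex_cnj_cnj sum_distrib_right by (rule sum.swap)
  qed
  finally show ?thesis .
qed

lemma mtrace_mult:
  assumes A: "A \<in> carrier_mat N N" and B: "B \<in> carrier_mat N N"
  shows "mtrace (A * B) = (\<Sum>k<N. sform N B (crow A k) (unitv k))"
  unfolding mtrace_def sform_def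
proof (intro sum.cong)
  fix k assume "k \<in> {..<N}"
  then have k: "k < N" by simp
  have "cdot N (crow A k) (mat_app B (unitv k)) = (\<Sum>j<N. A $$ (k, j) * B $$ (j, k))"
    unfolding cdot_def crow_def using mat_app_unitv[OF B _ k] by simp
  then show "(A * B) $$ (k, k) = cdot N (crow A k) (mat_app B (unitv k))"
    unfolding mult_mat_entry[OF A B k k] by simp
qed (use A in auto)

lemma cmod_mtrace_mult:
  assumes "opb N A a" "opb N B b"
  shows "cmod (mtrace (A * B)) \<le> real N * (a * b)"
proof -
  have A: "A \<in> carrier_mat N N" "0 \<le> a" and B: "B \<in> carrier_mat N N" using opbD(1,2)[OF assms(1)] opbD(1)[OF assms(2)] by auto
  have "cmod (mtrace (A * B)) \<le> (\<Sum>k<N. cmod (sform N B (crow A k) (unitv k)))" unfolding mtrace_mult[OF A(1) B] by (rule norm_sum)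
  also have "\<dots> \<le> (\<Sum>k<N. a * b)"
  proof (intro sum_mono)
    fix k assume "k \<in> {..<N}"
    then have k: "k < N" by simp
    have "cmod (sform N B (crow A k) (unitv k)) \<le> norm2 N (mat_app A (mat_app B (unitv k)))"
      unfolding sform_def cdot_crow[OF A(1) k] by (rule norm_component_le[OF k])
    also have "\<dots> \<le> a * (b * norm2 N (unitv k))"
      using opbD(3)[OF assms(1)] opbD(3)[OF assms(2)] A(2) by (meson mult_left_mono order_trans)
    finally show "cmod (sform N B (crow A k) (unitv k)) \<le> a * b" using k by (simp add: norm2_unitv)
  qed
  finally show ?thesis by simp
qed

text \<open>s |x|^2 <= |x^H Z x| <= |x| |Z x| gives |x| <= |Z x| / s. This excludes a kernel, so Z
  is invertible, and read at x = Z^{-1} y it bounds the inverse.\<close>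

lemma coercive_inverse:
  assumes Z: "Z \<in> carrier_mat N N" and s: "0 < s" and co: "\<And>x. s * (norm2 N x)^2 \<le> Re (sform N Z x x)"
  shows "the (mat_inverse Z) \<in> carrier_mat N N" "Z * the (mat_inverse Z) = 1\<^sub>m N" "the (mat_inverse Z) * Z = 1\<^sub>m N"
    "opb N (the (mat_inverse Z)) (1 / s)"
proof -
  have bound: "norm2 N x \<le> (1 / s) * norm2 N (mat_app Z x)" for x
  proof (cases "norm2 N x = 0")
    case False
    then have n: "0 < norm2 N x" using norm2_nonneg[of N x] by (simp add: less_le)
    have "s * (norm2 N x)^2 \<le> cmod (sform N Z x x)" using co[of x] complex_Re_le_cmod order_trans by blast
    also have "\<dots> \<le> norm2 N x * norm2 N (mat_app Z x)" unfolding sform_def by (rule cmod_cdot_le)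
    finally have "norm2 N x * (s * norm2 N x) \<le> norm2 N x * norm2 N (mat_app Z x)" by (simp add: power2_eq_square mult_ac)
    then have "s * norm2 N x \<le> norm2 N (mat_app Z x)" using n by simp
    then show ?thesis using s by (simp add: field_simps)
  qed (use s in simp)
  have "det Z \<noteq> 0"
  proof
    assume "det Z = 0"
    then obtain v where v: "v \<in> carrier_vec N" "v \<noteq> 0\<^sub>v N" "Z *\<^sub>v v = 0\<^sub>v N"
      using det_0_iff_vec_prod_zero_field[OF Z] by auto
    have "mat_app Z (\<lambda>i. v $ i) i = 0" if i: "i < N" for i
    proof -
      have "mat_app Z (\<lambda>i. v $ i) i = (Z *\<^sub>v v) $ i"
        using Z v(1) i by (simp add: mat_app_eq scalar_prod_def lessThan_atLeast0)
      then show ?thesis using v(3) i by simp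
    qed
    then have "norm2 N (mat_app Z (\<lambda>i. v $ i)) = 0" by (rule norm2_zero)
    then have "norm2 N (\<lambda>i. v $ i) \<le> 0" using bound[of "\<lambda>i. v $ i"] by simp
    then have "norm2 N (\<lambda>i. v $ i) = 0" using norm2_nonneg[of N "\<lambda>i. v $ i"] by (rule antisym)
    then have "v = 0\<^sub>v N" using v(1) norm2_eq_0[of N "\<lambda>i. v $ i"] by (intro eq_vecI) auto
    then show False using v(2) by simp
  qed
  then have "Z \<in> Units (ring_mat TYPE(complex) N b)" for b :: unit by (rule det_non_zero_imp_unit[OF Z])
  then obtain B where B: "mat_inverse Z = Some B" using mat_inverse(1)[OF Z, where b = "()"] by (cases "mat_inverse Z") auto
  note Bi = mat_inverse(2)[OF Z B]
  show 1: "the (mat_inverse Z) \<in> carrier_mat N N" "Z * the (mat_inverse Z) = 1\<^sub>m N" "the (mat_inverse Z) * Z = 1\<^sub>m N"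
    using B Bi by auto
  have "norm2 N (mat_app (the (mat_inverse Z)) y) \<le> 1 / s * norm2 N y" for y
  proof -
    have "norm2 N (mat_app Z (mat_app (the (mat_inverse Z)) y)) = norm2 N y"
    proof (rule norm2_cong)
      fix i assume i: "i < N"
      show "mat_app Z (mat_app (the (mat_inverse Z)) y) i = y i"
        unfolding mat_app_mult[OF Z 1(1) i, symmetric] 1(2) by (rule mat_app_one[OF i])
    qed
    then show ?thesis using bound[of "mat_app (the (mat_inverse Z)) y"] by simp
  qed
  then show "opb N (the (mat_inverse Z)) (1 / s)" using 1 s by (simp add: opb_def)
qed

section \<open>The LMMSE filter: operator bounds and traces\<close>

locale lmmse =
  fixes N :: nat and Upar :: "'u set" and R :: "complex mat" and Rl :: "'u \<Rightarrow> complex mat" and d :: complex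
    and p \<sigma>2 \<kappa>t \<kappa>r r rl :: real
    and Rdiag S Zbar A C \<Psi> :: "complex mat"
  assumes Upar: "finite Upar" and p: "0 < p" and \<sigma>2: "0 < \<sigma>2" and nonneg: "0 \<le> \<kappa>t" "0 \<le> \<kappa>r" and d: "(cmod d)^2 = p"
    and R: "cov_mat N R" "opb N R r" and Rl: "\<And>l. l \<in> Upar \<Longrightarrow> cov_mat N (Rl l)" "\<And>l. l \<in> Upar \<Longrightarrow> opb N (Rl l) rl" "0 \<le> rl"
    and S_def: "S = Matrix.mat N N (\<lambda>(i, j). complex_of_real p * (\<Sum>l\<in>Upar. Rl l $$ (i, j)))"
    and Rdiag_def: "Rdiag = mat_diag N (\<lambda>i. R $$ (i, i))"
    and Zbar_def: "Zbar = complex_of_real (p * (1 + \<kappa>t)) \<cdot>\<^sub>m R + complex_of_real (p * \<kappa>r) \<cdot>\<^sub>m Rdiag + S + complex_of_real \<sigma>2 \<cdot>\<^sub>m 1\<^sub>m N"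
    and A_def: "A = cnj d \<cdot>\<^sub>m (R * the (mat_inverse Zbar))"
    and C_def: "C = R - complex_of_real p \<cdot>\<^sub>m (R * the (mat_inverse Zbar) * R)"
    and \<Psi>_def: "\<Psi> = complex_of_real (p * \<kappa>r) \<cdot>\<^sub>m Rdiag + S + complex_of_real \<sigma>2 \<cdot>\<^sub>m 1\<^sub>m N"
begin

lemma Rc: "R \<in> carrier_mat N N" and Rlc: "l \<in> Upar \<Longrightarrow> Rl l \<in> carrier_mat N N"
  using cov_mat_carrier R(1) Rl(1) by auto

lemma carriers: "S \<in> carrier_mat N N" "Rdiag \<in> carrier_mat N N" "Zbar \<in> carrier_mat N N" "\<Psi> \<in> carrier_mat N N"
  using Rc by (auto simp: S_def Rdiag_def Zbar_def \<Psi>_def)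

text \<open>Operator bounds for S + \<open>\<sigma>2\<close> I, for Zbar (\<open>\<zeta>\<close>)
  and for A (\<open>a\<close>). The last one is |d| times r times 1 / \<open>\<sigma>2\<close>,
  because the noise floor makes Zbar coercive.\<close>

definition cw :: real where "cw = p * (real (card Upar) * rl) + \<sigma>2"
definition \<zeta> :: real where "\<zeta> = p * (1 + \<kappa>t) * r + p * \<kappa>r * r + cw"
definition a :: real where "a = sqrt p * r / \<sigma>2"

lemma opb_noise: "opb N (S + complex_of_real \<sigma>2 \<cdot>\<^sub>m 1\<^sub>m N) cw"
proof -
  have "opb N S (cmod (complex_of_real p) * (\<Sum>l\<in>Upar. rl))" unfolding S_def by (rule opb_sum_mat[OF Upar Rl(2)])
  from opb_add[OF this opb_smult[OF opb_one, of N "complex_of_real \<sigma>2"]] show ?thesis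
    using p \<sigma>2 by (simp add: cw_def)
qed

lemma opb_Zbar: "opb N Zbar \<zeta>"
proof -
  have c: "complex_of_real (p * (1 + \<kappa>t)) \<cdot>\<^sub>m R \<in> carrier_mat N N" "complex_of_real (p * \<kappa>r) \<cdot>\<^sub>m Rdiag \<in> carrier_mat N N"
    "complex_of_real \<sigma>2 \<cdot>\<^sub>m 1\<^sub>m N \<in> carrier_mat N N" using Rc carriers by auto
  have "Zbar = complex_of_real (p * (1 + \<kappa>t)) \<cdot>\<^sub>m R + complex_of_real (p * \<kappa>r) \<cdot>\<^sub>m Rdiag + (S + complex_of_real \<sigma>2 \<cdot>\<^sub>m 1\<^sub>m N)"
    unfolding Zbar_def using c carriers(1) by (intro assoc_add_mat) auto
  moreover have "opb N \<dots> (cmod (complex_of_real (p * (1 + \<kappa>t))) * r + cmod (complex_of_real (p * \<kappa>r)) * r + cw)"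
    unfolding Rdiag_def by (intro opb_add opb_smult R opb_diag opb_noise)
  ultimately show ?thesis using p nonneg by (simp add: \<zeta>_def del: of_real_mult of_real_add)
qed

lemma diag_real: "i < N \<Longrightarrow> R $$ (i, i) = complex_of_real (Re (R $$ (i, i)))" and diag_nonneg: "i < N \<Longrightarrow> 0 \<le> Re (R $$ (i, i))"
  using sform_self[OF R(1), of "unitv i"] sform_nonneg[OF R(1), of "unitv i"] by (simp_all add: sform_unitv[OF Rc])

lemma sform_S: "sform N S u w = complex_of_real p * (\<Sum>l\<in>Upar. sform N (Rl l) u w)"
  unfolding S_def by (rule sform_sum_mat[OF Upar Rlc])

lemma sform_Rdiag_self: "sform N Rdiag u u = complex_of_real (\<Sum>i<N. Re (R $$ (i, i)) * (cmod (u i))^2)"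
proof -
  have "sform N Rdiag u u = (\<Sum>i<N. complex_of_real (Re (R $$ (i, i)) * (cmod (u i))^2))"
    unfolding Rdiag_def sform_diag
  proof (intro sum.cong refl)
    fix i assume "i \<in> {..<N}"
    then have "R $$ (i, i) = complex_of_real (Re (R $$ (i, i)))" by (intro diag_real) simp
    then show "R $$ (i, i) * (cnj (u i) * u i) = complex_of_real (Re (R $$ (i, i)) * (cmod (u i))^2)"
      unfolding of_real_mult complex_norm_square by (simp add: mult.commute)
  qed
  then show ?thesis by simp
qed

lemma sform_noise: "sform N (S + complex_of_real \<sigma>2 \<cdot>\<^sub>m 1\<^sub>m N) u w = sform N S u w + complex_of_real \<sigma>2 * cdot N u w"
  using carriers by (simp add: sform_add_mat sform_smult_mat sform_one)

lemma sform_\<Psi>: "sform N \<Psi> u w = complex_of_real (p * \<kappa>r) * sform N Rdiag u w + sform N (S + complex_of_real \<sigma>2 \<cdot>\<^sub>m 1\<^sub>m N) u w"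
  unfolding \<Psi>_def sform_noise using carriers by (simp add: sform_add_mat sform_smult_mat sform_one)

lemma sform_Zbar: "sform N Zbar u w = complex_of_real (p * (1 + \<kappa>t)) * sform N R u w + sform N \<Psi> u w"
proof -
  have c: "complex_of_real (p * (1 + \<kappa>t)) \<cdot>\<^sub>m R \<in> carrier_mat N N" "complex_of_real (p * \<kappa>r) \<cdot>\<^sub>m Rdiag \<in> carrier_mat N N"
    "complex_of_real \<sigma>2 \<cdot>\<^sub>m 1\<^sub>m N \<in> carrier_mat N N" using Rc carriers by auto
  show ?thesis unfolding Zbar_def sform_\<Psi> sform_noise
    unfolding sform_add_mat[OF add_carrier_mat[OF carriers(1)] c(3)] sform_add_mat[OF add_carrier_mat[OF c(2)] carriers(1)]
      sform_add_mat[OF c(1,2)] sform_smult_mat[OF Rc] sform_smult_mat[OF carriers(2)] sform_smult_mat[OF one_carrier_mat] sform_one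
    by (simp only: add.assoc)
qed

lemma sform_noise_ge: "\<sigma>2 * (norm2 N u)^2 \<le> Re (sform N (S + complex_of_real \<sigma>2 \<cdot>\<^sub>m 1\<^sub>m N) u u)"
proof -
  have "0 \<le> Re (sform N S u u)"
    unfolding sform_S Re_of_real_mult Re_sum using p by (intro mult_nonneg_nonneg sum_nonneg sform_nonneg Rl(1)) auto
  then show ?thesis unfolding sform_noise cdot_self by simp
qed

lemma sform_Rdiag_nonneg: "0 \<le> Re (sform N Rdiag u u)"
  unfolding sform_Rdiag_self using diag_nonneg by (auto intro!: sum_nonneg)

lemma sform_Zbar_ge: "\<sigma>2 * (norm2 N u)^2 \<le> Re (sform N Zbar u u)"
proof -
  have "Re (sform N Zbar u u) = p * (1 + \<kappa>t) * Re (sform N R u u) + (p * \<kappa>r * Re (sform N Rdiag u u)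
      + Re (sform N (S + complex_of_real \<sigma>2 \<cdot>\<^sub>m 1\<^sub>m N) u u))"
    unfolding sform_Zbar sform_\<Psi> plus_complex.sel Re_of_real_mult by (rule refl)
  moreover have "0 \<le> p * (1 + \<kappa>t) * Re (sform N R u u)" "0 \<le> p * \<kappa>r * Re (sform N Rdiag u u)"
    using sform_Rdiag_nonneg[of u] sform_nonneg[OF R(1), of u] p nonneg by auto
  ultimately show ?thesis using sform_noise_ge[of u] by linarith
qed

lemma cov_Zbar: "cov_mat N Zbar"
proof (rule cov_matI[OF carriers(3)])
  show "0 \<le> Re (sform N Zbar x x)" for x
    using sform_Zbar_ge[of x] \<sigma>2 by (meson mult_nonneg_nonneg less_imp_le order_trans zero_le_power2)
  have sym: "cnj (sform N Zbar u w) = sform N Zbar w u" for u w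
  proof -
    have "cnj (sform N Rdiag u w) = sform N Rdiag w u"
      unfolding Rdiag_def sform_diag cnj_sum
    proof (intro sum.cong refl)
      fix i assume "i \<in> {..<N}"
      then have "cnj (R $$ (i, i)) = R $$ (i, i)" using diag_real[of i] by (metis complex_cnj_complex_of_real lessThan_iff)
      then show "cnj (R $$ (i, i) * (cnj (u i) * w i)) = R $$ (i, i) * (cnj (w i) * u i)" by (simp add: mult_ac)
    qed
    then show ?thesis
      unfolding sform_Zbar sform_\<Psi> sform_noise sform_S
      by (simp add: sform_cnj[OF R(1)] sform_cnj[OF Rl(1)] cdot_cnj del: of_real_mult of_real_add)
  qed
  show "Zbar $$ (j, i) = cnj (Zbar $$ (i, j))" if "i < N" "j < N" for i j
    using sym[of "unitv i" "unitv j"] that by (simp add: sform_unitv[OF carriers(3)])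
qed

abbreviation "Zi \<equiv> the (mat_inverse Zbar)"

lemmas Zi = coercive_inverse[OF carriers(3) \<sigma>2 sform_Zbar_ge]

lemma opb_A: "opb N A a"
proof -
  have "cmod d = sqrt p" using d by (metis norm_ge_zero real_sqrt_unique)
  then show ?thesis
    using opb_smult[OF opb_mult[OF R(2) Zi(4)], of "cnj d"] unfolding A_def a_def by simp
qed

lemma Ac: "A \<in> carrier_mat N N" using opbD(1)[OF opb_A] .

definition TR where "TR = (\<Sum>k<N. Re (sform N R (crow A k) (crow A k)))"
definition Tw where "Tw = (\<Sum>k<N. Re (sform N (S + complex_of_real \<sigma>2 \<cdot>\<^sub>m 1\<^sub>m N) (crow A k) (crow A k)))"
definition TD where "TD = (\<Sum>i<N. (norm2 N (col_of A i))^2 * Re (R $$ (i, i)))"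

lemma mtrace_\<tau>:
  "Re (mtrace (A * (complex_of_real x \<cdot>\<^sub>m R + \<Psi>) * mat_adjoint A)) = x * TR + \<kappa>r * p * TD + Tw"
proof -
  have "(\<Sum>k<N. Re (sform N Rdiag (crow A k) (crow A k))) = TD"
  proof -
    have "(\<Sum>k<N. Re (sform N Rdiag (crow A k) (crow A k))) = (\<Sum>k<N. \<Sum>i<N. Re (R $$ (i, i)) * (cmod (A $$ (k, i)))^2)"
      unfolding sform_Rdiag_self crow_def by simp
    also have "\<dots> = (\<Sum>i<N. \<Sum>k<N. Re (R $$ (i, i)) * (cmod (A $$ (k, i)))^2)" by (rule sum.swap)
    finally show ?thesis by (simp add: TD_def norm2_squared col_of_def sum_distrib_left sum_distrib_right mult.commute)
  qed
  moreover have "mtrace (A * (complex_of_real x \<cdot>\<^sub>m R + \<Psi>) * mat_adjoint A) =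
      (\<Sum>k<N. complex_of_real x * sform N R (crow A k) (crow A k) + (complex_of_real (p * \<kappa>r) * sform N Rdiag (crow A k) (crow A k)
        + sform N (S + complex_of_real \<sigma>2 \<cdot>\<^sub>m 1\<^sub>m N) (crow A k) (crow A k)))"
    using mtrace_conj[OF Ac, of "complex_of_real x \<cdot>\<^sub>m R + \<Psi>"] Rc carriers(4)
    by (simp add: sform_add_mat sform_smult_mat sform_\<Psi>)
  ultimately show ?thesis
    by (simp add: TR_def Tw_def sum.distrib sum_distrib_left[symmetric] del: of_real_mult)
qed

text \<open>The squared Frobenius norm of R, through which \<open>\<tau>\<close> and tr(R - C) are
  both bounded below.\<close>

definition Fr where "Fr = (\<Sum>i<N. \<Sum>j<N. (cmod (R $$ (i, j)))^2)"

lemma zeta_pos: "0 < N \<Longrightarrow> 0 < \<zeta>"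
proof -
  assume "0 < N"
  have "0 \<le> r" using opbD(2)[OF R(2)] .
  then show ?thesis unfolding \<zeta>_def cw_def using p \<sigma>2 nonneg Rl(3) by (intro add_nonneg_pos add_nonneg_nonneg mult_nonneg_nonneg) auto
qed

text \<open>A Zbar = cnj d R, so multiplication by Zbar, of norm at most \<open>\<zeta>\<close>,
  carries row k of A to row k of R scaled by |d|; the row of A cannot be shorter than that by more
  than the factor \<open>\<zeta>\<close>.\<close>

lemma crow_A_ge: "p * Fr \<le> \<zeta>^2 * (\<Sum>k<N. (norm2 N (crow A k))^2)"
proof -
  have AZ: "A * Zbar = cnj d \<cdot>\<^sub>m R"
  proof -
    have RZ: "R * Zi \<in> carrier_mat N N" by (rule mult_carrier_mat[OF Rc Zi(1)])
    have "A * Zbar = cnj d \<cdot>\<^sub>m (R * Zi * Zbar)" unfolding A_def by (rule mult_smult_assoc_mat[OF RZ carriers(3)])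
    also have "R * Zi * Zbar = R * (Zi * Zbar)" by (rule assoc_mult_mat[OF Rc Zi(1) carriers(3)])
    also have "\<dots> = R" unfolding Zi(3) using Rc by simp
    finally show ?thesis .
  qed
  have "p * (\<Sum>j<N. (cmod (R $$ (k, j)))^2) \<le> \<zeta>^2 * (norm2 N (crow A k))^2" if k: "k < N" for k
  proof -
    have "cdot N (crow A k) (col_of Zbar j) = cnj d * R $$ (k, j)" if j: "j < N" for j
    proof -
      have "cdot N (crow A k) (col_of Zbar j) = (A * Zbar) $$ (k, j)"
        unfolding mult_mat_entry[OF Ac carriers(3) k j] by (simp add: cdot_def crow_def col_of_def)
      then show ?thesis unfolding AZ using Rc k j by simp
    qed
    then have "(\<Sum>j<N. (cmod (cdot N (crow A k) (col_of Zbar j)))^2) = p * (\<Sum>j<N. (cmod (R $$ (k, j)))^2)"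
      by (simp add: norm_mult power_mult_distrib d sum_distrib_left)
    moreover have "(\<Sum>j<N. (cmod (cdot N (crow A k) (col_of Zbar j)))^2) = (\<Sum>j<N. (cmod (cdot N (col_of Zbar j) (crow A k)))^2)"
      by (intro sum.cong refl) (metis cdot_cnj complex_mod_cnj)
    ultimately show ?thesis using sum_cdot_col[OF opb_Zbar, of "crow A k"] by simp
  qed
  then have "(\<Sum>k<N. p * (\<Sum>j<N. (cmod (R $$ (k, j)))^2)) \<le> (\<Sum>k<N. \<zeta>^2 * (norm2 N (crow A k))^2)" by (intro sum_mono) auto
  then show ?thesis unfolding Fr_def by (simp add: sum_distrib_left)
qed

text \<open>The noise term alone suffices, as tr(A (S + \<open>\<sigma>2\<close> I) A^H) is at least
  \<open>\<sigma>2\<close> tr(A A^H). The bound therefore holds for every realization of the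
  transmitter distortion.\<close>

lemma \<tau>_ge:
  assumes N: "0 < N" and x: "0 \<le> x"
  shows "\<sigma>2 * p / \<zeta>^2 * Fr \<le> x * TR + \<kappa>r * p * TD + Tw"
proof -
  have "0 \<le> TR" unfolding TR_def by (intro sum_nonneg sform_nonneg R)
  moreover have "0 \<le> TD" unfolding TD_def using diag_nonneg by (auto intro!: sum_nonneg)
  moreover have "\<sigma>2 * (\<Sum>k<N. (norm2 N (crow A k))^2) \<le> Tw"
    unfolding Tw_def sum_distrib_left by (intro sum_mono sform_noise_ge)
  moreover have "\<sigma>2 * p / \<zeta>^2 * Fr \<le> \<sigma>2 * (\<Sum>k<N. (norm2 N (crow A k))^2)"
  proof -
    have z: "0 < \<zeta>^2" using zeta_pos[OF N] by simp
    have "\<sigma>2 * (p * Fr) \<le> \<sigma>2 * (\<zeta>^2 * (\<Sum>k<N. (norm2 N (crow A k))^2))" using \<sigma>2 by (intro mult_left_mono crow_A_ge) auto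
    then show ?thesis using z by (simp add: field_simps)
  qed
  ultimately show ?thesis
    using mult_nonneg_nonneg[OF x, of TR] mult_nonneg_nonneg[of "\<kappa>r * p" TD] nonneg p mult_nonneg_nonneg[OF nonneg(2), of p] by linarith
qed

definition trR where "trR = (\<Sum>k<N. sform N Zi (col_of R k) (col_of R k))"

text \<open>R - C and A R are p and cnj d times the same matrix R Zbar^{-1} R, and p = d cnj d. Its
  trace is the sum of r_k^H Zbar^{-1} r_k over the columns r_k of R, because R is Hermitian.\<close>

lemma trace_facts:
  assumes N: "0 < N"
  shows "mtrace (R - C) = complex_of_real (Re (mtrace (R - C)))" "mtrace (A * R) = inverse d * mtrace (R - C)"
    "p * \<sigma>2 / \<zeta>^2 * Fr \<le> Re (mtrace (R - C))"
proof -
  have z: "0 < \<zeta>^2" using zeta_pos[OF N] by simp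
  have RZ: "R * Zi \<in> carrier_mat N N" by (rule mult_carrier_mat[OF Rc Zi(1)])
  have RZR: "R * Zi * R \<in> carrier_mat N N" by (rule mult_carrier_mat[OF RZ Rc])
  have e: "(R * Zi * R) $$ (k, k) = sform N Zi (col_of R k) (col_of R k)" if k: "k < N" for k
  proof -
    have "(R * Zi * R) $$ (k, k) = (\<Sum>j<N. (\<Sum>i<N. R $$ (k, i) * Zi $$ (i, j)) * R $$ (j, k))"
      unfolding mult_mat_entry[OF RZ Rc k k] using mult_mat_entry[OF Rc Zi(1) k] by simp
    also have "\<dots> = (\<Sum>j<N. \<Sum>i<N. cnj (R $$ (i, k)) * Zi $$ (i, j) * R $$ (j, k))"
      using cov_mat_entry_cnj[OF R(1) _ k] by (simp add: sum_distrib_right)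
    also have "\<dots> = sform N Zi (col_of R k) (col_of R k)"
      unfolding sform_eq[OF Zi(1)] col_of_def by (rule sum.swap)
    finally show ?thesis .
  qed
  have "mtrace (R - C) = (\<Sum>k<N. complex_of_real p * sform N Zi (col_of R k) (col_of R k))"
    unfolding mtrace_def C_def using Rc RZR e by (intro sum.cong) (auto simp del: index_mult_mat(1))
  then have tRC: "mtrace (R - C) = complex_of_real p * trR" by (simp add: trR_def sum_distrib_left)
  have tAR: "mtrace (A * R) = cnj d * trR"
  proof -
    have "A * R = cnj d \<cdot>\<^sub>m (R * Zi * R)" unfolding A_def by (rule mult_smult_assoc_mat[OF RZ Rc])
    then have "mtrace (A * R) = (\<Sum>k<N. (cnj d \<cdot>\<^sub>m (R * Zi * R)) $$ (k, k))"
      unfolding mtrace_def using carrier_matD[OF Rc] by simp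
    also have "\<dots> = (\<Sum>k<N. cnj d * (R * Zi * R) $$ (k, k))"
      using carrier_matD[OF RZR] by (intro sum.cong refl) (simp del: index_mult_mat)
    finally show ?thesis unfolding trR_def sum_distrib_left using e by simp
  qed
  have part: "sform N Zi (col_of R k) (col_of R k) = complex_of_real (Re (sform N Zi (col_of R k) (col_of R k))) \<and>
    \<sigma>2 / \<zeta>^2 * (norm2 N (col_of R k))^2 \<le> Re (sform N Zi (col_of R k) (col_of R k))" for k
  proof -
    \<comment> \<open>With Zbar y = r_k the form in the inverse becomes y^H Zbar y, which is real
      and at least \<open>\<sigma>2\<close> |y|^2, while |r_k| is at most \<open>\<zeta>\<close>
      |y|.\<close>
    define y where "y = mat_app Zi (col_of R k)"
    have Zy: "mat_app Zbar y i = col_of R k i" if "i < N" for i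
      unfolding y_def mat_app_mult[OF carriers(3) Zi(1) that, symmetric] Zi(2) by (rule mat_app_one[OF that])
    have "sform N Zi (col_of R k) (col_of R k) = cdot N (mat_app Zbar y) y"
      unfolding sform_def y_def[symmetric] by (intro cdot_cong) (simp_all add: Zy)
    also have "\<dots> = cnj (sform N Zbar y y)" unfolding sform_def by (simp add: cdot_cnj)
    also have "\<dots> = sform N Zbar y y" by (rule sform_cnj[OF cov_Zbar])
    finally have eq: "sform N Zi (col_of R k) (col_of R k) = sform N Zbar y y" .
    have "(norm2 N (col_of R k))^2 = (norm2 N (mat_app Zbar y))^2" using Zy by (simp cong: norm2_cong)
    also have "\<dots> \<le> \<zeta>^2 * (norm2 N y)^2" by (rule opbD(4)[OF opb_Zbar])
    finally have "\<sigma>2 / \<zeta>^2 * (norm2 N (col_of R k))^2 \<le> \<sigma>2 / \<zeta>^2 * (\<zeta>^2 * (norm2 N y)^2)"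
      using \<sigma>2 by (intro mult_left_mono) auto
    also have "\<dots> = \<sigma>2 * (norm2 N y)^2" using z by simp
    also have "\<dots> \<le> Re (sform N Zbar y y)" by (rule sform_Zbar_ge)
    finally show ?thesis unfolding eq using sform_self[OF cov_Zbar] by simp
  qed
  have trR: "trR = complex_of_real (Re trR)" unfolding trR_def using part by (simp add: complex_eq_iff)
  show 1: "mtrace (R - C) = complex_of_real (Re (mtrace (R - C)))" unfolding tRC by (subst (1 2) trR) simp
  show "mtrace (A * R) = inverse d * mtrace (R - C)"
  proof -
    have "complex_of_real p = d * cnj d" using complex_norm_square[of d] by (simp add: d[symmetric])
    moreover have "d \<noteq> 0" using d p by auto
    ultimately show ?thesis unfolding tRC tAR by simp
  qed
  have "\<sigma>2 / \<zeta>^2 * (\<Sum>k<N. (norm2 N (col_of R k))^2) \<le> Re trR"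
    unfolding trR_def Re_sum sum_distrib_left using part by (intro sum_mono) simp
  moreover have "(\<Sum>k<N. (norm2 N (col_of R k))^2) = Fr"
    unfolding Fr_def norm2_squared col_of_def by (rule sum.swap)
  ultimately have "\<sigma>2 / \<zeta>^2 * Fr \<le> Re trR" by (simp only:)
  then have "p * (\<sigma>2 / \<zeta>^2 * Fr) \<le> p * Re trR" using p by (intro mult_left_mono) auto
  then show "p * \<sigma>2 / \<zeta>^2 * Fr \<le> Re (mtrace (R - C))" unfolding tRC by simp
qed

text \<open>Cauchy-Schwarz on the diagonal: (tr R)^2 is at most N times the sum of the squared
  diagonal entries, which is part of \<open>Fr\<close>.\<close>

lemma Fr_ge:
  assumes "0 \<le> c" "c * real N \<le> Re (mtrace R)" "0 < N"
  shows "c^2 * real N \<le> Fr"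
proof -
  have "(Re (mtrace R))^2 = (\<Sum>i<N. Re (R $$ (i, i)))^2" using Rc by (simp add: mtrace_def)
  also have "\<dots> \<le> (\<Sum>i<N. (Re (R $$ (i, i)))^2) * real (card {..<N})"
    by (rule sum_squared_le_sum_of_squares)
  also have "(\<Sum>i<N. (Re (R $$ (i, i)))^2) \<le> Fr"
    unfolding Fr_def
  proof (intro sum_mono)
    fix i assume i: "i \<in> {..<N}"
    have "(Re (R $$ (i, i)))^2 \<le> (cmod (R $$ (i, i)))^2" using abs_Re_le_cmod[of "R $$ (i, i)"] by (metis abs_le_square_iff abs_norm_cancel)
    also have "\<dots> \<le> (\<Sum>j<N. (cmod (R $$ (i, j)))^2)" using i by (intro member_le_sum) auto
    finally show "(Re (R $$ (i, i)))^2 \<le> (\<Sum>j<N. (cmod (R $$ (i, j)))^2)" .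
  qed
  finally have "(Re (mtrace R))^2 \<le> Fr * real N" by (simp add: mult_right_mono)
  moreover have "(c * real N)^2 \<le> (Re (mtrace R))^2" using assms by (intro power_mono) auto
  ultimately have "(c^2 * real N) * real N \<le> Fr * real N" by (simp add: power_mult_distrib power2_eq_square mult_ac)
  then show ?thesis using assms(3) by simp
qed

text \<open>One nonzero diagonal entry suffices. This serves the values of N at which the growth of
  the trace is not yet in force.\<close>

lemma Fr_pos:
  assumes "0 < N" "\<And>i. i < N \<Longrightarrow> 0 < Re (R $$ (i, i))"
  shows "0 < Fr"
proof -
  have "0 < (cmod (R $$ (0, 0)))^2" using assms(2)[OF assms(1)] by auto
  also have "\<dots> \<le> (\<Sum>j<N. (cmod (R $$ (0, j)))^2)" using assms(1) by (intro member_le_sum) auto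
  also have "\<dots> \<le> Fr" unfolding Fr_def using assms(1) by (intro member_le_sum[of 0 "{..<N}" "\<lambda>i. \<Sum>j<N. (cmod (R $$ (i, j)))^2"]) (auto intro: sum_nonneg)
  finally show ?thesis .
qed

end

section \<open>The pilot phase\<close>

lemma measurable_cvec_family:
  assumes "l \<in> J" "i < N"
  shows "(\<lambda>x. x l i) \<in> borel_measurable (PiM J (\<lambda>_. cvec N))"
  using measurable_compose[OF measurable_component_singleton[OF assms(1), of "\<lambda>_. cvec N"] measurable_cvec_component[OF assms(2)]] .

lemma indep_of_channels:
  assumes M: "prob_space M"
    and I: "prob_space.indep_vars M (\<lambda>_. cvec N) (case_option h hl) (insert None (Some ` U))"
  shows "indep_of M (cvec N) h (PiM U (\<lambda>_. cvec N)) (\<lambda>y. \<lambda>l\<in>U. hl l y)"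
    and "k \<in> U \<Longrightarrow> indep_of M (cvec N) (hl k) (cvec N \<Otimes>\<^sub>M PiM (U - {k}) (\<lambda>_. cvec N)) (\<lambda>y. (h y, \<lambda>l\<in>U - {k}. hl l y))"
proof -
  interpret prob_space M by fact
  note J = indep_var_imp_indep_of[OF M indep_var_restrict[OF I]]
  have "indep_of M (cvec N) (\<lambda>y. restrict (\<lambda>i. case_option h hl i y) {None} None) (PiM U (\<lambda>_. cvec N))
      (\<lambda>y. (\<lambda>x. \<lambda>l\<in>U. x (Some l)) (restrict (\<lambda>i. case_option h hl i y) (Some ` U)))"
  proof (rule indep_of_compose[OF M J, of "{None}" "Some ` U" "\<lambda>x. x None"])
    show "(\<lambda>x. \<lambda>l\<in>U. x (Some l)) \<in> measurable (PiM (Some ` U) (\<lambda>_. cvec N)) (PiM U (\<lambda>_. cvec N))"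
      by (intro measurable_restrict measurable_component_singleton) auto
  qed (auto intro: measurable_component_singleton)
  then show "indep_of M (cvec N) h (PiM U (\<lambda>_. cvec N)) (\<lambda>y. \<lambda>l\<in>U. hl l y)"
    by (simp cong: restrict_cong)
  assume k: "k \<in> U"
  have "indep_of M (cvec N) (\<lambda>y. restrict (\<lambda>i. case_option h hl i y) {Some k} (Some k)) (cvec N \<Otimes>\<^sub>M PiM (U - {k}) (\<lambda>_. cvec N))
      (\<lambda>y. (\<lambda>x. (x None, \<lambda>l\<in>U - {k}. x (Some l))) (restrict (\<lambda>i. case_option h hl i y) (insert None (Some ` (U - {k})))))"
  proof (rule indep_of_compose[OF M J, of "{Some k}" "insert None (Some ` (U - {k}))" "\<lambda>x. x (Some k)"])
    show "(\<lambda>x. (x None, \<lambda>l\<in>U - {k}. x (Some l))) \<in> measurable (PiM (insert None (Some ` (U - {k}))) (\<lambda>_. cvec N))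
        (cvec N \<Otimes>\<^sub>M PiM (U - {k}) (\<lambda>_. cvec N))"
      by (intro measurable_Pair measurable_restrict measurable_component_singleton) auto
  qed (use k in \<open>auto intro: measurable_component_singleton\<close>)
  then show "indep_of M (cvec N) (hl k) (cvec N \<Otimes>\<^sub>M PiM (U - {k}) (\<lambda>_. cvec N)) (\<lambda>y. (h y, \<lambda>l\<in>U - {k}. hl l y))"
    by (simp cong: restrict_cong)
qed

locale uplink_pilot = lmmse N Upar R Rl d p \<sigma>2 \<kappa>t \<kappa>r r rl Rdiag S Zbar A C \<Psi>
  for N and Upar :: "'u set" and R Rl d p \<sigma>2 \<kappa>t \<kappa>r r rl Rdiag S Zbar A C \<Psi> +
  fixes M :: "'a measure" and U :: "'u set" and h \<nu> \<eta>r :: "'a \<Rightarrow> nat \<Rightarrow> complex" and hl :: "'u \<Rightarrow> 'a \<Rightarrow> nat \<Rightarrow> complex"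
    and g :: "'a \<Rightarrow> 'u \<Rightarrow> nat \<Rightarrow> complex" and \<eta>t :: "'a \<Rightarrow> complex" and dl :: "'u \<Rightarrow> 'a \<Rightarrow> complex"
  assumes M: "prob_space M" and U: "finite U" "Upar \<subseteq> U"
    and h: "complex_normal M N R h" and hl: "\<And>l. l \<in> U \<Longrightarrow> complex_normal M N (Rl l) (hl l)"
    and opRl: "\<And>l. l \<in> U \<Longrightarrow> opb N (Rl l) rl"
    and channels: "prob_space.indep_vars M (\<lambda>_. cvec N) (case_option h hl) (insert None (Some ` U))"
    and g: "\<And>y. g y = (\<lambda>l\<in>U. hl l y)"
    and dl: "indep_elems M (PiM Upar (\<lambda>_. borel)) (\<lambda>y. \<lambda>l\<in>Upar. dl l y) (cvec N \<Otimes>\<^sub>M PiM U (\<lambda>_. cvec N)) (\<lambda>y. (h y, g y))"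
    and dl_power: "\<And>l. l \<in> Upar \<Longrightarrow> (\<integral>y. (cmod (dl l y))^2 \<partial>M) = p"
    and \<nu>: "indep_elems M (cvec N) \<nu> ((cvec N \<Otimes>\<^sub>M PiM U (\<lambda>_. cvec N)) \<Otimes>\<^sub>M PiM Upar (\<lambda>_. borel))
      (\<lambda>y. ((h y, g y), \<lambda>l\<in>Upar. dl l y))"
    and w: "complex_normal M N (S + complex_of_real \<sigma>2 \<cdot>\<^sub>m 1\<^sub>m N) (\<lambda>y. \<lambda>i\<in>{..<N}. \<nu> y i + (\<Sum>l\<in>Upar. dl l y * hl l y i))"
    and distortion: "has_cond_law M (((cvec N \<Otimes>\<^sub>M PiM U (\<lambda>_. cvec N)) \<Otimes>\<^sub>M PiM Upar (\<lambda>_. borel)) \<Otimes>\<^sub>M cvec N)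
      (\<lambda>y. (((h y, g y), \<lambda>l\<in>Upar. dl l y), \<nu> y)) (borel \<Otimes>\<^sub>M cvec N) (\<lambda>y. (\<eta>t y, \<eta>r y))
      (\<lambda>(((x, _), _), _). distortion_law N \<kappa>t \<kappa>r p x)"
begin

abbreviation D0 where "D0 \<equiv> \<lambda>x. \<lambda>l\<in>Upar. dl l x"
abbreviation w0 where "w0 \<equiv> \<lambda>x. \<lambda>i\<in>{..<N}. \<nu> x i + (\<Sum>l\<in>Upar. dl l x * hl l x i)"
abbreviation "CV \<equiv> cvec N"
abbreviation "GV \<equiv> PiM U (\<lambda>_. cvec N)"
abbreviation "DV \<equiv> PiM Upar (\<lambda>_. borel :: complex measure)"

lemmas dl_indep = indep_elems_imp_indep_of[OF M dl]
lemmas \<nu>_indep = indep_elems_imp_indep_of[OF M \<nu>]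

text \<open>Joint measurability of the conditional kernel, read along the section on which all
  conditioning arguments other than the channel are fixed at their values at one sample
  point.\<close>

lemma measurable_distortion_law: "distortion_law N \<kappa>t \<kappa>r p \<in> measurable CV (prob_algebra (borel \<Otimes>\<^sub>M CV))"
proof -
  interpret prob_space M by (rule M)
  obtain y where y: "y \<in> space M" using not_empty by auto
  have sp: "g y \<in> space GV" "D0 y \<in> space DV" "\<nu> y \<in> space CV"
    using measurable_space[OF has_cond_lawD(1)[OF distortion] y] by (auto simp: space_pair_measure)
  have "(\<lambda>x. (((x, g y), D0 y), \<nu> y)) \<in> measurable CV (((CV \<Otimes>\<^sub>M GV) \<Otimes>\<^sub>M DV) \<Otimes>\<^sub>M CV)"
    using sp by (intro measurable_Pair measurable_const measurable_ident_sets) auto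
  from measurable_compose[OF this has_cond_lawD(3)[OF distortion]] show ?thesis by simp
qed

text \<open>\<open>f\<close> forgets or reorders part of the conditioning data and \<open>q\<close>
  recovers \<open>h\<close> from the result, which is all that the kernel looks at.\<close>

lemma distortion_coarse:
  assumes "f \<in> measurable (((CV \<Otimes>\<^sub>M GV) \<Otimes>\<^sub>M DV) \<Otimes>\<^sub>M CV) S'" "q \<in> measurable S' CV"
    "\<And>x y e n. q (f (((x, y), e), n)) = x"
  shows "has_cond_law M S' (\<lambda>s. f (((h s, g s), D0 s), \<nu> s)) (borel \<Otimes>\<^sub>M CV) (\<lambda>s. (\<eta>t s, \<eta>r s)) (\<lambda>y. distortion_law N \<kappa>t \<kappa>r p (q y))"
proof (rule has_cond_law_coarsen[OF M _ assms(1)])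
  have "(\<lambda>(((x, _), _), _). distortion_law N \<kappa>t \<kappa>r p x) = (\<lambda>x. distortion_law N \<kappa>t \<kappa>r p (q (f x)))"
    by (intro ext) (auto simp: assms(3))
  with distortion show "has_cond_law M (((CV \<Otimes>\<^sub>M GV) \<Otimes>\<^sub>M DV) \<Otimes>\<^sub>M CV) (\<lambda>s. (((h s, g s), D0 s), \<nu> s))
      (borel \<Otimes>\<^sub>M CV) (\<lambda>s. (\<eta>t s, \<eta>r s)) (\<lambda>x. distortion_law N \<kappa>t \<kappa>r p (q (f x)))" by simp
  show "(\<lambda>y. distortion_law N \<kappa>t \<kappa>r p (q y)) \<in> measurable S' (prob_algebra (borel \<Otimes>\<^sub>M CV))"
    by (rule measurable_compose[OF assms(2) measurable_distortion_law])
qed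

lemma distortion_h: "has_cond_law M CV h (borel \<Otimes>\<^sub>M CV) (\<lambda>y. (\<eta>t y, \<eta>r y)) (distortion_law N \<kappa>t \<kappa>r p)"
proof -
  have "has_cond_law M CV (\<lambda>y. (\<lambda>x. fst (fst (fst x))) (((h y, g y), D0 y), \<nu> y)) (borel \<Otimes>\<^sub>M CV) (\<lambda>y. (\<eta>t y, \<eta>r y))
      (\<lambda>x. distortion_law N \<kappa>t \<kappa>r p ((\<lambda>x. x) x))"
  proof (rule distortion_coarse)
    show "(\<lambda>x. fst (fst (fst x))) \<in> measurable (((CV \<Otimes>\<^sub>M GV) \<Otimes>\<^sub>M DV) \<Otimes>\<^sub>M CV) CV" by measurable
  qed simp_all
  then show ?thesis by simp
qed

text \<open>\<open>h\<close> is independent of the co-user channels; the pilot signals and then the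
  noise join these, each being independent of all before. After a change of sides the distortions
  join \<open>h\<close>, since their kernel depends on \<open>h\<close> only. Finally
  \<open>w0\<close> is a function of co-user channels, signals and noise.\<close>

lemma w_indep: "indep_of M CV w0 (CV \<Otimes>\<^sub>M borel \<Otimes>\<^sub>M CV) (\<lambda>s. (h s, \<eta>t s, \<eta>r s))"
proof -
  have 1: "indep_of M CV h GV g" using indep_of_channels(1)[OF M channels] unfolding g .
  have 2: "indep_of M CV h (GV \<Otimes>\<^sub>M DV) (\<lambda>s. (g s, D0 s))" by (rule indep_of_extend'[OF M 1 dl_indep])
  have "indep_of M CV (\<lambda>s. (\<lambda>x. x) (\<nu> s)) (CV \<Otimes>\<^sub>M (GV \<Otimes>\<^sub>M DV)) (\<lambda>s. (\<lambda>q. (fst (fst q), snd (fst q), snd q)) ((h s, g s), D0 s))"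
    by (rule indep_of_compose[OF M \<nu>_indep]) measurable
  then have 3: "indep_of M CV h ((GV \<Otimes>\<^sub>M DV) \<Otimes>\<^sub>M CV) (\<lambda>s. ((g s, D0 s), \<nu> s))"
    using indep_of_extend'[OF M 2, of CV \<nu>] by simp
  have L: "has_cond_law M (((GV \<Otimes>\<^sub>M DV) \<Otimes>\<^sub>M CV) \<Otimes>\<^sub>M CV) (\<lambda>s. (((g s, D0 s), \<nu> s), h s)) (borel \<Otimes>\<^sub>M CV)
      (\<lambda>s. (\<eta>t s, \<eta>r s)) (\<lambda>(y, x). distortion_law N \<kappa>t \<kappa>r p x)"
  proof -
    have "has_cond_law M (((GV \<Otimes>\<^sub>M DV) \<Otimes>\<^sub>M CV) \<Otimes>\<^sub>M CV)
        (\<lambda>s. (\<lambda>q. (((snd (fst (fst q)), snd (fst q)), snd q), fst (fst (fst q)))) (((h s, g s), D0 s), \<nu> s))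
        (borel \<Otimes>\<^sub>M CV) (\<lambda>s. (\<eta>t s, \<eta>r s)) (\<lambda>y. distortion_law N \<kappa>t \<kappa>r p (snd y))"
    proof (rule distortion_coarse)
      show "(\<lambda>q. (((snd (fst (fst q)), snd (fst q)), snd q), fst (fst (fst q))))
          \<in> measurable (((CV \<Otimes>\<^sub>M GV) \<Otimes>\<^sub>M DV) \<Otimes>\<^sub>M CV) (((GV \<Otimes>\<^sub>M DV) \<Otimes>\<^sub>M CV) \<Otimes>\<^sub>M CV)" by measurable
    qed simp_all
    then show ?thesis by (simp add: case_prod_beta')
  qed
  have 4: "indep_of M ((GV \<Otimes>\<^sub>M DV) \<Otimes>\<^sub>M CV) (\<lambda>s. ((g s, D0 s), \<nu> s)) (CV \<Otimes>\<^sub>M borel \<Otimes>\<^sub>M CV) (\<lambda>s. (h s, \<eta>t s, \<eta>r s))"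
    by (rule indep_of_extend[OF M indep_of_sym[OF M 3] L])
  define W where "W = (\<lambda>q :: (('u \<Rightarrow> nat \<Rightarrow> complex) \<times> ('u \<Rightarrow> complex)) \<times> (nat \<Rightarrow> complex).
    \<lambda>i\<in>{..<N}. snd q i + (\<Sum>l\<in>Upar. snd (fst q) l * fst (fst q) l i))"
  have "W \<in> measurable ((GV \<Otimes>\<^sub>M DV) \<Otimes>\<^sub>M CV) CV"
    unfolding W_def
  proof (intro measurable_cvecI borel_measurable_add borel_measurable_sum borel_measurable_times)
    fix i l assume i: "i < N" and l: "l \<in> Upar"
    show "(\<lambda>x. fst (fst x) l i) \<in> borel_measurable ((GV \<Otimes>\<^sub>M DV) \<Otimes>\<^sub>M CV)"
      using U(2) l by (intro measurable_compose[OF measurable_compose[OF measurable_fst measurable_fst] measurable_cvec_family] i) auto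
    show "(\<lambda>x. snd (fst x) l) \<in> borel_measurable ((GV \<Otimes>\<^sub>M DV) \<Otimes>\<^sub>M CV)"
      using l by (intro measurable_compose[OF measurable_compose[OF measurable_fst measurable_snd] measurable_component_singleton])
  next
    fix i assume i: "i < N"
    show "(\<lambda>x. snd x i) \<in> borel_measurable ((GV \<Otimes>\<^sub>M DV) \<Otimes>\<^sub>M CV)"
      by (rule measurable_compose[OF measurable_snd measurable_cvec_component[OF i]])
  qed
  from indep_of_compose[OF M 4 this, of "\<lambda>x. x"] have "indep_of M CV (\<lambda>s. W ((g s, D0 s), \<nu> s)) (CV \<Otimes>\<^sub>M borel \<Otimes>\<^sub>M CV) (\<lambda>s. (h s, \<eta>t s, \<eta>r s))"
    by simp
  moreover have "W ((g s, D0 s), \<nu> s) = w0 s" for s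
  proof -
    have "(\<Sum>l\<in>Upar. (\<lambda>l\<in>Upar. dl l s) l * (\<lambda>l\<in>U. hl l s) l i) = (\<Sum>l\<in>Upar. dl l s * hl l s i)" for i
      by (rule sum.cong[OF refl]) (use U(2) in auto)
    then show ?thesis unfolding W_def g by simp
  qed
  ultimately show ?thesis by simp
qed

text \<open>The same chain, now with one co-user channel on one side and everything else on the
  other.\<close>

lemma hl_indep:
  assumes k: "k \<in> U"
  shows "indep_of M CV (hl k) ((((CV \<Otimes>\<^sub>M PiM (U - {k}) (\<lambda>_. cvec N)) \<Otimes>\<^sub>M DV) \<Otimes>\<^sub>M CV) \<Otimes>\<^sub>M (borel \<Otimes>\<^sub>M CV))
    (\<lambda>s. ((((h s, \<lambda>l\<in>U - {k}. hl l s), D0 s), \<nu> s), (\<eta>t s, \<eta>r s)))"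
proof -
  let ?G = "PiM (U - {k}) (\<lambda>_. cvec N)"
  have sub[measurable]: "(\<lambda>x. \<lambda>l\<in>U - {k}. x l) \<in> measurable GV ?G" by (intro measurable_restrict measurable_component_singleton) auto
  have kk[measurable]: "(\<lambda>x. x k) \<in> measurable GV CV" by (rule measurable_component_singleton[OF k])
  have gk: "g s k = hl k s" "(\<lambda>l\<in>U - {k}. g s l) = (\<lambda>l\<in>U - {k}. hl l s)" for s
    using k by (auto simp: g fun_eq_iff restrict_def)
  have "indep_of M DV (\<lambda>s. (\<lambda>x. x) (D0 s)) (CV \<Otimes>\<^sub>M (CV \<Otimes>\<^sub>M ?G)) (\<lambda>s. (\<lambda>q. (snd q k, fst q, \<lambda>l\<in>U - {k}. snd q l)) (h s, g s))"
    by (rule indep_of_compose[OF M dl_indep]) measurable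
  then have d: "indep_of M DV D0 (CV \<Otimes>\<^sub>M (CV \<Otimes>\<^sub>M ?G)) (\<lambda>s. (hl k s, h s, \<lambda>l\<in>U - {k}. hl l s))"
    by (simp add: gk)
  note 1 = indep_of_extend'[OF M indep_of_channels(2)[OF M channels k] d]
  have "indep_of M CV (\<lambda>s. (\<lambda>x. x) (\<nu> s)) (CV \<Otimes>\<^sub>M ((CV \<Otimes>\<^sub>M ?G) \<Otimes>\<^sub>M DV))
      (\<lambda>s. (\<lambda>q. (snd (fst q) k, (fst (fst q), \<lambda>l\<in>U - {k}. snd (fst q) l), snd q)) ((h s, g s), D0 s))"
    by (rule indep_of_compose[OF M \<nu>_indep]) measurable
  then have n: "indep_of M CV \<nu> (CV \<Otimes>\<^sub>M ((CV \<Otimes>\<^sub>M ?G) \<Otimes>\<^sub>M DV)) (\<lambda>s. (hl k s, (h s, \<lambda>l\<in>U - {k}. hl l s), D0 s))"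
    by (simp add: gk)
  note 2 = indep_of_extend'[OF M 1 n]
  have "has_cond_law M (CV \<Otimes>\<^sub>M (((CV \<Otimes>\<^sub>M ?G) \<Otimes>\<^sub>M DV) \<Otimes>\<^sub>M CV))
      (\<lambda>s. (\<lambda>q. (snd (fst (fst q)) k, ((fst (fst (fst q)), \<lambda>l\<in>U - {k}. snd (fst (fst q)) l), snd (fst q)), snd q)) (((h s, g s), D0 s), \<nu> s))
      (borel \<Otimes>\<^sub>M CV) (\<lambda>s. (\<eta>t s, \<eta>r s)) (\<lambda>y. distortion_law N \<kappa>t \<kappa>r p ((\<lambda>y. fst (fst (fst (snd y)))) y))"
  proof (rule distortion_coarse)
    show "(\<lambda>q. (snd (fst (fst q)) k, ((fst (fst (fst q)), \<lambda>l\<in>U - {k}. snd (fst (fst q)) l), snd (fst q)), snd q))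
        \<in> measurable (((CV \<Otimes>\<^sub>M GV) \<Otimes>\<^sub>M DV) \<Otimes>\<^sub>M CV) (CV \<Otimes>\<^sub>M (((CV \<Otimes>\<^sub>M ?G) \<Otimes>\<^sub>M DV) \<Otimes>\<^sub>M CV))"
      by measurable
  qed simp_all
  then have "has_cond_law M (CV \<Otimes>\<^sub>M (((CV \<Otimes>\<^sub>M ?G) \<Otimes>\<^sub>M DV) \<Otimes>\<^sub>M CV))
      (\<lambda>s. (hl k s, ((h s, \<lambda>l\<in>U - {k}. hl l s), D0 s), \<nu> s)) (borel \<Otimes>\<^sub>M CV) (\<lambda>s. (\<eta>t s, \<eta>r s))
      (\<lambda>(x, y). distortion_law N \<kappa>t \<kappa>r p (fst (fst (fst y))))"
    by (simp add: gk case_prod_beta')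
  from indep_of_extend[OF M 2 this] show ?thesis .
qed

text \<open>The pilot signal without the contribution of co-user \<open>k\<close>; for
  \<open>k\<close> outside \<open>Upar\<close> nothing is removed and it is the whole received
  signal.\<close>

definition zrest where
  "zrest k x = (\<lambda>i\<in>{..<N}. (d + \<eta>t x) * h x i + \<eta>r x i + (\<nu> x i + (\<Sum>l\<in>Upar - {k}. dl l x * hl l x i)))"

lemma hl_indep_zrest:
  assumes k: "k \<in> U"
  shows "indep_of M CV (hl k) CV (zrest k)"
proof -
  let ?G = "PiM (U - {k}) (\<lambda>_. cvec N)"
  let ?S = "(((CV \<Otimes>\<^sub>M ?G) \<Otimes>\<^sub>M DV) \<Otimes>\<^sub>M CV) \<Otimes>\<^sub>M (borel \<Otimes>\<^sub>M CV)"
  define W where "W = (\<lambda>q :: ((((nat \<Rightarrow> complex) \<times> ('u \<Rightarrow> nat \<Rightarrow> complex)) \<times> ('u \<Rightarrow> complex)) \<times> (nat \<Rightarrow> complex)) \<times> complex \<times> (nat \<Rightarrow> complex).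
    \<lambda>i\<in>{..<N}. (d + fst (snd q)) * fst (fst (fst (fst q))) i + snd (snd q) i
      + (snd (fst q) i + (\<Sum>l\<in>Upar - {k}. snd (fst (fst q)) l * snd (fst (fst (fst q))) l i)))"
  have "W \<in> measurable ?S CV"
    unfolding W_def
  proof (intro measurable_cvecI borel_measurable_add borel_measurable_sum borel_measurable_times)
    fix i assume i: "i < N"
    note c = measurable_cvec_component[OF i]
    show "(\<lambda>q. d) \<in> borel_measurable ?S" "(\<lambda>q. fst (snd q)) \<in> borel_measurable ?S" by measurable
    have "(\<lambda>q. fst (fst (fst (fst q)))) \<in> measurable ?S CV" by measurable
    from measurable_compose[OF this c] show "(\<lambda>q. fst (fst (fst (fst q))) i) \<in> borel_measurable ?S" .
    have "(\<lambda>q. snd (snd q)) \<in> measurable ?S CV" by measurable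
    from measurable_compose[OF this c] show "(\<lambda>q. snd (snd q) i) \<in> borel_measurable ?S" .
    have "(\<lambda>q. snd (fst q)) \<in> measurable ?S CV" by measurable
    from measurable_compose[OF this c] show "(\<lambda>q. snd (fst q) i) \<in> borel_measurable ?S" .
    fix l assume l: "l \<in> Upar - {k}"
    have "(\<lambda>q. snd (fst (fst q))) \<in> measurable ?S DV" by measurable
    from measurable_compose[OF this measurable_component_singleton] show "(\<lambda>q. snd (fst (fst q)) l) \<in> borel_measurable ?S" using l by auto
    have "(\<lambda>q. snd (fst (fst (fst q)))) \<in> measurable ?S ?G" by measurable
    from measurable_compose[OF this measurable_cvec_family[OF _ i]] show "(\<lambda>q. snd (fst (fst (fst q))) l i) \<in> borel_measurable ?S"
      using l U(2) by auto
  qed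
  from indep_of_compose[OF M hl_indep[OF k] measurable_ident_sets[OF refl] this] show ?thesis
  proof (rule back_subst[of "indep_of M CV (hl k) CV"])
    have "(\<Sum>l\<in>Upar - {k}. (\<lambda>l\<in>Upar. dl l x) l * (\<lambda>l\<in>U - {k}. hl l x) l i) = (\<Sum>l\<in>Upar - {k}. dl l x * hl l x i)" for i x
      by (rule sum.cong[OF refl]) (use U(2) in auto)
    then show "(\<lambda>x. W ((((h x, \<lambda>l\<in>U - {k}. hl l x), D0 x), \<nu> x), \<eta>t x, \<eta>r x)) = zrest k"
      unfolding W_def by (simp add: zrest_def fun_eq_iff)
  qed
qed

lemma hl_indep_dl:
  assumes k: "k \<in> Upar"
  shows "indep_of M CV (hl k) borel (dl k)"
proof -
  have kU: "k \<in> U" using k U(2) by auto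
  have "(\<lambda>q. snd q k) \<in> measurable (CV \<Otimes>\<^sub>M GV) CV"
    by (rule measurable_compose[OF measurable_snd measurable_component_singleton[OF kU]])
  from indep_of_compose[OF M indep_of_sym[OF M dl_indep] this measurable_component_singleton[OF k]]
  show ?thesis using k kU by (simp add: g)
qed

text \<open>The marginal law of the transmitter distortion does not depend on the conditioning data,
  which include the pilot signals. With this, |dl|^2 can be averaged apart from
  \<open>\<tau>\<close>, a function of \<open>\<eta>t\<close> alone.\<close>

lemma \<eta>t_indep_dl:
  assumes k: "k \<in> Upar"
  shows "indep_of M borel \<eta>t borel (dl k)"
proof -
  let ?S = "((CV \<Otimes>\<^sub>M GV) \<Otimes>\<^sub>M DV) \<Otimes>\<^sub>M CV" and ?X = "\<lambda>y. (((h y, g y), D0 y), \<nu> y)"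
  have "has_cond_law M ?S ?X borel \<eta>t (\<lambda>_. cnormal (\<kappa>t * p))"
    unfolding has_cond_law_def
  proof (intro conjI ballI)
    show "?X \<in> measurable M ?S" by (rule has_cond_lawD(1)[OF distortion])
    show "\<eta>t \<in> borel_measurable M" using measurable_compose[OF has_cond_lawD(2)[OF distortion] measurable_fst] by simp
    show "(\<lambda>_. cnormal (\<kappa>t * p)) \<in> measurable ?S (prob_algebra borel)"
      by (intro measurable_const) (simp add: space_prob_algebra prob_space_cnormal)
    fix P B assume P: "P \<in> sets ?S" and B: "B \<in> sets (borel :: complex measure)"
    \<comment> \<open>The receiver part integrates out to 1, and only this factor of the law
      involves \<open>x\<close>.\<close>
    have K: "emeasure (distortion_law N \<kappa>t \<kappa>r p x) (B \<times> space CV) = emeasure (cnormal (\<kappa>t * p)) B" for x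
    proof -
      interpret f: product_prob_space "\<lambda>i. cnormal (\<kappa>r * p * (cmod (x i))^2)" "{..<N}"
        by (simp add: product_prob_space_def product_prob_space_axioms_def product_sigma_finite_def prob_space_cnormal prob_space_imp_sigma_finite)
      have s: "sets (PiM {..<N} (\<lambda>i. cnormal (\<kappa>r * p * (cmod (x i))^2))) = sets CV"
        unfolding cvec_def by (intro sets_PiM_cong) auto
      have "emeasure (distortion_law N \<kappa>t \<kappa>r p x) (B \<times> space CV) = emeasure (cnormal (\<kappa>t * p)) B *
          emeasure (PiM {..<N} (\<lambda>i. cnormal (\<kappa>r * p * (cmod (x i))^2))) (space CV)"
        unfolding distortion_law_def using B s by (intro f.emeasure_pair_measure_Times) auto
      then show ?thesis using f.emeasure_space_1 sets_eq_imp_space_eq[OF s] by simp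
    qed
    have "emeasure M {y\<in>space M. ?X y \<in> P \<and> \<eta>t y \<in> B} = emeasure M {y\<in>space M. ?X y \<in> P \<and> (\<eta>t y, \<eta>r y) \<in> B \<times> space CV}"
      using measurable_space[OF has_cond_lawD(2)[OF distortion]] by (intro arg_cong[where f = "emeasure M"]) (auto simp: space_pair_measure)
    also have "\<dots> = (\<integral>\<^sup>+y. indicator P (?X y) * emeasure ((\<lambda>(((x, _), _), _). distortion_law N \<kappa>t \<kappa>r p x) (?X y)) (B \<times> space CV) \<partial>M)"
      by (rule distortion[unfolded has_cond_law_def, THEN conjunct2, THEN conjunct2, THEN conjunct2, rule_format, OF P pair_measureI[OF B sets.top]])
    finally show "emeasure M {y\<in>space M. ?X y \<in> P \<and> \<eta>t y \<in> B} = (\<integral>\<^sup>+y. indicator P (?X y) * emeasure (cnormal (\<kappa>t * p)) B \<partial>M)"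
      by (simp add: K)
  qed
  note i = cond_law_imp_indep_of(1)[OF M this]
  have "(\<lambda>q. snd (fst q)) \<in> measurable ?S DV" by measurable
  from indep_of_compose[OF M i measurable_ident_sets[OF refl] measurable_compose[OF this measurable_component_singleton[OF k]]]
  show ?thesis using k by simp
qed

sublocale pilot: pilot M N R "S + complex_of_real \<sigma>2 \<cdot>\<^sub>m 1\<^sub>m N" A h w0 \<eta>t \<eta>r d \<kappa>t \<kappa>r p r cw a
  by (intro pilot.intro M h w R(2) opb_noise opb_A nonneg less_imp_le[OF p] w_indep distortion_h)

end

section \<open>Asymptotic estimates\<close>

lemma L2le_mult_indep:
  fixes f :: "'x \<Rightarrow> real" and q :: "'y \<Rightarrow> real"
  assumes M: "prob_space M" and I: "indep_of M S X T Y"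
    and f: "f \<in> borel_measurable S" "L2le M (\<lambda>s. f (X s)) B"
    and q: "q \<in> borel_measurable T" "L2le M (\<lambda>s. q (Y s)) B'"
  shows "L2le M (\<lambda>s. f (X s) * q (Y s)) (B * B')"
proof -
  note [measurable] = f(1) q(1) L2leD(1)[OF f(2)] L2leD(1)[OF q(2)]
  have "(\<integral>\<^sup>+s. ennreal ((norm (f (X s) * q (Y s)))^2) \<partial>M) = (\<integral>\<^sup>+s. ennreal ((norm (f (X s)))^2) * ennreal ((norm (q (Y s)))^2) \<partial>M)"
    by (intro nn_integral_cong) (simp add: abs_mult power_mult_distrib ennreal_mult)
  also have "\<dots> = (\<integral>\<^sup>+s. (\<integral>\<^sup>+s'. ennreal ((norm (f (X s')))^2) * ennreal ((norm (q (Y s)))^2) \<partial>M) \<partial>M)"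
    by (rule nn_integral_indep_of[OF M I, of "\<lambda>x y. ennreal ((norm (f x))^2) * ennreal ((norm (q y))^2)"]) measurable
  also have "\<dots> = (\<integral>\<^sup>+s. ennreal ((norm (f (X s)))^2) \<partial>M) * (\<integral>\<^sup>+s. ennreal ((norm (q (Y s)))^2) \<partial>M)"
    by (simp add: nn_integral_cmult nn_integral_multc)
  also have "\<dots> \<le> ennreal B * ennreal B'"
    using L2leD(3)[OF f(2)] L2leD(3)[OF q(2)] by (intro mult_mono) auto
  finally show ?thesis
    using L2leD(2)[OF f(2)] L2leD(2)[OF q(2)] by (simp add: L2le_def ennreal_mult)
qed

lemma measurable_normalize:
  assumes "\<And>i. i < N \<Longrightarrow> (\<lambda>y. x y i) \<in> borel_measurable M" "i < N"
  shows "(\<lambda>y. normalize N (x y) i) \<in> borel_measurable M"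
proof -
  have [measurable]: "(\<lambda>y. x y i) \<in> borel_measurable M" "(\<lambda>y. norm2 N (x y)) \<in> borel_measurable M"
    by (intro assms borel_measurable_norm2)+
  show ?thesis unfolding normalize_def by measurable
qed

text \<open>a^2 / s^2 - b^2 = (a / s - b) (a / s + b), where the first factor is at most K / s, of
  order 1 / sqrt n, and the second is bounded, b being within K / s of a / s. In the application a
  and b are the moduli of the means of h^H v and of \<open>\<phi>\<close>, and s = sqrt t.\<close>

lemma square_quotient_bound:
  fixes a b s K c n r :: real
  assumes "\<bar>a - s * b\<bar> \<le> K" "0 \<le> a" "0 \<le> b" "0 < c" "1 \<le> n" "0 < s" "c * n \<le> s^2" "a \<le> sqrt (n * r)" "0 \<le> r"
  shows "\<bar>a^2 / s^2 - b^2\<bar> \<le> K / sqrt c * (2 * sqrt (r / c) + K / sqrt c) * (1 / sqrt n)"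
proof -
  have K: "0 \<le> K" using assms(1) by linarith
  have s: "sqrt c * sqrt n \<le> s" using real_sqrt_le_mono[OF assms(7)] assms(6) by (simp add: real_sqrt_mult)
  have cn: "0 < sqrt c" "1 \<le> sqrt n" using assms by auto
  have Ks: "K / s \<le> K / sqrt c * (1 / sqrt n)"
  proof -
    have "K / s \<le> K / (sqrt c * sqrt n)" using K s cn assms(6) by (intro divide_left_mono mult_pos_pos) auto
    then show ?thesis by simp
  qed
  have Ks': "K / sqrt c * (1 / sqrt n) \<le> K / sqrt c" using K cn by (intro mult_left_le) auto
  have "a / s \<le> sqrt (n * r) / (sqrt c * sqrt n)" using s cn assms by (intro frac_le) auto
  also have "\<dots> = sqrt (r / c)" using cn assms by (simp add: real_sqrt_mult real_sqrt_divide)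
  finally have as: "a / s \<le> sqrt (r / c)" .
  have d: "\<bar>a / s - b\<bar> \<le> K / s"
  proof -
    have "a / s - b = (a - s * b) / s" using assms(6) by (simp add: field_simps)
    then show ?thesis using assms(1,6) by (simp add: divide_right_mono)
  qed
  have "a^2 / s^2 - b^2 = (a / s - b) * (a / s + b)" by (simp add: power2_eq_square algebra_simps)
  then have "\<bar>a^2 / s^2 - b^2\<bar> = \<bar>a / s - b\<bar> * \<bar>a / s + b\<bar>" by (simp add: abs_mult)
  also have "\<dots> \<le> (K / sqrt c * (1 / sqrt n)) * (2 * sqrt (r / c) + K / sqrt c)"
  proof (rule mult_mono)
    have "0 \<le> a / s" using assms by auto
    then show "\<bar>a / s + b\<bar> \<le> 2 * sqrt (r / c) + K / sqrt c" using d as Ks Ks' assms(3) unfolding abs_le_iff by linarith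
  qed (use d Ks K cn in auto)
  finally show ?thesis by (simp add: mult_ac)
qed

context uplink_pilot
begin

definition v where "v x = normalize N (mat_app A (pilot.z x))"
definition t where "t = Re (mtrace (R - C))"
definition \<phi> where "\<phi> x = (1 + inverse d * \<eta>t x) * complex_of_real (sqrt t) / complex_of_real (sqrt (pilot.\<tau> x))"

lemma d_nonzero: "d \<noteq> 0"
  using d p by auto

lemma z_eq: "i < N \<Longrightarrow> pilot.z x i = h x i * (d + \<eta>t x) + \<eta>r x i + \<nu> x i + (\<Sum>l\<in>Upar. dl l x * hl l x i)"
  by (simp add: pilot.z_def mult.commute add.assoc)

lemma \<tau>_eq: "pilot.\<tau> x = Re (mtrace (A * (complex_of_real ((cmod (d + \<eta>t x))^2) \<cdot>\<^sub>m R + \<Psi>) * mat_adjoint A))"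
  unfolding mtrace_\<tau> by (simp add: pilot.\<tau>_def TR_def TD_def Tw_def pilot.TR_def pilot.TD_def pilot.Tw_def pilot.\<kappa>_def)

lemma trAR_eq: "pilot.trAR = inverse d * complex_of_real t" if "0 < N"
proof -
  have "pilot.trAR = mtrace (A * R)" unfolding pilot.trAR_def mtrace_mult[OF Ac Rc] ..
  also have "\<dots> = inverse d * complex_of_real t" unfolding t_def trace_facts(2)[OF that] trace_facts(1)[OF that, symmetric] ..
  finally show ?thesis .
qed

lemma norm2_v: "norm2 N (v x) \<le> 1"
  unfolding v_def by (rule norm2_normalize_le)

lemma measurable_v: "i < N \<Longrightarrow> (\<lambda>x. v x i) \<in> borel_measurable M"
  unfolding v_def by (intro measurable_normalize pilot.measurable_Az)

lemma measurable_hl: "l \<in> U \<Longrightarrow> i < N \<Longrightarrow> (\<lambda>x. hl l x i) \<in> borel_measurable M"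
  by (rule measurable_cvec_comp[OF complex_normalD(2)[OF hl]])

lemma L2le_hl: "l \<in> U \<Longrightarrow> L2le M (\<lambda>x. norm2 N (hl l x)) (real N * rl)"
  by (rule L2le_gaussian_norm_sq(1)[OF M hl opRl])

sublocale comb: combining M N U h v hl p \<sigma>2 \<kappa>t \<kappa>r
  "\<lambda>x. Matrix.mat N N (\<lambda>(i, j). complex_of_real p * (\<Sum>l\<in>U. hl l x i * cnj (hl l x j)))"
proof (intro combining.intro M U(1) p \<sigma>2 nonneg pilot.measurable_h measurable_v measurable_hl norm2_v refl)
  show "integrable M (\<lambda>x. (norm2 N (h x))^2)" using L2le_integrable(1)[OF pilot.L2le_h] by simp
  show "integrable M (\<lambda>x. (norm2 N (hl l x))^2)" if "l \<in> U" for l using L2le_integrable(1)[OF L2le_hl[OF that]] by simp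
qed

lemma L2le_dl:
  assumes k: "k \<in> Upar"
  shows "L2le M (dl k) p"
proof -
  have [measurable]: "dl k \<in> borel_measurable M" by (rule indep_of_measurable(2)[OF hl_indep_dl[OF k]])
  \<comment> \<open>A non-integrable function has Bochner integral 0; the value p > 0 rules this
    out.\<close>
  have "integrable M (\<lambda>x. (cmod (dl k x))^2)" using dl_power[OF k] p not_integrable_integral_eq by force
  then have "(\<integral>\<^sup>+x. ennreal ((norm (dl k x))^2) \<partial>M) = ennreal p"
    using dl_power[OF k] by (simp add: nn_integral_eq_integral)
  then show ?thesis using p by (simp add: L2le_def)
qed

definition z\<rho> where "z\<rho> = 2 * (2 * (pilot.e2 * r) + 2 * (pilot.\<kappa> * r)) + 2 * (2 * cw + 2 * (rl * p))"

lemma z_split: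
  assumes k: "k \<in> Upar" and i: "i < N"
  shows "pilot.z x i = zrest k x i + dl k x * hl k x i"
  using i sum.remove[OF Upar k, of "\<lambda>l. dl l x * hl l x i"] by (simp add: z_eq zrest_def algebra_simps)

text \<open>Gaussianity is known for the full sum \<open>w0\<close> of noise and interference. The
  norm is therefore bounded by adding the full \<open>w0\<close> and subtracting the contribution of
  co-user \<open>k\<close> again.\<close>

lemma L2le_zrest:
  assumes k: "k \<in> Upar"
  shows "L2le M (\<lambda>x. norm2 N (zrest k x)) (real N * z\<rho>)"
proof -
  have kU: "k \<in> U" using k U(2) by auto
  have 3: "L2le M (\<lambda>x. norm2 N (hl k x) * norm (dl k x)) (real N * rl * p)"
    by (rule L2le_mult_indep[OF M hl_indep_dl[OF k], where f = "norm2 N" and q = norm])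
       (use L2le_dl[OF k] L2le_hl[OF kU] in \<open>auto simp: L2le_def intro!: borel_measurable_norm2 measurable_cvec_component\<close>)
  note 1 = L2le_add[OF pilot.L2le_signal L2le_add[OF pilot.L2le_w 3]]
  have "norm (norm2 N (zrest k x)) \<le> 1 * norm (norm2 N (\<lambda>i. (d + \<eta>t x) * h x i + \<eta>r x i) + (norm2 N (w0 x) + norm2 N (hl k x) * norm (dl k x)))" for x
  proof -
    have "norm2 N (zrest k x) = norm2 N (\<lambda>i. ((d + \<eta>t x) * h x i + \<eta>r x i) + (w0 x i + (- dl k x) * hl k x i))"
    proof (rule norm2_cong)
      fix i assume i: "i < N"
      show "zrest k x i = ((d + \<eta>t x) * h x i + \<eta>r x i) + (w0 x i + (- dl k x) * hl k x i)"
        using z_split[OF k i, of x] unfolding pilot.z_def by (simp add: algebra_simps)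
    qed
    also have "\<dots> \<le> norm2 N (\<lambda>i. (d + \<eta>t x) * h x i + \<eta>r x i) + (norm2 N (w0 x) + norm2 N (\<lambda>i. (- dl k x) * hl k x i))"
      by (rule order_trans[OF norm2_triangle add_left_mono[OF norm2_triangle]])
    finally show ?thesis unfolding norm2_scale by (simp add: mult.commute)
  qed
  moreover have "(\<lambda>x. norm2 N (zrest k x)) \<in> borel_measurable M"
    by (intro borel_measurable_norm2 measurable_cvec_comp[OF indep_of_measurable(2)[OF hl_indep_zrest[OF kU]]])
  ultimately have "L2le M (\<lambda>x. norm2 N (zrest k x)) (1^2 * (2 * (2 * (pilot.e2 * (real N * r)) + 2 * (pilot.\<kappa> * (real N * r))) + 2 * (2 * (real N * cw) + 2 * (real N * rl * p))))"
    by (intro L2le_bound[OF 1]) auto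
  then show ?thesis by (rule L2le_mono) (simp add: z\<rho>_def algebra_simps)
qed

lemma interference_orthogonal:
  assumes k: "k \<in> U" "k \<notin> Upar"
  shows "(\<integral>y. (cmod (cdot N (hl k y) (v y)))^2 \<partial>M) \<le> rl"
proof -
  define W where "W = (\<lambda>x. \<lambda>i\<in>{..<N}. normalize N (mat_app A x) i)"
  have W: "W \<in> measurable CV CV"
    unfolding W_def
    by (intro measurable_cvecI measurable_normalize borel_measurable_mat_app[OF Ac] measurable_cvec_component)
  have n: "norm2 N (W x) \<le> 1" for x
  proof -
    have "norm2 N (W x) = norm2 N (normalize N (mat_app A x))" by (rule norm2_cong) (simp add: W_def)
    then show ?thesis using norm2_normalize_le[of N "mat_app A x"] by simp
  qed
  have e: "cdot N (hl k y) (W (zrest k y)) = cdot N (hl k y) (v y)" for y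
  proof (rule cdot_cong)
    fix i assume i: "i < N"
    \<comment> \<open>Here \<open>Upar - {k}\<close> equals \<open>Upar\<close>, so the combining
      vector is a function of \<open>zrest k\<close>, which is independent of
      \<open>hl k\<close>.\<close>
    have "mat_app A (zrest k y) = mat_app A (pilot.z y)"
      using k by (intro mat_app_cong[OF Ac]) (simp add: z_eq zrest_def algebra_simps)
    then show "W (zrest k y) i = v y i" using i by (simp add: W_def v_def)
  qed simp
  have "L2le M (\<lambda>y. cdot N (hl k y) (W (zrest k y))) rl"
    by (rule L2le_gaussian_indep_unit[OF M hl[OF k(1)] opRl[OF k(1)] _ n])
       (use indep_of_compose[OF M hl_indep_zrest[OF k(1)] measurable_ident_sets[OF refl] W] in simp)
  from L2le_integrable(2)[OF this] show ?thesis unfolding e by simp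
qed

text \<open>Pointwise the sum is at most the root of the sum of |h_i|^4, whose mean is of order sqrt
  N. The cruder bound |h|^2 is of order N and would survive the division by
  \<open>t\<close>.\<close>

lemma distortion_gain:
  "(\<integral>s. comb.Hv s \<partial>M) \<le> sqrt (real N * (2 * r^2))"
proof -
  define f where "f = (\<lambda>s. sqrt (\<Sum>i<N. (cmod (h s i)) ^ 4))"
  have mh: "i < N \<Longrightarrow> (\<lambda>s. (cmod (h s i)) ^ 4) \<in> borel_measurable M" for i
    using pilot.measurable_h[of i] by measurable
  have mf[measurable]: "f \<in> borel_measurable M"
    unfolding f_def by (intro borel_measurable_sqrt[THEN measurable_compose[rotated]] borel_measurable_sum mh) auto
  have f0: "0 \<le> f s" for s unfolding f_def by (simp add: sum_nonneg)
  have "(\<integral>\<^sup>+s. ennreal ((norm (f s))^2) \<partial>M) = (\<Sum>i<N. \<integral>\<^sup>+s. ennreal ((cmod (h s i)) ^ 4) \<partial>M)"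
    unfolding f_def using mh by (subst nn_integral_sum[symmetric]) (auto simp: sum_nonneg sum_ennreal)
  also have "\<dots> \<le> (\<Sum>i<N. ennreal (2 * r^2))"
  proof (intro sum_mono)
    fix i assume "i \<in> {..<N}"
    then have i: "i < N" by simp
    have "cdot N (unitv i) x = x i" for x using i by (simp add: cdot_def unitv_def if_distrib[of cnj] if_distrib[of "\<lambda>y. y * _"] cong: if_cong)
    then show "(\<integral>\<^sup>+s. ennreal ((cmod (h s i)) ^ 4) \<partial>M) \<le> ennreal (2 * r^2)"
      using nn_integral_gaussian_pow4[OF M h R(2), of "unitv i"] i by (simp add: norm2_unitv)
  qed
  also have "\<dots> = ennreal (real N * (2 * r^2))" by (simp add: ennreal_mult ennreal_of_nat_eq_real_of_nat)
  finally have L: "L2le M f (real N * (2 * r^2))" by (simp add: L2le_def)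
  have L1: "L2le M (\<lambda>_. 1 :: real) 1" by (simp add: L2le_def pilot.emeasure_space_1)
  have "(\<integral>s. comb.Hv s \<partial>M) \<le> (\<integral>s. norm (f s) * norm (1 :: real) \<partial>M)"
  proof (rule integral_mono[OF comb.integrables(3) L2le_mult_integrable(1)[OF L L1]])
    show "comb.Hv s \<le> norm (f s) * norm (1 :: real)" for s
      using norm2_unit_sum_le(2)[OF norm2_v, of "h s" s] f0[of s] unfolding comb.Hv_def f_def by simp
  qed
  also have "\<dots> \<le> sqrt (real N * (2 * r^2) * 1)" by (rule L2le_mult_integrable(2)[OF L L1])
  finally show ?thesis by simp
qed

lemma mean_X_le: "cmod (\<integral>x. comb.X x \<partial>M) \<le> sqrt (real N * r)"
proof -
  have L1: "L2le M (\<lambda>_. 1 :: real) 1" by (simp add: L2le_def pilot.emeasure_space_1)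
  have "norm (comb.X x) \<le> 1 * norm (norm2 N (h x))" for x
    unfolding comb.X_def using order_trans[OF cmod_cdot_le mult_left_le[OF norm2_v norm2_nonneg]] by simp
  then have "L2le M comb.X (1^2 * (real N * r))"
    using comb.integrables(1) by (intro L2le_bound[OF pilot.L2le_h]) auto
  from L2le_mult_integrable(2)[OF this L1] have "(\<integral>x. norm (comb.X x) \<partial>M) \<le> sqrt (real N * r)" by simp
  then show ?thesis using integral_norm_bound[of M comb.X] by linarith
qed

end

locale uplink_asymp = uplink_pilot N Upar R Rl d p \<sigma>2 \<kappa>t \<kappa>r r rl Rdiag S Zbar A C \<Psi> M U h \<nu> \<eta>r hl g \<eta>t dl
  for N and Upar :: "'u set" and R Rl d p \<sigma>2 \<kappa>t \<kappa>r r rl Rdiag S Zbar A C \<Psi>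
    and M :: "'a measure" and U h \<nu> \<eta>r hl g \<eta>t dl +
  fixes c1 :: real
  assumes N: "0 < N" and c1: "0 < c1" and trace_R: "c1 * real N \<le> Re (mtrace R)"
begin

text \<open>The common lower bound of \<open>\<tau>\<close> / N and of \<open>t\<close> / N. The
  constants from here on are built from scalar parameters and cardinalities, not from N or the
  matrices, so that one value of each serves all large N.\<close>

definition c0 where "c0 = \<sigma>2 * p / \<zeta>^2 * c1^2"
definition kX where "kX = sqrt (r * pilot.Kb) / c0 + sqrt (pilot.Ka / c0)"
definition kX2 where "kX2 = (sqrt (4 * r^2 * pilot.Kb) + sqrt (pilot.Ka * (2 * pilot.Ka + 8 * (pilot.e2 * (a * r)^2)))) / c0"
definition kL where "kL = 2 * (rl * a^2 * z\<rho>) + 2 * (p * ((a + 1) ^ 4 * rl^2))"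
definition kI where "kI = (sqrt (4 * rl^2 * pilot.Kb) + sqrt (kL * (2 * kL + 8 * (p * (a * rl)^2)))) / c0"

lemma N1: "1 \<le> real N" using N by simp

lemma c0: "0 < c0"
  using zeta_pos[OF N] \<sigma>2 p c1 by (simp add: c0_def)

lemma c0_le_Fr: "c0 * real N \<le> \<sigma>2 * p / \<zeta>^2 * Fr"
  using mult_left_mono[OF Fr_ge[OF less_imp_le[OF c1] trace_R N], of "\<sigma>2 * p / \<zeta>^2"] \<sigma>2 p
  by (simp add: c0_def mult.assoc)

lemma \<tau>_lower: "c0 * real N \<le> pilot.\<tau> x"
  using c0_le_Fr \<tau>_ge[OF N, of "(cmod (d + \<eta>t x))^2"] unfolding \<tau>_eq mtrace_\<tau> by simp

lemma \<tau>_pos: "0 < pilot.\<tau> x"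
  using mult_pos_pos[OF c0, of "real N"] \<tau>_lower[of x] N by simp

lemma t_lower: "c0 * real N \<le> t"
  using c0_le_Fr trace_facts(3)[OF N] unfolding t_def by (simp add: mult.commute)

lemma t_pos: "0 < t"
  using mult_pos_pos[OF c0, of "real N"] t_lower N by simp

definition \<Xi>0 where
  "\<Xi>0 = (\<integral>x. t / pilot.\<tau> x \<partial>M) * (\<Sum>l\<in>Upar. (cmod (mtrace (A * Rl l) / mtrace (A * R)))^2)"

text \<open>The comparison term supplied by \<open>correlation_bounds\<close> is |dl tr(A Rl)|^2 /
  \<open>\<tau>\<close>, which still contains the co-user signal. As \<open>dl\<close> and
  \<open>\<eta>t\<close> are independent, its mean factorises and |dl|^2 contributes p.\<close>

lemma interference_parallel:
  assumes l: "l \<in> Upar"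
  shows "\<bar>(\<integral>x. (cmod (cdot N (hl l x) (v x)))^2 \<partial>M) - (\<integral>x. p * (cmod (mtrace (A * Rl l)))^2 / pilot.\<tau> x \<partial>M)\<bar> \<le> kI * sqrt (real N)"
proof -
  have lU: "l \<in> U" using l U(2) by auto
  interpret pc: pilot_couser M N R "S + complex_of_real \<sigma>2 \<cdot>\<^sub>m 1\<^sub>m N" A h w0 \<eta>t \<eta>r d \<kappa>t \<kappa>r p r cw a "hl l" "zrest l" "dl l" "Rl l" rl z\<rho> p
  proof (unfold_locales)
    show "complex_normal M N (Rl l) (hl l)" "opb N (Rl l) rl" by (rule hl[OF lU] opRl[OF lU])+
    show "pilot.z x i = zrest l x i + dl l x * hl l x i" if "i < N" for x i by (rule z_split[OF l that])
    have "(\<lambda>x. \<lambda>i\<in>{..<N}. zrest l x i) = zrest l" by (simp add: zrest_def fun_eq_iff)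
    then show "indep_of M CV (hl l) CV (\<lambda>x. \<lambda>i\<in>{..<N}. zrest l x i)"
      using hl_indep_zrest[OF lU] by simp
    show "L2le M (\<lambda>x. norm2 N (zrest l x)) (real N * z\<rho>)" by (rule L2le_zrest[OF l])
    show "indep_of M CV (hl l) borel (dl l)" "L2le M (dl l) p" by (rule hl_indep_dl[OF l] L2le_dl[OF l])+
  qed
  have tr: "pc.trARl = mtrace (A * Rl l)" unfolding pc.trARl_def mtrace_mult[OF Ac Rlc[OF l]] ..
  have "cmod pc.trARl \<le> real N * (a * rl)" unfolding tr by (rule cmod_mtrace_mult[OF opb_A opRl[OF lU]])
  then have trs: "(cmod pc.trARl)^2 \<le> (real N * (a * rl))^2" by (intro power_mono) auto
  have "L2le M (\<lambda>x. dl l x * pc.trARl) ((cmod pc.trARl)^2 * p)"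
    using L2leD(1)[OF L2le_dl[OF l]] by (intro L2le_bound[OF L2le_dl[OF l]]) (auto simp: norm_mult mult.commute)
  then have y: "L2le M (\<lambda>x. dl l x * pc.trARl) ((real N)^2 * (p * (a * rl)^2))"
    by (rule L2le_mono) (use mult_right_mono[OF trs, of p] p in \<open>simp add: power_mult_distrib mult_ac\<close>)
  have kLN: "real N * pc.Kl = real N * kL" by (simp add: pc.Kl_def kL_def)
  have main: "\<bar>(\<integral>x. (cmod (cdot N (hl l x) (v x)))^2 \<partial>M) - (\<integral>x. (cmod (dl l x * pc.trARl))^2 / pilot.\<tau> x \<partial>M)\<bar> \<le> kI * sqrt (real N)"
    unfolding kI_def v_def
    by (rule pilot.correlation_bounds(3)[OF N c0 \<tau>_lower hl[OF lU] opRl[OF lU] y pc.L2le_hlAz[unfolded kLN]])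
  \<comment> \<open>\<open>\<tau>\<close> exhibited as a function of the transmitter distortion
    alone, the form in which independence can be applied.\<close>
  define q where "q = (\<lambda>e. (cmod pc.trARl)^2 / ((cmod (d + e))^2 * TR + pilot.\<kappa> * TD + Tw))"
  have q: "(cmod pc.trARl)^2 / pilot.\<tau> x = q (\<eta>t x)" for x
    by (simp add: q_def pilot.\<tau>_def TR_def TD_def Tw_def pilot.TR_def pilot.TD_def pilot.Tw_def)
  have q0: "0 \<le> q (\<eta>t x)" for x unfolding q[symmetric] using \<tau>_pos[of x] by simp
  have [measurable]: "q \<in> borel_measurable borel" unfolding q_def by measurable
  have [measurable]: "dl l \<in> borel_measurable M" by (rule L2leD(1)[OF L2le_dl[OF l]])
  have "(\<integral>\<^sup>+x. ennreal ((cmod (dl l x))^2 * q (\<eta>t x)) \<partial>M) = (\<integral>\<^sup>+x. ennreal ((cmod (dl l x))^2) * ennreal (q (\<eta>t x)) \<partial>M)"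
    by (simp add: ennreal_mult' q0)
  also have "\<dots> = (\<integral>\<^sup>+x. (\<integral>\<^sup>+x'. ennreal ((cmod (dl l x))^2) * ennreal (q (\<eta>t x')) \<partial>M) \<partial>M)"
    by (rule nn_integral_indep_of[OF M \<eta>t_indep_dl[OF l], of "\<lambda>e y. ennreal ((cmod y)^2) * ennreal (q e)"]) measurable
  also have "\<dots> = (\<integral>\<^sup>+x. ennreal ((cmod (dl l x))^2) \<partial>M) * (\<integral>\<^sup>+x. ennreal (q (\<eta>t x)) \<partial>M)"
    by (simp add: nn_integral_cmult nn_integral_multc)
  also have "(\<integral>\<^sup>+x. ennreal ((cmod (dl l x))^2) \<partial>M) = ennreal p"
    using L2le_integrable(1)[OF L2le_dl[OF l]] dl_power[OF l] by (subst nn_integral_eq_integral) auto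
  finally have nn: "(\<integral>\<^sup>+x. ennreal ((cmod (dl l x))^2 * q (\<eta>t x)) \<partial>M) = ennreal p * (\<integral>\<^sup>+x. ennreal (q (\<eta>t x)) \<partial>M)" .
  have "(\<integral>x. (cmod (dl l x))^2 * q (\<eta>t x) \<partial>M) = p * (\<integral>x. q (\<eta>t x) \<partial>M)"
    using nn p q0 by (simp add: integral_eq_nn_integral enn2real_mult)
  also have "\<dots> = (\<integral>x. p * (cmod (mtrace (A * Rl l)))^2 / pilot.\<tau> x \<partial>M)"
    unfolding integral_mult_right_zero[symmetric] q[symmetric] tr by simp
  finally have "(\<integral>x. (cmod (dl l x * pc.trARl))^2 / pilot.\<tau> x \<partial>M) = (\<integral>x. p * (cmod (mtrace (A * Rl l)))^2 / pilot.\<tau> x \<partial>M)"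
    by (simp add: norm_mult power_mult_distrib q[symmetric])
  with main show ?thesis by simp
qed

text \<open>With tr(A R) = t / d the approximation (d + \<open>\<eta>t\<close>) tr(A R) of h^H A z,
  divided by the root of \<open>\<tau>\<close>, is exactly sqrt t times
  \<open>\<phi>\<close>.\<close>

lemma signal_bounds:
  shows "\<bar>(\<integral>x. (cmod (comb.X x))^2 \<partial>M) - t * (\<integral>x. (cmod (\<phi> x))^2 \<partial>M)\<bar> \<le> kX2 * sqrt (real N)"
    and "cmod ((\<integral>x. comb.X x \<partial>M) - complex_of_real (sqrt t) * (\<integral>x. \<phi> x \<partial>M)) \<le> kX"
proof -
  define y where "y = (\<lambda>x. (d + \<eta>t x) * pilot.trAR)"
  have "(cmod pilot.trAR)^2 \<le> (real N * (a * r))^2" by (intro power_mono pilot.cmod_trAR) auto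
  then have y: "L2le M y ((real N)^2 * (pilot.e2 * (a * r)^2))"
    unfolding y_def using mult_left_mono[of "(cmod pilot.trAR)^2" "(real N * (a * r))^2" pilot.e2] pilot.const_nonneg(1)
    by (intro L2le_mono[OF pilot.L2le_\<eta>]) (simp add: power_mult_distrib mult_ac)
  note B = pilot.correlation_bounds[OF N c0 \<tau>_lower h R(2) y pilot.L2le_hAz[folded y_def[THEN fun_cong]]]
  have s: "complex_of_real t = complex_of_real (sqrt t) * complex_of_real (sqrt t)"
    unfolding of_real_mult[symmetric] using t_pos by simp
  have yphi: "y x / complex_of_real (sqrt (pilot.\<tau> x)) = complex_of_real (sqrt t) * \<phi> x" for x
    unfolding y_def \<phi>_def trAR_eq[OF N] s using d_nonzero by (simp add: field_simps)
  have y2: "(cmod (y x))^2 / pilot.\<tau> x = t * (cmod (\<phi> x))^2" for x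
  proof -
    have "(cmod (y x))^2 / pilot.\<tau> x = (cmod (y x / complex_of_real (sqrt (pilot.\<tau> x))))^2"
      using \<tau>_pos[of x] by (simp add: norm_divide power_divide)
    also have "\<dots> = t * (cmod (\<phi> x))^2" unfolding yphi using t_pos by (simp add: norm_mult power_mult_distrib)
    finally show ?thesis .
  qed
  show "\<bar>(\<integral>x. (cmod (comb.X x))^2 \<partial>M) - t * (\<integral>x. (cmod (\<phi> x))^2 \<partial>M)\<bar> \<le> kX2 * sqrt (real N)"
    using B(3) unfolding kX2_def comb.X_def v_def y2 integral_mult_right_zero .
  show "cmod ((\<integral>x. comb.X x \<partial>M) - complex_of_real (sqrt t) * (\<integral>x. \<phi> x \<partial>M)) \<le> kX"
    using B(6) unfolding kX_def comb.X_def v_def yphi integral_mult_right_zero .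
qed

definition k1 where "k1 = kX / sqrt c0 * (2 * sqrt (r / c0) + kX / sqrt c0)"

lemma mean_bound: "\<bar>(cmod (\<integral>x. comb.X x \<partial>M))^2 / t - (cmod (\<integral>x. \<phi> x \<partial>M))^2\<bar> \<le> k1 * (1 / sqrt (real N))"
proof -
  have "\<bar>cmod (\<integral>x. comb.X x \<partial>M) - sqrt t * cmod (\<integral>x. \<phi> x \<partial>M)\<bar> \<le> kX"
    using norm_triangle_ineq3[of "\<integral>x. comb.X x \<partial>M" "complex_of_real (sqrt t) * (\<integral>x. \<phi> x \<partial>M)"] signal_bounds(2) t_pos
    by (simp add: norm_mult)
  from square_quotient_bound[OF this _ _ c0 N1 _ _ mean_X_le] show ?thesis
    using t_pos t_lower pilot.const_nonneg(4) by (simp add: k1_def)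
qed

definition k2 where
  "k2 = (1 + \<kappa>t) * (kX2 / c0) + k1 + \<kappa>r * (sqrt (2 * r^2) / c0) + real (card Upar) * (kI / c0) + real (card (U - Upar)) * (rl / c0) + \<sigma>2 / p / c0"

text \<open>\<open>t\<close> grows at least linearly, so an error of order sqrt N becomes one of
  order 1 / sqrt N after the division.\<close>

lemma div_t: "0 \<le> K \<Longrightarrow> x \<le> K * sqrt (real N) \<Longrightarrow> x / t \<le> K / c0 * (1 / sqrt (real N))"
proof -
  assume K: "0 \<le> K" and x: "x \<le> K * sqrt (real N)"
  have "x / t \<le> K * sqrt (real N) / t" using x t_pos by (intro divide_right_mono) auto
  also have "\<dots> \<le> K * sqrt (real N) / (c0 * real N)"
    using K t_lower t_pos c0 N by (intro divide_left_mono mult_nonneg_nonneg mult_pos_pos) auto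
  also have "\<dots> = K / c0 * (sqrt (real N) / real N)" by simp
  also have "\<dots> = K / c0 * (1 / sqrt (real N))" by (simp add: sqrt_divide_self_eq inverse_eq_divide)
  finally show "x / t \<le> K / c0 * (1 / sqrt (real N))" .
qed

text \<open>|tr(A R)|^2 = t^2 / p, so dividing the comparison term by \<open>t\<close> reproduces
  the summand of \<open>\<Xi>0\<close> without remainder.\<close>

lemma interference_main:
  assumes "l \<in> Upar"
  shows "(\<integral>x. p * (cmod (mtrace (A * Rl l)))^2 / pilot.\<tau> x \<partial>M) / t = (\<integral>x. t / pilot.\<tau> x \<partial>M) * (cmod (mtrace (A * Rl l) / mtrace (A * R)))^2"
proof -
  have "mtrace (A * R) = inverse d * complex_of_real t" unfolding trace_facts(2)[OF N] t_def trace_facts(1)[OF N, symmetric] ..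
  then have "(cmod (mtrace (A * Rl l) / mtrace (A * R)))^2 = p * (cmod (mtrace (A * Rl l)))^2 / t^2"
    using t_pos d by (simp add: norm_divide norm_mult norm_inverse power_divide power_mult_distrib power_inverse divide_inverse mult_ac)
  then have e: "p * (cmod (mtrace (A * Rl l)))^2 / pilot.\<tau> x / t = t / pilot.\<tau> x * (cmod (mtrace (A * Rl l) / mtrace (A * R)))^2" for x
    using t_pos by (simp add: power2_eq_square)
  show ?thesis unfolding integral_divide_zero[symmetric] integral_mult_left_zero[symmetric] e ..
qed

text \<open>Six contributions are compared separately: signal power, squared mean, receiver
  distortion, parallel co-users, orthogonal co-users and thermal noise. Only the first, second and
  fourth leave a main term.\<close>

lemma denominator_bound:
  "\<bar>comb.Den / t - ((1 + \<kappa>t) * (\<integral>x. (cmod (\<phi> x))^2 \<partial>M) - (cmod (\<integral>x. \<phi> x \<partial>M))^2) - \<Xi>0\<bar> \<le> k2 * (1 / sqrt (real N))"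
proof -
  define n where "n = 1 / sqrt (real N)"
  define E2 H V where "E2 = (\<integral>x. (cmod (comb.X x))^2 \<partial>M)" and "H = (\<integral>x. comb.Hv x \<partial>M)" and "V = (\<integral>x. (norm2 N (v x))^2 \<partial>M)"
  define I where "I = (\<lambda>l. \<integral>x. comb.Il l x \<partial>M)"
  define J where "J = (\<lambda>l. (\<integral>x. t / pilot.\<tau> x \<partial>M) * (cmod (mtrace (A * Rl l) / mtrace (A * R)))^2)"
  define m where "m = (cmod (\<integral>x. comb.X x \<partial>M))^2"
  define f2 f1 where "f2 = (\<integral>x. (cmod (\<phi> x))^2 \<partial>M)" and "f1 = (cmod (\<integral>x. \<phi> x \<partial>M))^2"
  have rl0: "0 \<le> rl" by (rule Rl(3))
  have Np: "0 < real N" "1 \<le> sqrt (real N)" using N by auto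
  have kX2: "0 \<le> kX2" using order_trans[OF abs_ge_zero signal_bounds(1)] Np by (simp add: zero_le_mult_iff)
  have 1: "\<bar>E2 / t - f2\<bar> \<le> kX2 / c0 * n"
  proof -
    have "E2 / t - f2 = (E2 - t * f2) / t" using t_pos by (simp add: field_simps)
    then have "\<bar>E2 / t - f2\<bar> = \<bar>E2 - t * f2\<bar> / t" using t_pos by simp
    then show ?thesis unfolding n_def using div_t[OF kX2 signal_bounds(1)] by (simp add: E2_def f2_def)
  qed
  have 2: "\<bar>m / t - f1\<bar> \<le> k1 * n" using mean_bound by (simp add: m_def f1_def n_def)
  have 3: "\<bar>H / t\<bar> \<le> sqrt (2 * r^2) / c0 * n"
  proof -
    have "0 \<le> H" unfolding H_def comb.Hv_def by (intro Bochner_Integration.integral_nonneg sum_nonneg) auto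
    moreover have "H / t \<le> sqrt (2 * r^2) / c0 * n"
      unfolding n_def by (rule div_t) (use distortion_gain in \<open>auto simp: H_def real_sqrt_mult mult_ac\<close>)
    ultimately show ?thesis using t_pos by simp
  qed
  have 4: "\<bar>I l / t - J l\<bar> \<le> kI / c0 * n" if l: "l \<in> Upar" for l
  proof -
    have kI: "0 \<le> kI" using order_trans[OF abs_ge_zero interference_parallel[OF l]] Np by (simp add: zero_le_mult_iff)
    have "\<bar>I l / t - J l\<bar> = \<bar>I l - (\<integral>x. p * (cmod (mtrace (A * Rl l)))^2 / pilot.\<tau> x \<partial>M)\<bar> / t"
      unfolding J_def interference_main[OF l, symmetric] using t_pos by (simp add: diff_divide_distrib[symmetric])
    then show ?thesis unfolding n_def using div_t[OF kI interference_parallel[OF l]] by (simp add: I_def comb.Il_def)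
  qed
  have 5: "\<bar>I l / t\<bar> \<le> rl / c0 * n" if l: "l \<in> U - Upar" for l
  proof -
    have "0 \<le> I l" unfolding I_def comb.Il_def by (intro Bochner_Integration.integral_nonneg) auto
    \<comment> \<open>A bounded quantity is weakened to order sqrt N so that \<open>div_t\<close>
      covers it together with the others; the total error is 1 / sqrt N in any case.\<close>
    moreover have "I l \<le> rl * sqrt (real N)"
      using interference_orthogonal[of l] l mult_left_mono[OF Np(2) rl0] by (auto simp: I_def comb.Il_def)
    ultimately show ?thesis unfolding n_def using div_t[OF rl0, of "I l"] t_pos by simp
  qed
  have 6: "\<bar>\<sigma>2 * V / p / t\<bar> \<le> \<sigma>2 / p / c0 * n"
  proof -
    have V: "0 \<le> V" "V \<le> 1"
      unfolding V_def using integral_mono[OF comb.integrables(5), of "\<lambda>_. 1"] comb.v2 pilot.prob_space by auto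
    have "\<sigma>2 * V / p \<le> \<sigma>2 / p * sqrt (real N)"
      using mult_left_mono[of V "sqrt (real N)" "\<sigma>2 / p"] V Np \<sigma>2 p by simp
    then have "\<sigma>2 * V / p / t \<le> \<sigma>2 / p / c0 * n" unfolding n_def by (intro div_t) (use \<sigma>2 p in auto)
    then show ?thesis using V \<sigma>2 p t_pos by simp
  qed
  have abs6: "\<lbrakk>\<bar>x1\<bar> \<le> b1; \<bar>x2\<bar> \<le> b2; \<bar>x3\<bar> \<le> b3; \<bar>x4\<bar> \<le> b4; \<bar>x5\<bar> \<le> b5; \<bar>x6\<bar> \<le> b6\<rbrakk> \<Longrightarrow>
      \<bar>x1 - x2 + x3 + x4 + x5 + x6\<bar> \<le> b1 + b2 + b3 + b4 + b5 + b6" for x1 x2 x3 x4 x5 x6 b1 b2 b3 b4 b5 b6 :: real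
    by linarith
  have "(\<Sum>l\<in>U. I l) = (\<Sum>l\<in>Upar. I l) + (\<Sum>l\<in>U - Upar. I l)"
    using sum.subset_diff[OF U(2,1), of I] by simp
  then have eq: "comb.Den / t - ((1 + \<kappa>t) * f2 - f1) - \<Xi>0 =
      (1 + \<kappa>t) * (E2 / t - f2) - (m / t - f1) + \<kappa>r * (H / t) + (\<Sum>l\<in>Upar. I l / t - J l) + (\<Sum>l\<in>U - Upar. I l / t) + \<sigma>2 * V / p / t"
    unfolding comb.Den_def \<Xi>0_def sum_distrib_left sum_subtractf sum_divide_distrib[symmetric]
      E2_def[symmetric] m_def[symmetric] H_def[symmetric] V_def[symmetric] I_def[symmetric] J_def
    by (simp add: add_divide_distrib diff_divide_distrib algebra_simps)
  have 7: "\<bar>(1 + \<kappa>t) * (E2 / t - f2)\<bar> \<le> (1 + \<kappa>t) * (kX2 / c0 * n)"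
    using nonneg mult_left_mono[OF 1, of "1 + \<kappa>t"] by (simp add: abs_mult)
  have 8: "\<bar>\<kappa>r * (H / t)\<bar> \<le> \<kappa>r * (sqrt (2 * r^2) / c0 * n)"
    using nonneg mult_left_mono[OF 3, of \<kappa>r] by (simp add: abs_mult)
  have 9: "\<bar>\<Sum>l\<in>Upar. I l / t - J l\<bar> \<le> real (card Upar) * (kI / c0 * n)"
    by (rule order_trans[OF sum_abs]) (use sum_bounded_above[of Upar _ "kI / c0 * n"] 4 in auto)
  have 10: "\<bar>\<Sum>l\<in>U - Upar. I l / t\<bar> \<le> real (card (U - Upar)) * (rl / c0 * n)"
    by (rule order_trans[OF sum_abs]) (use sum_bounded_above[of "U - Upar" _ "rl / c0 * n"] 5 in auto)
  have "\<bar>comb.Den / t - ((1 + \<kappa>t) * f2 - f1) - \<Xi>0\<bar> \<le> (1 + \<kappa>t) * (kX2 / c0 * n) + k1 * n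
      + \<kappa>r * (sqrt (2 * r^2) / c0 * n) + real (card Upar) * (kI / c0 * n) + real (card (U - Upar)) * (rl / c0 * n) + \<sigma>2 / p / c0 * n"
    unfolding eq by (rule abs6[OF 7 2 8 9 10 6])
  then show ?thesis unfolding k2_def n_def[symmetric] f1_def f2_def by (simp add: algebra_simps)
qed

end

section \<open>Assembly of the asymptotic statement\<close>

lemma bigoI_ge:
  fixes f q :: "nat \<Rightarrow> real"
  assumes "\<And>N. N0 \<le> N \<Longrightarrow> \<bar>f N\<bar> \<le> K * q N" "\<And>N. 0 \<le> q N"
  shows "f \<in> O(q)"
  using assms by (intro bigoI[of _ K] eventually_sequentiallyI[of N0]) auto

theorem theorem6:
  fixes p \<sigma>2 \<kappa>t \<kappa>r :: real and d :: complex and Tdata Tcoher :: nat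
    and U Upar Uperp :: "'u set"
    and M :: "nat \<Rightarrow> 'a measure"
    and R :: "nat \<Rightarrow> complex mat" and Rl :: "nat \<Rightarrow> 'u \<Rightarrow> complex mat"
    and h :: "nat \<Rightarrow> 'a \<Rightarrow> nat \<Rightarrow> complex" and hl :: "nat \<Rightarrow> 'u \<Rightarrow> 'a \<Rightarrow> nat \<Rightarrow> complex"
    and g :: "nat \<Rightarrow> 'a \<Rightarrow> 'u \<Rightarrow> nat \<Rightarrow> complex"
    \<comment> \<open>pilot phase\<close>
    and \<eta>t :: "nat \<Rightarrow> 'a \<Rightarrow> complex" and \<eta>r \<nu> z :: "nat \<Rightarrow> 'a \<Rightarrow> nat \<Rightarrow> complex"
    and dl :: "nat \<Rightarrow> 'u \<Rightarrow> 'a \<Rightarrow> complex"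
    and Rdiag S Zbar A C \<Psi> :: "nat \<Rightarrow> complex mat"
    and hhat v :: "nat \<Rightarrow> 'a \<Rightarrow> nat \<Rightarrow> complex"
    \<comment> \<open>data phase\<close>
    and W :: "nat \<Rightarrow> 'a \<Rightarrow> 'u disturbance" and D :: "nat \<Rightarrow> 'u \<Rightarrow> complex measure"
    and K :: "nat \<Rightarrow> (nat \<Rightarrow> complex) \<times> ('u \<Rightarrow> nat \<Rightarrow> complex) \<times> 'bs \<times> 'ue \<Rightarrow> 'u disturbance measure"
    and Q :: "nat \<Rightarrow> 'a \<Rightarrow> complex mat"
    and SBS :: "nat \<Rightarrow> 'bs measure" and SUE :: "nat \<Rightarrow> 'ue measure"
    and hBS :: "nat \<Rightarrow> 'a \<Rightarrow> 'bs" and hUE :: "nat \<Rightarrow> 'a \<Rightarrow> 'ue"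
    \<comment> \<open>quantities in the claim\<close>
    and \<tau> :: "nat \<Rightarrow> 'a \<Rightarrow> real" and trRC :: "nat \<Rightarrow> real" and \<phi> :: "nat \<Rightarrow> 'a \<Rightarrow> complex"
  assumes "0 < p" and "0 < \<sigma>2" and "0 \<le> \<kappa>t" and "0 \<le> \<kappa>r" and "(cmod d)\<^sup>2 = p"
    and "0 < Tcoher" and "Tdata \<le> Tcoher"
    and "finite U" and "U = Upar \<union> Uperp" and "Upar \<inter> Uperp = {}"
    \<comment> \<open>covariance matrices\<close>
    and "\<And>N. 0 < N \<Longrightarrow> cov_mat N (R N)"
    and "\<And>N i. i < N \<Longrightarrow> 0 < Re (R N $$ (i, i))"
    and "(\<lambda>N. spectral_norm (R N)) \<in> O(\<lambda>_. 1)"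
    and "0 < liminf (\<lambda>N. ereal (Re (mtrace (R N)) / real N))"
    and "limsup (\<lambda>N. ereal (Re (mtrace (R N)) / real N)) < \<infinity>"
    and "\<And>l. l \<in> U \<Longrightarrow> (\<lambda>N. spectral_norm (Rl N l)) \<in> O(\<lambda>_. 1)"
    \<comment> \<open>channels\<close>
    and "\<And>N. 0 < N \<Longrightarrow> prob_space (M N)"
    and "\<And>N. 0 < N \<Longrightarrow> complex_normal (M N) N (R N) (h N)"
    and "\<And>N l. 0 < N \<Longrightarrow> l \<in> U \<Longrightarrow> complex_normal (M N) N (Rl N l) (hl N l)"
    and "\<And>N. 0 < N \<Longrightarrow> prob_space.indep_vars (M N) (\<lambda>_. cvec N)
           (case_option (h N) (hl N)) (insert None (Some ` U))"
    and "\<And>N \<omega>. g N \<omega> = (\<lambda>l\<in>U. hl N l \<omega>)"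
    \<comment> \<open>pilot phase: signals of the co-users, noise, distortions\<close>
    and "\<And>N. 0 < N \<Longrightarrow> indep_elems (M N)
           (PiM Upar (\<lambda>_. borel)) (\<lambda>\<omega>. \<lambda>l\<in>Upar. dl N l \<omega>)
           (cvec N \<Otimes>\<^sub>M PiM U (\<lambda>_. cvec N)) (\<lambda>\<omega>. (h N \<omega>, g N \<omega>))"
    and "\<And>N l. 0 < N \<Longrightarrow> l \<in> Upar \<Longrightarrow> (\<integral>\<omega>. (cmod (dl N l \<omega>))\<^sup>2 \<partial>M N) = p"
    and "\<And>N. 0 < N \<Longrightarrow> complex_normal (M N) N (complex_of_real \<sigma>2 \<cdot>\<^sub>m 1\<^sub>m N) (\<nu> N)"
    and "\<And>N. 0 < N \<Longrightarrow> indep_elems (M N) (cvec N) (\<nu> N)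
           ((cvec N \<Otimes>\<^sub>M PiM U (\<lambda>_. cvec N)) \<Otimes>\<^sub>M PiM Upar (\<lambda>_. borel))
           (\<lambda>\<omega>. ((h N \<omega>, g N \<omega>), \<lambda>l\<in>Upar. dl N l \<omega>))"
    and "\<And>N. S N = Matrix.mat N N (\<lambda>(i, j). complex_of_real p * (\<Sum>l\<in>Upar. Rl N l $$ (i, j)))"
    and "\<And>N. 0 < N \<Longrightarrow> complex_normal (M N) N (S N + complex_of_real \<sigma>2 \<cdot>\<^sub>m 1\<^sub>m N)
           (\<lambda>\<omega>. \<lambda>i\<in>{..<N}. \<nu> N \<omega> i + (\<Sum>l\<in>Upar. dl N l \<omega> * hl N l \<omega> i))"
    and "\<And>N. 0 < N \<Longrightarrow> has_cond_law (M N)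
           (((cvec N \<Otimes>\<^sub>M PiM U (\<lambda>_. cvec N)) \<Otimes>\<^sub>M PiM Upar (\<lambda>_. borel)) \<Otimes>\<^sub>M cvec N)
           (\<lambda>\<omega>. (((h N \<omega>, g N \<omega>), \<lambda>l\<in>Upar. dl N l \<omega>), \<nu> N \<omega>))
           (borel \<Otimes>\<^sub>M cvec N) (\<lambda>\<omega>. (\<eta>t N \<omega>, \<eta>r N \<omega>))
           (\<lambda>(((x, _), _), _). distortion_law N \<kappa>t \<kappa>r p x)"
    \<comment> \<open>pilot phase: received signal and LMMSE estimate\<close>
    and "\<And>N \<omega> i. z N \<omega> i = h N \<omega> i * (d + \<eta>t N \<omega>) + \<eta>r N \<omega> i + \<nu> N \<omega> i
           + (\<Sum>l\<in>Upar. dl N l \<omega> * hl N l \<omega> i)"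
    and "\<And>N. Rdiag N = mat_diag N (\<lambda>i. R N $$ (i, i))"
    and "\<And>N. Zbar N = complex_of_real (p * (1 + \<kappa>t)) \<cdot>\<^sub>m R N
           + complex_of_real (p * \<kappa>r) \<cdot>\<^sub>m Rdiag N + S N + complex_of_real \<sigma>2 \<cdot>\<^sub>m 1\<^sub>m N"
    and "\<And>N. A N = cnj d \<cdot>\<^sub>m (R N * the (mat_inverse (Zbar N)))"
    and "\<And>N. C N = R N - complex_of_real p \<cdot>\<^sub>m (R N * the (mat_inverse (Zbar N)) * R N)"
    and "\<And>N. \<Psi> N = complex_of_real (p * \<kappa>r) \<cdot>\<^sub>m Rdiag N + S N + complex_of_real \<sigma>2 \<cdot>\<^sub>m 1\<^sub>m N"
    and "\<And>N \<omega>. hhat N \<omega> = mat_app (A N) (z N \<omega>)"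
    and "\<And>N \<omega> i. v N \<omega> i = hhat N \<omega> i / complex_of_real (norm2 N (hhat N \<omega>))"
    \<comment> \<open>data phase: channel knowledge, disturbances, interference covariance\<close>
    and "\<And>N. 0 < N \<Longrightarrow>
           \<exists>e\<in>measurable (SBS N) (cvec N). \<forall>\<omega>\<in>space (M N). hhat N \<omega> = e (hBS N \<omega>)"
    and "\<And>N l. 0 < N \<Longrightarrow> l \<in> U \<Longrightarrow> prob_space (D N l) \<and> sets (D N l) = sets borel \<and>
           (\<integral>s. s \<partial>D N l) = 0 \<and> (\<integral>s. (cmod s)\<^sup>2 \<partial>D N l) = p"
    and "\<And>N. K N = (\<lambda>(x, _, _, _). disturbance_law N U \<kappa>t \<kappa>r p \<sigma>2 (D N) x)"
    and "\<And>N. 0 < N \<Longrightarrow> has_cond_law (M N)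
           (cvec N \<Otimes>\<^sub>M PiM U (\<lambda>_. cvec N) \<Otimes>\<^sub>M SBS N \<Otimes>\<^sub>M SUE N)
           (\<lambda>\<omega>. (h N \<omega>, g N \<omega>, hBS N \<omega>, hUE N \<omega>))
           (disturbance_space N U) (W N) (K N)"
    and "\<And>N \<omega>. Q N \<omega> =
           Matrix.mat N N (\<lambda>(i, j). complex_of_real p * (\<Sum>l\<in>U. hl N l \<omega> i * cnj (hl N l \<omega> j)))"
    \<comment> \<open>quantities in the claim\<close>
    and "\<And>N \<omega>. \<tau> N \<omega> = Re (mtrace
           (A N * (complex_of_real ((cmod (d + \<eta>t N \<omega>))\<^sup>2) \<cdot>\<^sub>m R N + \<Psi> N) * mat_adjoint (A N)))"
    and "\<And>N. trRC N = Re (mtrace (R N - C N))"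
    and "\<And>N \<omega>. \<phi> N \<omega> =
           (1 + inverse d * \<eta>t N \<omega>) * complex_of_real (sqrt (trRC N)) / complex_of_real (sqrt (\<tau> N \<omega>))"
  shows
    "(\<forall>l\<in>Upar.
        (\<lambda>N. (\<integral>\<omega>. (cmod (cdot N (hl N l \<omega>) (v N \<omega>)))\<^sup>2 \<partial>M N)
             - (\<integral>\<omega>. p * (cmod (mtrace (A N * Rl N l)))\<^sup>2 / \<tau> N \<omega> \<partial>M N))
          \<in> O(\<lambda>N. sqrt (real N))) \<and>
     (\<forall>l\<in>Uperp.
        (\<lambda>N. \<integral>\<omega>. (cmod (cdot N (hl N l \<omega>) (v N \<omega>)))\<^sup>2 \<partial>M N) \<in> O(\<lambda>_. 1)) \<and>
     (\<exists>e1 e2 e3 \<Xi> :: nat \<Rightarrow> real.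
        e1 \<in> O(\<lambda>N. 1 / sqrt (real N)) \<and>
        e2 \<in> O(\<lambda>N. 1 / sqrt (real N)) \<and>
        e3 \<in> O(\<lambda>N. 1 / real N) \<and>
        (\<forall>N>0.
          \<Xi> N = (\<integral>\<omega>. trRC N / \<tau> N \<omega> \<partial>M N)
                * (\<Sum>l\<in>Upar. (cmod (mtrace (A N * Rl N l) / mtrace (A N * R N)))\<^sup>2) + e3 N \<and>
          uplink_lower_bound (real Tdata) (real Tcoher) (M N) N p \<kappa>t \<kappa>r \<sigma>2 (Q N) (h N) (v N) =
            real Tdata / real Tcoher * log 2 (1 +
              ((cmod (\<integral>\<omega>. \<phi> N \<omega> \<partial>M N))\<^sup>2 + e1 N) /
              ((1 + \<kappa>t) * (\<integral>\<omega>. (cmod (\<phi> N \<omega>))\<^sup>2 \<partial>M N)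
               - (cmod (\<integral>\<omega>. \<phi> N \<omega> \<partial>M N))\<^sup>2 + e2 N + \<Xi> N)) \<and>
          uplink_capacity (real Tdata) (real Tcoher) (M N) N U p (SUE N) (K N)
              (h N) (g N) (hBS N) (hUE N) \<ge>
            ennreal (uplink_lower_bound (real Tdata) (real Tcoher) (M N) N p \<kappa>t \<kappa>r \<sigma>2
              (Q N) (h N) (v N))))"
proof -
  have Up: "finite Upar" "Upar \<subseteq> U" using assms(8,9) by auto
  have Rlc: "cov_mat N (Rl N l)" if "0 < N" "l \<in> U" for N l
    by (rule complex_normalD(1)[OF assms(19)[OF that]])
  have up: "uplink_pilot N Upar (R N) (Rl N) d p \<sigma>2 \<kappa>t \<kappa>r r rl (Rdiag N) (S N) (Zbar N) (A N) (C N) (\<Psi> N)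
      (M N) U (h N) (\<nu> N) (\<eta>r N) (hl N) (g N) (\<eta>t N) (dl N)"
    if "0 < N" "opb N (R N) r" "\<And>l. l \<in> U \<Longrightarrow> opb N (Rl N l) rl" "0 \<le> rl" for N r rl
    by (intro uplink_pilot.intro lmmse.intro uplink_pilot_axioms.intro)
       (assumption | rule Up assms(1-5,8) assms(11)[OF that(1)] that(2-4) Rlc[OF that(1)] subsetD[OF Up(2)] assms(17)[OF that(1)]
          assms(18)[OF that(1)] assms(19)[OF that(1)] assms(20)[OF that(1)] assms(21) assms(22)[OF that(1)] assms(23)[OF that(1)]
          assms(25)[OF that(1)] assms(26) assms(27)[OF that(1)] assms(28)[OF that(1)] assms(30-34))+
  define mX where "mX N = (\<integral>\<omega>. cdot N (h N \<omega>) (v N \<omega>) \<partial>M N)" for N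
  define Den where "Den N = (1 + \<kappa>t) * (\<integral>\<omega>. (cmod (cdot N (h N \<omega>) (v N \<omega>)))^2 \<partial>M N) - (cmod (mX N))^2
      + \<kappa>r * (\<integral>\<omega>. (\<Sum>i<N. (cmod (h N \<omega> i))^2 * (cmod (v N \<omega> i))^2) \<partial>M N)
      + (\<Sum>l\<in>U. \<integral>\<omega>. (cmod (cdot N (hl N l \<omega>) (v N \<omega>)))^2 \<partial>M N) + \<sigma>2 * (\<integral>\<omega>. (norm2 N (v N \<omega>))^2 \<partial>M N) / p" for N
  define m\<phi> where "m\<phi> N = (cmod (\<integral>\<omega>. \<phi> N \<omega> \<partial>M N))^2" for N
  define q\<phi> where "q\<phi> N = (1 + \<kappa>t) * (\<integral>\<omega>. (cmod (\<phi> N \<omega>))^2 \<partial>M N) - m\<phi> N" for N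
  define \<Xi> where "\<Xi> N = (\<integral>\<omega>. trRC N / \<tau> N \<omega> \<partial>M N)
      * (\<Sum>l\<in>Upar. (cmod (mtrace (A N * Rl N l) / mtrace (A N * R N)))^2)" for N
  \<comment> \<open>The remainders are the exact differences after division by \<open>trRC\<close>,
    so the displayed form of the bound is an algebraic identity for every N > 0; largeness of N
    concerns only their size.\<close>
  define e1 where "e1 N = (cmod (mX N))^2 / trRC N - m\<phi> N" for N
  define e2 where "e2 N = Den N / trRC N - q\<phi> N - \<Xi> N" for N
  have exact: "uplink_lower_bound (real Tdata) (real Tcoher) (M N) N p \<kappa>t \<kappa>r \<sigma>2 (Q N) (h N) (v N) =
        real Tdata / real Tcoher * log 2 (1 + (m\<phi> N + e1 N) / (q\<phi> N + e2 N + \<Xi> N)) \<and>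
      ennreal (uplink_lower_bound (real Tdata) (real Tcoher) (M N) N p \<kappa>t \<kappa>r \<sigma>2 (Q N) (h N) (v N)) \<le>
        uplink_capacity (real Tdata) (real Tcoher) (M N) N U p (SUE N) (K N) (h N) (g N) (hBS N) (hUE N)"
    if N: "0 < N" for N
  proof -
    \<comment> \<open>At a fixed N any finite operator bounds will do: here the spectral norms of
      the matrices at hand, and their sum for all co-users at once.\<close>
    define rl where "rl = (\<Sum>l\<in>U. spectral_norm (Rl N l))"
    have s: "opb N (Rl N l) (spectral_norm (Rl N l))" if "l \<in> U" for l
      by (rule opb_spectral_norm[OF cov_mat_carrier[OF Rlc[OF N that]]])
    have "opb N (Rl N l) rl" if "l \<in> U" for l
      unfolding rl_def using opbD(2)[OF s] that assms(8) by (intro opb_mono[OF s[OF that]] member_le_sum) auto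
    moreover have "0 \<le> rl" unfolding rl_def using opbD(2)[OF s] by (intro sum_nonneg)
    ultimately interpret u: uplink_pilot N Upar "R N" "Rl N" d p \<sigma>2 \<kappa>t \<kappa>r "spectral_norm (R N)" rl "Rdiag N" "S N" "Zbar N" "A N" "C N" "\<Psi> N"
        "M N" U "h N" "\<nu> N" "\<eta>r N" "hl N" "g N" "\<eta>t N" "dl N"
      by (intro up[OF N] opb_spectral_norm[OF cov_mat_carrier[OF assms(11)[OF N]]])
    have "hhat N \<omega> = mat_app (A N) (u.pilot.z \<omega>)" for \<omega>
      unfolding assms(35) by (rule mat_app_cong[OF u.Ac]) (simp only: assms(29) u.z_eq)
    then have v: "v N = u.v" by (intro ext) (simp add: assms(36) u.v_def normalize_def)
    \<comment> \<open>The strictly positive diagonal makes \<open>trRC\<close> positive at every N >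
      0, so it cancels between numerator and denominator.\<close>
    have "0 < p * \<sigma>2 / (u.\<zeta>)^2 * u.Fr"
      using u.zeta_pos[OF N] u.Fr_pos[OF N assms(12)] assms(1,2) by simp
    then have t: "0 < trRC N" using u.trace_facts(3)[OF N] unfolding assms(43) by linarith
    have Q: "Q N = (\<lambda>\<omega>. Matrix.mat N N (\<lambda>(i, j). complex_of_real p * (\<Sum>l\<in>U. hl N l \<omega> i * cnj (hl N l \<omega> j))))"
      by (rule ext) (rule assms(41))
    have Den: "u.comb.Den = Den N"
      unfolding u.comb.Den_def Den_def mX_def v u.comb.X_def u.comb.Hv_def u.comb.Il_def ..
    have X: "(\<integral>\<omega>. u.comb.X \<omega> \<partial>M N) = mX N" unfolding mX_def v u.comb.X_def ..
    have "(m\<phi> N + e1 N) / (q\<phi> N + e2 N + \<Xi> N) = (cmod (mX N))^2 / Den N"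
      unfolding e1_def e2_def using t by simp
    moreover have "centered (D N l) p" if "l \<in> U" for l
    proof (rule centeredI)
      show "prob_space (D N l)" "sets (D N l) = sets borel" "(\<integral>y. y \<partial>D N l) = 0" "(\<integral>y. (cmod y)^2 \<partial>D N l) = p"
        using assms(38)[OF N that] by auto
      \<comment> \<open>As for the pilot signals, a positive Bochner integral excludes the default
        value 0.\<close>
      then show "integrable (D N l) (\<lambda>y. (cmod y)^2)" using assms(1) not_integrable_integral_eq by force
    qed
    ultimately show ?thesis
      unfolding v Q using u.comb.uplink_lower_bound_eq[of "real Tdata" "real Tcoher"]
        u.comb.uplink_capacity_ge[OF _ _ _ assms(39), of "real Tdata" "real Tcoher" "g N" "SUE N" "hBS N" "hUE N"] assms(6)
      unfolding Den X by (simp add: assms(21))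
  qed
  have bounded: "\<exists>c. \<forall>\<^sub>F N in sequentially. f N \<le> c" if O: "f \<in> O(\<lambda>_. 1)" for f :: "nat \<Rightarrow> real"
  proof -
    from O obtain c where "\<forall>\<^sub>F N in sequentially. norm (f N) \<le> c * norm (1 :: real)" by (rule landau_o.bigE)
    then have "\<forall>\<^sub>F N in sequentially. f N \<le> c" by (rule eventually_mono) auto
    then show ?thesis by blast
  qed
  obtain r where r: "\<forall>\<^sub>F N in sequentially. spectral_norm (R N) \<le> r" using bounded[OF assms(13)] by blast
  obtain c where c: "\<And>l. l \<in> U \<Longrightarrow> \<forall>\<^sub>F N in sequentially. spectral_norm (Rl N l) \<le> c l"
    using bounded[OF assms(16)] by metis
  \<comment> \<open>The eventual bounds \<open>c l\<close> come with no sign; absolute values make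
    the sum nonnegative and at least as large as each of them.\<close>
  define rl where "rl = (\<Sum>l\<in>U. \<bar>c l\<bar>)"
  have rl: "c l \<le> rl" if "l \<in> U" for l
    using member_le_sum[of l U "\<lambda>l. \<bar>c l\<bar>"] that assms(8) unfolding rl_def by fastforce
  have rl0: "0 \<le> rl" unfolding rl_def by (simp add: sum_nonneg)
  have "\<forall>\<^sub>F N in sequentially. \<forall>l\<in>U. spectral_norm (Rl N l) \<le> c l"
    using c by (intro eventually_ball_finite assms(8)) auto
  then have Rl: "\<forall>\<^sub>F N in sequentially. \<forall>l\<in>U. spectral_norm (Rl N l) \<le> rl"
    by (rule eventually_mono) (use rl in \<open>auto intro: order_trans\<close>)
  \<comment> \<open>A number strictly between 0 and the lower limit is eventually a lower bound for
    tr(R) / N.\<close>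
  obtain c1 where c1: "0 < c1" "ereal c1 < liminf (\<lambda>N. ereal (Re (mtrace (R N)) / real N))"
    using ereal_dense2[OF assms(14)] by auto
  have "\<forall>\<^sub>F N in sequentially. 0 < N \<and> spectral_norm (R N) \<le> r \<and> (\<forall>l\<in>U. spectral_norm (Rl N l) \<le> rl) \<and>
      ereal c1 < ereal (Re (mtrace (R N)) / real N)"
    by (intro eventually_conj eventually_gt_at_top r Rl less_LiminfD c1)
  then obtain N0 where N0: "\<And>N. N0 \<le> N \<Longrightarrow> 0 < N \<and> spectral_norm (R N) \<le> r \<and> (\<forall>l\<in>U. spectral_norm (Rl N l) \<le> rl) \<and>
      c1 < Re (mtrace (R N)) / real N"
    unfolding eventually_sequentially by auto
  {
    fix N assume "N0 \<le> N"
    note N = N0[OF this]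
    have N': "0 < N" using N by simp
    interpret u: uplink_asymp N Upar "R N" "Rl N" d p \<sigma>2 \<kappa>t \<kappa>r r rl "Rdiag N" "S N" "Zbar N" "A N" "C N" "\<Psi> N"
        "M N" U "h N" "\<nu> N" "\<eta>r N" "hl N" "g N" "\<eta>t N" "dl N" c1
    proof (intro uplink_asymp.intro up uplink_asymp_axioms.intro rl0 c1(1))
      show "opb N (R N) r" using N by (intro opb_mono[OF opb_spectral_norm[OF cov_mat_carrier[OF assms(11)]]]) auto
      show "opb N (Rl N l) rl" if "l \<in> U" for l
        using N that by (intro opb_mono[OF opb_spectral_norm[OF cov_mat_carrier[OF Rlc]]]) auto
      show "c1 * real N \<le> Re (mtrace (R N))" using N pos_less_divide_eq[of "real N" c1 "Re (mtrace (R N))"] by simp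
    qed (use N in auto)
    have "hhat N \<omega> = mat_app (A N) (u.pilot.z \<omega>)" for \<omega>
      unfolding assms(35) by (rule mat_app_cong[OF u.Ac]) (simp only: assms(29) u.z_eq)
    then have v: "v N = u.v" by (intro ext) (simp add: assms(36) u.v_def normalize_def)
    have t: "trRC N = u.t" unfolding assms(43) u.t_def ..
    have \<tau>: "\<tau> N = u.pilot.\<tau>" by (rule ext) (simp only: assms(42) u.\<tau>_eq)
    have \<phi>: "\<phi> N = u.\<phi>" by (rule ext) (simp only: assms(44) u.\<phi>_def t \<tau>)
    have "\<bar>e1 N\<bar> \<le> u.k1 * (1 / sqrt (real N))"
      using u.mean_bound unfolding e1_def m\<phi>_def mX_def v t \<phi> u.comb.X_def .
    moreover have "\<bar>e2 N\<bar> \<le> u.k2 * (1 / sqrt (real N))"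
      using u.denominator_bound
      unfolding e2_def Den_def q\<phi>_def m\<phi>_def \<Xi>_def mX_def v t \<tau> \<phi> u.\<Xi>0_def u.comb.Den_def u.comb.X_def u.comb.Hv_def u.comb.Il_def .
    moreover have "\<forall>l\<in>Upar. \<bar>(\<integral>\<omega>. (cmod (cdot N (hl N l \<omega>) (v N \<omega>)))^2 \<partial>M N)
        - (\<integral>\<omega>. p * (cmod (mtrace (A N * Rl N l)))^2 / \<tau> N \<omega> \<partial>M N)\<bar> \<le> u.kI * sqrt (real N)"
      using u.interference_parallel unfolding v \<tau> by blast
    moreover have "\<forall>l\<in>Uperp. \<bar>\<integral>\<omega>. (cmod (cdot N (hl N l \<omega>) (v N \<omega>)))^2 \<partial>M N\<bar> \<le> rl * 1"
      using u.interference_orthogonal assms(9,10) unfolding v by auto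
    ultimately have "\<bar>e1 N\<bar> \<le> u.k1 * (1 / sqrt (real N)) \<and> \<bar>e2 N\<bar> \<le> u.k2 * (1 / sqrt (real N)) \<and>
      (\<forall>l\<in>Upar. \<bar>(\<integral>\<omega>. (cmod (cdot N (hl N l \<omega>) (v N \<omega>)))^2 \<partial>M N)
        - (\<integral>\<omega>. p * (cmod (mtrace (A N * Rl N l)))^2 / \<tau> N \<omega> \<partial>M N)\<bar> \<le> u.kI * sqrt (real N)) \<and>
      (\<forall>l\<in>Uperp. \<bar>\<integral>\<omega>. (cmod (cdot N (hl N l \<omega>) (v N \<omega>)))^2 \<partial>M N\<bar> \<le> rl * 1)"
      by blast
  }
  note est = this
  note E1 = conjunct1[OF est] and E2 = conjunct1[OF conjunct2[OF est]]
    and E3 = bspec[OF conjunct1[OF conjunct2[OF conjunct2[OF est]]]] and E4 = bspec[OF conjunct2[OF conjunct2[OF conjunct2[OF est]]]]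
  show ?thesis
  proof (intro conjI ballI; (rule exI[of _ e1], rule exI[of _ e2], rule exI[of _ "\<lambda>_. 0"], rule exI[of _ \<Xi>], intro conjI allI impI)?)
    show "e1 \<in> O(\<lambda>N. 1 / sqrt (real N))" by (rule bigoI_ge[OF E1]) auto
    show "e2 \<in> O(\<lambda>N. 1 / sqrt (real N))" by (rule bigoI_ge[OF E2]) auto
    show "(\<lambda>_. 0) \<in> O(\<lambda>N. 1 / real N)" by simp
    fix l
    show "(\<lambda>N. (\<integral>\<omega>. (cmod (cdot N (hl N l \<omega>) (v N \<omega>)))^2 \<partial>M N)
             - (\<integral>\<omega>. p * (cmod (mtrace (A N * Rl N l)))^2 / \<tau> N \<omega> \<partial>M N)) \<in> O(\<lambda>N. sqrt (real N))" if "l \<in> Upar"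
      by (rule bigoI_ge[OF E3[OF _ that]]) auto
    show "(\<lambda>N. \<integral>\<omega>. (cmod (cdot N (hl N l \<omega>) (v N \<omega>)))^2 \<partial>M N) \<in> O(\<lambda>_. 1)" if "l \<in> Uperp"
      by (rule bigoI_ge[OF E4[OF _ that]]) auto
  next
    fix N :: nat assume N: "0 < N"
    show "\<Xi> N = (\<integral>\<omega>. trRC N / \<tau> N \<omega> \<partial>M N) * (\<Sum>l\<in>Upar. (cmod (mtrace (A N * Rl N l) / mtrace (A N * R N)))^2) + 0"
      by (simp add: \<Xi>_def)
    show "uplink_lower_bound (real Tdata) (real Tcoher) (M N) N p \<kappa>t \<kappa>r \<sigma>2 (Q N) (h N) (v N) =
        real Tdata / real Tcoher * log 2 (1 + ((cmod (\<integral>\<omega>. \<phi> N \<omega> \<partial>M N))^2 + e1 N) /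
          ((1 + \<kappa>t) * (\<integral>\<omega>. (cmod (\<phi> N \<omega>))^2 \<partial>M N) - (cmod (\<integral>\<omega>. \<phi> N \<omega> \<partial>M N))^2 + e2 N + \<Xi> N))"
      using conjunct1[OF exact[OF N]] unfolding q\<phi>_def m\<phi>_def .
    show "ennreal (uplink_lower_bound (real Tdata) (real Tcoher) (M N) N p \<kappa>t \<kappa>r \<sigma>2 (Q N) (h N) (v N)) \<le>
        uplink_capacity (real Tdata) (real Tcoher) (M N) N U p (SUE N) (K N) (h N) (g N) (hBS N) (hUE N)"
      by (rule conjunct2[OF exact[OF N]])
  qed
qed

end
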